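(* Let $\mathcal{E}$ be a category with a class of small maps $\mathcal{S}$ satisfying (PE), and let $f:B\to A$ be a small map. For a $P_f$-algebra $(W,\mathrm{sup}:P_f(W)\to W)$ the following are equivalent: (1) $(W,\mathrm{sup})$ is a W-type for $f$; (2) $\mathrm{sup}$ is an isomorphism and $W$ has no proper $P_f$-subalgebras in $\mathcal{E}$; (3) $\mathrm{sup}$ is an isomorphism and, for every object $X$ of $\mathcal{E}$, $X^*W$ has no proper $P_{X^*f}$-subalgebras in $\mathcal{E}/X$; (4) $(W,\mathrm{sup})$ is an indexed W-type for $f$.
   Context: Positive Heyting category: finite limits, stable (cover, mono)-factorisations (cover: $f=mg$ with $m$ mono forces $m$ iso), disjoint stable finite coproducts, right adjoints $\forall_f$ to pullback of subobjects. Covering square: commutative square with bottom a cover, top-left corner covering the pullback of bottom and right sides. Class of small maps $\mathcal{S}$: pullback stable, descent along covers, closed under sums and composition, contains $0\to1,1\to1,1+1\to1$ and diagonals, Quotients ($g\circ e\in\mathcal{S}$ with $e$ a cover $\Rightarrow g\in\mathcal{S}$), Collection (given cover $p:Y\to X$ and $f:X\to A\in\mathcal{S}$ there is a covering square with left side in $\mathcal{S}$, top factoring through $p$, right side $f$), $\forall_f$ ($f\in\mathcal{S}$) preserves subobjects given by monos in $\mathcal{S}$. (PE): every $X$ has a power class object $\mathcal{P}X$ with $\in_X\subseteq X\times\mathcal{P}X$, $\in_X\to\mathcal{P}X\in\mathcal{S}$, such that every $R\subseteq X\times Y$ with $R\to Y\in\mathcal{S}$ equals $(1\times\rho)^*\in_X$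 for a unique $\rho$. Under (PE) every small map is exponentiable. For exponentiable $f:B\to A$, $P_f=\Sigma_A\circ\Pi_f\circ B^*:\mathcal{E}\to\mathcal{E}$, i.e. $P_f(X)=\sum_{a\in A}X^{B_a}$. A $P_f$-algebra is $(W,\mathrm{sup}:P_fW\to W)$; morphisms commute with structure maps; a subalgebra is an algebra morphism whose underlying map is mono, proper if not an iso. A W-type for $f$ is an initial $P_f$-algebra. For an object $X$, $X^*f$ is the pullback of $f$ to $\mathcal{E}/X$ and $X^*W$ carries the induced $P_{X^*f}$-algebra structure; an indexed W-type is a W-type such that for every $X$, $X^*W$ is the W-type for $X^*f$ in $\mathcal{E}/X$. *)

theory Defs
  imports Main
begin

section \<open>Categories\<close>

text \<open>
  A category is a record carrying sets of objects and of arrows; composition is only meaningful on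
  composable arrows. Records rather than locale constants are used so that every notion below can
  be instantiated both in a category and in its slices.
\<close>

record ('o, 'm) cat =
  Obj :: "'o set"
  Arr :: "'m set"
  Dom :: "'m \<Rightarrow> 'o"
  Cod :: "'m \<Rightarrow> 'o"
  Id :: "'o \<Rightarrow> 'm"
  Comp :: "'m \<Rightarrow> 'm \<Rightarrow> 'm" (infixl "\<cdot>\<index>" 70)

definition Hom :: "('o, 'm) cat \<Rightarrow> 'o \<Rightarrow> 'o \<Rightarrow> 'm set" where
  "Hom C a b = {f \<in> Arr C. Dom C f = a \<and> Cod C f = b}"

locale category =
  fixes C :: "('o, 'm) cat" (structure)
  assumes Dom_in_Obj: "f \<in> Arr C \<Longrightarrow> Dom C f \<in> Obj C"
    and Cod_in_Obj: "f \<in> Arr C \<Longrightarrow> Cod C f \<in> Obj C"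
    and Id_in_Hom: "a \<in> Obj C \<Longrightarrow> Id C a \<in> Hom C a a"
    and Comp_in_Hom: "\<lbrakk>f \<in> Hom C a b; g \<in> Hom C b c\<rbrakk> \<Longrightarrow> g \<cdot> f \<in> Hom C a c"
    and Id_left: "f \<in> Hom C a b \<Longrightarrow> Id C b \<cdot> f = f"
    and Id_right: "f \<in> Hom C a b \<Longrightarrow> f \<cdot> Id C a = f"
    and Comp_assoc: "\<lbrakk>f \<in> Hom C a b; g \<in> Hom C b c; h \<in> Hom C c d\<rbrakk>
      \<Longrightarrow> (h \<cdot> g) \<cdot> f = h \<cdot> (g \<cdot> f)"

definition is_mono :: "('o, 'm) cat \<Rightarrow> 'm \<Rightarrow> bool" where
  "is_mono C m \<longleftrightarrow> m \<in> Arr C \<and>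
     (\<forall>u\<in>Arr C. \<forall>v\<in>Arr C. Dom C u = Dom C v \<and> Cod C u = Dom C m \<and> Cod C v = Dom C m \<and>
        m \<cdot>\<^bsub>C\<^esub> u = m \<cdot>\<^bsub>C\<^esub> v \<longrightarrow> u = v)"

definition inverse_of :: "('o, 'm) cat \<Rightarrow> 'm \<Rightarrow> 'm \<Rightarrow> bool" where
  "inverse_of C f g \<longleftrightarrow> f \<in> Arr C \<and> g \<in> Hom C (Cod C f) (Dom C f) \<and>
     g \<cdot>\<^bsub>C\<^esub> f = Id C (Dom C f) \<and> f \<cdot>\<^bsub>C\<^esub> g = Id C (Cod C f)"

definition is_iso :: "('o, 'm) cat \<Rightarrow> 'm \<Rightarrow> bool" where
  "is_iso C f \<longleftrightarrow> (\<exists>g. inverse_of C f g)"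

definition inverse_arrow :: "('o, 'm) cat \<Rightarrow> 'm \<Rightarrow> 'm" where
  "inverse_arrow C f = (THE g. inverse_of C f g)"

definition is_cover :: "('o, 'm) cat \<Rightarrow> 'm \<Rightarrow> bool" where
  "is_cover C f \<longleftrightarrow> f \<in> Arr C \<and>
     (\<forall>m g. is_mono C m \<and> g \<in> Hom C (Dom C f) (Dom C m) \<and> Cod C m = Cod C f \<and>
        f = m \<cdot>\<^bsub>C\<^esub> g \<longrightarrow> is_iso C m)"

definition is_terminal :: "('o, 'm) cat \<Rightarrow> 'o \<Rightarrow> bool" where
  "is_terminal C t \<longleftrightarrow> t \<in> Obj C \<and> (\<forall>a\<in>Obj C. \<exists>!u. u \<in> Hom C a t)"

definition is_initial :: "('o, 'm) cat \<Rightarrow> 'o \<Rightarrow> bool" where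
  "is_initial C z \<longleftrightarrow> z \<in> Obj C \<and> (\<forall>a\<in>Obj C. \<exists>!u. u \<in> Hom C z a)"

text \<open>The span \<open>p, q\<close> is a product of \<open>Cod p\<close> and \<open>Cod q\<close>; dually for the cospan \<open>i, j\<close>.\<close>

definition is_product :: "('o, 'm) cat \<Rightarrow> 'm \<Rightarrow> 'm \<Rightarrow> bool" where
  "is_product C p q \<longleftrightarrow> p \<in> Arr C \<and> q \<in> Arr C \<and> Dom C p = Dom C q \<and>
     (\<forall>u\<in>Arr C. \<forall>v\<in>Arr C. Dom C u = Dom C v \<and> Cod C u = Cod C p \<and> Cod C v = Cod C q \<longrightarrow>
        (\<exists>!k. k \<in> Hom C (Dom C u) (Dom C p) \<and> p \<cdot>\<^bsub>C\<^esub> k = u \<and> q \<cdot>\<^bsub>C\<^esub> k = v))"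

definition is_coproduct :: "('o, 'm) cat \<Rightarrow> 'm \<Rightarrow> 'm \<Rightarrow> bool" where
  "is_coproduct C i j \<longleftrightarrow> i \<in> Arr C \<and> j \<in> Arr C \<and> Cod C i = Cod C j \<and>
     (\<forall>u\<in>Arr C. \<forall>v\<in>Arr C. Cod C u = Cod C v \<and> Dom C u = Dom C i \<and> Dom C v = Dom C j \<longrightarrow>
        (\<exists>!k. k \<in> Hom C (Cod C i) (Cod C u) \<and> k \<cdot>\<^bsub>C\<^esub> i = u \<and> k \<cdot>\<^bsub>C\<^esub> j = v))"

text \<open>
  \<open>is_pullback C f g p q\<close>: the square \<open>f p = g q\<close> is a pullback, so that \<open>p\<close> is a pullback of \<open>g\<close>
  along \<open>f\<close>, and \<open>q\<close> a pullback of \<open>f\<close> along \<open>g\<close>.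
\<close>

definition is_pullback :: "('o, 'm) cat \<Rightarrow> 'm \<Rightarrow> 'm \<Rightarrow> 'm \<Rightarrow> 'm \<Rightarrow> bool" where
  "is_pullback C f g p q \<longleftrightarrow> f \<in> Arr C \<and> g \<in> Arr C \<and> Cod C f = Cod C g \<and>
     p \<in> Arr C \<and> q \<in> Arr C \<and> Dom C p = Dom C q \<and> Cod C p = Dom C f \<and> Cod C q = Dom C g \<and>
     f \<cdot>\<^bsub>C\<^esub> p = g \<cdot>\<^bsub>C\<^esub> q \<and>
     (\<forall>u\<in>Arr C. \<forall>v\<in>Arr C. Dom C u = Dom C v \<and> Cod C u = Dom C f \<and> Cod C v = Dom C g \<and>
        f \<cdot>\<^bsub>C\<^esub> u = g \<cdot>\<^bsub>C\<^esub> v \<longrightarrow>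
        (\<exists>!k. k \<in> Hom C (Dom C u) (Dom C p) \<and> p \<cdot>\<^bsub>C\<^esub> k = u \<and> q \<cdot>\<^bsub>C\<^esub> k = v))"

text \<open>The order on subobjects of a common codomain, on representing monos.\<close>

definition sub_le :: "('o, 'm) cat \<Rightarrow> 'm \<Rightarrow> 'm \<Rightarrow> bool" where
  "sub_le C m n \<longleftrightarrow> (\<exists>k \<in> Hom C (Dom C m) (Dom C n). n \<cdot>\<^bsub>C\<^esub> k = m)"

text \<open>The mono \<open>n\<close> represents \<open>\<forall>\<^sub>f(m)\<close>: a subobject \<open>k\<close> lies below \<open>n\<close> iff \<open>f\<^sup>*k\<close> lies below \<open>m\<close>.\<close>

definition is_univ_image :: "('o, 'm) cat \<Rightarrow> 'm \<Rightarrow> 'm \<Rightarrow> 'm \<Rightarrow> bool" where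
  "is_univ_image C f m n \<longleftrightarrow> f \<in> Arr C \<and> is_mono C m \<and> Cod C m = Dom C f \<and>
     is_mono C n \<and> Cod C n = Cod C f \<and>
     (\<forall>k k' r. is_mono C k \<and> Cod C k = Cod C f \<and> is_pullback C f k k' r \<longrightarrow>
        (sub_le C k' m \<longleftrightarrow> sub_le C k n))"

locale positive_Heyting_category = category +
  assumes terminal_exists: "\<exists>t. is_terminal C t"
    and pullbacks_exist: "\<lbrakk>f \<in> Arr C; g \<in> Arr C; Cod C f = Cod C g\<rbrakk>
      \<Longrightarrow> \<exists>p q. is_pullback C f g p q"
    and cover_mono_factorisation: "f \<in> Arr C \<Longrightarrow>
      \<exists>e m. is_cover C e \<and> is_mono C m \<and> Cod C e = Dom C m \<and> f = m \<cdot> e"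
    and cover_stable: "\<lbrakk>is_cover C e; is_pullback C h e e' k\<rbrakk> \<Longrightarrow> is_cover C e'"
    and initial_exists: "\<exists>z. is_initial C z"
    and coproducts_exist: "\<lbrakk>a \<in> Obj C; b \<in> Obj C\<rbrakk>
      \<Longrightarrow> \<exists>i j. is_coproduct C i j \<and> Dom C i = a \<and> Dom C j = b"
    and initial_stable: "\<lbrakk>h \<in> Arr C; is_initial C (Cod C h)\<rbrakk> \<Longrightarrow> is_initial C (Dom C h)"
    and coproduct_stable: "\<lbrakk>is_coproduct C i j; is_pullback C h i i' r; is_pullback C h j j' s\<rbrakk>
      \<Longrightarrow> is_coproduct C i' j'"
    and coproduct_disjoint: "is_coproduct C i j \<Longrightarrow> is_mono C i \<and> is_mono C j"
      "\<lbrakk>is_coproduct C i j; is_pullback C i j p q\<rbrakk> \<Longrightarrow> is_initial C (Dom C p)"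
    and univ_image_exists: "\<lbrakk>f \<in> Arr C; is_mono C m; Cod C m = Dom C f\<rbrakk>
      \<Longrightarrow> \<exists>n. is_univ_image C f m n"


section \<open>Small maps\<close>

text \<open>\<open>top, left, right, bottom\<close> with \<open>right \<cdot> top = bottom \<cdot> left\<close>.\<close>

definition covering_square :: "('o, 'm) cat \<Rightarrow> 'm \<Rightarrow> 'm \<Rightarrow> 'm \<Rightarrow> 'm \<Rightarrow> bool" where
  "covering_square C t l r b \<longleftrightarrow>
     t \<in> Arr C \<and> l \<in> Arr C \<and> r \<in> Arr C \<and> Dom C t = Dom C l \<and> Cod C t = Dom C r \<and>
     Cod C l = Dom C b \<and> Cod C r = Cod C b \<and> r \<cdot>\<^bsub>C\<^esub> t = b \<cdot>\<^bsub>C\<^esub> l \<and> is_cover C b \<and>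
     (\<exists>p q k. is_pullback C b r p q \<and> k \<in> Hom C (Dom C t) (Dom C p) \<and>
        p \<cdot>\<^bsub>C\<^esub> k = l \<and> q \<cdot>\<^bsub>C\<^esub> k = t \<and> is_cover C k)"

locale category_with_small_maps = positive_Heyting_category +
  fixes S :: "'b set"
  assumes small_Arr: "S \<subseteq> Arr C"
    and small_pullback: "\<lbrakk>f \<in> S; is_pullback C h f f' k\<rbrakk> \<Longrightarrow> f' \<in> S"
    and small_descent: "\<lbrakk>is_cover C e; is_pullback C e f f' k; f' \<in> S\<rbrakk> \<Longrightarrow> f \<in> S"
    and small_sums: "\<lbrakk>f \<in> S; f' \<in> S; is_coproduct C i i'; Dom C i = Dom C f; Dom C i' = Dom C f';
        is_coproduct C j j'; Dom C j = Cod C f; Dom C j' = Cod C f';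
        h \<in> Hom C (Cod C i) (Cod C j); h \<cdot> i = j \<cdot> f; h \<cdot> i' = j' \<cdot> f'\<rbrakk> \<Longrightarrow> h \<in> S"
    and small_zero: "\<lbrakk>is_initial C z; is_terminal C t; u \<in> Hom C z t\<rbrakk> \<Longrightarrow> u \<in> S"
    and small_one: "\<lbrakk>is_terminal C t; u \<in> Hom C t t\<rbrakk> \<Longrightarrow> u \<in> S"
    and small_two: "\<lbrakk>is_terminal C t; is_coproduct C i j; Dom C i = t; Dom C j = t;
        u \<in> Hom C (Cod C i) t\<rbrakk> \<Longrightarrow> u \<in> S"
    and small_comp: "\<lbrakk>f \<in> S; g \<in> S; Cod C f = Dom C g\<rbrakk> \<Longrightarrow> g \<cdot> f \<in> S"
    and small_quotient: "\<lbrakk>is_cover C e; g \<in> Arr C; Cod C e = Dom C g; g \<cdot> e \<in> S\<rbrakk> \<Longrightarrow> g \<in> S"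
    and collection: "\<lbrakk>is_cover C p; f \<in> S; Cod C p = Dom C f\<rbrakk> \<Longrightarrow>
        \<exists>y l b. y \<in> Arr C \<and> Cod C y = Dom C p \<and> l \<in> S \<and> covering_square C (p \<cdot> y) l f b"
    and small_univ_image: "\<lbrakk>f \<in> S; m \<in> S; is_univ_image C f m n\<rbrakk> \<Longrightarrow> n \<in> S"
    and small_diagonal: "\<lbrakk>is_product C p q; Cod C p = a; Cod C q = a; d \<in> Hom C a (Dom C p);
        p \<cdot> d = Id C a; q \<cdot> d = Id C a\<rbrakk> \<Longrightarrow> d \<in> S"

text \<open>
  \<open>(e, p, q)\<close> with \<open>e\<close> a mono into the product \<open>(p, q)\<close> of \<open>X\<close> and \<open>PX\<close> is a power class of \<open>X\<close>, with
  \<open>e\<close> the membership relation. Equality of the subobjects \<open>r\<close> and \<open>(1 \<times> \<rho>)\<^sup>*e\<close> means that \<open>r\<close>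
  is itself a pullback of \<open>e\<close> along \<open>w = 1 \<times> \<rho>\<close>.
\<close>

definition is_power_class :: "('o, 'm) cat \<Rightarrow> 'm set \<Rightarrow> 'o \<Rightarrow> 'm \<Rightarrow> 'm \<Rightarrow> 'm \<Rightarrow> bool" where
  "is_power_class C S X e p q \<longleftrightarrow>
     is_product C p q \<and> Cod C p = X \<and> is_mono C e \<and> Cod C e = Dom C p \<and> q \<cdot>\<^bsub>C\<^esub> e \<in> S \<and>
     (\<forall>p' q' r. is_product C p' q' \<and> Cod C p' = X \<and> is_mono C r \<and> Cod C r = Dom C p' \<and>
        q' \<cdot>\<^bsub>C\<^esub> r \<in> S \<longrightarrow>
        (\<exists>!\<rho>. \<rho> \<in> Hom C (Cod C q') (Cod C q) \<and>
           (\<exists>w k. w \<in> Hom C (Dom C p') (Dom C p) \<and> p \<cdot>\<^bsub>C\<^esub> w = p' \<and> q \<cdot>\<^bsub>C\<^esub> w = \<rho> \<cdot>\<^bsub>C\<^esub> q' \<and>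
              is_pullback C w e r k)))"

locale category_with_small_maps_PE = category_with_small_maps +
  assumes PE: "X \<in> Obj C \<Longrightarrow> \<exists>e p q. is_power_class C S X e p q"


section \<open>Slices, and the functors between them\<close>

definition slice :: "('o, 'm) cat \<Rightarrow> 'o \<Rightarrow> ('m, 'm \<times> 'm \<times> 'm) cat" where
  "slice C X = \<lparr>
     Obj = {p \<in> Arr C. Cod C p = X},
     Arr = {(p, h, q). p \<in> Arr C \<and> Cod C p = X \<and> q \<in> Arr C \<and> Cod C q = X \<and>
              h \<in> Hom C (Dom C p) (Dom C q) \<and> q \<cdot>\<^bsub>C\<^esub> h = p},
     Dom = (\<lambda>(p, h, q). p),
     Cod = (\<lambda>(p, h, q). q),
     Id = (\<lambda>p. (p, Id C (Dom C p), p)),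
     Comp = (\<lambda>(p', h', q') (p, h, q). (p, h' \<cdot>\<^bsub>C\<^esub> h, q'))\<rparr>"

lemma (in category) category_slice: "category (slice C X)"
proof -
  have arr: "x \<in> Hom (slice C X) a b \<longleftrightarrow> (\<exists>h. x = (a, h, b) \<and> a \<in> Arr C \<and> Cod C a = X \<and>
      b \<in> Arr C \<and> Cod C b = X \<and> h \<in> Hom C (Dom C a) (Dom C b) \<and> b \<cdot> h = a)" for x a b
    by (cases x) (auto simp: slice_def Hom_def)
  have comp: "(p', h', q') \<cdot>\<^bsub>slice C X\<^esub> (p, h, q) = (p, h' \<cdot> h, q')" for p' h' q' p h q
    by (simp add: slice_def)
  have hom: "a \<in> Hom C (Dom C a) (Cod C a)" if "a \<in> Arr C" for a
    using that by (simp add: Hom_def)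
  show ?thesis
  proof
    fix f a b g c h d
    assume f: "f \<in> Hom (slice C X) a b" and g: "g \<in> Hom (slice C X) b c"
    then obtain u v where u: "f = (a, u, b)" "u \<in> Hom C (Dom C a) (Dom C b)" "b \<cdot> u = a"
        "a \<in> Arr C" "Cod C a = X"
      and v: "g = (b, v, c)" "v \<in> Hom C (Dom C b) (Dom C c)" "c \<cdot> v = b" "c \<in> Arr C" "Cod C c = X"
      unfolding arr by blast
    have "c \<cdot> (v \<cdot> u) = a"
      using Comp_assoc[OF u(2) v(2) hom[OF v(4)]] u(3) v(3) by simp
    then show "g \<cdot>\<^bsub>slice C X\<^esub> f \<in> Hom (slice C X) a c"
      unfolding arr u(1) v(1) comp using Comp_in_Hom[OF u(2) v(2)] u v by blast
    show "(h \<cdot>\<^bsub>slice C X\<^esub> g) \<cdot>\<^bsub>slice C X\<^esub> f = h \<cdot>\<^bsub>slice C X\<^esub> (g \<cdot>\<^bsub>slice C X\<^esub> f)"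
      if "h \<in> Hom (slice C X) c d"
    proof -
      from that obtain w where w: "h = (c, w, d)" "w \<in> Hom C (Dom C c) (Dom C d)"
        unfolding arr by blast
      show ?thesis
        unfolding u(1) v(1) w(1) comp by (simp add: Comp_assoc[OF u(2) v(2) w(2)])
    qed
  next
    fix a assume "a \<in> Obj (slice C X)"
    then have "a \<in> Arr C" "Cod C a = X" by (auto simp: slice_def)
    moreover from this have "Id C (Dom C a) \<in> Hom C (Dom C a) (Dom C a)" "a \<cdot> Id C (Dom C a) = a"
      using Id_in_Hom Dom_in_Obj Id_right[OF hom] by blast+
    ultimately show "Id (slice C X) a \<in> Hom (slice C X) a a"
      unfolding arr by (simp add: slice_def)
  next
    fix f a b assume "f \<in> Hom (slice C X) a b"
    then obtain u where u: "f = (a, u, b)" "u \<in> Hom C (Dom C a) (Dom C b)"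
      unfolding arr by blast
    have *: "Id (slice C X) x = (x, Id C (Dom C x), x)" for x by (simp add: slice_def)
    show "Id (slice C X) b \<cdot>\<^bsub>slice C X\<^esub> f = f"
      unfolding * u(1) comp using Id_left[OF u(2)] by simp
    show "f \<cdot>\<^bsub>slice C X\<^esub> Id (slice C X) a = f"
      unfolding * u(1) comp using Id_right[OF u(2)] by simp
  qed (auto simp: slice_def)
qed

record ('o, 'm, 'p, 'n) fctr =
  on_obj :: "'o \<Rightarrow> 'p"
  on_arr :: "'m \<Rightarrow> 'n"

definition fctr_comp ::
  "('p, 'n, 'q, 'k) fctr \<Rightarrow> ('o, 'm, 'p, 'n) fctr \<Rightarrow> ('o, 'm, 'q, 'k) fctr" (infixr "\<circ>\<^sub>F" 60) where
  "G \<circ>\<^sub>F F = \<lparr>on_obj = on_obj G \<circ> on_obj F, on_arr = on_arr G \<circ> on_arr F\<rparr>"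

text \<open>
  Products, pullbacks and right adjoints are chosen by Hilbert choice; they are only meaningful
  where the respective universal objects exist.
\<close>

definition chosen_product :: "('o, 'm) cat \<Rightarrow> 'o \<Rightarrow> 'o \<Rightarrow> 'm \<times> 'm" where
  "chosen_product C a b = (SOME (p, q). is_product C p q \<and> Cod C p = a \<and> Cod C q = b)"

definition chosen_pullback :: "('o, 'm) cat \<Rightarrow> 'm \<Rightarrow> 'm \<Rightarrow> 'm \<times> 'm" where
  "chosen_pullback C f g = (SOME (p, q). is_pullback C f g p q)"

text \<open>\<open>\<Sigma>\<^sub>A : C/A \<rightarrow> C\<close>\<close>

definition Sigma_fctr :: "('o, 'm) cat \<Rightarrow> 'o \<Rightarrow> ('m, 'm \<times> 'm \<times> 'm, 'o, 'm) fctr" where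
  "Sigma_fctr C A = \<lparr>on_obj = Dom C, on_arr = (\<lambda>(p, h, q). h)\<rparr>"

text \<open>\<open>X\<^sup>* : C \<rightarrow> C/X\<close>, sending \<open>Y\<close> to the projection \<open>Y \<times> X \<rightarrow> X\<close>\<close>

definition star :: "('o, 'm) cat \<Rightarrow> 'o \<Rightarrow> ('o, 'm, 'm, 'm \<times> 'm \<times> 'm) fctr" where
  "star C X = \<lparr>
     on_obj = (\<lambda>Y. snd (chosen_product C Y X)),
     on_arr = (\<lambda>h.
       let (p, q) = chosen_product C (Dom C h) X; (p', q') = chosen_product C (Cod C h) X
       in (q, THE k. k \<in> Hom C (Dom C p) (Dom C p') \<and>
                p' \<cdot>\<^bsub>C\<^esub> k = h \<cdot>\<^bsub>C\<^esub> p \<and> q' \<cdot>\<^bsub>C\<^esub> k = q, q'))\<rparr>"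

text \<open>\<open>f\<^sup>* : C/A \<rightarrow> C/B\<close> for \<open>f : B \<rightarrow> A\<close>\<close>

definition pullback_fctr ::
  "('o, 'm) cat \<Rightarrow> 'm \<Rightarrow> ('m, 'm \<times> 'm \<times> 'm, 'm, 'm \<times> 'm \<times> 'm) fctr" where
  "pullback_fctr C f = \<lparr>
     on_obj = (\<lambda>g. snd (chosen_pullback C g f)),
     on_arr = (\<lambda>(g, h, g').
       let (p, q) = chosen_pullback C g f; (p', q') = chosen_pullback C g' f
       in (q, THE k. k \<in> Hom C (Dom C p) (Dom C p') \<and>
                p' \<cdot>\<^bsub>C\<^esub> k = h \<cdot>\<^bsub>C\<^esub> p \<and> q' \<cdot>\<^bsub>C\<^esub> k = q, q'))\<rparr>"

text \<open>
  The right adjoint of \<open>F : C \<rightarrow> D\<close>, given by a choice, for every object \<open>d\<close> of \<open>D\<close>, of a universal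
  arrow \<open>\<epsilon>\<^sub>d : F (G d) \<rightarrow> d\<close> from \<open>F\<close> to \<open>d\<close>.
\<close>

definition is_universal_from :: "('o, 'm) cat \<Rightarrow> ('p, 'n) cat \<Rightarrow> ('o, 'm, 'p, 'n) fctr \<Rightarrow>
    'p \<Rightarrow> 'o \<Rightarrow> 'n \<Rightarrow> bool" where
  "is_universal_from C D F d c e \<longleftrightarrow> c \<in> Obj C \<and> e \<in> Hom D (on_obj F c) d \<and>
     (\<forall>c'\<in>Obj C. \<forall>g \<in> Hom D (on_obj F c') d. \<exists>!h. h \<in> Hom C c' c \<and> e \<cdot>\<^bsub>D\<^esub> on_arr F h = g)"

definition radj_data :: "('o, 'm) cat \<Rightarrow> ('p, 'n) cat \<Rightarrow> ('o, 'm, 'p, 'n) fctr \<Rightarrow>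
    'p \<Rightarrow> 'o \<times> 'n" where
  "radj_data C D F d = (SOME (c, e). is_universal_from C D F d c e)"

definition counit :: "('o, 'm) cat \<Rightarrow> ('p, 'n) cat \<Rightarrow> ('o, 'm, 'p, 'n) fctr \<Rightarrow> 'p \<Rightarrow> 'n" where
  "counit C D F d = snd (radj_data C D F d)"

definition radj :: "('o, 'm) cat \<Rightarrow> ('p, 'n) cat \<Rightarrow> ('o, 'm, 'p, 'n) fctr \<Rightarrow>
    ('p, 'n, 'o, 'm) fctr" where
  "radj C D F = \<lparr>
     on_obj = (\<lambda>d. fst (radj_data C D F d)),
     on_arr = (\<lambda>h. THE k.
        k \<in> Hom C (fst (radj_data C D F (Dom D h))) (fst (radj_data C D F (Cod D h))) \<and>
        counit C D F (Cod D h) \<cdot>\<^bsub>D\<^esub> on_arr F k = h \<cdot>\<^bsub>D\<^esub> counit C D F (Dom D h))\<rparr>"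

text \<open>\<open>\<Pi>\<^sub>f : C/B \<rightarrow> C/A\<close> for exponentiable \<open>f : B \<rightarrow> A\<close>\<close>

definition Pi_fctr ::
  "('o, 'm) cat \<Rightarrow> 'm \<Rightarrow> ('m, 'm \<times> 'm \<times> 'm, 'm, 'm \<times> 'm \<times> 'm) fctr" where
  "Pi_fctr C f = radj (slice C (Cod C f)) (slice C (Dom C f)) (pullback_fctr C f)"

text \<open>\<open>P\<^sub>f = \<Sigma>\<^sub>A \<circ> \<Pi>\<^sub>f \<circ> B\<^sup>*\<close>\<close>

definition poly :: "('o, 'm) cat \<Rightarrow> 'm \<Rightarrow> ('o, 'm, 'o, 'm) fctr" where
  "poly C f = Sigma_fctr C (Cod C f) \<circ>\<^sub>F Pi_fctr C f \<circ>\<^sub>F star C (Dom C f)"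


section \<open>Algebras and W-types\<close>

definition is_algebra :: "('o, 'm) cat \<Rightarrow> ('o, 'm, 'o, 'm) fctr \<Rightarrow> 'o \<Rightarrow> 'm \<Rightarrow> bool" where
  "is_algebra C F W s \<longleftrightarrow> W \<in> Obj C \<and> s \<in> Hom C (on_obj F W) W"

definition is_algebra_hom :: "('o, 'm) cat \<Rightarrow> ('o, 'm, 'o, 'm) fctr \<Rightarrow>
    'o \<Rightarrow> 'm \<Rightarrow> 'o \<Rightarrow> 'm \<Rightarrow> 'm \<Rightarrow> bool" where
  "is_algebra_hom C F V t W s h \<longleftrightarrow> is_algebra C F V t \<and> is_algebra C F W s \<and>
     h \<in> Hom C V W \<and> h \<cdot>\<^bsub>C\<^esub> t = s \<cdot>\<^bsub>C\<^esub> on_arr F h"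

definition is_subalgebra :: "('o, 'm) cat \<Rightarrow> ('o, 'm, 'o, 'm) fctr \<Rightarrow>
    'o \<Rightarrow> 'm \<Rightarrow> 'o \<Rightarrow> 'm \<Rightarrow> 'm \<Rightarrow> bool" where
  "is_subalgebra C F V t W s m \<longleftrightarrow> is_algebra_hom C F V t W s m \<and> is_mono C m"

definition no_proper_subalgebras :: "('o, 'm) cat \<Rightarrow> ('o, 'm, 'o, 'm) fctr \<Rightarrow>
    'o \<Rightarrow> 'm \<Rightarrow> bool" where
  "no_proper_subalgebras C F W s \<longleftrightarrow>
     \<not> (\<exists>V t m. is_subalgebra C F V t W s m \<and> \<not> is_iso C m)"

definition is_W_type :: "('o, 'm) cat \<Rightarrow> 'm \<Rightarrow> 'o \<Rightarrow> 'm \<Rightarrow> bool" where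
  "is_W_type C f W s \<longleftrightarrow> is_algebra C (poly C f) W s \<and>
     (\<forall>V t. is_algebra C (poly C f) V t \<longrightarrow> (\<exists>!h. is_algebra_hom C (poly C f) W s V t h))"


section \<open>The induced algebra in a slice\<close>

text \<open>
  \<open>P\<^sub>f W\<close> comes with a projection \<open>\<pi> : P\<^sub>f W \<rightarrow> A\<close>, and the counit of \<open>f\<^sup>* \<stileturn> \<Pi>\<^sub>f\<close> at \<open>B\<^sup>*W\<close>, followed
  by \<open>W \<times> B \<rightarrow> W\<close>, gives an evaluation map \<open>ev : P\<^sub>f W \<times>\<^sub>A B \<rightarrow> W\<close>. Here \<open>P\<^sub>f W \<times>\<^sub>A B\<close> is
  \<open>chosen_pullback C \<pi> f\<close>.
\<close>

definition poly_proj :: "('o, 'm) cat \<Rightarrow> 'm \<Rightarrow> 'o \<Rightarrow> 'm" where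
  "poly_proj C f W = on_obj (Pi_fctr C f) (on_obj (star C (Dom C f)) W)"

definition poly_ev :: "('o, 'm) cat \<Rightarrow> 'm \<Rightarrow> 'o \<Rightarrow> 'm" where
  "poly_ev C f W = fst (chosen_product C W (Dom C f)) \<cdot>\<^bsub>C\<^esub>
     on_arr (Sigma_fctr C (Dom C f))
       (counit (slice C (Cod C f)) (slice C (Dom C f)) (pullback_fctr C f)
          (on_obj (star C (Dom C f)) W))"

text \<open>
  The canonical isomorphism \<open>X\<^sup>*(P\<^sub>f W) \<rightarrow> P\<^bsub>X\<^sup>*f\<^esub>(X\<^sup>*W)\<close>: the unique arrow \<open>\<theta>\<close> compatible with
  projection and evaluation, where \<open>s\<close> is the map
  \<open>X\<^sup>*(P\<^sub>f W \<times>\<^sub>A B) \<rightarrow> P\<^bsub>X\<^sup>*f\<^esub>(X\<^sup>*W) \<times>\<^bsub>X\<^sup>*A\<^esub> X\<^sup>*B\<close> induced by \<open>\<theta>\<close>.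
\<close>

definition poly_comparison ::
  "('o, 'm) cat \<Rightarrow> 'o \<Rightarrow> 'm \<Rightarrow> 'o \<Rightarrow> 'm \<times> 'm \<times> 'm" where
  "poly_comparison C X f W =
     (let D = slice C X; T = on_obj (star C X); T1 = on_arr (star C X);
          (p, q) = chosen_pullback C (poly_proj C f W) f;
          (p', q') = chosen_pullback D (poly_proj D (T1 f) (T W)) (T1 f)
      in THE \<theta>. \<theta> \<in> Hom D (T (on_obj (poly C f) W)) (on_obj (poly D (T1 f)) (T W)) \<and>
           poly_proj D (T1 f) (T W) \<cdot>\<^bsub>D\<^esub> \<theta> = T1 (poly_proj C f W) \<and>
           (\<exists>s \<in> Hom D (T (Dom C p)) (Dom D p').
              p' \<cdot>\<^bsub>D\<^esub> s = \<theta> \<cdot>\<^bsub>D\<^esub> T1 p \<and> q' \<cdot>\<^bsub>D\<^esub> s = T1 q \<and>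
              poly_ev D (T1 f) (T W) \<cdot>\<^bsub>D\<^esub> s = T1 (poly_ev C f W)))"

text \<open>The structure map \<open>P\<^bsub>X\<^sup>*f\<^esub>(X\<^sup>*W) \<cong> X\<^sup>*(P\<^sub>f W) \<rightarrow> X\<^sup>*W\<close>\<close>

definition star_algebra :: "('o, 'm) cat \<Rightarrow> 'o \<Rightarrow> 'm \<Rightarrow> 'o \<Rightarrow> 'm \<Rightarrow> 'm \<times> 'm \<times> 'm" where
  "star_algebra C X f W s =
     on_arr (star C X) s \<cdot>\<^bsub>slice C X\<^esub> inverse_arrow (slice C X) (poly_comparison C X f W)"

definition is_indexed_W_type :: "('o, 'm) cat \<Rightarrow> 'm \<Rightarrow> 'o \<Rightarrow> 'm \<Rightarrow> bool" where
  "is_indexed_W_type C f W s \<longleftrightarrow> is_W_type C f W s \<and>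
     (\<forall>X\<in>Obj C. is_W_type (slice C X) (on_arr (star C X) f)
        (on_obj (star C X) W) (star_algebra C X f W s))"

end

theory Submission
  imports Defs
begin

text \<open>
  Everything is expressed through generalized elements. An element of \<open>P\<^sub>f W\<close> is some \<open>a \<in> A\<close> with a
  family \<open>B\<^sub>a \<rightarrow> W\<close>; \<open>P\<^sub>f W\<close> exists because small functional relations can be carved out of power
  classes. The absence of proper subalgebras is induction: a subobject of \<open>W\<close> closed under \<open>sup\<close> is
  all of \<open>W\<close>.

  For initiality, given an algebra \<open>V\<close>, let \<open>G \<subseteq> W \<times> V\<close> be the union of all small relations \<open>R\<close> each of
  whose elements is of the form \<open>(sup\<^sub>a t, sup\<^sub>a s)\<close> with \<open>(t b, s b) \<in> R\<close> for all \<open>b \<in> B\<^sub>a\<close>. No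
  functionality is demanded of \<open>R\<close>: by induction on \<open>W\<close> the projection \<open>G \<rightarrow> W\<close> is mono, and as \<open>G\<close> is
  closed under \<open>sup\<close> its image is a subalgebra, so \<open>G\<close> is the graph of the required morphism.

  All ingredients are statements about elements and pass to slices. A closed \<open>M \<subseteq> X \<times> W\<close> over \<open>X\<close>
  yields the closed \<open>{w. \<forall>x. (x, w) \<in> M}\<close>, whence induction over \<open>X\<close> reduces to induction for \<open>W\<close>;
  conversely induction for \<open>W\<close> follows from the slice over \<open>X = W\<close>, where \<open>W \<times> W\<close> has a diagonal.
\<close>

section \<open>Generalized elements, products and equalizers\<close>

text \<open>Only small subobjects have codes in a power class, so the least relation closed under
  the two structure maps cannot be formed as an intersection of all closed relations. An existential
  quantifier over codes is available, and it yields the union of the small backward closed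
  relations. This is a coinductive object: nothing in it is well-founded by itself, so that it is
  single-valued and total has to be drawn from induction on \<open>W\<close>. The witnessing
  relations exist only locally, and the small family of them that Collection returns is not
  canonical; demanding that they be functional would require a proof that they agree before they are
  glued. The other obstacle is that \<open>P\<^sub>f\<close>, \<open>X\<^sup>*\<close> and the
  comparison map rest on Hilbert choices. They are traded for universal properties about elements in
  which the pullbacks are parameters. No class of small maps is set up on a slice: finite limits,
  universal quantification, the required dependent products and the property
  \<open>has_inductive_subobjects\<close> are transferred separately.\<close>

definition is_epi :: "('o, 'm) cat \<Rightarrow> 'm \<Rightarrow> bool" where
  "is_epi C e \<longleftrightarrow> e \<in> Arr C \<and> (\<forall>u v Y. u \<in> Hom C (Cod C e) Y \<and> v \<in> Hom C (Cod C e) Y \<and>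
     u \<cdot>\<^bsub>C\<^esub> e = v \<cdot>\<^bsub>C\<^esub> e \<longrightarrow> u = v)"

definition pr1 :: "('o, 'm) cat \<Rightarrow> 'o \<Rightarrow> 'o \<Rightarrow> 'm" where
  "pr1 C a b = fst (chosen_product C a b)"

definition pr2 :: "('o, 'm) cat \<Rightarrow> 'o \<Rightarrow> 'o \<Rightarrow> 'm" where
  "pr2 C a b = snd (chosen_product C a b)"

definition prod_obj :: "('o, 'm) cat \<Rightarrow> 'o \<Rightarrow> 'o \<Rightarrow> 'o" where
  "prod_obj C a b = Dom C (pr1 C a b)"

text \<open>The factors of the product are read off from the codomains of the two components, so
  that no objects have to be passed along.\<close>

definition pairing :: "('o, 'm) cat \<Rightarrow> 'm \<Rightarrow> 'm \<Rightarrow> 'm" where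
  "pairing C u v = (THE k. k \<in> Hom C (Dom C u) (prod_obj C (Cod C u) (Cod C v)) \<and>
     pr1 C (Cod C u) (Cod C v) \<cdot>\<^bsub>C\<^esub> k = u \<and> pr2 C (Cod C u) (Cod C v) \<cdot>\<^bsub>C\<^esub> k = v)"

context category
begin

lemma comp_arr [simp]:
  assumes "f \<in> Arr C" "g \<in> Arr C" "Cod C f = Dom C g"
  shows "g \<cdot> f \<in> Arr C" "Dom C (g \<cdot> f) = Dom C f" "Cod C (g \<cdot> f) = Cod C g"
  using Comp_in_Hom[of f "Dom C f" "Cod C f" g "Cod C g"] assms by (auto simp: Hom_def)

lemma assoc [simp]:
  assumes "f \<in> Arr C" "g \<in> Arr C" "h \<in> Arr C" "Cod C f = Dom C g" "Cod C g = Dom C h"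
  shows "(h \<cdot> g) \<cdot> f = h \<cdot> (g \<cdot> f)"
  using Comp_assoc[of f "Dom C f" "Cod C f" g "Cod C g" h "Cod C h"] assms by (auto simp: Hom_def)

lemma Id_simps [simp]:
  assumes "a \<in> Obj C"
  shows "Id C a \<in> Arr C" "Dom C (Id C a) = a" "Cod C (Id C a) = a"
  using Id_in_Hom[OF assms] by (auto simp: Hom_def)

lemma Id_comp [simp]:
  assumes "f \<in> Arr C"
  shows "Cod C f = b \<Longrightarrow> Id C b \<cdot> f = f" "Dom C f = a \<Longrightarrow> f \<cdot> Id C a = f"
  using Id_left[of f "Dom C f" "Cod C f"] Id_right[of f "Dom C f" "Cod C f"] assms
  by (auto simp: Hom_def)

lemma obj [simp]: "f \<in> Arr C \<Longrightarrow> Dom C f \<in> Obj C" "f \<in> Arr C \<Longrightarrow> Cod C f \<in> Obj C"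
  using Dom_in_Obj Cod_in_Obj by auto

lemma Hom_Obj: "f \<in> Hom C a b \<Longrightarrow> a \<in> Obj C" "f \<in> Hom C a b \<Longrightarrow> b \<in> Obj C"
  by (auto simp: Hom_def)

lemma arr_Hom: "f \<in> Arr C \<Longrightarrow> f \<in> Hom C (Dom C f) (Cod C f)"
  by (simp add: Hom_def)

text \<open>The simp rule \<open>assoc\<close> pushes all brackets to the right, after which an
  equation \<open>f \<cdot> p = x\<close> no longer matches \<open>f \<cdot> (p \<cdot> k)\<close>.
  Most diagram chases below use this bridge.\<close>

lemma whisker:
  assumes "f \<cdot> p = x" "f \<in> Arr C" "p \<in> Arr C" "k \<in> Arr C" "Cod C p = Dom C f" "Cod C k = Dom C p"
  shows "f \<cdot> (p \<cdot> k) = x \<cdot> k"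
  using assms by (metis assoc)

lemma monoD:
  assumes "is_mono C m" "m \<cdot> u = m \<cdot> v" "u \<in> Hom C z (Dom C m)" "v \<in> Hom C z (Dom C m)"
  shows "u = v"
  using assms unfolding is_mono_def Hom_def by auto

lemma monoI:
  assumes "m \<in> Hom C a b"
    "\<And>z u v. \<lbrakk>u \<in> Hom C z a; v \<in> Hom C z a; m \<cdot> u = m \<cdot> v\<rbrakk> \<Longrightarrow> u = v"
  shows "is_mono C m"
  using assms unfolding is_mono_def Hom_def by auto

lemma mono_arr: "is_mono C m \<Longrightarrow> m \<in> Arr C"
  by (simp add: is_mono_def)

lemma cover_arr: "is_cover C e \<Longrightarrow> e \<in> Arr C"
  by (simp add: is_cover_def)

lemma isoI: "\<lbrakk>f \<in> Hom C a b; g \<in> Hom C b a; g \<cdot> f = Id C a; f \<cdot> g = Id C b\<rbrakk> \<Longrightarrow> is_iso C f"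
  unfolding is_iso_def inverse_of_def Hom_def by auto

lemma isoE:
  assumes "is_iso C f" "f \<in> Hom C a b"
  obtains g where "g \<in> Hom C b a" "g \<cdot> f = Id C a" "f \<cdot> g = Id C b"
  using assms unfolding is_iso_def inverse_of_def Hom_def by auto

lemma inverse_of_unique: "inverse_of C f g \<Longrightarrow> inverse_of C f g' \<Longrightarrow> g = g'"
  unfolding inverse_of_def Hom_def
  by (smt (verit) Id_comp assoc mem_Collect_eq)

lemma inverse_arrow_inverse: "is_iso C f \<Longrightarrow> inverse_of C f (inverse_arrow C f)"
  unfolding is_iso_def inverse_arrow_def using inverse_of_unique by (metis theI)

lemma inverse_arrow:
  assumes "is_iso C f" "f \<in> Hom C a b"
  shows "inverse_arrow C f \<in> Hom C b a" "inverse_arrow C f \<cdot> f = Id C a"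
    "f \<cdot> inverse_arrow C f = Id C b"
  using inverse_arrow_inverse[OF assms(1)] assms(2) unfolding inverse_of_def Hom_def by auto

lemma iso_comp:
  assumes "is_iso C f" "is_iso C g" "f \<in> Hom C a b" "g \<in> Hom C b c"
  shows "is_iso C (g \<cdot> f)"
proof -
  obtain f' where f': "f' \<in> Hom C b a" "f' \<cdot> f = Id C a" "f \<cdot> f' = Id C b"
    using isoE[OF assms(1,3)] .
  obtain g' where g': "g' \<in> Hom C c b" "g' \<cdot> g = Id C b" "g \<cdot> g' = Id C c"
    using isoE[OF assms(2,4)] .
  note t = assms(3,4) f'(1) g'(1)
  show ?thesis
  proof (rule isoI)
    show "g \<cdot> f \<in> Hom C a c" "f' \<cdot> g' \<in> Hom C c a"
      using t by (auto simp: Hom_def)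
    have "g' \<cdot> (g \<cdot> f) = f" "f \<cdot> (f' \<cdot> g') = g'"
      using t whisker[OF g'(2), of f] whisker[OF f'(3), of g'] by (auto simp: Hom_def)
    then show "f' \<cdot> g' \<cdot> (g \<cdot> f) = Id C a" "g \<cdot> f \<cdot> (f' \<cdot> g') = Id C c"
      using t f' g' by (auto simp: Hom_def)
  qed
qed

lemma iso_mono:
  assumes "is_iso C f" "f \<in> Hom C a b"
  shows "is_mono C f"
proof -
  obtain g where g: "g \<in> Hom C b a" "g \<cdot> f = Id C a" "f \<cdot> g = Id C b"
    using isoE[OF assms] .
  show ?thesis
  proof (rule monoI[OF assms(2)])
    fix z u v assume u: "u \<in> Hom C z a" "v \<in> Hom C z a" "f \<cdot> u = f \<cdot> v"
    have "g \<cdot> (f \<cdot> x) = x" if "x \<in> Hom C z a" for x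
      using that assms(2) g(1) whisker[OF g(2), of x] by (auto simp: Hom_def)
    then show "u = v" using u by metis
  qed
qed

text \<open>This is how maximality of a subobject turns into an isomorphism: a \<open>k\<close> with
  \<open>m \<cdot> k = Id C b\<close> gives \<open>m \<cdot> (k \<cdot> m) = m\<close>, and
  cancelling \<open>m\<close> gives the other identity.\<close>

lemma mono_split_iso:
  assumes "is_mono C m" "m \<in> Hom C a b" "sub_le C (Id C b) m"
  shows "is_iso C m"
proof -
  have b: "b \<in> Obj C" "a \<in> Obj C" using assms(2) Hom_Obj by auto
  obtain k where k: "k \<in> Hom C b a" "m \<cdot> k = Id C b"
    using assms(2,3) b unfolding sub_le_def by (auto simp: Hom_def)
  have "m \<cdot> (k \<cdot> m) = m \<cdot> Id C a"
    using whisker[OF k(2), of m] k(1) assms(2) by (auto simp: Hom_def)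
  then have "k \<cdot> m = Id C a"
    by (rule monoD[OF assms(1), where z = a]) (use k(1) assms(2) b in \<open>auto simp: Hom_def\<close>)
  then show ?thesis using isoI[OF assms(2) k(1)] k(2) by blast
qed

text \<open>From here on \<open>sub_le C u m\<close> is applied to arbitrary arrows
  \<open>u\<close>, not only to monos: it reads as membership of the generalized element
  \<open>u\<close> in the subobject \<open>m\<close>.\<close>

lemma sub_leI: "\<lbrakk>k \<in> Hom C z (Dom C m); m \<cdot> k = u; m \<in> Arr C\<rbrakk> \<Longrightarrow> sub_le C u m"
  unfolding sub_le_def Hom_def by auto

lemma sub_leE:
  assumes "sub_le C u m" "u \<in> Hom C z a"
  obtains k where "k \<in> Hom C z (Dom C m)" "m \<cdot> k = u"
  using assms unfolding sub_le_def Hom_def by auto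

lemma sub_le_comp:
  assumes "sub_le C u m" "u \<in> Hom C z a" "m \<in> Arr C" "h \<in> Hom C z' z"
  shows "sub_le C (u \<cdot> h) m"
proof -
  obtain k where "k \<in> Hom C z (Dom C m)" "m \<cdot> k = u" using sub_leE[OF assms(1,2)] .
  then show ?thesis using assms
    by (intro sub_leI[of "k \<cdot> h" z']) (auto simp: Hom_def)
qed

lemma sub_le_iso:
  assumes "is_iso C m" "m \<in> Hom C a b" "u \<in> Hom C z b"
  shows "sub_le C u m"
proof -
  obtain g where g: "g \<in> Hom C b a" "g \<cdot> m = Id C a" "m \<cdot> g = Id C b"
    using isoE[OF assms(1,2)] .
  then show ?thesis using assms whisker[OF g(3), of u]
    by (intro sub_leI[of "g \<cdot> u" z]) (auto simp: Hom_def)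
qed

lemma epiD: "\<lbrakk>is_epi C e; u \<cdot> e = v \<cdot> e; u \<in> Hom C (Cod C e) y; v \<in> Hom C (Cod C e) y\<rbrakk> \<Longrightarrow> u = v"
  unfolding is_epi_def by blast

lemma pullbackD:
  assumes "is_pullback C f g p q"
  shows "f \<in> Arr C" "g \<in> Arr C" "Cod C f = Cod C g" "p \<in> Arr C" "q \<in> Arr C" "Dom C q = Dom C p"
    "Cod C p = Dom C f" "Cod C q = Dom C g" "f \<cdot> p = g \<cdot> q"
  using assms unfolding is_pullback_def by auto

lemma pullback_ex1:
  assumes "is_pullback C f g p q" "u \<in> Hom C z (Dom C f)" "v \<in> Hom C z (Dom C g)" "f \<cdot> u = g \<cdot> v"
  shows "\<exists>!k. k \<in> Hom C z (Dom C p) \<and> p \<cdot> k = u \<and> q \<cdot> k = v"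
proof -
  have "\<forall>u\<in>Arr C. \<forall>v\<in>Arr C. Dom C u = Dom C v \<and> Cod C u = Dom C f \<and> Cod C v = Dom C g \<and>
        f \<cdot> u = g \<cdot> v \<longrightarrow>
        (\<exists>!k. k \<in> Hom C (Dom C u) (Dom C p) \<and> p \<cdot> k = u \<and> q \<cdot> k = v)"
    using assms(1) unfolding is_pullback_def by blast
  moreover have "u \<in> Arr C" "v \<in> Arr C" "Dom C u = z"
    "Dom C u = Dom C v \<and> Cod C u = Dom C f \<and> Cod C v = Dom C g \<and> f \<cdot> u = g \<cdot> v"
    using assms(2-4) by (auto simp: Hom_def)
  ultimately show ?thesis by blast
qed

lemma pullbackE:
  assumes "is_pullback C f g p q" "u \<in> Hom C z (Dom C f)" "v \<in> Hom C z (Dom C g)" "f \<cdot> u = g \<cdot> v"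
  obtains k where "k \<in> Hom C z (Dom C p)" "p \<cdot> k = u" "q \<cdot> k = v"
  using pullback_ex1[OF assms] by blast

lemma pullback_ext:
  assumes "is_pullback C f g p q" "k \<in> Hom C z (Dom C p)" "k' \<in> Hom C z (Dom C p)"
    "p \<cdot> k = p \<cdot> k'" "q \<cdot> k = q \<cdot> k'"
  shows "k = k'"
proof -
  note P = pullbackD[OF assms(1)]
  have "f \<cdot> (p \<cdot> k) = g \<cdot> (q \<cdot> k)"
    using assms(2) P whisker[OF P(9), of k] by (auto simp: Hom_def)
  then have "\<exists>!j. j \<in> Hom C z (Dom C p) \<and> p \<cdot> j = p \<cdot> k \<and> q \<cdot> j = q \<cdot> k"
    by (intro pullback_ex1[OF assms(1)]) (use assms(2) P in \<open>auto simp: Hom_def\<close>)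
  then show ?thesis using assms by metis
qed

lemma pullbackI:
  assumes "f \<in> Hom C a c" "g \<in> Hom C b c" "p \<in> Hom C d a" "q \<in> Hom C d b" "f \<cdot> p = g \<cdot> q"
    "\<And>z u v. \<lbrakk>u \<in> Hom C z a; v \<in> Hom C z b; f \<cdot> u = g \<cdot> v\<rbrakk>
       \<Longrightarrow> \<exists>k. k \<in> Hom C z d \<and> p \<cdot> k = u \<and> q \<cdot> k = v"
    "\<And>z k k'. \<lbrakk>k \<in> Hom C z d; k' \<in> Hom C z d; p \<cdot> k = p \<cdot> k'; q \<cdot> k = q \<cdot> k'\<rbrakk> \<Longrightarrow> k = k'"
  shows "is_pullback C f g p q"
  unfolding is_pullback_def
proof (intro conjI ballI impI)
  fix u v assume uv: "u \<in> Arr C" "v \<in> Arr C" "Dom C u = Dom C v \<and> Cod C u = Dom C f \<and>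
    Cod C v = Dom C g \<and> f \<cdot> u = g \<cdot> v"
  then obtain k where "k \<in> Hom C (Dom C u) d \<and> p \<cdot> k = u \<and> q \<cdot> k = v"
    using assms(6)[of u "Dom C u" v] assms(1,2) by (auto simp: Hom_def)
  then show "\<exists>!k. k \<in> Hom C (Dom C u) (Dom C p) \<and> p \<cdot> k = u \<and> q \<cdot> k = v"
    using assms(3) assms(7)[of _ "Dom C u"] by (intro ex1I[of _ k]) (auto simp: Hom_def)
qed (use assms(1-5) in \<open>auto simp: Hom_def\<close>)

lemma pullback_mono:
  assumes "is_pullback C f m p q" "is_mono C m"
  shows "is_mono C p"
proof -
  note P = pullbackD[OF assms(1)]
  show ?thesis
  proof (rule monoI[OF arr_Hom[OF P(4)]])
    fix z u v assume u: "u \<in> Hom C z (Dom C p)" "v \<in> Hom C z (Dom C p)" "p \<cdot> u = p \<cdot> v"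
    have "m \<cdot> (q \<cdot> u) = m \<cdot> (q \<cdot> v)"
      using whisker[OF P(9), of u] whisker[OF P(9), of v] u P by (auto simp: Hom_def)
    then have "q \<cdot> u = q \<cdot> v"
      by (rule monoD[OF assms(2), where z = z]) (use u P in \<open>auto simp: Hom_def\<close>)
    then show "u = v" using pullback_ext[OF assms(1) u(1,2)] u(3) by blast
  qed
qed

lemma pullback_sub_le:
  assumes "is_pullback C f m p q" "u \<in> Hom C z (Dom C f)"
  shows "sub_le C u p \<longleftrightarrow> sub_le C (f \<cdot> u) m"
proof
  note P = pullbackD[OF assms(1)]
  assume "sub_le C u p"
  then obtain k where k: "k \<in> Hom C z (Dom C p)" "p \<cdot> k = u" using sub_leE assms(2) by blast
  show "sub_le C (f \<cdot> u) m"
    by (rule sub_leI[of "q \<cdot> k" z]) (use k P whisker[OF P(9), of k] in \<open>auto simp: Hom_def\<close>)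
next
  note P = pullbackD[OF assms(1)]
  assume "sub_le C (f \<cdot> u) m"
  moreover have "f \<cdot> u \<in> Hom C z (Cod C f)" using assms(2) P by (auto simp: Hom_def)
  ultimately obtain k where k: "k \<in> Hom C z (Dom C m)" "m \<cdot> k = f \<cdot> u" using sub_leE by blast
  obtain j where "j \<in> Hom C z (Dom C p)" "p \<cdot> j = u"
    using pullbackE[OF assms k(1)] k(2) by metis
  then show "sub_le C u p" using sub_leI P by blast
qed

end

text \<open>Finite limits are kept apart from the Heyting structure because elements, products and
  slices are handled on this layer alone; slices are later shown to satisfy it without reference to
  covers.\<close>

locale lex_cat = category +
  assumes lex_terminal: "\<exists>t. is_terminal C t"
    and lex_pullbacks: "\<lbrakk>f \<in> Arr C; g \<in> Arr C; Cod C f = Cod C g\<rbrakk> \<Longrightarrow> \<exists>p q. is_pullback C f g p q"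
begin

text \<open>A product is a pullback over the terminal object, where commutation of the square is
  automatic.\<close>

lemma product_exists:
  assumes "a \<in> Obj C" "b \<in> Obj C"
  shows "\<exists>p q. is_product C p q \<and> Cod C p = a \<and> Cod C q = b"
proof -
  obtain t where t: "is_terminal C t" using lex_terminal by blast
  then have T: "\<exists>!u. u \<in> Hom C x t" if "x \<in> Obj C" for x
    using that unfolding is_terminal_def by blast
  obtain f g where fg: "f \<in> Hom C a t" "g \<in> Hom C b t" using T assms by metis
  then obtain p q where pq: "is_pullback C f g p q"
    using lex_pullbacks[of f g] by (auto simp: Hom_def)
  note P = pullbackD[OF pq]
  have "\<exists>!k. k \<in> Hom C (Dom C u) (Dom C p) \<and> p \<cdot> k = u \<and> q \<cdot> k = v"
    if uv: "u \<in> Arr C" "v \<in> Arr C" "Dom C u = Dom C v" "Cod C u = Cod C p" "Cod C v = Cod C q" for u v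
  proof -
    have "f \<cdot> u \<in> Hom C (Dom C u) t" "g \<cdot> v \<in> Hom C (Dom C u) t"
      using uv P fg by (auto simp: Hom_def)
    then have "f \<cdot> u = g \<cdot> v" using T[of "Dom C u"] uv by auto
    then show ?thesis using pq uv P unfolding is_pullback_def by auto
  qed
  then have "is_product C p q" using P unfolding is_product_def by auto
  then show ?thesis using P fg by (auto simp: Hom_def)
qed

lemma product:
  assumes "a \<in> Obj C" "b \<in> Obj C"
  shows "is_product C (pr1 C a b) (pr2 C a b)" "Cod C (pr1 C a b) = a" "Cod C (pr2 C a b) = b"
proof -
  have "\<exists>x. (\<lambda>(p, q). is_product C p q \<and> Cod C p = a \<and> Cod C q = b) x"
    using product_exists[OF assms] by auto
  then have "(\<lambda>(p, q). is_product C p q \<and> Cod C p = a \<and> Cod C q = b) (chosen_product C a b)"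
    unfolding chosen_product_def by (rule someI_ex)
  then show "is_product C (pr1 C a b) (pr2 C a b)" "Cod C (pr1 C a b) = a" "Cod C (pr2 C a b) = b"
    unfolding pr1_def pr2_def by (auto simp: case_prod_beta)
qed

lemma pr_Hom:
  assumes "a \<in> Obj C" "b \<in> Obj C"
  shows "pr1 C a b \<in> Hom C (prod_obj C a b) a" "pr2 C a b \<in> Hom C (prod_obj C a b) b"
  using product[OF assms] unfolding is_product_def prod_obj_def Hom_def by auto

lemma pr_simps [simp]:
  assumes "a \<in> Obj C" "b \<in> Obj C"
  shows "pr1 C a b \<in> Arr C" "pr2 C a b \<in> Arr C" "Dom C (pr1 C a b) = prod_obj C a b"
    "Dom C (pr2 C a b) = prod_obj C a b" "Cod C (pr1 C a b) = a" "Cod C (pr2 C a b) = b"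
    "prod_obj C a b \<in> Obj C"
  using pr_Hom[OF assms] Hom_Obj(1)[OF pr_Hom(1)[OF assms]] by (auto simp: Hom_def)

lemma is_product_ex1:
  assumes "is_product C p q" "u \<in> Hom C z (Cod C p)" "v \<in> Hom C z (Cod C q)"
  shows "\<exists>!k. k \<in> Hom C z (Dom C p) \<and> p \<cdot> k = u \<and> q \<cdot> k = v"
proof -
  have "\<forall>u\<in>Arr C. \<forall>v\<in>Arr C. Dom C u = Dom C v \<and> Cod C u = Cod C p \<and> Cod C v = Cod C q \<longrightarrow>
        (\<exists>!k. k \<in> Hom C (Dom C u) (Dom C p) \<and> p \<cdot> k = u \<and> q \<cdot> k = v)"
    using assms(1) unfolding is_product_def by blast
  moreover have "u \<in> Arr C" "v \<in> Arr C" "Dom C u = z"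
    "Dom C u = Dom C v \<and> Cod C u = Cod C p \<and> Cod C v = Cod C q"
    using assms(2-) by (auto simp: Hom_def)
  ultimately show ?thesis by blast
qed

lemma product_ex1:
  assumes "u \<in> Hom C z a" "v \<in> Hom C z b"
  shows "\<exists>!k. k \<in> Hom C z (prod_obj C a b) \<and> pr1 C a b \<cdot> k = u \<and> pr2 C a b \<cdot> k = v"
proof -
  have "a \<in> Obj C" "b \<in> Obj C" using assms Hom_Obj by auto
  from product[OF this] show ?thesis
    using is_product_ex1[of "pr1 C a b" "pr2 C a b" u z v] assms by (simp add: prod_obj_def)
qed

lemma pairing:
  assumes "u \<in> Hom C z a" "v \<in> Hom C z b"
  shows "pairing C u v \<in> Hom C z (prod_obj C a b)" "pr1 C a b \<cdot> pairing C u v = u"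
    "pr2 C a b \<cdot> pairing C u v = v"
proof -
  have "Dom C u = z" "Cod C u = a" "Cod C v = b" using assms by (auto simp: Hom_def)
  then show "pairing C u v \<in> Hom C z (prod_obj C a b)" "pr1 C a b \<cdot> pairing C u v = u"
    "pr2 C a b \<cdot> pairing C u v = v"
    using theI'[OF product_ex1[OF assms]] unfolding pairing_def by auto
qed

lemma pairing_simps [simp]:
  assumes "u \<in> Arr C" "v \<in> Arr C" "Dom C u = Dom C v"
  shows "pairing C u v \<in> Arr C" "Dom C (pairing C u v) = Dom C v"
    "Cod C (pairing C u v) = prod_obj C (Cod C u) (Cod C v)"
    "Cod C u = a \<Longrightarrow> Cod C v = b \<Longrightarrow> pr1 C a b \<cdot> pairing C u v = u"
    "Cod C u = a \<Longrightarrow> Cod C v = b \<Longrightarrow> pr2 C a b \<cdot> pairing C u v = v"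
  using pairing[of u "Dom C u" "Cod C u" v "Cod C v"] assms by (auto simp: Hom_def)

lemma product_ext:
  assumes "a \<in> Obj C" "b \<in> Obj C" "k \<in> Hom C z (prod_obj C a b)" "k' \<in> Hom C z (prod_obj C a b)"
    "pr1 C a b \<cdot> k = pr1 C a b \<cdot> k'" "pr2 C a b \<cdot> k = pr2 C a b \<cdot> k'"
  shows "k = k'"
proof -
  have "pr1 C a b \<cdot> k \<in> Hom C z a" "pr2 C a b \<cdot> k \<in> Hom C z b"
    using assms by (auto simp: Hom_def)
  from product_ex1[OF this] assms show ?thesis by auto
qed

lemma pairing_comp [simp]:
  assumes "u \<in> Arr C" "v \<in> Arr C" "Dom C u = Dom C v" "h \<in> Arr C" "Cod C h = Dom C v"
  shows "pairing C u v \<cdot> h = pairing C (u \<cdot> h) (v \<cdot> h)"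
proof (rule product_ext[of "Cod C u" "Cod C v" _ "Dom C h"])
  show "pr1 C (Cod C u) (Cod C v) \<cdot> (pairing C u v \<cdot> h)
      = pr1 C (Cod C u) (Cod C v) \<cdot> pairing C (u \<cdot> h) (v \<cdot> h)"
    using assms whisker[of "pr1 C (Cod C u) (Cod C v)" "pairing C u v" u h] by simp
  show "pr2 C (Cod C u) (Cod C v) \<cdot> (pairing C u v \<cdot> h)
      = pr2 C (Cod C u) (Cod C v) \<cdot> pairing C (u \<cdot> h) (v \<cdot> h)"
    using assms whisker[of "pr2 C (Cod C u) (Cod C v)" "pairing C u v" v h] by simp
qed (use assms in \<open>auto simp: Hom_def\<close>)

lemma pairing_eta:
  assumes "a \<in> Obj C" "b \<in> Obj C" "k \<in> Hom C z (prod_obj C a b)"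
  shows "pairing C (pr1 C a b \<cdot> k) (pr2 C a b \<cdot> k) = k"
  by (rule product_ext[OF assms(1,2), of _ z]) (use assms in \<open>auto simp: Hom_def\<close>)

lemma pairing_eq_iff:
  assumes "u \<in> Hom C z a" "v \<in> Hom C z b" "u' \<in> Hom C z a" "v' \<in> Hom C z b"
  shows "pairing C u v = pairing C u' v' \<longleftrightarrow> u = u' \<and> v = v'"
  using assms pairing by metis

text \<open>The equalizer is the pullback of the graphs \<open>l\<close> and \<open>r\<close> of
  \<open>u\<close> and \<open>v\<close>. Comparing first components shows that its two projections
  coincide. The conclusion is phrased as membership of elements so that it can serve as a
  representable predicate.\<close>

lemma equalizer:
  assumes "u \<in> Hom C a b" "v \<in> Hom C a b"
  obtains m where "is_mono C m" "Cod C m = a"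
    "\<And>z x. x \<in> Hom C z a \<Longrightarrow> sub_le C x m \<longleftrightarrow> u \<cdot> x = v \<cdot> x"
proof -
  have O: "a \<in> Obj C" "b \<in> Obj C" using assms Hom_Obj by auto
  note t = assms O
  define l where "l = pairing C (Id C a) u"
  define r where "r = pairing C (Id C a) v"
  have lr: "l \<in> Hom C a (prod_obj C a b)" "r \<in> Hom C a (prod_obj C a b)"
    unfolding l_def r_def using t by (auto simp: Hom_def)
  then obtain p q where pq: "is_pullback C l r p q"
    using lex_pullbacks[of l r] by (auto simp: Hom_def)
  note P = pullbackD[OF pq]
  have ty: "p \<in> Hom C (Dom C p) a" "q \<in> Hom C (Dom C p) a" using P lr by (auto simp: Hom_def)
  have lrx: "l \<cdot> x = pairing C x (u \<cdot> x)" "r \<cdot> x = pairing C x (v \<cdot> x)" if "x \<in> Hom C z a" for x z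
    unfolding l_def r_def using that t by (auto simp: Hom_def)
  have pq': "p = q" "u \<cdot> p = v \<cdot> q"
  proof -
    have "u \<cdot> p \<in> Hom C (Dom C p) b" "v \<cdot> q \<in> Hom C (Dom C p) b" using ty t by (auto simp: Hom_def)
    moreover have "pairing C p (u \<cdot> p) = pairing C q (v \<cdot> q)"
      using P(9) lrx ty by simp
    ultimately show "p = q" "u \<cdot> p = v \<cdot> q"
      using pairing_eq_iff[OF ty(1) _ ty(2)] by auto
  qed
  show thesis
  proof (rule that)
    show "is_mono C p"
    proof (rule monoI[OF ty(1)])
      fix z u v assume "u \<in> Hom C z (Dom C p)" "v \<in> Hom C z (Dom C p)" "p \<cdot> u = p \<cdot> v"
      then show "u = v" using pullback_ext[OF pq] pq'(1) by auto
    qed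
    show "Cod C p = a" using ty by (simp add: Hom_def)
    fix z x assume x: "x \<in> Hom C z a"
    show "sub_le C x p \<longleftrightarrow> u \<cdot> x = v \<cdot> x"
    proof
      assume "sub_le C x p"
      then obtain k where k: "k \<in> Hom C z (Dom C p)" "p \<cdot> k = x" using sub_leE x by blast
      then show "u \<cdot> x = v \<cdot> x"
        using whisker[OF pq'(2), of k] pq'(1) ty t by (auto simp: Hom_def)
    next
      assume "u \<cdot> x = v \<cdot> x"
      then have "l \<cdot> x = r \<cdot> x" using lrx x by simp
      then obtain k where "k \<in> Hom C z (Dom C p)" "p \<cdot> k = x"
        using pullbackE[OF pq, of x z x] x lr by (auto simp: Hom_def)
      then show "sub_le C x p" using sub_leI P by blast
    qed
  qed
qed

text \<open>If \<open>u \<cdot> e = v \<cdot> e\<close>, then \<open>e\<close> factors through the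
  equalizer of \<open>u\<close> and \<open>v\<close>; as \<open>e\<close> is a cover, this mono is
  an isomorphism.\<close>

lemma cover_epi:
  assumes "is_cover C e"
  shows "is_epi C e"
  unfolding is_epi_def
proof (intro conjI allI impI)
  fix u v Y assume uv: "u \<in> Hom C (Cod C e) Y \<and> v \<in> Hom C (Cod C e) Y \<and> u \<cdot> e = v \<cdot> e"
  have e: "e \<in> Arr C" using assms cover_arr by blast
  obtain m where m: "is_mono C m" "Cod C m = Cod C e"
    "\<And>z x. x \<in> Hom C z (Cod C e) \<Longrightarrow> sub_le C x m \<longleftrightarrow> u \<cdot> x = v \<cdot> x"
    using equalizer uv by metis
  have "sub_le C e m" using m(3)[OF arr_Hom[OF e]] uv by blast
  then have "is_iso C m" using assms m(1,2) unfolding is_cover_def sub_le_def by auto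
  moreover have "m \<in> Hom C (Dom C m) (Cod C e)" using m mono_arr by (simp add: Hom_def)
  ultimately have "sub_le C (Id C (Cod C e)) m"
    using sub_le_iso Id_in_Hom e by (metis obj(2))
  then show "u = v" using m(3)[OF Id_in_Hom] uv e by (auto simp: Hom_def)
qed (use assms cover_arr in blast)

end

section \<open>Predicates on generalized elements\<close>

text \<open>Relations are kept as spans rather than as monos into a product: the two legs can then
  be composed and pulled back separately, and no choice of product enters.\<close>

definition span_in :: "('o, 'm) cat \<Rightarrow> 'm \<Rightarrow> 'm \<Rightarrow> 'm \<Rightarrow> 'm \<Rightarrow> bool" where
  "span_in C i j y z \<longleftrightarrow>
     (\<exists>k \<in> Hom C (Dom C y) (Dom C i). i \<cdot>\<^bsub>C\<^esub> k = y \<and> j \<cdot>\<^bsub>C\<^esub> k = z)"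

definition joint_mono :: "('o, 'm) cat \<Rightarrow> 'm \<Rightarrow> 'm \<Rightarrow> bool" where
  "joint_mono C i j \<longleftrightarrow> i \<in> Arr C \<and> j \<in> Arr C \<and> Dom C i = Dom C j \<and>
     (\<forall>z k k'. k \<in> Hom C z (Dom C i) \<and> k' \<in> Hom C z (Dom C i) \<and>
        i \<cdot>\<^bsub>C\<^esub> k = i \<cdot>\<^bsub>C\<^esub> k' \<and> j \<cdot>\<^bsub>C\<^esub> k = j \<cdot>\<^bsub>C\<^esub> k' \<longrightarrow> k = k')"

text \<open>A subobject is described by the predicate "factors through it" on generalized elements; the
  quantifiers below are the Kripke--Joyal clauses, existence being up to a cover.\<close>

definition representable :: "('o, 'm) cat \<Rightarrow> 'o \<Rightarrow> ('m \<Rightarrow> bool) \<Rightarrow> bool" where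
  "representable C a \<Phi> \<longleftrightarrow> (\<exists>m. is_mono C m \<and> Cod C m = a \<and>
     (\<forall>z. \<forall>x \<in> Hom C z a. sub_le C x m \<longleftrightarrow> \<Phi> x))"

definition forall_along :: "('o, 'm) cat \<Rightarrow> 'm \<Rightarrow> ('m \<Rightarrow> bool) \<Rightarrow> 'm \<Rightarrow> bool" where
  "forall_along C f \<Phi> y \<longleftrightarrow> (\<forall>t \<zeta> x. \<zeta> \<in> Hom C t (Dom C y) \<and> x \<in> Hom C t (Dom C f) \<and>
     f \<cdot>\<^bsub>C\<^esub> x = y \<cdot>\<^bsub>C\<^esub> \<zeta> \<longrightarrow> \<Phi> x)"

definition exists_along :: "('o, 'm) cat \<Rightarrow> 'm \<Rightarrow> ('m \<Rightarrow> bool) \<Rightarrow> 'm \<Rightarrow> bool" where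
  "exists_along C f \<Phi> y \<longleftrightarrow> (\<exists>e x. is_cover C e \<and> Cod C e = Dom C y \<and>
     x \<in> Hom C (Dom C e) (Dom C f) \<and> f \<cdot>\<^bsub>C\<^esub> x = y \<cdot>\<^bsub>C\<^esub> e \<and> \<Phi> x)"

context category
begin

lemma joint_monoD:
  "\<lbrakk>joint_mono C i j; k \<in> Hom C z (Dom C i); k' \<in> Hom C z (Dom C i);
    i \<cdot> k = i \<cdot> k'; j \<cdot> k = j \<cdot> k'\<rbrakk> \<Longrightarrow> k = k'"
  unfolding joint_mono_def by blast

lemma span_inI:
  "\<lbrakk>k \<in> Hom C z (Dom C i); i \<in> Arr C; i \<cdot> k = y; j \<cdot> k = w\<rbrakk> \<Longrightarrow> span_in C i j y w"
  unfolding span_in_def by (auto simp: Hom_def)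

lemma span_inE:
  assumes "span_in C i j y w" "y \<in> Hom C z a"
  obtains k where "k \<in> Hom C z (Dom C i)" "i \<cdot> k = y" "j \<cdot> k = w"
  using assms unfolding span_in_def by (auto simp: Hom_def)

lemma span_in_comp:
  assumes "span_in C i j y w" "y \<in> Hom C z a" "h \<in> Hom C z' z" "i \<in> Arr C" "j \<in> Arr C"
    "Dom C i = Dom C j"
  shows "span_in C i j (y \<cdot> h) (w \<cdot> h)"
proof -
  obtain k where "k \<in> Hom C z (Dom C i)" "i \<cdot> k = y" "j \<cdot> k = w"
    using span_inE[OF assms(1,2)] .
  then show ?thesis
    by (intro span_inI[of "k \<cdot> h" z']) (use assms(3-) in \<open>auto simp: Hom_def\<close>)
qed

lemma representableE:
  assumes "representable C a \<Phi>"
  obtains m where "is_mono C m" "m \<in> Hom C (Dom C m) a"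
    "\<And>z x. x \<in> Hom C z a \<Longrightarrow> sub_le C x m \<longleftrightarrow> \<Phi> x"
  using assms mono_arr unfolding representable_def Hom_def by auto

lemma representableI:
  assumes "is_mono C m" "Cod C m = a" "\<And>z x. x \<in> Hom C z a \<Longrightarrow> sub_le C x m \<longleftrightarrow> \<Phi> x"
  shows "representable C a \<Phi>"
  using assms unfolding representable_def by blast

lemma representable_cong:
  assumes "representable C a \<Phi>" "\<And>z x. x \<in> Hom C z a \<Longrightarrow> \<Phi> x \<longleftrightarrow> \<Psi> x"
  shows "representable C a \<Psi>"
  using assms unfolding representable_def by metis

text \<open>This is the monotonicity half of Kripke-Joyal semantics; the other half, locality along
  covers, is \<open>representable_local\<close>.\<close>

lemma representable_comp:
  assumes "representable C a \<Phi>" "\<Phi> x" "x \<in> Hom C z a" "h \<in> Hom C z' z"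
  shows "\<Phi> (x \<cdot> h)"
proof -
  obtain m where m: "is_mono C m" "m \<in> Hom C (Dom C m) a"
    "\<And>z x. x \<in> Hom C z a \<Longrightarrow> sub_le C x m \<longleftrightarrow> \<Phi> x" using representableE[OF assms(1)] by blast
  have "x \<cdot> h \<in> Hom C z' a" using assms by (auto simp: Hom_def)
  then show ?thesis
    using m(3) assms sub_le_comp[OF _ assms(3) mono_arr[OF m(1)] assms(4)] by blast
qed

lemma forall_alongD:
  assumes "forall_along C f \<Phi> y" "y \<in> Hom C z b" "\<zeta> \<in> Hom C t z" "x \<in> Hom C t (Dom C f)"
    "f \<cdot> x = y \<cdot> \<zeta>"
  shows "\<Phi> x"
  using assms unfolding forall_along_def by (auto simp: Hom_def)

lemma exists_alongE:
  assumes "exists_along C f \<Phi> y" "y \<in> Hom C z b"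
  obtains e t x where "is_cover C e" "e \<in> Hom C t z" "x \<in> Hom C t (Dom C f)" "f \<cdot> x = y \<cdot> e" "\<Phi> x"
  using assms cover_arr unfolding exists_along_def by (auto simp: Hom_def)

lemma exists_alongI:
  assumes "is_cover C e" "e \<in> Hom C t z" "x \<in> Hom C t (Dom C f)" "f \<cdot> x = y \<cdot> e" "\<Phi> x"
    "y \<in> Hom C z b"
  shows "exists_along C f \<Phi> y"
  using assms unfolding exists_along_def by (auto simp: Hom_def)

end

context lex_cat
begin

lemma representable_subst:
  assumes "representable C b \<Phi>" "h \<in> Hom C a b"
  shows "representable C a (\<lambda>x. \<Phi> (h \<cdot> x))"
proof -
  obtain m where m: "is_mono C m" "m \<in> Hom C (Dom C m) b"
    "\<And>z x. x \<in> Hom C z b \<Longrightarrow> sub_le C x m \<longleftrightarrow> \<Phi> x" using representableE[OF assms(1)] by blast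
  obtain p q where pq: "is_pullback C h m p q"
    using lex_pullbacks[of h m] m(2) assms(2) by (auto simp: Hom_def)
  have H: "Dom C h = a" using assms(2) by (simp add: Hom_def)
  show ?thesis
  proof (rule representableI[of p])
    show "is_mono C p" using pullback_mono[OF pq m(1)] .
    show "Cod C p = a" using pullbackD[OF pq] H by simp
    fix z x assume x: "x \<in> Hom C z a"
    then have "h \<cdot> x \<in> Hom C z b" using assms(2) by (auto simp: Hom_def)
    then show "sub_le C x p \<longleftrightarrow> \<Phi> (h \<cdot> x)"
      using pullback_sub_le[OF pq, of x z] x H m(3) by simp
  qed
qed

text \<open>The second predicate is restricted to the domain of the subobject for the first, so the
  composite of the two monos represents both at once.\<close>

lemma representable_conj:
  assumes "representable C a \<Phi>" "representable C a \<Psi>"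
  shows "representable C a (\<lambda>x. \<Phi> x \<and> \<Psi> x)"
proof -
  obtain m where m: "is_mono C m" "m \<in> Hom C (Dom C m) a"
    "\<And>z x. x \<in> Hom C z a \<Longrightarrow> sub_le C x m \<longleftrightarrow> \<Phi> x" using representableE[OF assms(1)] by blast
  obtain n where n: "is_mono C n" "Cod C n = Dom C m"
    "\<And>z x. x \<in> Hom C z (Dom C m) \<Longrightarrow> sub_le C x n \<longleftrightarrow> \<Psi> (m \<cdot> x)"
    using representable_subst[OF assms(2) m(2)] unfolding representable_def by blast
  note nA = mono_arr[OF n(1)] and mA = m(2)
  show ?thesis
  proof (rule representableI[of "m \<cdot> n"])
    show "is_mono C (m \<cdot> n)"
    proof (rule monoI)
      show "m \<cdot> n \<in> Hom C (Dom C n) a" using m(2) n(2) nA by (auto simp: Hom_def)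
      fix z u v assume u: "u \<in> Hom C z (Dom C n)" "v \<in> Hom C z (Dom C n)" "m \<cdot> n \<cdot> u = m \<cdot> n \<cdot> v"
      have nuv: "n \<cdot> u \<in> Hom C z (Dom C m)" "n \<cdot> v \<in> Hom C z (Dom C m)"
        using u(1,2) n(2) nA by (auto simp: Hom_def)
      have "m \<cdot> (n \<cdot> u) = m \<cdot> (n \<cdot> v)" using u n(2) nA mA by (auto simp: Hom_def)
      then show "u = v" using monoD[OF m(1) _ nuv] monoD[OF n(1) _ u(1,2)] by blast
    qed
    show "Cod C (m \<cdot> n) = a" using mA n(2) nA by (auto simp: Hom_def)
    have D: "Dom C (m \<cdot> n) = Dom C n" using mA n(2) nA by (auto simp: Hom_def)
    fix z x assume x: "x \<in> Hom C z a"
    show "sub_le C x (m \<cdot> n) \<longleftrightarrow> \<Phi> x \<and> \<Psi> x"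
    proof
      assume "sub_le C x (m \<cdot> n)"
      then obtain k where "k \<in> Hom C z (Dom C (m \<cdot> n))" "m \<cdot> n \<cdot> k = x"
        using sub_leE x by blast
      then have k: "k \<in> Hom C z (Dom C n)" "m \<cdot> n \<cdot> k = x" unfolding D by auto
      have nk: "n \<cdot> k \<in> Hom C z (Dom C m)" "m \<cdot> (n \<cdot> k) = x"
        using k nA n(2) mA by (auto simp: Hom_def)
      then have "sub_le C x m" using mA by (intro sub_leI) (auto simp: Hom_def)
      moreover have "sub_le C (n \<cdot> k) n" using k nA by (intro sub_leI[of k z]) auto
      ultimately show "\<Phi> x \<and> \<Psi> x" using m(3)[OF x] n(3)[OF nk(1)] nk(2) by simp
    next
      assume a: "\<Phi> x \<and> \<Psi> x"
      then obtain k where k: "k \<in> Hom C z (Dom C m)" "m \<cdot> k = x" using m(3)[OF x] sub_leE[OF _ x] by metis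
      then have "sub_le C k n" using n(3)[OF k(1)] a by simp
      then obtain l where l: "l \<in> Hom C z (Dom C n)" "n \<cdot> l = k" using sub_leE k(1) by blast
      show "sub_le C x (m \<cdot> n)"
        by (rule sub_leI[of l z]) (use l k nA mA n(2) in \<open>auto simp: Hom_def\<close>)
    qed
  qed
qed

lemma representable_eq:
  assumes "u \<in> Hom C a b" "v \<in> Hom C a b"
  shows "representable C a (\<lambda>x. u \<cdot> x = v \<cdot> x)"
  by (rule equalizer[OF assms]) (rule representableI)

lemma representable_True:
  assumes "a \<in> Obj C"
  shows "representable C a (\<lambda>x. True)"
  using representable_eq[of "Id C a" a a "Id C a"] assms by (auto simp: Hom_def)

end

text \<open>The argument about algebras is run both in the base and in slices, and of the Heyting
  structure it uses universal quantification. This is therefore isolated as an axiom about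
  predicates on elements; images and existential quantifiers stay in the base category.\<close>

locale forall_cat = lex_cat +
  assumes representable_forall: "\<lbrakk>f \<in> Hom C a b; representable C a \<Phi>\<rbrakk>
    \<Longrightarrow> representable C b (forall_along C f \<Phi>)"

section \<open>Covers, images and the Kripke-Joyal quantifiers\<close>

context positive_Heyting_category
begin

sublocale lex_cat
  by unfold_locales (use terminal_exists pullbacks_exist in auto)

text \<open>Membership is local: the pullback of \<open>m\<close> along \<open>x\<close> is a mono
  through which the cover \<open>e\<close> factors, so it is an isomorphism.\<close>

lemma cover_lift:
  assumes "is_cover C e" "e \<in> Hom C t z" "x \<in> Hom C z a" "is_mono C m" "Cod C m = a"
    "sub_le C (x \<cdot> e) m"
  shows "sub_le C x m"
proof -
  have mA: "m \<in> Arr C" using assms mono_arr by blast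
  obtain p q where pq: "is_pullback C x m p q"
    using lex_pullbacks[of x m] mA assms by (auto simp: Hom_def)
  have e: "e \<in> Hom C t (Dom C x)" using assms by (simp add: Hom_def)
  have "sub_le C e p" using pullback_sub_le[OF pq e] assms(6) by simp
  moreover have "Cod C p = Cod C e" using assms(2,3) pullbackD(7)[OF pq] by (simp add: Hom_def)
  ultimately have i: "is_iso C p"
    using assms(1) pullback_mono[OF pq assms(4)] unfolding is_cover_def sub_le_def by metis
  have z: "z \<in> Obj C" using assms(3) Hom_Obj by blast
  have "sub_le C (Id C z) p"
    by (rule sub_le_iso[OF i arr_Hom[OF pullbackD(4)[OF pq]], of _ z])
      (use z assms pullbackD(7)[OF pq] in \<open>auto simp: Hom_def\<close>)
  then have "sub_le C (x \<cdot> Id C z) m"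
    using pullback_sub_le[OF pq, of "Id C z" z] assms(3) z by (auto simp: Hom_def)
  then show ?thesis using assms(3) by (simp add: Hom_def)
qed

lemma mono_cover_iso:
  assumes "is_mono C m" "m \<in> Hom C a b" "is_cover C e" "e \<in> Hom C t b" "sub_le C e m"
  shows "is_iso C m"
proof -
  have b: "b \<in> Obj C" using assms(2) Hom_Obj by blast
  have "sub_le C (Id C b) m"
    by (rule cover_lift[OF assms(3,4) Id_in_Hom[OF b] assms(1)]) (use assms in \<open>auto simp: Hom_def\<close>)
  then show ?thesis using mono_split_iso assms(1,2) by blast
qed

lemma representable_local:
  assumes "representable C a \<Phi>" "is_cover C e" "e \<in> Hom C t z" "x \<in> Hom C z a" "\<Phi> (x \<cdot> e)"
  shows "\<Phi> x"
proof -
  obtain m where m: "is_mono C m" "m \<in> Hom C (Dom C m) a"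
    "\<And>z x. x \<in> Hom C z a \<Longrightarrow> sub_le C x m \<longleftrightarrow> \<Phi> x" using representableE[OF assms(1)] by blast
  have "x \<cdot> e \<in> Hom C t a" using assms by (auto simp: Hom_def)
  then have "sub_le C (x \<cdot> e) m" using m assms by blast
  then show ?thesis using cover_lift[OF assms(2-4) m(1)] m assms by (auto simp: Hom_def)
qed

text \<open>The definition of a cover is recast through membership of the identity, so that
  \<open>cover_lift\<close> can discharge it.\<close>

lemma coverI:
  assumes "e \<in> Hom C a b" "\<And>m. \<lbrakk>is_mono C m; Cod C m = b; sub_le C e m\<rbrakk> \<Longrightarrow> sub_le C (Id C b) m"
  shows "is_cover C e"
  unfolding is_cover_def
proof (intro conjI allI impI)
  show "e \<in> Arr C" using assms(1) by (simp add: Hom_def)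
  fix m g assume m: "is_mono C m \<and> g \<in> Hom C (Dom C e) (Dom C m) \<and> Cod C m = Cod C e \<and> e = m \<cdot> g"
  then have "sub_le C e m" unfolding sub_le_def by metis
  moreover have "Cod C m = b" using m assms(1) by (simp add: Hom_def)
  moreover have "is_mono C m" using m by blast
  ultimately show "is_iso C m"
    using mono_split_iso[of m "Dom C m" b] mono_arr assms(2) by (simp add: Hom_def)
qed

lemma cover_comp:
  assumes "is_cover C e" "e \<in> Hom C a b" "is_cover C e'" "e' \<in> Hom C b c"
  shows "is_cover C (e' \<cdot> e)"
proof (rule coverI)
  show ty: "e' \<cdot> e \<in> Hom C a c" using assms by (auto simp: Hom_def)
  have c: "c \<in> Obj C" using assms(4) Hom_Obj by blast
  fix m assume m: "is_mono C m" "Cod C m = c" "sub_le C (e' \<cdot> e) m"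
  have "sub_le C e' m" by (rule cover_lift[OF assms(1,2,4) m])
  then show "sub_le C (Id C c) m"
    using cover_lift[OF assms(3,4) Id_in_Hom[OF c] m(1,2)] assms(4) c by (simp add: Hom_def)
qed

lemma cover_Id: "a \<in> Obj C \<Longrightarrow> is_cover C (Id C a)"
  by (rule coverI[OF Id_in_Hom]) auto

lemma cover_pull:
  assumes "is_cover C e" "e \<in> Hom C t z" "h \<in> Hom C y z"
  obtains e' k d where "is_cover C e'" "e' \<in> Hom C d y" "k \<in> Hom C d t" "h \<cdot> e' = e \<cdot> k"
proof -
  obtain e' k where pb: "is_pullback C h e e' k"
    using lex_pullbacks[of h e] assms by (auto simp: Hom_def)
  show thesis
    using that[OF cover_stable[OF assms(1) pb], of "Dom C e'" k] pullbackD[OF pb] assms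
    by (auto simp: Hom_def)
qed

lemma image:
  assumes "f \<in> Hom C a b"
  obtains e m d where "is_cover C e" "e \<in> Hom C a d" "is_mono C m" "m \<in> Hom C d b" "f = m \<cdot> e"
proof -
  obtain e m where em: "is_cover C e" "is_mono C m" "Cod C e = Dom C m" "f = m \<cdot> e"
    using cover_mono_factorisation[of f] assms by (auto simp: Hom_def)
  then show thesis
    using that[OF em(1) _ em(2), of "Dom C m"] assms cover_arr[OF em(1)] mono_arr[OF em(2)]
    by (auto simp: Hom_def)
qed

text \<open>The adjunction in \<open>is_univ_image\<close> tests against monos only. An arbitrary
  element \<open>y\<close> is replaced by its image \<open>k\<close>: as \<open>y\<close> covers
  \<open>k\<close>, both lie in the same subobjects, and the universal clause passes between them
  because covers pull back.\<close>

sublocale forall_cat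
proof
  fix f a b \<Phi> assume f: "f \<in> Hom C a b" and "representable C a \<Phi>"
  then obtain m where m: "is_mono C m" "m \<in> Hom C (Dom C m) a"
    "\<And>z x. x \<in> Hom C z a \<Longrightarrow> sub_le C x m \<longleftrightarrow> \<Phi> x" using representableE by blast
  obtain n where n: "is_univ_image C f m n"
    using univ_image_exists[of f m] f m by (auto simp: Hom_def)
  have nm: "is_mono C n" "Cod C n = b" using n f unfolding is_univ_image_def by (auto simp: Hom_def)
  show "representable C b (forall_along C f \<Phi>)"
  proof (rule representableI[OF nm])
    fix z y assume y: "y \<in> Hom C z b"
    obtain e k d where ek: "is_cover C e" "e \<in> Hom C z d" "is_mono C k" "k \<in> Hom C d b" "y = k \<cdot> e"
      using image[OF y] .
    obtain k' r where pb: "is_pullback C f k k' r"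
      using lex_pullbacks[of f k] f ek by (auto simp: Hom_def)
    note P = pullbackD[OF pb]
    have ty: "k' \<in> Hom C (Dom C k') a" "r \<in> Hom C (Dom C k') d"
      using P f ek(4) by (auto simp: Hom_def)
    have "sub_le C y n \<longleftrightarrow> sub_le C k n"
      using cover_lift[OF ek(1,2,4) nm] sub_le_comp[OF _ ek(4) mono_arr[OF nm(1)] ek(2)] ek(5) by blast
    also have "\<dots> \<longleftrightarrow> sub_le C k' m"
      using n ek(3,4) pb f unfolding is_univ_image_def by (auto simp: Hom_def)
    also have "\<dots> \<longleftrightarrow> \<Phi> k'" using m(3)[OF ty(1)] .
    also have "\<dots> \<longleftrightarrow> forall_along C f \<Phi> y"
    proof
      assume k': "\<Phi> k'"
      show "forall_along C f \<Phi> y"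
        unfolding forall_along_def
      proof (intro allI impI)
        fix t \<zeta> x assume x: "\<zeta> \<in> Hom C t (Dom C y) \<and> x \<in> Hom C t (Dom C f) \<and> f \<cdot> x = y \<cdot> \<zeta>"
        have "f \<cdot> x = k \<cdot> (e \<cdot> \<zeta>)" "e \<cdot> \<zeta> \<in> Hom C t (Dom C k)"
          using x ek y by (auto simp: Hom_def)
        then obtain j where j: "j \<in> Hom C t (Dom C k')" "k' \<cdot> j = x"
          using pullbackE[OF pb] x by metis
        show "\<Phi> x"
          using representable_comp[OF \<open>representable C a \<Phi>\<close> k' ty(1) j(1)] j(2) by simp
      qed
    next
      assume A: "forall_along C f \<Phi> y"
      \<comment> \<open>The element \<open>k'\<close> lies over \<open>k\<close>, not over
        \<open>y\<close>. After a further cover it comes with an element \<open>\<zeta>\<close> of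
        the domain of \<open>y\<close>, and there the hypothesis applies.\<close>
      obtain e' \<zeta> t where e': "is_cover C e'" "e' \<in> Hom C t (Dom C k')" "\<zeta> \<in> Hom C t z" "r \<cdot> e' = e \<cdot> \<zeta>"
        using cover_pull[OF ek(1,2) ty(2)] .
      have "f \<cdot> (k' \<cdot> e') = y \<cdot> \<zeta>"
        using whisker[OF P(9), of e'] P e' ek(2,4,5) f by (auto simp: Hom_def)
      then have "\<Phi> (k' \<cdot> e')"
        by (intro forall_alongD[OF A y e'(3)]) (use e' ty f in \<open>auto simp: Hom_def\<close>)
      then show "\<Phi> k'" by (rule representable_local[OF \<open>representable C a \<Phi>\<close> e'(1,2) ty(1)])
    qed
    finally show "sub_le C y n \<longleftrightarrow> forall_along C f \<Phi> y" .
  qed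
qed

text \<open>The representing subobject is the image of \<open>f \<cdot> m\<close>. An element of it
  lifts to the domain of \<open>m\<close> after pulling back the cover part of the factorisation,
  and this pullback is the cover in \<open>exists_along\<close>.\<close>

lemma representable_exists:
  assumes "f \<in> Hom C a b" "representable C a \<Phi>"
  shows "representable C b (exists_along C f \<Phi>)"
proof -
  obtain m where m: "is_mono C m" "m \<in> Hom C (Dom C m) a"
    "\<And>z x. x \<in> Hom C z a \<Longrightarrow> sub_le C x m \<longleftrightarrow> \<Phi> x" using representableE[OF assms(2)] by blast
  have fm: "f \<cdot> m \<in> Hom C (Dom C m) b" using assms m by (auto simp: Hom_def)
  obtain c n d where c: "is_cover C c" "c \<in> Hom C (Dom C m) d" "is_mono C n" "n \<in> Hom C d b" "f \<cdot> m = n \<cdot> c"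
    using image[OF fm] .
  show ?thesis
  proof (rule representableI[OF c(3)])
    show "Cod C n = b" using c by (simp add: Hom_def)
    fix z y assume y: "y \<in> Hom C z b"
    show "sub_le C y n \<longleftrightarrow> exists_along C f \<Phi> y"
    proof
      assume "sub_le C y n"
      then obtain j where j: "j \<in> Hom C z (Dom C n)" "n \<cdot> j = y" using sub_leE y by blast
      then have j': "j \<in> Hom C z d" using c by (simp add: Hom_def)
      obtain e k t where e: "is_cover C e" "e \<in> Hom C t z" "k \<in> Hom C t (Dom C m)" "j \<cdot> e = c \<cdot> k"
        using cover_pull[OF c(1,2) j'] .
      have mk: "m \<cdot> k \<in> Hom C t a" using e m by (auto simp: Hom_def)
      have "f \<cdot> (m \<cdot> k) = n \<cdot> (c \<cdot> k)"
        using assms(1) m(2) e(3) c whisker[OF c(5), of k] by (auto simp: Hom_def)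
      also have "\<dots> = y \<cdot> e" using whisker[OF j(2), of e] e j' c by (auto simp: Hom_def)
      finally have "f \<cdot> (m \<cdot> k) = y \<cdot> e" .
      moreover have "\<Phi> (m \<cdot> k)" using m(3)[OF mk] sub_leI[OF e(3) refl mono_arr[OF m(1)]] by simp
      ultimately show "exists_along C f \<Phi> y"
        using exists_alongI[OF e(1,2) _ _ _ y, of "m \<cdot> k" f] mk assms(1) by (auto simp: Hom_def)
    next
      assume "exists_along C f \<Phi> y"
      then obtain e t x where e: "is_cover C e" "e \<in> Hom C t z" "x \<in> Hom C t (Dom C f)" "f \<cdot> x = y \<cdot> e" "\<Phi> x"
        using exists_alongE y by blast
      then have x: "x \<in> Hom C t a" using assms by (simp add: Hom_def)
      then obtain k where k: "k \<in> Hom C t (Dom C m)" "m \<cdot> k = x" using m(3) e(5) sub_leE by metis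
      have "y \<cdot> e = n \<cdot> (c \<cdot> k)"
        using whisker[OF c(5), of k] k assms(1) m(2) c e(4) by (auto simp: Hom_def)
      then have "sub_le C (y \<cdot> e) n"
        using k c by (intro sub_leI[of "c \<cdot> k" t]) (auto simp: Hom_def)
      then show "sub_le C y n"
        using cover_lift[OF e(1,2) y c(3)] c(4) by (auto simp: Hom_def)
    qed
  qed
qed

end

section \<open>Subobjects generated by small rules\<close>

text \<open>
  Read \<open>n : N \<rightarrow> M\<close>, \<open>ev : N \<rightarrow> Y\<close>, \<open>\<beta> : M \<rightarrow> Y\<close> as a system of rules in which \<open>u \<in> M\<close> derives \<open>\<beta> u\<close>
  from the premises \<open>ev \<nu>\<close>, \<open>\<nu> \<in> N\<^sub>u\<close>. The subobject \<open>g\<close> is closed under the rules, and each of its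
  elements is (locally) derived by a rule with premises in \<open>g\<close>. Local existence is stated with an
  epi, not a cover, because this is all that is used and epis are easily transferred to slices.
\<close>

definition has_inductive_subobjects :: "('o, 'm) cat \<Rightarrow> 'm \<Rightarrow> bool" where
  "has_inductive_subobjects C n \<longleftrightarrow> (\<forall>Y ev \<beta>. ev \<in> Hom C (Dom C n) Y \<and> \<beta> \<in> Hom C (Cod C n) Y \<longrightarrow>
     (\<exists>g. is_mono C g \<and> Cod C g = Y \<and>
        (\<forall>z y. y \<in> Hom C z Y \<and> sub_le C y g \<longrightarrow>
           (\<exists>t e u. is_epi C e \<and> e \<in> Hom C t z \<and> u \<in> Hom C t (Cod C n) \<and> \<beta> \<cdot>\<^bsub>C\<^esub> u = y \<cdot>\<^bsub>C\<^esub> e \<and>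
              forall_along C n (\<lambda>\<nu>. sub_le C (ev \<cdot>\<^bsub>C\<^esub> \<nu>) g) u)) \<and>
        (\<forall>z u. u \<in> Hom C z (Cod C n) \<and> forall_along C n (\<lambda>\<nu>. sub_le C (ev \<cdot>\<^bsub>C\<^esub> \<nu>) g) u \<longrightarrow>
           sub_le C (\<beta> \<cdot>\<^bsub>C\<^esub> u) g)))"

context lex_cat
begin

lemma joint_mono_pairing:
  assumes "joint_mono C r1 r2"
  shows "is_mono C (pairing C r1 r2)"
    "\<lbrakk>r1 \<in> Hom C R a; r2 \<in> Hom C R b; x \<in> Hom C z (prod_obj C a b)\<rbrakk> \<Longrightarrow>
      sub_le C x (pairing C r1 r2) \<longleftrightarrow> span_in C r1 r2 (pr1 C a b \<cdot> x) (pr2 C a b \<cdot> x)"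
proof -
  have r: "r1 \<in> Hom C (Dom C r1) (Cod C r1)" "r2 \<in> Hom C (Dom C r1) (Cod C r2)"
    using assms unfolding joint_mono_def by (auto simp: Hom_def)
  show "is_mono C (pairing C r1 r2)"
  proof (rule monoI[OF pairing(1)[OF r]])
    fix z u v assume u: "u \<in> Hom C z (Dom C r1)" "v \<in> Hom C z (Dom C r1)"
      "pairing C r1 r2 \<cdot> u = pairing C r1 r2 \<cdot> v"
    have "pairing C (r1 \<cdot> u) (r2 \<cdot> u) = pairing C (r1 \<cdot> v) (r2 \<cdot> v)"
      using u r by (auto simp: Hom_def)
    then have "r1 \<cdot> u = r1 \<cdot> v \<and> r2 \<cdot> u = r2 \<cdot> v"
      by (subst (asm) pairing_eq_iff[of _ z "Cod C r1" _ "Cod C r2"]) (use u(1,2) r in \<open>auto simp: Hom_def\<close>)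
    then show "u = v" using joint_monoD[OF assms u(1,2)] by blast
  qed
  assume r': "r1 \<in> Hom C R a" "r2 \<in> Hom C R b" and x: "x \<in> Hom C z (prod_obj C a b)"
  have O: "a \<in> Obj C" "b \<in> Obj C" using r' Hom_Obj by auto
  have p: "pr1 C a b \<cdot> x \<in> Hom C z a" "pr2 C a b \<cdot> x \<in> Hom C z b"
    using x O by (auto simp: Hom_def)
  have D: "Dom C r1 = R" "Dom C (pairing C r1 r2) = R" "pairing C r1 r2 \<in> Arr C"
    using r' by (auto simp: Hom_def)
  have eq: "pairing C r1 r2 \<cdot> k = x \<longleftrightarrow> r1 \<cdot> k = pr1 C a b \<cdot> x \<and> r2 \<cdot> k = pr2 C a b \<cdot> x"
    if k: "k \<in> Hom C z R" for k
  proof -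
    have "pairing C r1 r2 \<cdot> k = pairing C (r1 \<cdot> k) (r2 \<cdot> k)" using k r' by (auto simp: Hom_def)
    moreover have "pairing C (pr1 C a b \<cdot> x) (pr2 C a b \<cdot> x) = x" using pairing_eta[OF O x] .
    moreover have "r1 \<cdot> k \<in> Hom C z a" "r2 \<cdot> k \<in> Hom C z b" using k r' by (auto simp: Hom_def)
    ultimately show ?thesis using pairing_eq_iff p by metis
  qed
  show "sub_le C x (pairing C r1 r2) \<longleftrightarrow> span_in C r1 r2 (pr1 C a b \<cdot> x) (pr2 C a b \<cdot> x)"
    using eq x p D unfolding sub_le_def span_in_def by (auto simp: Hom_def)
qed

lemma joint_mono_representable:
  assumes "joint_mono C r1 r2" "r1 \<in> Hom C R a" "r2 \<in> Hom C R b"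
  shows "representable C (prod_obj C a b) (\<lambda>x. span_in C r1 r2 (pr1 C a b \<cdot> x) (pr2 C a b \<cdot> x))"
  using joint_mono_pairing[OF assms(1)] pairing(1)[OF assms(2,3)] assms
  by (intro representableI[of "pairing C r1 r2"]) (auto simp: Hom_def)

end

context forall_cat
begin

text \<open>Quantification over the fibres of \<open>n\<close> with a parameter in \<open>p\<close>
  is quantification along the product of \<open>n\<close> with \<open>p\<close>. The fibre of that
  map over a pair is the fibre of \<open>n\<close> over its first component, which lets the
  predicate be written with \<open>\<nu>\<close> paired with the parameter.\<close>

lemma representable_forall_prod:
  assumes "n \<in> Hom C a b" "p \<in> Obj C" "representable C (prod_obj C a p) \<Psi>"
  shows "representable C (prod_obj C b p) (\<lambda>x. \<forall>t \<zeta> \<nu>. \<zeta> \<in> Hom C t (Dom C x) \<and> \<nu> \<in> Hom C t a \<and>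
    n \<cdot> \<nu> = pr1 C b p \<cdot> x \<cdot> \<zeta> \<longrightarrow> \<Psi> (pairing C \<nu> (pr2 C b p \<cdot> x \<cdot> \<zeta>)))"
proof -
  have O: "a \<in> Obj C" "b \<in> Obj C" using assms(1) Hom_Obj by auto
  define f where "f = pairing C (n \<cdot> pr1 C a p) (pr2 C a p)"
  have f: "f \<in> Hom C (prod_obj C a p) (prod_obj C b p)"
    unfolding f_def by (rule pairing(1)) (use O assms in \<open>auto simp: Hom_def\<close>)
  show ?thesis
  proof (rule representable_cong[OF representable_forall[OF f assms(3)]])
    fix z x assume x: "x \<in> Hom C z (prod_obj C b p)"
    have px: "pr1 C b p \<cdot> x \<in> Hom C z b" "pr2 C b p \<cdot> x \<in> Hom C z p"
      using x O assms by (auto simp: Hom_def)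
    have key: "f \<cdot> w = x \<cdot> \<zeta> \<longleftrightarrow> n \<cdot> (pr1 C a p \<cdot> w) = pr1 C b p \<cdot> x \<cdot> \<zeta> \<and> pr2 C a p \<cdot> w = pr2 C b p \<cdot> x \<cdot> \<zeta>"
      if w: "w \<in> Hom C t (prod_obj C a p)" and z: "\<zeta> \<in> Hom C t z" for w t \<zeta>
    proof -
      have "f \<cdot> w = pairing C (n \<cdot> (pr1 C a p \<cdot> w)) (pr2 C a p \<cdot> w)"
        unfolding f_def using w O assms by (auto simp: Hom_def)
      moreover have "x \<cdot> \<zeta> = pairing C (pr1 C b p \<cdot> x \<cdot> \<zeta>) (pr2 C b p \<cdot> x \<cdot> \<zeta>)"
        using pairing_eta[of b p "x \<cdot> \<zeta>" t] x z O assms by (auto simp: Hom_def)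
      moreover have "n \<cdot> (pr1 C a p \<cdot> w) \<in> Hom C t b" "pr2 C a p \<cdot> w \<in> Hom C t p"
        "pr1 C b p \<cdot> x \<cdot> \<zeta> \<in> Hom C t b" "pr2 C b p \<cdot> x \<cdot> \<zeta> \<in> Hom C t p"
        using x w z O assms by (auto simp: Hom_def)
      ultimately show ?thesis using pairing_eq_iff by metis
    qed
    show "forall_along C f \<Psi> x \<longleftrightarrow> (\<forall>t \<zeta> \<nu>. \<zeta> \<in> Hom C t (Dom C x) \<and> \<nu> \<in> Hom C t a \<and>
      n \<cdot> \<nu> = pr1 C b p \<cdot> x \<cdot> \<zeta> \<longrightarrow> \<Psi> (pairing C \<nu> (pr2 C b p \<cdot> x \<cdot> \<zeta>)))"
    proof
      assume A: "forall_along C f \<Psi> x"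
      show "\<forall>t \<zeta> \<nu>. \<zeta> \<in> Hom C t (Dom C x) \<and> \<nu> \<in> Hom C t a \<and>
        n \<cdot> \<nu> = pr1 C b p \<cdot> x \<cdot> \<zeta> \<longrightarrow> \<Psi> (pairing C \<nu> (pr2 C b p \<cdot> x \<cdot> \<zeta>))"
      proof (intro allI impI)
        fix t \<zeta> \<nu> assume "\<zeta> \<in> Hom C t (Dom C x) \<and> \<nu> \<in> Hom C t a \<and> n \<cdot> \<nu> = pr1 C b p \<cdot> x \<cdot> \<zeta>"
        then have h: "\<zeta> \<in> Hom C t z" "\<nu> \<in> Hom C t a" "n \<cdot> \<nu> = pr1 C b p \<cdot> x \<cdot> \<zeta>"
          using x by (auto simp: Hom_def)
        have p: "pr2 C b p \<cdot> x \<cdot> \<zeta> \<in> Hom C t p" using px(2) h(1) by (auto simp: Hom_def)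
        note w = pairing[OF h(2) p]
        have "f \<cdot> pairing C \<nu> (pr2 C b p \<cdot> x \<cdot> \<zeta>) = x \<cdot> \<zeta>"
          unfolding key[OF w(1) h(1)] w(2,3) using h(3) by simp
        then show "\<Psi> (pairing C \<nu> (pr2 C b p \<cdot> x \<cdot> \<zeta>))"
          by (intro forall_alongD[OF A x h(1)]) (use w(1) f in \<open>auto simp: Hom_def\<close>)
      qed
    next
      assume A: "\<forall>t \<zeta> \<nu>. \<zeta> \<in> Hom C t (Dom C x) \<and> \<nu> \<in> Hom C t a \<and>
        n \<cdot> \<nu> = pr1 C b p \<cdot> x \<cdot> \<zeta> \<longrightarrow> \<Psi> (pairing C \<nu> (pr2 C b p \<cdot> x \<cdot> \<zeta>))"
      show "forall_along C f \<Psi> x"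
        unfolding forall_along_def
      proof (intro allI impI)
        fix t \<zeta> w assume h0: "\<zeta> \<in> Hom C t (Dom C x) \<and> w \<in> Hom C t (Dom C f) \<and> f \<cdot> w = x \<cdot> \<zeta>"
        then have h: "\<zeta> \<in> Hom C t z" "w \<in> Hom C t (prod_obj C a p)" "f \<cdot> w = x \<cdot> \<zeta>"
          using x f by (auto simp: Hom_def)
        have e: "n \<cdot> (pr1 C a p \<cdot> w) = pr1 C b p \<cdot> x \<cdot> \<zeta>" "pr2 C a p \<cdot> w = pr2 C b p \<cdot> x \<cdot> \<zeta>"
          using key[OF h(2,1)] h(3) by auto
        have "pr1 C a p \<cdot> w \<in> Hom C t a" using h(2) O assms by (auto simp: Hom_def)
        then have "\<Psi> (pairing C (pr1 C a p \<cdot> w) (pr2 C b p \<cdot> x \<cdot> \<zeta>))"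
          using A h0 e(1) by blast
        then show "\<Psi> w" using e(2) pairing_eta[OF O(1) assms(2) h(2)] by simp
      qed
    qed
  qed
qed

end

section \<open>Sums of small maps and the elements of power classes\<close>

context category_with_small_maps
begin

lemma small_arr: "f \<in> S \<Longrightarrow> f \<in> Arr C"
  using small_Arr by blast

lemma terminal_arrow:
  assumes "is_terminal C t" "a \<in> Obj C"
  obtains u where "u \<in> Hom C a t" "\<And>v. v \<in> Hom C a t \<Longrightarrow> v = u"
  using assms unfolding is_terminal_def by blast

lemma coproduct_ex1:
  assumes "is_coproduct C i j" "u \<in> Hom C (Dom C i) y" "v \<in> Hom C (Dom C j) y"
  shows "\<exists>!k. k \<in> Hom C (Cod C i) y \<and> k \<cdot> i = u \<and> k \<cdot> j = v"
proof -
  have "\<forall>u\<in>Arr C. \<forall>v\<in>Arr C. Cod C u = Cod C v \<and> Dom C u = Dom C i \<and> Dom C v = Dom C j \<longrightarrow>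
        (\<exists>!k. k \<in> Hom C (Cod C i) (Cod C u) \<and> k \<cdot> i = u \<and> k \<cdot> j = v)"
    using assms(1) unfolding is_coproduct_def by blast
  moreover have "u \<in> Arr C" "v \<in> Arr C" "Cod C u = y"
    "Cod C u = Cod C v \<and> Dom C u = Dom C i \<and> Dom C v = Dom C j"
    using assms(2-) by (auto simp: Hom_def)
  ultimately show ?thesis by blast
qed

lemma coproductD:
  assumes "is_coproduct C i j"
  shows "i \<in> Arr C" "j \<in> Arr C" "Cod C j = Cod C i"
  using assms unfolding is_coproduct_def by auto

text \<open>Proof by cases: the factorisations of \<open>x \<cdot> i\<close> and
  \<open>x \<cdot> j\<close> through the representing mono copair to one of
  \<open>x\<close>.\<close>

lemma coproduct_representable:
  assumes "is_coproduct C i j" "representable C a \<Phi>" "x \<in> Hom C (Cod C i) a" "\<Phi> (x \<cdot> i)" "\<Phi> (x \<cdot> j)"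
  shows "\<Phi> x"
proof -
  note P = coproductD[OF assms(1)]
  obtain m where m: "is_mono C m" "m \<in> Hom C (Dom C m) a"
    "\<And>z x. x \<in> Hom C z a \<Longrightarrow> sub_le C x m \<longleftrightarrow> \<Phi> x" using representableE[OF assms(2)] by blast
  have xij: "x \<cdot> i \<in> Hom C (Dom C i) a" "x \<cdot> j \<in> Hom C (Dom C j) a"
    using P assms(3) by (auto simp: Hom_def)
  obtain u where u: "u \<in> Hom C (Dom C i) (Dom C m)" "m \<cdot> u = x \<cdot> i"
    using m(3)[OF xij(1)] assms(4) sub_leE xij by metis
  obtain v where v: "v \<in> Hom C (Dom C j) (Dom C m)" "m \<cdot> v = x \<cdot> j"
    using m(3)[OF xij(2)] assms(5) sub_leE xij by metis
  obtain k where k: "k \<in> Hom C (Cod C i) (Dom C m)" "k \<cdot> i = u" "k \<cdot> j = v"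
    using coproduct_ex1[OF assms(1) u(1) v(1)] by blast
  have "m \<cdot> k \<in> Hom C (Cod C i) a" "m \<cdot> k \<cdot> i = x \<cdot> i" "m \<cdot> k \<cdot> j = x \<cdot> j"
    using k u v m(2) P by (auto simp: Hom_def)
  then have "m \<cdot> k = x" using coproduct_ex1[OF assms(1) xij] assms(3) by blast
  then show ?thesis using m(3)[OF assms(3)] sub_leI[OF k(1)] mono_arr[OF m(1)] by blast
qed

text \<open>The identity of \<open>z\<close> is a pullback of the identity of the terminal
  object.\<close>

lemma small_Id:
  assumes "z \<in> Obj C"
  shows "Id C z \<in> S"
proof -
  obtain t where t: "is_terminal C t" using terminal_exists by blast
  then have "t \<in> Obj C" unfolding is_terminal_def by blast
  note It = Id_in_Hom[OF this]
  obtain u where u: "u \<in> Hom C z t" using terminal_arrow[OF t assms] by blast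
  have "is_pullback C u (Id C t) (Id C z) u"
  proof (rule pullbackI[OF u It Id_in_Hom[OF assms] u])
    show "u \<cdot> Id C z = Id C t \<cdot> u" using u by (simp add: Hom_def)
  next
    fix s x y assume x: "x \<in> Hom C s z" "y \<in> Hom C s t" "u \<cdot> x = Id C t \<cdot> y"
    then have "u \<cdot> x = y" by (simp add: Hom_def)
    then show "\<exists>k. k \<in> Hom C s z \<and> Id C z \<cdot> k = x \<and> u \<cdot> k = y"
      using x(1) Id_left by blast
  next
    fix s k k' assume "k \<in> Hom C s z" "k' \<in> Hom C s z" "Id C z \<cdot> k = Id C z \<cdot> k'"
    then show "k = k'" by (simp add: Hom_def)
  qed
  then show ?thesis using small_pullback small_one[OF t It] by blast
qed

text \<open>The codiagonal is realised as the projection from the product of \<open>z\<close> with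
  \<open>two\<close>, the sum of two terminal objects. It is a pullback of the small map from
  \<open>two\<close> to the terminal object, and the product is a coproduct of two copies of
  \<open>z\<close> because coproducts are stable under pullback along \<open>r\<close>.\<close>

lemma small_codiagonal:
  assumes "z \<in> Obj C"
  obtains i j d p where "is_coproduct C i j" "i \<in> Hom C z d" "j \<in> Hom C z d"
    "p \<in> S" "p \<in> Hom C d z" "p \<cdot> i = Id C z" "p \<cdot> j = Id C z"
proof -
  obtain t where t: "is_terminal C t" using terminal_exists by blast
  then have tO: "t \<in> Obj C" unfolding is_terminal_def by blast
  obtain i0 j0 where cop: "is_coproduct C i0 j0" "Dom C i0 = t" "Dom C j0 = t"
    using coproducts_exist[OF tO tO] by blast
  define two where "two = Cod C i0"
  have ij0: "i0 \<in> Hom C t two" "j0 \<in> Hom C t two"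
    using coproductD[OF cop(1)] cop unfolding two_def by (auto simp: Hom_def)
  have twoO: "two \<in> Obj C" using ij0 Hom_Obj by blast
  obtain b where b: "b \<in> Hom C z t" using terminal_arrow[OF t assms] by blast
  obtain u where u: "u \<in> Hom C two t" using terminal_arrow[OF t twoO] by blast
  have uniq: "f = g" if "f \<in> Hom C s t" "g \<in> Hom C s t" for f g s
    using terminal_arrow[OF t] that Hom_Obj by metis
  note O = assms twoO tO
  define p where "p = pr1 C z two"
  define r where "r = pr2 C z two"
  have pr: "p \<in> Hom C (prod_obj C z two) z" "r \<in> Hom C (prod_obj C z two) two"
    unfolding p_def r_def using pr_Hom O by auto
  have "u \<in> S" using small_two[OF t cop, of u] u unfolding two_def by blast
  moreover have "is_pullback C b u p r"
  proof (rule pullbackI[OF b u pr])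
    show "b \<cdot> p = u \<cdot> r" by (rule uniq[of _ "prod_obj C z two"]) (use b u pr in \<open>auto simp: Hom_def\<close>)
    show "\<exists>k. k \<in> Hom C s (prod_obj C z two) \<and> p \<cdot> k = x \<and> r \<cdot> k = y"
      if "x \<in> Hom C s z" "y \<in> Hom C s two" for x y s
      using pairing[OF that] unfolding p_def r_def by blast
  qed (use product_ext O in \<open>auto simp: p_def r_def\<close>)
  ultimately have pS: "p \<in> S" using small_pullback by blast
  define inj where "inj k = pairing C (Id C z) (k \<cdot> b)" for k
  have inj: "inj k \<in> Hom C z (prod_obj C z two)" "p \<cdot> inj k = Id C z" "r \<cdot> inj k = k \<cdot> b"
    if "k \<in> Hom C t two" for k
  proof -
    have kb: "k \<cdot> b \<in> Hom C z two" using that b by (auto simp: Hom_def)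
    show "inj k \<in> Hom C z (prod_obj C z two)" "p \<cdot> inj k = Id C z" "r \<cdot> inj k = k \<cdot> b"
      unfolding inj_def p_def r_def using pairing[OF Id_in_Hom[OF assms] kb] by auto
  qed
  have pb: "is_pullback C r k (inj k) b" if k: "k \<in> Hom C t two" for k
  proof (rule pullbackI[OF pr(2) k inj(1)[OF k] b inj(3)[OF k]])
    fix s x v assume x: "x \<in> Hom C s (prod_obj C z two)" "v \<in> Hom C s t" "r \<cdot> x = k \<cdot> v"
    have px: "p \<cdot> x \<in> Hom C s z" using x pr by (auto simp: Hom_def)
    have bv: "b \<cdot> (p \<cdot> x) = v" by (rule uniq[of _ s]) (use px x b in \<open>auto simp: Hom_def\<close>)
    have "inj k \<cdot> (p \<cdot> x) = x"
    proof (rule product_ext[OF assms twoO _ x(1)])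
      show "inj k \<cdot> (p \<cdot> x) \<in> Hom C s (prod_obj C z two)" using inj(1)[OF k] px by (auto simp: Hom_def)
      show "pr1 C z two \<cdot> (inj k \<cdot> (p \<cdot> x)) = pr1 C z two \<cdot> x"
        using whisker[OF inj(2)[OF k], of "p \<cdot> x"] inj(1)[OF k] px pr
        unfolding p_def[symmetric] by (auto simp: Hom_def)
      have "r \<cdot> (inj k \<cdot> (p \<cdot> x)) = k \<cdot> (b \<cdot> (p \<cdot> x))"
        using whisker[OF inj(3)[OF k], of "p \<cdot> x"] inj(1)[OF k] px pr b k by (auto simp: Hom_def)
      then show "pr2 C z two \<cdot> (inj k \<cdot> (p \<cdot> x)) = pr2 C z two \<cdot> x"
        using bv x(3) unfolding r_def by simp
    qed
    then show "\<exists>l. l \<in> Hom C s z \<and> inj k \<cdot> l = x \<and> b \<cdot> l = v" using px bv by blast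
  next
    fix s l l' assume l: "l \<in> Hom C s z" "l' \<in> Hom C s z" "inj k \<cdot> l = inj k \<cdot> l'"
    have "p \<cdot> (inj k \<cdot> x) = x" if "x \<in> Hom C s z" for x
      using whisker[OF inj(2)[OF k], of x] inj(1)[OF k] that pr by (auto simp: Hom_def)
    then show "l = l'" using l by metis
  qed
  have "is_coproduct C (inj i0) (inj j0)"
    by (rule coproduct_stable[OF cop(1) pb[OF ij0(1)] pb[OF ij0(2)]])
  then show thesis using that inj ij0 pS pr(1) by blast
qed

text \<open>Adds one point to every fibre of the small map \<open>l\<close>: the sum of
  \<open>l\<close> and an identity, followed by the codiagonal. The extra point will carry a newly
  derived element.\<close>

lemma small_copair_Id:
  assumes "l \<in> S" "l \<in> Hom C t z"
  obtains i j q h where "is_coproduct C i j" "i \<in> Hom C t q" "j \<in> Hom C z q"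
    "h \<in> S" "h \<in> Hom C q z" "h \<cdot> i = l" "h \<cdot> j = Id C z"
proof -
  have O: "t \<in> Obj C" "z \<in> Obj C" using assms Hom_Obj by auto
  obtain i' j' d p where p: "is_coproduct C i' j'" "i' \<in> Hom C z d" "j' \<in> Hom C z d"
    "p \<in> S" "p \<in> Hom C d z" "p \<cdot> i' = Id C z" "p \<cdot> j' = Id C z"
    using small_codiagonal[OF O(2)] .
  obtain i j where cop: "is_coproduct C i j" "Dom C i = t" "Dom C j = z"
    using coproducts_exist[OF O] by blast
  have ij: "i \<in> Hom C t (Cod C i)" "j \<in> Hom C z (Cod C i)"
    using coproductD[OF cop(1)] cop by (auto simp: Hom_def)
  have "i' \<cdot> l \<in> Hom C t d" using p assms by (auto simp: Hom_def)
  then obtain h where h: "h \<in> Hom C (Cod C i) d" "h \<cdot> i = i' \<cdot> l" "h \<cdot> j = j'"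
    using coproduct_ex1[OF cop(1), of "i' \<cdot> l" d j'] p cop by auto
  have "h \<in> S"
    by (rule small_sums[OF assms(1) small_Id[OF O(2)] cop(1) _ _ p(1)])
      (use assms p h cop O in \<open>auto simp: Hom_def\<close>)
  then have "p \<cdot> h \<in> S" using small_comp p h by (auto simp: Hom_def)
  moreover have "p \<cdot> h \<in> Hom C (Cod C i) z" using p h by (auto simp: Hom_def)
  moreover have "p \<cdot> h \<cdot> i = l"
    using whisker[OF p(6), of l] assms p(2,5) ij h(1,2) by (auto simp: Hom_def)
  moreover have "p \<cdot> h \<cdot> j = Id C z" using p(5,7) ij h by (auto simp: Hom_def)
  ultimately show thesis using that cop(1) ij by blast
qed

text \<open>Pairing the legs of a jointly monic span gives a subobject of the product, for which
  locality along covers is available.\<close>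

lemma span_in_representable:
  assumes "joint_mono C i j" "i \<in> Hom C I a" "j \<in> Hom C I b" "u \<in> Hom C z a" "v \<in> Hom C z b"
    "is_cover C e" "e \<in> Hom C t z" "span_in C i j (u \<cdot> e) (v \<cdot> e)"
  shows "span_in C i j u v"
proof -
  have O: "a \<in> Obj C" "b \<in> Obj C" using assms Hom_Obj by auto
  note R = joint_mono_representable[OF assms(1-3)]
  note p = pairing[OF assms(4,5)]
  have "pr1 C a b \<cdot> (pairing C u v \<cdot> e) = u \<cdot> e" "pr2 C a b \<cdot> (pairing C u v \<cdot> e) = v \<cdot> e"
    using whisker[OF p(2), of e] whisker[OF p(3), of e] p(1) assms(7) O by (auto simp: Hom_def)
  then show ?thesis
    using representable_local[OF R assms(6,7) p(1)] assms(8) p(2,3) by simp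
qed

text \<open>Power classes are specified by equality of subobjects of products. This is turned into a
  property of elements: \<open>i\<close> and \<open>j\<close> are the legs of the membership
  relation, and \<open>\<rho>\<close> classifies a relation when belonging to
  \<open>\<rho> \<cdot> \<zeta>\<close> means being related to \<open>\<zeta>\<close>.\<close>

lemma power_class_span:
  assumes "is_power_class C S X e p q"
  defines "i \<equiv> p \<cdot> e" and "j \<equiv> q \<cdot> e"
  shows "i \<in> Hom C (Dom C e) X" "j \<in> Hom C (Dom C e) (Cod C q)" "j \<in> S" "joint_mono C i j"
    "\<lbrakk>r1 \<in> Hom C R X; r2 \<in> Hom C R Z; r2 \<in> S; joint_mono C r1 r2\<rbrakk> \<Longrightarrow>
      \<exists>!\<rho>. \<rho> \<in> Hom C Z (Cod C q) \<and> (\<forall>t y \<zeta>. y \<in> Hom C t X \<and> \<zeta> \<in> Hom C t Z \<longrightarrow>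
        (span_in C i j y (\<rho> \<cdot> \<zeta>) \<longleftrightarrow> span_in C r1 r2 y \<zeta>))"
proof -
  have pq: "is_product C p q" "Cod C p = X" "is_mono C e" "Cod C e = Dom C p" "q \<cdot> e \<in> S"
    using assms(1) unfolding is_power_class_def by blast+
  have ty: "p \<in> Hom C (Dom C p) X" "q \<in> Hom C (Dom C p) (Cod C q)" "e \<in> Hom C (Dom C e) (Dom C p)"
    using pq mono_arr unfolding is_product_def by (auto simp: Hom_def)
  have ext: "k = k'" if "k \<in> Hom C t (Dom C p)" "k' \<in> Hom C t (Dom C p)" "p \<cdot> k = p \<cdot> k'" "q \<cdot> k = q \<cdot> k'" for k k' t
  proof -
    have "p \<cdot> k \<in> Hom C t (Cod C p)" "q \<cdot> k \<in> Hom C t (Cod C q)" using that ty by (auto simp: Hom_def)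
    from is_product_ex1[OF pq(1) this] that show ?thesis by metis
  qed
  show i: "i \<in> Hom C (Dom C e) X" and j: "j \<in> Hom C (Dom C e) (Cod C q)"
    unfolding i_def j_def using ty by (auto simp: Hom_def)
  show "j \<in> S" unfolding j_def using pq by blast
  have ik: "i \<cdot> k = p \<cdot> (e \<cdot> k)" "j \<cdot> k = q \<cdot> (e \<cdot> k)" if "k \<in> Hom C t (Dom C e)" for k t
    unfolding i_def j_def using that ty by (auto simp: Hom_def)
  have ek: "e \<cdot> k \<in> Hom C t (Dom C p)" if "k \<in> Hom C t (Dom C e)" for k t
    using that ty by (auto simp: Hom_def)
  show jm: "joint_mono C i j"
    unfolding joint_mono_def
  proof (intro conjI allI impI)
    fix t k k' assume "k \<in> Hom C t (Dom C i) \<and> k' \<in> Hom C t (Dom C i) \<and> i \<cdot> k = i \<cdot> k' \<and> j \<cdot> k = j \<cdot> k'"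
    moreover have "Dom C i = Dom C e" using i by (simp add: Hom_def)
    ultimately have k: "k \<in> Hom C t (Dom C e)" "k' \<in> Hom C t (Dom C e)" "i \<cdot> k = i \<cdot> k'" "j \<cdot> k = j \<cdot> k'"
      by auto
    have "e \<cdot> k = e \<cdot> k'" using ext[OF ek[OF k(1)] ek[OF k(2)]] ik[OF k(1)] ik[OF k(2)] k(3,4) by simp
    then show "k = k'" using monoD[OF pq(3) _ k(1,2)] by blast
  qed (use i j in \<open>auto simp: Hom_def\<close>)
  assume r: "r1 \<in> Hom C R X" "r2 \<in> Hom C R Z" "r2 \<in> S" "joint_mono C r1 r2"
  have O: "X \<in> Obj C" "Z \<in> Obj C" using r Hom_Obj by auto
  define p' where "p' = pr1 C X Z"
  define q' where "q' = pr2 C X Z"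
  define m where "m = pairing C r1 r2"
  have p': "p' \<in> Hom C (prod_obj C X Z) X" "q' \<in> Hom C (prod_obj C X Z) Z"
    unfolding p'_def q'_def using pr_Hom O by auto
  have m: "m \<in> Hom C R (prod_obj C X Z)" "p' \<cdot> m = r1" "q' \<cdot> m = r2" "is_mono C m"
    unfolding m_def p'_def q'_def using pairing[OF r(1,2)] joint_mono_pairing(1)[OF r(4)] by auto
  have mem: "sub_le C x m \<longleftrightarrow> span_in C r1 r2 (p' \<cdot> x) (q' \<cdot> x)" if "x \<in> Hom C t (prod_obj C X Z)" for x t
    unfolding m_def p'_def q'_def using joint_mono_pairing(2)[OF r(4,1,2) that] .
  \<comment> \<open>Two subobjects of the product agree exactly when they have the same generalized
    elements, and an element of the pullback of \<open>e\<close> along \<open>w\<close> is one that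
    \<open>w\<close> carries into \<open>e\<close>.\<close>
  have iff: "(\<exists>w k. w \<in> Hom C (Dom C p') (Dom C p) \<and> p \<cdot> w = p' \<and> q \<cdot> w = \<rho> \<cdot> q' \<and> is_pullback C w e m k)
      \<longleftrightarrow> (\<forall>t y \<zeta>. y \<in> Hom C t X \<and> \<zeta> \<in> Hom C t Z \<longrightarrow> (span_in C i j y (\<rho> \<cdot> \<zeta>) \<longleftrightarrow> span_in C r1 r2 y \<zeta>))"
    (is "?L \<longleftrightarrow> ?R") if \<rho>: "\<rho> \<in> Hom C Z (Cod C q)" for \<rho>
  proof
    assume ?L
    then obtain w k where w: "w \<in> Hom C (prod_obj C X Z) (Dom C p)" "p \<cdot> w = p'" "q \<cdot> w = \<rho> \<cdot> q'"
      "is_pullback C w e m k" using p' by (auto simp: Hom_def)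
    show ?R
    proof (intro allI impI)
      fix t y \<zeta> assume h: "y \<in> Hom C t X \<and> \<zeta> \<in> Hom C t Z"
      define x where "x = pairing C y \<zeta>"
      have x: "x \<in> Hom C t (prod_obj C X Z)" "p' \<cdot> x = y" "q' \<cdot> x = \<zeta>"
        unfolding x_def p'_def q'_def using pairing h by blast+
      have wx: "w \<cdot> x \<in> Hom C t (Dom C p)" using w(1) x by (auto simp: Hom_def)
      have pw: "p \<cdot> (w \<cdot> x) = y" using whisker[OF w(2), of x] w(1) x ty by (auto simp: Hom_def)
      have qw: "q \<cdot> (w \<cdot> x) = \<rho> \<cdot> \<zeta>" using whisker[OF w(3), of x] w(1) x ty p' \<rho> by (auto simp: Hom_def)
      have "span_in C r1 r2 y \<zeta> \<longleftrightarrow> sub_le C x m" using mem[OF x(1)] x(2,3) by simp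
      also have "\<dots> \<longleftrightarrow> sub_le C (w \<cdot> x) e"
        using pullback_sub_le[OF w(4), of x t] x(1) w(1) by (simp add: Hom_def)
      also have "\<dots> \<longleftrightarrow> span_in C i j y (\<rho> \<cdot> \<zeta>)"
      proof
        assume "sub_le C (w \<cdot> x) e"
        then obtain l where l: "l \<in> Hom C t (Dom C e)" "e \<cdot> l = w \<cdot> x" using sub_leE wx by blast
        then show "span_in C i j y (\<rho> \<cdot> \<zeta>)"
          using i ik[OF l(1)] pw qw by (intro span_inI[of l t]) (auto simp: Hom_def)
      next
        assume "span_in C i j y (\<rho> \<cdot> \<zeta>)"
        then obtain l where l: "l \<in> Hom C t (Dom C i)" "i \<cdot> l = y" "j \<cdot> l = \<rho> \<cdot> \<zeta>"
          using span_inE h by blast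
        then have l': "l \<in> Hom C t (Dom C e)" using i by (simp add: Hom_def)
        have "e \<cdot> l = w \<cdot> x" using ext[OF ek[OF l'] wx] ik[OF l'] l pw qw by simp
        then show "sub_le C (w \<cdot> x) e" using sub_leI[OF l'] ty by (auto simp: Hom_def)
      qed
      finally show "span_in C i j y (\<rho> \<cdot> \<zeta>) \<longleftrightarrow> span_in C r1 r2 y \<zeta>" by blast
    qed
  next
    assume R: ?R
    have "\<rho> \<cdot> q' \<in> Hom C (prod_obj C X Z) (Cod C q)" using p' \<rho> by (auto simp: Hom_def)
    then obtain w where w: "w \<in> Hom C (prod_obj C X Z) (Dom C p)" "p \<cdot> w = p'" "q \<cdot> w = \<rho> \<cdot> q'"
      using is_product_ex1[OF pq(1), of p' "prod_obj C X Z" "\<rho> \<cdot> q'"] p' pq(2) by auto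
    have px: "p \<cdot> (w \<cdot> x) = p' \<cdot> x" and qx: "q \<cdot> (w \<cdot> x) = \<rho> \<cdot> (q' \<cdot> x)"
      if "x \<in> Hom C t (prod_obj C X Z)" for x t
      using whisker[OF w(2), of x] whisker[OF w(3), of x] w(1) that ty p' \<rho> by (auto simp: Hom_def)
    have m_e: "\<exists>l. l \<in> Hom C t (Dom C e) \<and> e \<cdot> l = w \<cdot> x"
      if x: "x \<in> Hom C t (prod_obj C X Z)" and "sub_le C x m" for x t
    proof -
      have h: "p' \<cdot> x \<in> Hom C t X" "q' \<cdot> x \<in> Hom C t Z" using x p' by (auto simp: Hom_def)
      have "span_in C i j (p' \<cdot> x) (\<rho> \<cdot> (q' \<cdot> x))" using R h mem that by blast
      then obtain l where l: "l \<in> Hom C t (Dom C i)" "i \<cdot> l = p' \<cdot> x" "j \<cdot> l = \<rho> \<cdot> (q' \<cdot> x)"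
        using span_inE h by blast
      then have l': "l \<in> Hom C t (Dom C e)" using i by (simp add: Hom_def)
      have "w \<cdot> x \<in> Hom C t (Dom C p)" using x w by (auto simp: Hom_def)
      then have "e \<cdot> l = w \<cdot> x" using ext[OF ek[OF l']] ik[OF l'] l px[OF x] qx[OF x] by simp
      then show ?thesis using l' by blast
    qed
    \<comment> \<open>The generic element of \<open>m\<close>, namely \<open>m\<close> itself,
      produces the remaining side \<open>k\<close> of the pullback square.\<close>
    have "sub_le C m m" using m(1) Hom_Obj(1)[OF m(1)] by (intro sub_leI[of "Id C R" R]) (auto simp: Hom_def)
    then obtain k where k: "k \<in> Hom C R (Dom C e)" "e \<cdot> k = w \<cdot> m" using m_e m(1) by blast
    have "is_pullback C w e m k"
    proof (rule pullbackI[OF w(1) ty(3) m(1) k(1) k(2)[symmetric]])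
      fix t x l assume x: "x \<in> Hom C t (prod_obj C X Z)" "l \<in> Hom C t (Dom C e)" "w \<cdot> x = e \<cdot> l"
      have h: "p' \<cdot> x \<in> Hom C t X" "q' \<cdot> x \<in> Hom C t Z" using x p' by (auto simp: Hom_def)
      have "span_in C i j (p' \<cdot> x) (\<rho> \<cdot> (q' \<cdot> x))"
        using i ik[OF x(2)] x px[OF x(1)] qx[OF x(1)] by (intro span_inI[of l t]) (auto simp: Hom_def)
      then have "sub_le C x m" using R h mem[OF x(1)] by blast
      then obtain k' where k': "k' \<in> Hom C t (Dom C m)" "m \<cdot> k' = x" using sub_leE x(1) by blast
      then have k'R: "k' \<in> Hom C t R" using m(1) by (simp add: Hom_def)
      have "e \<cdot> (k \<cdot> k') = w \<cdot> (m \<cdot> k')"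
        using whisker[OF k(2), of k'] k(1) k'R ty(3) w(1) m(1) by (auto simp: Hom_def)
      then have "e \<cdot> (k \<cdot> k') = e \<cdot> l" using k'(2) x(3) by simp
      then have "k \<cdot> k' = l"
        by (rule monoD[OF pq(3), where z = t]) (use x(2) k(1) k'R in \<open>auto simp: Hom_def\<close>)
      then show "\<exists>k'. k' \<in> Hom C t R \<and> m \<cdot> k' = x \<and> k \<cdot> k' = l" using k'R k'(2) by blast
    next
      fix t l l' assume "l \<in> Hom C t R" "l' \<in> Hom C t R" "m \<cdot> l = m \<cdot> l'"
      then show "l = l'" using monoD[OF m(4), of l l' t] m(1) by (simp add: Hom_def)
    qed
    then show ?L using w p' by (auto simp: Hom_def)
  qed
  have ex1: "\<exists>!\<rho>. \<rho> \<in> Hom C (Cod C q') (Cod C q) \<and>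
    (\<exists>w k. w \<in> Hom C (Dom C p') (Dom C p) \<and> p \<cdot> w = p' \<and> q \<cdot> w = \<rho> \<cdot> q' \<and> is_pullback C w e m k)"
  proof -
    have "is_product C p' q'" "Cod C p' = X" "Cod C m = Dom C p'" "q' \<cdot> m \<in> S"
      using product[OF O] m p' r(3) unfolding p'_def q'_def by (auto simp: Hom_def)
    then show ?thesis using assms(1) m(4) unfolding is_power_class_def by blast
  qed
  have cod: "Cod C q' = Z" using p' by (simp add: Hom_def)
  have eq: "(\<rho> \<in> Hom C Z (Cod C q) \<and>
      (\<exists>w k. w \<in> Hom C (Dom C p') (Dom C p) \<and> p \<cdot> w = p' \<and> q \<cdot> w = \<rho> \<cdot> q' \<and> is_pullback C w e m k))
    = (\<rho> \<in> Hom C Z (Cod C q) \<and> (\<forall>t y \<zeta>. y \<in> Hom C t X \<and> \<zeta> \<in> Hom C t Z \<longrightarrow>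
        (span_in C i j y (\<rho> \<cdot> \<zeta>) \<longleftrightarrow> span_in C r1 r2 y \<zeta>)))" for \<rho>
    using iff by (rule conj_cong[OF refl])
  show "\<exists>!\<rho>. \<rho> \<in> Hom C Z (Cod C q) \<and> (\<forall>t y \<zeta>. y \<in> Hom C t X \<and> \<zeta> \<in> Hom C t Z \<longrightarrow>
        (span_in C i j y (\<rho> \<cdot> \<zeta>) \<longleftrightarrow> span_in C r1 r2 y \<zeta>))"
    using ex1 unfolding cod eq .
qed

end

section \<open>Generating subobjects with codes from a power class\<close>

context category_with_small_maps_PE
begin

lemma power_span:
  assumes "X \<in> Obj C"
  obtains I P i j where "i \<in> Hom C I X" "j \<in> Hom C I P" "j \<in> S" "joint_mono C i j"
    "\<And>R Z r1 r2. \<lbrakk>r1 \<in> Hom C R X; r2 \<in> Hom C R Z; r2 \<in> S; joint_mono C r1 r2\<rbrakk> \<Longrightarrow>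
      \<exists>!\<rho>. \<rho> \<in> Hom C Z P \<and> (\<forall>t y \<zeta>. y \<in> Hom C t X \<and> \<zeta> \<in> Hom C t Z \<longrightarrow>
        (span_in C i j y (\<rho> \<cdot> \<zeta>) \<longleftrightarrow> span_in C r1 r2 y \<zeta>))"
proof -
  obtain e p q where pc: "is_power_class C S X e p q" using PE[OF assms] by blast
  show thesis
    by (rule that[OF power_class_span(1-4)[OF pc]]) (rule power_class_span(5)[OF pc])
qed

text \<open>
  \<open>g\<close> is the union of all small \<open>R \<subseteq> Y\<close> every element of which is derived from premises in \<open>R\<close>.
  If all premises of \<open>u\<close> lie in \<open>g\<close>, Collection yields a small family of such \<open>R\<close> covering them, and
  its union together with \<open>\<beta> u\<close> is again such an \<open>R\<close>.
\<close>

lemma small_has_inductive_subobjects: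
  assumes nS: "n \<in> S"
  shows "has_inductive_subobjects C n"
  unfolding has_inductive_subobjects_def
proof (intro allI impI)
  fix Y ev \<beta> assume "ev \<in> Hom C (Dom C n) Y \<and> \<beta> \<in> Hom C (Cod C n) Y"
  define N where "N = Dom C n"
  define M where "M = Cod C n"
  have n: "n \<in> Hom C N M" using small_arr[OF nS] unfolding N_def M_def by (simp add: Hom_def)
  have ev: "ev \<in> Hom C N Y" and \<beta>: "\<beta> \<in> Hom C M Y"
    using \<open>ev \<in> Hom C (Dom C n) Y \<and> _\<close> unfolding N_def M_def by auto
  have YO: "Y \<in> Obj C" and MO: "M \<in> Obj C" and NO: "N \<in> Obj C" using ev \<beta> Hom_Obj by auto
  obtain I P i j where i: "i \<in> Hom C I Y" and j: "j \<in> Hom C I P" and jS: "j \<in> S"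
    and jm: "joint_mono C i j"
    and power: "\<And>R Z r1 r2. \<lbrakk>r1 \<in> Hom C R Y; r2 \<in> Hom C R Z; r2 \<in> S; joint_mono C r1 r2\<rbrakk> \<Longrightarrow>
      \<exists>!\<rho>. \<rho> \<in> Hom C Z P \<and> (\<forall>t y \<zeta>. y \<in> Hom C t Y \<and> \<zeta> \<in> Hom C t Z \<longrightarrow>
        (span_in C i j y (\<rho> \<cdot> \<zeta>) \<longleftrightarrow> span_in C r1 r2 y \<zeta>))"
    by (rule power_span[OF YO]) (rule that)
  have PO: "P \<in> Obj C" and IO: "I \<in> Obj C" using j Hom_Obj by auto
  \<comment> \<open>\<open>mem y \<rho>\<close> reads: \<open>y\<close> belongs to the small set
    coded by \<open>\<rho>\<close>.\<close>
  define mem where "mem = span_in C i j"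
  have ij: "i \<in> Arr C" "j \<in> Arr C" "Dom C i = I" "Dom C j = I" "Cod C i = Y" "Cod C j = P"
    using i j by (auto simp: Hom_def)
  have memI: "mem (i \<cdot> k) (j \<cdot> k)" if "k \<in> Hom C t I" for k t
    unfolding mem_def using that ij by (intro span_inI[of k t]) auto
  have memE: "\<exists>k. k \<in> Hom C t I \<and> i \<cdot> k = y \<and> j \<cdot> k = \<rho>" if "mem y \<rho>" "y \<in> Hom C t Y" for y \<rho> t
    using span_inE that ij unfolding mem_def by metis
  have mem_comp: "mem (y \<cdot> h) (\<rho> \<cdot> h)" if "mem y \<rho>" "y \<in> Hom C t Y" "h \<in> Hom C t' t" for y \<rho> h t t'
    unfolding mem_def using span_in_comp that ij unfolding mem_def by metis
  have mem_local: "mem y \<rho>"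
    if "is_cover C e" "e \<in> Hom C s t" "y \<in> Hom C t Y" "\<rho> \<in> Hom C t P" "mem (y \<cdot> e) (\<rho> \<cdot> e)" for e s t y \<rho>
    using span_in_representable[OF jm i j that(3,4,1,2)] that(5) unfolding mem_def by blast

  \<comment> \<open>\<open>A1 \<mu> \<rho>\<close> reads: every premise of the rule
    \<open>\<mu>\<close> belongs to the set coded by \<open>\<rho>\<close>.\<close>
  define A1 where "A1 \<mu> \<rho> \<longleftrightarrow> (\<forall>t \<zeta> \<nu>. \<zeta> \<in> Hom C t (Dom C \<mu>) \<and> \<nu> \<in> Hom C t N \<and> n \<cdot> \<nu> = \<mu> \<cdot> \<zeta> \<longrightarrow>
    mem (ev \<cdot> \<nu>) (\<rho> \<cdot> \<zeta>))" for \<mu> \<rho>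
  have A1_rep: "representable C (prod_obj C M P) (\<lambda>x. A1 (pr1 C M P \<cdot> x) (pr2 C M P \<cdot> x))"
  proof -
    define g where "g = pairing C (ev \<cdot> pr1 C N P) (pr2 C N P)"
    have evp: "ev \<cdot> pr1 C N P \<in> Hom C (prod_obj C N P) Y" using NO PO ev by (auto simp: Hom_def)
    note g = pairing[OF evp pr_Hom(2)[OF NO PO], folded g_def]
    have "representable C (prod_obj C N P) (\<lambda>x. mem (ev \<cdot> (pr1 C N P \<cdot> x)) (pr2 C N P \<cdot> x))"
    proof (rule representable_cong[OF representable_subst[OF joint_mono_representable[OF jm i j] g(1)]])
      fix z x assume x: "x \<in> Hom C z (prod_obj C N P)"
      show "span_in C i j (pr1 C Y P \<cdot> (g \<cdot> x)) (pr2 C Y P \<cdot> (g \<cdot> x)) \<longleftrightarrow>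
        mem (ev \<cdot> (pr1 C N P \<cdot> x)) (pr2 C N P \<cdot> x)"
        using whisker[OF g(2), of x] whisker[OF g(3), of x] g(1) x NO PO YO ev
        unfolding mem_def by (simp add: Hom_def)
    qed
    then show ?thesis
    proof (rule representable_cong[OF representable_forall_prod[OF n PO]])
      fix z x assume x: "x \<in> Hom C z (prod_obj C M P)"
      have D: "Dom C (pr1 C M P \<cdot> x) = Dom C x" using x MO PO by (simp add: Hom_def)
      have "ev \<cdot> (pr1 C N P \<cdot> pairing C \<nu> (pr2 C M P \<cdot> x \<cdot> \<zeta>)) = ev \<cdot> \<nu>"
        "pr2 C N P \<cdot> pairing C \<nu> (pr2 C M P \<cdot> x \<cdot> \<zeta>) = pr2 C M P \<cdot> x \<cdot> \<zeta>"
        if "\<zeta> \<in> Hom C t (Dom C x)" "\<nu> \<in> Hom C t N" for t \<zeta> \<nu>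
        using that x MO PO by (auto simp: Hom_def)
      then show "(\<forall>t \<zeta> \<nu>. \<zeta> \<in> Hom C t (Dom C x) \<and> \<nu> \<in> Hom C t N \<and> n \<cdot> \<nu> = pr1 C M P \<cdot> x \<cdot> \<zeta> \<longrightarrow>
         mem (ev \<cdot> (pr1 C N P \<cdot> pairing C \<nu> (pr2 C M P \<cdot> x \<cdot> \<zeta>)))
           (pr2 C N P \<cdot> pairing C \<nu> (pr2 C M P \<cdot> x \<cdot> \<zeta>))) \<longleftrightarrow>
        A1 (pr1 C M P \<cdot> x) (pr2 C M P \<cdot> x)"
        unfolding A1_def D by metis
    qed
  qed

  \<comment> \<open>This pullback consists of an element of a coded set together with a rule whose
    conclusion is that element. Hence \<open>A2 k\<close> says that \<open>i \<cdot> k\<close> is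
    locally derived by a rule all of whose premises lie in the set
    \<open>j \<cdot> k\<close>.\<close>
  obtain q1 q2 where Q: "is_pullback C i \<beta> q1 q2"
    using lex_pullbacks[of i \<beta>] i \<beta> by (auto simp: Hom_def)
  have q: "q1 \<in> Hom C (Dom C q1) I" "q2 \<in> Hom C (Dom C q1) M"
    using pullbackD[OF Q] i \<beta> by (auto simp: Hom_def)
  define A2 where "A2 = exists_along C q1 (\<lambda>x. A1 (q2 \<cdot> x) (j \<cdot> (q1 \<cdot> x)))"
  have A2_rep: "representable C I A2"
    unfolding A2_def
  proof (rule representable_exists[OF q(1)])
    have "j \<cdot> q1 \<in> Hom C (Dom C q1) P" using q j by (auto simp: Hom_def)
    note g = pairing[OF q(2) this]
    show "representable C (Dom C q1) (\<lambda>x. A1 (q2 \<cdot> x) (j \<cdot> (q1 \<cdot> x)))"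
    proof (rule representable_cong[OF representable_subst[OF A1_rep g(1)]])
      fix z x assume x: "x \<in> Hom C z (Dom C q1)"
      have "pr1 C M P \<cdot> (pairing C q2 (j \<cdot> q1) \<cdot> x) = q2 \<cdot> x"
        using whisker[OF g(2), of x] g(1) x MO PO q by (simp add: Hom_def)
      moreover have "pr2 C M P \<cdot> (pairing C q2 (j \<cdot> q1) \<cdot> x) = j \<cdot> (q1 \<cdot> x)"
        using whisker[OF g(3), of x] g(1) x MO PO q j by (simp add: Hom_def)
      ultimately show "A1 (pr1 C M P \<cdot> (pairing C q2 (j \<cdot> q1) \<cdot> x)) (pr2 C M P \<cdot> (pairing C q2 (j \<cdot> q1) \<cdot> x)) \<longleftrightarrow>
        A1 (q2 \<cdot> x) (j \<cdot> (q1 \<cdot> x))" by simp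
    qed
  qed
  have A2I: "A2 k" if k: "k \<in> Hom C z I" and e: "is_cover C e" "e \<in> Hom C t z"
    and \<mu>: "\<mu> \<in> Hom C t M" "\<beta> \<cdot> \<mu> = i \<cdot> (k \<cdot> e)" "A1 \<mu> (j \<cdot> (k \<cdot> e))" for k z e t \<mu>
  proof -
    have ke: "k \<cdot> e \<in> Hom C t I" using k e by (auto simp: Hom_def)
    obtain x where x: "x \<in> Hom C t (Dom C q1)" "q1 \<cdot> x = k \<cdot> e" "q2 \<cdot> x = \<mu>"
      using pullbackE[OF Q, of "k \<cdot> e" t \<mu>] ke \<mu>(1,2) i \<beta> by (auto simp: Hom_def)
    show ?thesis unfolding A2_def
      by (rule exists_alongI[OF e x(1,2) _ k]) (use x \<mu>(3) in simp)
  qed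
  have A2E: "\<exists>e t \<mu>. is_cover C e \<and> e \<in> Hom C t z \<and> \<mu> \<in> Hom C t M \<and> \<beta> \<cdot> \<mu> = i \<cdot> (k \<cdot> e) \<and> A1 \<mu> (j \<cdot> (k \<cdot> e))"
    if A: "A2 k" "k \<in> Hom C z I" for k z
  proof -
    obtain e t x where x: "is_cover C e" "e \<in> Hom C t z" "x \<in> Hom C t (Dom C q1)" "q1 \<cdot> x = k \<cdot> e"
      "A1 (q2 \<cdot> x) (j \<cdot> (q1 \<cdot> x))"
      using exists_alongE[OF A(1)[unfolded A2_def] A(2)] .
    have "q2 \<cdot> x \<in> Hom C t M" using x(3) q by (auto simp: Hom_def)
    moreover have "\<beta> \<cdot> (q2 \<cdot> x) = i \<cdot> (q1 \<cdot> x)"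
      using whisker[OF pullbackD(9)[OF Q], of x] x(3) q i \<beta> by (auto simp: Hom_def)
    ultimately show ?thesis using x by metis
  qed

  \<comment> \<open>\<open>K \<rho>\<close> is backward closure of the coded set: each of its
    elements is locally derived from premises inside it.\<close>
  define K where "K = forall_along C j A2"
  have K_rep: "representable C P K" unfolding K_def by (rule representable_forall[OF j A2_rep])
  have K_comp: "K (\<rho> \<cdot> h)" if "K \<rho>" "\<rho> \<in> Hom C t P" "h \<in> Hom C t' t" for \<rho> h t t'
    using representable_comp[OF K_rep that] .
  have KD: "A2 k" if "K (j \<cdot> k)" "k \<in> Hom C t I" for k t
  proof (rule forall_alongD[OF that(1)[unfolded K_def]])
    show "j \<cdot> k \<in> Hom C t P" "Id C t \<in> Hom C t t" "k \<in> Hom C t (Dom C j)" "j \<cdot> k = j \<cdot> k \<cdot> Id C t"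
      using that(2) ij Hom_Obj(1)[OF that(2)] by (auto simp: Hom_def)
  qed
  \<comment> \<open>The union over all backward closed codes. Existence is local, so a member of
    \<open>G\<close> has a witnessing code only after a cover.\<close>
  define G where "G = exists_along C i (\<lambda>k. K (j \<cdot> k))"
  have G_rep: "representable C Y G"
    unfolding G_def by (rule representable_exists[OF i representable_subst[OF K_rep j]])
  have GI: "G y" if y: "y \<in> Hom C z Y" and e: "is_cover C e" "e \<in> Hom C t z"
    and m: "mem (y \<cdot> e) \<rho>" "K \<rho>" for y z e t \<rho>
  proof -
    have "y \<cdot> e \<in> Hom C t Y" using y e by (auto simp: Hom_def)
    then obtain k where k: "k \<in> Hom C t I" "i \<cdot> k = y \<cdot> e" "j \<cdot> k = \<rho>" using memE m by blast
    show ?thesis unfolding G_def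
      by (rule exists_alongI[OF e _ k(2) _ y]) (use k ij m in auto)
  qed
  have GE: "\<exists>e t k. is_cover C e \<and> e \<in> Hom C t z \<and> k \<in> Hom C t I \<and> i \<cdot> k = y \<cdot> e \<and> K (j \<cdot> k)"
    if "G y" "y \<in> Hom C z Y" for y z
    using exists_alongE[OF that(1)[unfolded G_def] that(2)] ij by metis

  \<comment> \<open>The code that witnesses \<open>G y\<close> also witnesses all premises of the
    rule deriving \<open>y\<close>, since \<open>K\<close> persists under change of stage.\<close>
  have post: "\<exists>t e u. is_epi C e \<and> e \<in> Hom C t z \<and> u \<in> Hom C t M \<and> \<beta> \<cdot> u = y \<cdot> e \<and>
      forall_along C n (\<lambda>\<nu>. G (ev \<cdot> \<nu>)) u" if Gy: "G y" "y \<in> Hom C z Y" for y z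
  proof -
    obtain e t k where k: "is_cover C e" "e \<in> Hom C t z" "k \<in> Hom C t I" "i \<cdot> k = y \<cdot> e" "K (j \<cdot> k)"
      using GE[OF Gy] by blast
    obtain e' t' \<mu> where \<mu>: "is_cover C e'" "e' \<in> Hom C t' t" "\<mu> \<in> Hom C t' M"
      "\<beta> \<cdot> \<mu> = i \<cdot> (k \<cdot> e')" "A1 \<mu> (j \<cdot> (k \<cdot> e'))"
      using A2E[OF KD[OF k(5,3)] k(3)] by blast
    have "e \<cdot> e' \<in> Hom C t' z" using k(2) \<mu>(2) by (auto simp: Hom_def)
    moreover have "\<beta> \<cdot> \<mu> = y \<cdot> (e \<cdot> e')"
      using \<mu>(4) whisker[OF k(4), of e'] k(2,3) \<mu>(2) ij Gy(2) by (auto simp: Hom_def)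
    moreover have "forall_along C n (\<lambda>\<nu>. G (ev \<cdot> \<nu>)) \<mu>"
      unfolding forall_along_def
    proof (intro allI impI)
      fix s \<zeta> \<nu> assume "\<zeta> \<in> Hom C s (Dom C \<mu>) \<and> \<nu> \<in> Hom C s (Dom C n) \<and> n \<cdot> \<nu> = \<mu> \<cdot> \<zeta>"
      then have h: "\<zeta> \<in> Hom C s t'" "\<nu> \<in> Hom C s N" "n \<cdot> \<nu> = \<mu> \<cdot> \<zeta>" "\<zeta> \<in> Hom C s (Dom C \<mu>)"
        using \<mu>(3) unfolding N_def by (auto simp: Hom_def)
      have m: "mem (ev \<cdot> \<nu>) (j \<cdot> (k \<cdot> e') \<cdot> \<zeta>)" using \<mu>(5) h unfolding A1_def by blast
      have "K (j \<cdot> k \<cdot> (e' \<cdot> \<zeta>))"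
        by (rule K_comp[OF k(5), of t]) (use k(3) \<mu>(2) h ij in \<open>auto simp: Hom_def\<close>)
      moreover have "j \<cdot> (k \<cdot> e') \<cdot> \<zeta> = j \<cdot> k \<cdot> (e' \<cdot> \<zeta>)"
        using k(3) \<mu>(2) h ij by (simp add: Hom_def)
      ultimately have K: "K (j \<cdot> (k \<cdot> e') \<cdot> \<zeta>)" by simp
      have evn: "ev \<cdot> \<nu> \<in> Hom C s Y" using ev h by (auto simp: Hom_def)
      have sO: "s \<in> Obj C" using h Hom_Obj by blast
      have "ev \<cdot> \<nu> \<cdot> Id C s = ev \<cdot> \<nu>" using evn by (simp add: Hom_def)
      then show "G (ev \<cdot> \<nu>)"
        using GI[OF evn cover_Id[OF sO] Id_in_Hom[OF sO], of "j \<cdot> (k \<cdot> e') \<cdot> \<zeta>"] m K by simp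
    qed
    ultimately show ?thesis
      using cover_epi[OF cover_comp[OF \<mu>(1,2) k(1,2)]] \<mu>(3) by blast
  qed

  have closed: "G (\<beta> \<cdot> u)" if u: "u \<in> Hom C Z M" and H: "forall_along C n (\<lambda>\<nu>. G (ev \<cdot> \<nu>)) u" for u Z
  proof -
    have ZO: "Z \<in> Obj C" using u Hom_Obj by blast
    \<comment> \<open>\<open>b0\<close> is the small map whose fibres index the premises of
      \<open>u\<close>.\<close>
    obtain b0 \<nu>0 where B: "is_pullback C u n b0 \<nu>0"
      using lex_pullbacks[of u n] u n by (auto simp: Hom_def)
    define BZ where "BZ = Dom C b0"
    have b0: "b0 \<in> Hom C BZ Z" and \<nu>0: "\<nu>0 \<in> Hom C BZ N" and b0eq: "u \<cdot> b0 = n \<cdot> \<nu>0"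
      using pullbackD[OF B] u n unfolding BZ_def by (auto simp: Hom_def)
    have b0S: "b0 \<in> S" using small_pullback[OF nS B] .
    have ev0: "ev \<cdot> \<nu>0 \<in> Hom C BZ Y" using ev \<nu>0 by (auto simp: Hom_def)
    have "G (ev \<cdot> \<nu>0)"
      by (rule forall_alongD[OF H u b0]) (use \<nu>0 b0eq N_def in auto)
    \<comment> \<open>The codes \<open>j \<cdot> k\<close> witnessing the premises live over a cover
      \<open>e\<close> of the index object; it is to this cover that Collection is applied.\<close>
    then obtain e k Cc where k: "is_cover C e" "e \<in> Hom C Cc BZ" "k \<in> Hom C Cc I"
      "i \<cdot> k = ev \<cdot> \<nu>0 \<cdot> e" "K (j \<cdot> k)"
      using GE ev0 by blast
    obtain y l b where yl: "y \<in> Arr C" "Cod C y = Dom C e" "l \<in> S" "covering_square C (e \<cdot> y) l b0 b"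
      using collection[OF k(1) b0S] k(2) b0 by (auto simp: Hom_def)
    define D where "D = Dom C y"
    define Z' where "Z' = Dom C b"
    obtain p q' c where sq: "is_cover C b" "is_pullback C b b0 p q'"
      "c \<in> Hom C (Dom C (e \<cdot> y)) (Dom C p)" "p \<cdot> c = l" "q' \<cdot> c = e \<cdot> y" "is_cover C c"
      "Cod C b0 = Cod C b" "Cod C l = Dom C b" "Dom C (e \<cdot> y) = Dom C l"
      using yl(4) unfolding covering_square_def by blast
    have y: "y \<in> Hom C D Cc" using yl k(2) unfolding D_def by (simp add: Hom_def)
    have ey: "e \<cdot> y \<in> Hom C D BZ" using y k(2) by (auto simp: Hom_def)
    have b: "b \<in> Hom C Z' Z" using cover_arr[OF sq(1)] sq(7) b0 unfolding Z'_def by (simp add: Hom_def)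
    have l: "l \<in> Hom C D Z'" using small_arr[OF yl(3)] sq(8,9) ey unfolding Z'_def by (simp add: Hom_def)
    have c: "c \<in> Hom C D (Dom C p)" using sq(3) ey by (simp add: Hom_def)
    have pq': "p \<in> Hom C (Dom C p) Z'" "q' \<in> Hom C (Dom C p) BZ"
      using pullbackD[OF sq(2)] b b0 by (auto simp: Hom_def)
    have Z'O: "Z' \<in> Obj C" using b Hom_Obj by blast
    \<comment> \<open>The family of backward closed codes, indexed by \<open>D\<close>, which is
      small over \<open>Z'\<close> through \<open>l\<close>.\<close>
    define \<rho>' where "\<rho>' = j \<cdot> (k \<cdot> y)"
    have ky: "k \<cdot> y \<in> Hom C D I" using y k by (auto simp: Hom_def)
    have \<rho>': "\<rho>' \<in> Hom C D P" unfolding \<rho>'_def using ky j by (auto simp: Hom_def)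
    have K\<rho>': "K \<rho>'"
      using K_comp[OF k(5) _ y] k(3) ij y unfolding \<rho>'_def by (auto simp: Hom_def)
    \<comment> \<open>The disjoint union of the sets in the family: a point of \<open>T0\<close> is
      an index given by \<open>\<tau>\<close> together with an element, given by
      \<open>\<kappa>\<close>, of the set it codes.\<close>
    obtain \<tau> \<kappa> where T: "is_pullback C \<rho>' j \<tau> \<kappa>"
      using lex_pullbacks[of \<rho>' j] \<rho>' j by (auto simp: Hom_def)
    define T0 where "T0 = Dom C \<tau>"
    have \<tau>: "\<tau> \<in> Hom C T0 D" and \<kappa>: "\<kappa> \<in> Hom C T0 I" and Teq: "\<rho>' \<cdot> \<tau> = j \<cdot> \<kappa>"
      using pullbackD[OF T] \<rho>' j unfolding T0_def by (auto simp: Hom_def)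
    have "l \<cdot> \<tau> \<in> S" using small_comp[OF small_pullback[OF jS T] yl(3)] \<tau> l by (simp add: Hom_def)
    moreover have l\<tau>: "l \<cdot> \<tau> \<in> Hom C T0 Z'" using l \<tau> by (auto simp: Hom_def)
    \<comment> \<open>The summand \<open>Z'\<close> contributes one further point over each stage.
      The map \<open>w\<close> below sends that point to the conclusion
      \<open>\<beta> \<cdot> (u \<cdot> b)\<close> and the points of \<open>T0\<close> to the
      elements they stand for.\<close>
    ultimately obtain in1 in2 Q0 h where Q0: "is_coproduct C in1 in2" "in1 \<in> Hom C T0 Q0"
      "in2 \<in> Hom C Z' Q0" "h \<in> S" "h \<in> Hom C Q0 Z'" "h \<cdot> in1 = l \<cdot> \<tau>" "h \<cdot> in2 = Id C Z'"
      by (rule small_copair_Id)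
    have Q0c: "Cod C in1 = Q0" "Dom C in1 = T0" "Dom C in2 = Z'" using Q0 by (auto simp: Hom_def)
    have ub: "u \<cdot> b \<in> Hom C Z' M" using u b by (auto simp: Hom_def)
    have \<beta>ub: "\<beta> \<cdot> (u \<cdot> b) \<in> Hom C Z' Y" using ub \<beta> by (auto simp: Hom_def)
    have i\<kappa>: "i \<cdot> \<kappa> \<in> Hom C T0 Y" using \<kappa> ij by (auto simp: Hom_def)
    obtain w where w: "w \<in> Hom C Q0 Y" "w \<cdot> in1 = i \<cdot> \<kappa>" "w \<cdot> in2 = \<beta> \<cdot> (u \<cdot> b)"
      using coproduct_ex1[OF Q0(1), of "i \<cdot> \<kappa>" Y "\<beta> \<cdot> (u \<cdot> b)"] i\<kappa> \<beta>ub unfolding Q0c by blast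
    note wh = pairing[OF w(1) Q0(5)]
    \<comment> \<open>Different sets of the family may share elements, so the union is the image of
      \<open>Q0\<close> in the product of \<open>Y\<close> and \<open>Z'\<close>. Its projection to
      \<open>Z'\<close> is small by Quotients, applied to the cover \<open>c0\<close>.\<close>
    obtain c0 m R where R: "is_cover C c0" "c0 \<in> Hom C Q0 R" "is_mono C m"
      "m \<in> Hom C R (prod_obj C Y Z')" "pairing C w h = m \<cdot> c0"
      using image[OF wh(1)] .
    define r1 where "r1 = pr1 C Y Z' \<cdot> m"
    define r2 where "r2 = pr2 C Y Z' \<cdot> m"
    have r: "r1 \<in> Hom C R Y" "r2 \<in> Hom C R Z'"
      unfolding r1_def r2_def using R(4) YO Z'O by (auto simp: Hom_def)
    have rc: "r1 \<cdot> c0 = w" "r2 \<cdot> c0 = h"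
      using wh(2,3) R(2,4,5) YO Z'O unfolding r1_def r2_def by (auto simp: Hom_def)
    have r2S: "r2 \<in> S" using small_quotient[OF R(1), of r2] rc(2) Q0(4) r R(2) by (simp add: Hom_def)
    have rjm: "joint_mono C r1 r2"
      unfolding joint_mono_def
    proof (intro conjI allI impI)
      fix t x x' assume "x \<in> Hom C t (Dom C r1) \<and> x' \<in> Hom C t (Dom C r1) \<and>
        r1 \<cdot> x = r1 \<cdot> x' \<and> r2 \<cdot> x = r2 \<cdot> x'"
      then have x: "x \<in> Hom C t R" "x' \<in> Hom C t R" "r1 \<cdot> x = r1 \<cdot> x'" "r2 \<cdot> x = r2 \<cdot> x'"
        using r by (auto simp: Hom_def)
      have "pr1 C Y Z' \<cdot> (m \<cdot> v) = r1 \<cdot> v" "pr2 C Y Z' \<cdot> (m \<cdot> v) = r2 \<cdot> v" if "v \<in> Hom C t R" for v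
        using that R(4) YO Z'O unfolding r1_def r2_def by (auto simp: Hom_def)
      then have "pr1 C Y Z' \<cdot> (m \<cdot> x) = pr1 C Y Z' \<cdot> (m \<cdot> x')" "pr2 C Y Z' \<cdot> (m \<cdot> x) = pr2 C Y Z' \<cdot> (m \<cdot> x')"
        using x by metis+
      moreover have "m \<cdot> x \<in> Hom C t (prod_obj C Y Z')" "m \<cdot> x' \<in> Hom C t (prod_obj C Y Z')"
        using x(1,2) R(4) by (auto simp: Hom_def)
      ultimately have "m \<cdot> x = m \<cdot> x'" using product_ext[OF YO Z'O] by blast
      then show "x = x'" by (rule monoD[OF R(3), of _ _ t]) (use x(1,2) R(4) in \<open>auto simp: Hom_def\<close>)
    qed (use r in \<open>auto simp: Hom_def\<close>)
    \<comment> \<open>Being small over \<open>Z'\<close>, the union has a code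
      \<open>\<rho>\<close>.\<close>
    obtain \<rho> where \<rho>: "\<rho> \<in> Hom C Z' P"
      "\<And>t y \<zeta>. y \<in> Hom C t Y \<Longrightarrow> \<zeta> \<in> Hom C t Z' \<Longrightarrow> mem y (\<rho> \<cdot> \<zeta>) \<longleftrightarrow> span_in C r1 r2 y \<zeta>"
      using power[OF r r2S rjm] unfolding mem_def by blast
    have memQ: "mem (w \<cdot> x) (\<rho> \<cdot> (h \<cdot> x))" if x: "x \<in> Hom C s Q0" for x s
    proof -
      have "span_in C r1 r2 (w \<cdot> x) (h \<cdot> x)"
        using whisker[OF rc(1), of x] whisker[OF rc(2), of x] x r R(2)
        by (intro span_inI[of "c0 \<cdot> x" s]) (auto simp: Hom_def)
      then show ?thesis using \<rho>(2)[of "w \<cdot> x" s "h \<cdot> x"] x w(1) Q0(5) by (auto simp: Hom_def)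
    qed
    \<comment> \<open>The set coded by \<open>\<rho>' \<cdot> \<delta>\<close> is contained in the
      union at the stage \<open>l \<cdot> \<delta>\<close>, because each of its elements is a point
      of \<open>T0\<close>.\<close>
    have memT: "mem v (\<rho> \<cdot> (l \<cdot> \<delta>))"
      if h1: "v \<in> Hom C s Y" "\<delta> \<in> Hom C s D" "mem v (\<rho>' \<cdot> \<delta>)" for v \<delta> s
    proof -
      obtain k' where k': "k' \<in> Hom C s I" "i \<cdot> k' = v" "j \<cdot> k' = \<rho>' \<cdot> \<delta>" using memE h1 by blast
      obtain x where x: "x \<in> Hom C s T0" "\<tau> \<cdot> x = \<delta>" "\<kappa> \<cdot> x = k'"
        using pullbackE[OF T, of \<delta> s k'] h1(2) k' \<rho>' ij unfolding T0_def by (auto simp: Hom_def)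
      have "w \<cdot> (in1 \<cdot> x) = v"
        using whisker[OF w(2), of x] x(1) w(1) Q0(2) ij \<kappa> x(3) k'(2) by (auto simp: Hom_def)
      moreover have "h \<cdot> (in1 \<cdot> x) = l \<cdot> \<delta>"
        using whisker[OF Q0(6), of x] x(1) Q0(2,5) l \<tau> x(2) by (auto simp: Hom_def)
      moreover have "in1 \<cdot> x \<in> Hom C s Q0" using x(1) Q0(2) by (auto simp: Hom_def)
      ultimately show ?thesis using memQ by metis
    qed
    have memZ: "mem (\<beta> \<cdot> (u \<cdot> b)) \<rho>"
      using memQ[OF Q0(3)] w(3) Q0(7) \<rho>(1) by (simp add: Hom_def)
    have RO: "R \<in> Obj C" using r Hom_Obj by blast
    have "span_in C r1 r2 r1 r2"
      by (rule span_inI[OF Id_in_Hom]) (use r RO in \<open>auto simp: Hom_def\<close>)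
    then have "mem r1 (\<rho> \<cdot> r2)" using \<rho>(2)[OF r] by blast
    \<comment> \<open>\<open>\<gamma>\<close> is the generic element of the union; backward closure
      of \<open>\<rho>\<close> will reduce to the single statement
      \<open>A2 \<gamma>\<close>.\<close>
    then obtain \<gamma> where \<gamma>: "\<gamma> \<in> Hom C R I" "i \<cdot> \<gamma> = r1" "j \<cdot> \<gamma> = \<rho> \<cdot> r2" using memE r(1) by blast
    have \<gamma>c: "\<gamma> \<cdot> c0 \<in> Hom C Q0 I" using \<gamma> R by (auto simp: Hom_def)
    have i\<gamma>: "i \<cdot> (\<gamma> \<cdot> (c0 \<cdot> x)) = w \<cdot> x" and j\<gamma>: "j \<cdot> (\<gamma> \<cdot> (c0 \<cdot> x)) = \<rho> \<cdot> (h \<cdot> x)"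
      if x: "x \<in> Hom C s Q0" for x s
    proof -
      have "i \<cdot> (\<gamma> \<cdot> (c0 \<cdot> x)) = r1 \<cdot> (c0 \<cdot> x)" "j \<cdot> (\<gamma> \<cdot> (c0 \<cdot> x)) = \<rho> \<cdot> (r2 \<cdot> (c0 \<cdot> x))"
        using whisker[OF \<gamma>(2), of "c0 \<cdot> x"] whisker[OF \<gamma>(3), of "c0 \<cdot> x"] x R(2) \<gamma>(1) ij \<rho>(1) r
        by (auto simp: Hom_def)
      moreover have "r1 \<cdot> (c0 \<cdot> x) = w \<cdot> x" "r2 \<cdot> (c0 \<cdot> x) = h \<cdot> x"
        using whisker[OF rc(1), of x] whisker[OF rc(2), of x] x R(2) r by (auto simp: Hom_def)
      ultimately show "i \<cdot> (\<gamma> \<cdot> (c0 \<cdot> x)) = w \<cdot> x" "j \<cdot> (\<gamma> \<cdot> (c0 \<cdot> x)) = \<rho> \<cdot> (h \<cdot> x)" by auto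
    qed

    \<comment> \<open>Elements of the old sets keep their derivations: premises in an old set lie in
      the union by \<open>memT\<close>.\<close>
    have A2in1: "A2 (\<gamma> \<cdot> c0 \<cdot> in1)"
    proof -
      have "K (j \<cdot> \<kappa>)" using K_comp[OF K\<rho>' \<rho>' \<tau>] Teq by simp
      then obtain e2 t \<mu> where \<mu>: "is_cover C e2" "e2 \<in> Hom C t T0" "\<mu> \<in> Hom C t M"
        "\<beta> \<cdot> \<mu> = i \<cdot> (\<kappa> \<cdot> e2)" "A1 \<mu> (j \<cdot> (\<kappa> \<cdot> e2))"
        using A2E[OF KD[OF _ \<kappa>] \<kappa>] by blast
      have x: "in1 \<cdot> e2 \<in> Hom C t Q0" using Q0(2) \<mu>(2) by (auto simp: Hom_def)
      have g: "\<gamma> \<cdot> c0 \<cdot> in1 \<in> Hom C T0 I" using \<gamma>c Q0(2) by (auto simp: Hom_def)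
      have gx: "\<gamma> \<cdot> c0 \<cdot> in1 \<cdot> e2 = \<gamma> \<cdot> (c0 \<cdot> (in1 \<cdot> e2))"
        using \<gamma>(1) R(2) Q0(2) \<mu>(2) by (simp add: Hom_def)
      have "w \<cdot> (in1 \<cdot> e2) = i \<cdot> (\<kappa> \<cdot> e2)"
        using whisker[OF w(2), of e2] Q0(2) \<mu>(2) w(1) ij \<kappa> by (auto simp: Hom_def)
      then have 1: "\<beta> \<cdot> \<mu> = i \<cdot> (\<gamma> \<cdot> c0 \<cdot> in1 \<cdot> e2)" using \<mu>(4) i\<gamma>[OF x] gx by simp
      have "h \<cdot> (in1 \<cdot> e2) = l \<cdot> (\<tau> \<cdot> e2)"
        using whisker[OF Q0(6), of e2] Q0(2,5) \<mu>(2) l \<tau> by (auto simp: Hom_def)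
      then have 2: "j \<cdot> (\<gamma> \<cdot> c0 \<cdot> in1 \<cdot> e2) = \<rho> \<cdot> (l \<cdot> (\<tau> \<cdot> e2))" using j\<gamma>[OF x] gx by simp
      have 3: "j \<cdot> (\<kappa> \<cdot> e2) = \<rho>' \<cdot> (\<tau> \<cdot> e2)"
        using whisker[OF Teq[symmetric], of e2] \<kappa> \<tau> \<rho>' \<mu>(2) ij by (auto simp: Hom_def)
      have "A1 \<mu> (\<rho> \<cdot> (l \<cdot> (\<tau> \<cdot> e2)))"
        unfolding A1_def
      proof (intro allI impI)
        fix s \<zeta> \<nu> assume h1: "\<zeta> \<in> Hom C s (Dom C \<mu>) \<and> \<nu> \<in> Hom C s N \<and> n \<cdot> \<nu> = \<mu> \<cdot> \<zeta>"
        then have m: "mem (ev \<cdot> \<nu>) (\<rho>' \<cdot> (\<tau> \<cdot> e2) \<cdot> \<zeta>)" using \<mu>(5) unfolding A1_def 3 by blast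
        have \<zeta>: "\<zeta> \<in> Hom C s t" using h1 \<mu>(3) by (simp add: Hom_def)
        have ty: "\<tau> \<cdot> (e2 \<cdot> \<zeta>) \<in> Hom C s D" "ev \<cdot> \<nu> \<in> Hom C s Y"
          using \<tau> \<mu>(2) \<zeta> h1 ev by (auto simp: Hom_def)
        have "mem (ev \<cdot> \<nu>) (\<rho>' \<cdot> (\<tau> \<cdot> (e2 \<cdot> \<zeta>)))" using m \<zeta> \<mu>(2) \<tau> \<rho>' by (simp add: Hom_def)
        then have "mem (ev \<cdot> \<nu>) (\<rho> \<cdot> (l \<cdot> (\<tau> \<cdot> (e2 \<cdot> \<zeta>))))" using memT ty by blast
        then show "mem (ev \<cdot> \<nu>) (\<rho> \<cdot> (l \<cdot> (\<tau> \<cdot> e2)) \<cdot> \<zeta>)"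
          using \<zeta> \<mu>(2) \<tau> \<rho>(1) l by (simp add: Hom_def)
      qed
      then show ?thesis using A2I[OF g \<mu>(1-3) 1] 2 by simp
    qed
    \<comment> \<open>The new element is derived by the rule \<open>u \<cdot> b\<close>. Its
      premises lie in the union because the covering square makes each index of a premise come,
      locally, from an index in \<open>D\<close> whose code contains that premise.\<close>
    have A2in2: "A2 (\<gamma> \<cdot> c0 \<cdot> in2)"
    proof -
      have g: "\<gamma> \<cdot> c0 \<cdot> in2 \<in> Hom C Z' I" using \<gamma>c Q0(3) by (auto simp: Hom_def)
      have gx: "\<gamma> \<cdot> c0 \<cdot> in2 \<cdot> Id C Z' = \<gamma> \<cdot> (c0 \<cdot> in2)"
        using \<gamma>(1) R(2) Q0(3) by (simp add: Hom_def)
      have 1: "\<beta> \<cdot> (u \<cdot> b) = i \<cdot> (\<gamma> \<cdot> c0 \<cdot> in2 \<cdot> Id C Z')"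
        unfolding gx i\<gamma>[OF Q0(3)] w(3) ..
      have 2: "j \<cdot> (\<gamma> \<cdot> c0 \<cdot> in2 \<cdot> Id C Z') = \<rho>"
        unfolding gx j\<gamma>[OF Q0(3)] Q0(7) using \<rho>(1) by (simp add: Hom_def)
      have "A1 (u \<cdot> b) \<rho>"
        unfolding A1_def
      proof (intro allI impI)
        fix s \<zeta> \<nu> assume h1: "\<zeta> \<in> Hom C s (Dom C (u \<cdot> b)) \<and> \<nu> \<in> Hom C s N \<and> n \<cdot> \<nu> = u \<cdot> b \<cdot> \<zeta>"
        then have \<zeta>: "\<zeta> \<in> Hom C s Z'" using ub by (simp add: Hom_def)
        have b\<zeta>: "b \<cdot> \<zeta> \<in> Hom C s Z" using b \<zeta> by (auto simp: Hom_def)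
        have "u \<cdot> (b \<cdot> \<zeta>) = n \<cdot> \<nu>" using h1 u b \<zeta> by (simp add: Hom_def)
        then obtain x where x: "x \<in> Hom C s BZ" "b0 \<cdot> x = b \<cdot> \<zeta>" "\<nu>0 \<cdot> x = \<nu>"
          using pullbackE[OF B, of "b \<cdot> \<zeta>" s \<nu>] b\<zeta> h1 u n unfolding BZ_def by (auto simp: Hom_def)
        obtain x' where x': "x' \<in> Hom C s (Dom C p)" "p \<cdot> x' = \<zeta>" "q' \<cdot> x' = x"
          using pullbackE[OF sq(2), of \<zeta> s x] \<zeta> x(1,2) b b0 by (auto simp: Hom_def)
        \<comment> \<open>The map \<open>c\<close> from \<open>D\<close> to the pullback in the
          covering square is a cover; pulling it back along \<open>x'\<close> lifts the premise to
          an index \<open>\<delta>\<close>.\<close>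
        obtain e3 \<delta> s' where e3: "is_cover C e3" "e3 \<in> Hom C s' s" "\<delta> \<in> Hom C s' D" "x' \<cdot> e3 = c \<cdot> \<delta>"
          using cover_pull[OF sq(6) c x'(1)] .
        have l\<delta>: "l \<cdot> \<delta> = \<zeta> \<cdot> e3"
        proof -
          have "l \<cdot> \<delta> = p \<cdot> (c \<cdot> \<delta>)" using whisker[OF sq(4), of \<delta>] pq'(1) c e3(3) by (simp add: Hom_def)
          also have "\<dots> = \<zeta> \<cdot> e3"
            using whisker[OF x'(2), of e3] e3(2) e3(4)[symmetric] x'(1) pq'(1) by (simp add: Hom_def)
          finally show ?thesis .
        qed
        have ey\<delta>: "e \<cdot> (y \<cdot> \<delta>) = x \<cdot> e3"
        proof -
          have "e \<cdot> (y \<cdot> \<delta>) = q' \<cdot> (c \<cdot> \<delta>)"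
            using whisker[OF sq(5), of \<delta>] pq'(2) c e3(3) k(2) y by (simp add: Hom_def)
          also have "\<dots> = x \<cdot> e3"
            using whisker[OF x'(3), of e3] e3(2) e3(4)[symmetric] x'(1) pq'(2) by (simp add: Hom_def)
          finally show ?thesis .
        qed
        have kyd: "k \<cdot> (y \<cdot> \<delta>) \<in> Hom C s' I" using k(3) y e3(3) by (auto simp: Hom_def)
        have "i \<cdot> (k \<cdot> (y \<cdot> \<delta>)) = ev \<cdot> (\<nu>0 \<cdot> (e \<cdot> (y \<cdot> \<delta>)))"
          using whisker[OF k(4), of "y \<cdot> \<delta>"] k(2,3) y e3(3) ij ev \<nu>0 by (simp add: Hom_def)
        also have "\<dots> = ev \<cdot> (\<nu> \<cdot> e3)"
          unfolding ey\<delta> using whisker[OF x(3), of e3] x(1) \<nu>0 e3(2) by (simp add: Hom_def)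
        finally have iky: "i \<cdot> (k \<cdot> (y \<cdot> \<delta>)) = ev \<cdot> \<nu> \<cdot> e3"
          using ev h1 e3(2) by (simp add: Hom_def)
        have "j \<cdot> (k \<cdot> (y \<cdot> \<delta>)) = \<rho>' \<cdot> \<delta>"
          unfolding \<rho>'_def using ij k(3) y e3(3) by (simp add: Hom_def)
        then have "mem (ev \<cdot> \<nu> \<cdot> e3) (\<rho>' \<cdot> \<delta>)" using memI[OF kyd] iky by simp
        moreover have "ev \<cdot> \<nu> \<cdot> e3 \<in> Hom C s' Y" and evn: "ev \<cdot> \<nu> \<in> Hom C s Y"
          using ev h1 e3(2) by (auto simp: Hom_def)
        ultimately have "mem (ev \<cdot> \<nu> \<cdot> e3) (\<rho> \<cdot> (l \<cdot> \<delta>))" using memT e3(3) by blast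
        then have "mem (ev \<cdot> \<nu> \<cdot> e3) (\<rho> \<cdot> \<zeta> \<cdot> e3)"
          unfolding l\<delta> using \<rho>(1) \<zeta> e3(2) by (simp add: Hom_def)
        then show "mem (ev \<cdot> \<nu>) (\<rho> \<cdot> \<zeta>)"
          using mem_local[OF e3(1,2) evn] \<rho>(1) \<zeta> by (auto simp: Hom_def)
      qed
      then show ?thesis using A2I[OF g cover_Id[OF Z'O] Id_in_Hom[OF Z'O] ub 1] 2 by simp
    qed
    \<comment> \<open>Cases over the coproduct \<open>Q0\<close>, followed by descent along the
      cover \<open>c0\<close> to the image.\<close>
    have "A2 (\<gamma> \<cdot> c0)"
      by (rule coproduct_representable[OF Q0(1) A2_rep _ A2in1 A2in2]) (use \<gamma>c Q0c in simp)
    then have A2\<gamma>: "A2 \<gamma>" by (rule representable_local[OF A2_rep R(1,2) \<gamma>(1)])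
    \<comment> \<open>By joint monicity of the membership span, every element of the set
      \<open>\<rho> \<cdot> \<zeta>\<close> is a reindexing of \<open>\<gamma>\<close>.\<close>
    have "K \<rho>"
      unfolding K_def forall_along_def
    proof (intro allI impI)
      fix t \<zeta> x assume "\<zeta> \<in> Hom C t (Dom C \<rho>) \<and> x \<in> Hom C t (Dom C j) \<and> j \<cdot> x = \<rho> \<cdot> \<zeta>"
      then have x: "\<zeta> \<in> Hom C t Z'" "x \<in> Hom C t I" "j \<cdot> x = \<rho> \<cdot> \<zeta>"
        using ij \<rho>(1) by (auto simp: Hom_def)
      have ix: "i \<cdot> x \<in> Hom C t Y" using x ij by (auto simp: Hom_def)
      have "mem (i \<cdot> x) (\<rho> \<cdot> \<zeta>)" using memI[OF x(2)] x(3) by simp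
      then have "span_in C r1 r2 (i \<cdot> x) \<zeta>" using \<rho>(2)[OF ix x(1)] by blast
      then obtain v where "v \<in> Hom C t (Dom C r1)" "r1 \<cdot> v = i \<cdot> x" "r2 \<cdot> v = \<zeta>"
        using span_inE ix by blast
      then have v: "v \<in> Hom C t R" "r1 \<cdot> v = i \<cdot> x" "r2 \<cdot> v = \<zeta>" using r by (auto simp: Hom_def)
      have "i \<cdot> (\<gamma> \<cdot> v) = i \<cdot> x"
        using whisker[OF \<gamma>(2), of v] v(1,2) \<gamma>(1) ij by (simp add: Hom_def)
      moreover have "j \<cdot> (\<gamma> \<cdot> v) = j \<cdot> x"
        using whisker[OF \<gamma>(3), of v] v(1,3) x(3) \<gamma>(1) ij r(2) \<rho>(1) by (simp add: Hom_def)
      ultimately have "\<gamma> \<cdot> v = x"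
        by (rule joint_monoD[OF jm, where z = t, rotated 2])
          (use v(1) \<gamma>(1) x(2) ij in \<open>auto simp: Hom_def\<close>)
      then show "A2 x" using representable_comp[OF A2_rep A2\<gamma> \<gamma>(1) v(1)] by simp
    qed
    moreover have "mem (\<beta> \<cdot> u \<cdot> b) \<rho>" using memZ u b \<beta> by (simp add: Hom_def)
    moreover have "\<beta> \<cdot> u \<in> Hom C Z Y" using u \<beta> by (auto simp: Hom_def)
    ultimately show "G (\<beta> \<cdot> u)" using GI[OF _ sq(1) b] by blast
  qed

  obtain g where g: "is_mono C g" "g \<in> Hom C (Dom C g) Y"
    "\<And>z x. x \<in> Hom C z Y \<Longrightarrow> sub_le C x g \<longleftrightarrow> G x" using representableE[OF G_rep] by blast
  have fa: "forall_along C n (\<lambda>\<nu>. sub_le C (ev \<cdot> \<nu>) g) u \<longleftrightarrow> forall_along C n (\<lambda>\<nu>. G (ev \<cdot> \<nu>)) u" for u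
  proof -
    have "sub_le C (ev \<cdot> \<nu>) g \<longleftrightarrow> G (ev \<cdot> \<nu>)" if "\<nu> \<in> Hom C t (Dom C n)" for \<nu> t
      by (rule g(3)[of _ t]) (use that ev N_def in \<open>auto simp: Hom_def\<close>)
    then show ?thesis unfolding forall_along_def by metis
  qed
  show "\<exists>g. is_mono C g \<and> Cod C g = Y \<and>
        (\<forall>z y. y \<in> Hom C z Y \<and> sub_le C y g \<longrightarrow>
           (\<exists>t e u. is_epi C e \<and> e \<in> Hom C t z \<and> u \<in> Hom C t (Cod C n) \<and> \<beta> \<cdot> u = y \<cdot> e \<and>
              forall_along C n (\<lambda>\<nu>. sub_le C (ev \<cdot> \<nu>) g) u)) \<and>
        (\<forall>z u. u \<in> Hom C z (Cod C n) \<and> forall_along C n (\<lambda>\<nu>. sub_le C (ev \<cdot> \<nu>) g) u \<longrightarrow>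
           sub_le C (\<beta> \<cdot> u) g)"
  proof (intro exI[of _ g] conjI allI impI)
    show "is_mono C g" "Cod C g = Y" using g by (auto simp: Hom_def)
  next
    fix z y assume "y \<in> Hom C z Y \<and> sub_le C y g"
    then show "\<exists>t e u. is_epi C e \<and> e \<in> Hom C t z \<and> u \<in> Hom C t (Cod C n) \<and> \<beta> \<cdot> u = y \<cdot> e \<and>
              forall_along C n (\<lambda>\<nu>. sub_le C (ev \<cdot> \<nu>) g) u"
      unfolding fa using g(3) post M_def by blast
  next
    fix z u assume u: "u \<in> Hom C z (Cod C n) \<and> forall_along C n (\<lambda>\<nu>. sub_le C (ev \<cdot> \<nu>) g) u"
    then have "\<beta> \<cdot> u \<in> Hom C z Y" using \<beta> M_def by (auto simp: Hom_def)
    then show "sub_le C (\<beta> \<cdot> u) g" using u closed g(3) M_def unfolding fa by blast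
  qed
qed

end

section \<open>Dependent products along small maps\<close>

text \<open>Maps \<open>Z \<times>\<^sub>A B \<rightarrow> Y\<close> are encoded, by Yoneda, as natural families \<open>\<phi> \<zeta> b\<close>; this avoids choosing the
  pullback. \<open>\<phi>\<close> is only meaningful on pairs with \<open>f b = a \<zeta>\<close>.\<close>

definition is_family :: "('o, 'm) cat \<Rightarrow> 'm \<Rightarrow> 'm \<Rightarrow> 'o \<Rightarrow> ('m \<Rightarrow> 'm \<Rightarrow> 'm) \<Rightarrow> bool" where
  "is_family C f a Y \<phi> \<longleftrightarrow> (\<forall>t \<zeta> b. \<zeta> \<in> Hom C t (Dom C a) \<and> b \<in> Hom C t (Dom C f) \<and>
     f \<cdot>\<^bsub>C\<^esub> b = a \<cdot>\<^bsub>C\<^esub> \<zeta> \<longrightarrow> \<phi> \<zeta> b \<in> Hom C t Y \<and>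
       (\<forall>s. \<forall>h \<in> Hom C s t. \<phi> (\<zeta> \<cdot>\<^bsub>C\<^esub> h) (b \<cdot>\<^bsub>C\<^esub> h) = \<phi> \<zeta> b \<cdot>\<^bsub>C\<^esub> h))"

text \<open>The universal property of the counit at \<open>d\<close>; the equation on
  \<open>d\<close> and \<open>\<phi>\<close> says that the family is a map over
  \<open>Dom f\<close>. The pullback \<open>p\<close>, \<open>q\<close> is a parameter because the
  right adjoint is built on whichever pullback Hilbert choice selects.\<close>

definition is_Pi :: "('o, 'm) cat \<Rightarrow> 'm \<Rightarrow> 'm \<Rightarrow> 'm \<Rightarrow> 'm \<Rightarrow> 'm \<Rightarrow> 'm \<Rightarrow> bool" where
  "is_Pi C f d \<pi> p q \<epsilon> \<longleftrightarrow> is_pullback C \<pi> f p q \<and> d \<in> Arr C \<and> Cod C d = Dom C f \<and>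
     \<epsilon> \<in> Hom C (Dom C p) (Dom C d) \<and> d \<cdot>\<^bsub>C\<^esub> \<epsilon> = q \<and>
     (\<forall>a \<phi>. a \<in> Arr C \<and> Cod C a = Cod C f \<and> is_family C f a (Dom C d) \<phi> \<and>
        (\<forall>t \<zeta> b. \<zeta> \<in> Hom C t (Dom C a) \<and> b \<in> Hom C t (Dom C f) \<and> f \<cdot>\<^bsub>C\<^esub> b = a \<cdot>\<^bsub>C\<^esub> \<zeta> \<longrightarrow>
           d \<cdot>\<^bsub>C\<^esub> \<phi> \<zeta> b = b) \<longrightarrow>
        (\<exists>!u. u \<in> Hom C (Dom C a) (Dom C \<pi>) \<and> \<pi> \<cdot>\<^bsub>C\<^esub> u = a \<and>
           (\<forall>t \<zeta> k. \<zeta> \<in> Hom C t (Dom C a) \<and> k \<in> Hom C t (Dom C p) \<and> p \<cdot>\<^bsub>C\<^esub> k = u \<cdot>\<^bsub>C\<^esub> \<zeta> \<longrightarrow>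
              \<epsilon> \<cdot>\<^bsub>C\<^esub> k = \<phi> \<zeta> (q \<cdot>\<^bsub>C\<^esub> k))))"

context category
begin

lemma is_familyD:
  assumes "is_family C f a Y \<phi>" "a \<in> Hom C z x" "\<zeta> \<in> Hom C t z" "b \<in> Hom C t (Dom C f)" "f \<cdot> b = a \<cdot> \<zeta>"
  shows "\<phi> \<zeta> b \<in> Hom C t Y" "h \<in> Hom C s t \<Longrightarrow> \<phi> (\<zeta> \<cdot> h) (b \<cdot> h) = \<phi> \<zeta> b \<cdot> h"
proof -
  have "\<zeta> \<in> Hom C t (Dom C a)" using assms by (simp add: Hom_def)
  then have "\<phi> \<zeta> b \<in> Hom C t Y \<and> (\<forall>s. \<forall>h \<in> Hom C s t. \<phi> (\<zeta> \<cdot> h) (b \<cdot> h) = \<phi> \<zeta> b \<cdot> h)"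
    using assms(1,4,5) unfolding is_family_def by blast
  then show "\<phi> \<zeta> b \<in> Hom C t Y" "h \<in> Hom C s t \<Longrightarrow> \<phi> (\<zeta> \<cdot> h) (b \<cdot> h) = \<phi> \<zeta> b \<cdot> h"
    by blast+
qed

end

section \<open>Dependent products from small functional relations\<close>

context category_with_small_maps_PE
begin

text \<open>An element of \<open>\<Pi>\<^sub>f d\<close> over \<open>a\<close> is a small \<open>R \<subseteq> Dom d\<close> lying over \<open>B\<^sub>a\<close> (\<open>c1\<close>) that meets each fibre of
  \<open>d\<close> at most (\<open>c2\<close>) and at least (\<open>c3\<close>) once.\<close>

lemma small_Pi_exists:
  assumes fS: "f \<in> S" and dA: "d \<in> Arr C" and dc: "Cod C d = Dom C f"
  shows "\<exists>\<pi> p q \<epsilon>. is_Pi C f d \<pi> p q \<epsilon>"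
proof -
  define B where "B = Dom C f"
  define A where "A = Cod C f"
  define D where "D = Dom C d"
  have f: "f \<in> Hom C B A" and d: "d \<in> Hom C D B"
    using small_arr[OF fS] dA dc unfolding A_def B_def D_def by (auto simp: Hom_def)
  have AO: "A \<in> Obj C" and BO: "B \<in> Obj C" and DO: "D \<in> Obj C" using f d Hom_Obj by auto
  obtain I P i j where i: "i \<in> Hom C I D" and j: "j \<in> Hom C I P" and jS: "j \<in> S"
    and jm: "joint_mono C i j"
    and power: "\<And>R Z r1 r2. \<lbrakk>r1 \<in> Hom C R D; r2 \<in> Hom C R Z; r2 \<in> S; joint_mono C r1 r2\<rbrakk> \<Longrightarrow>
      \<exists>!\<rho>. \<rho> \<in> Hom C Z P \<and> (\<forall>t y \<zeta>. y \<in> Hom C t D \<and> \<zeta> \<in> Hom C t Z \<longrightarrow>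
        (span_in C i j y (\<rho> \<cdot> \<zeta>) \<longleftrightarrow> span_in C r1 r2 y \<zeta>))"
    by (rule power_span[OF DO]) (rule that)
  have PO: "P \<in> Obj C" and IO: "I \<in> Obj C" using j Hom_Obj by auto
  have ty: "i \<in> Arr C" "j \<in> Arr C" "Dom C i = I" "Dom C j = I" "Cod C i = D" "Cod C j = P"
    "d \<in> Arr C" "f \<in> Arr C" "Dom C d = D" "Cod C d = B" "Dom C f = B" "Cod C f = A"
    using i j d f by (auto simp: Hom_def)
  \<comment> \<open>\<open>di\<close> sends an element of a coded set to its place in
    \<open>B\<close>; \<open>dj\<close> records this place together with the code.\<close>
  define di where "di = d \<cdot> i"
  have di: "di \<in> Hom C I B" unfolding di_def using ty by (simp add: Hom_def)
  have di_k: "di \<cdot> k = d \<cdot> (i \<cdot> k)" if "k \<in> Hom C t I" for k t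
    unfolding di_def using that ty by (simp add: Hom_def)
  define dj where "dj = pairing C di j"
  note dj = pairing[OF di j, folded dj_def]
  have dj_k: "dj \<cdot> k = pairing C (di \<cdot> k) (j \<cdot> k)" if "k \<in> Hom C t I" for k t
    unfolding dj_def using that di j by (simp add: Hom_def)
  have dj_eq: "dj \<cdot> k = x \<longleftrightarrow> di \<cdot> k = pr1 C B P \<cdot> x \<and> j \<cdot> k = pr2 C B P \<cdot> x"
    if k: "k \<in> Hom C t I" and x: "x \<in> Hom C t (prod_obj C B P)" for k x t
  proof -
    have "di \<cdot> k \<in> Hom C t B" "j \<cdot> k \<in> Hom C t P" "pr1 C B P \<cdot> x \<in> Hom C t B" "pr2 C B P \<cdot> x \<in> Hom C t P"
      using k x di j BO PO by (auto simp: Hom_def)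
    then show ?thesis
      using dj_k[OF k] pairing_eta[OF BO PO x] pairing_eq_iff by metis
  qed

  define c1 where "c1 a \<rho> \<longleftrightarrow> (\<forall>t \<zeta> k. \<zeta> \<in> Hom C t (Dom C \<rho>) \<and> k \<in> Hom C t I \<and> j \<cdot> k = \<rho> \<cdot> \<zeta> \<longrightarrow>
    f \<cdot> (di \<cdot> k) = a \<cdot> \<zeta>)" for a \<rho>
  define c2 where "c2 \<rho> \<longleftrightarrow> (\<forall>t \<zeta> k k'. \<zeta> \<in> Hom C t (Dom C \<rho>) \<and> k \<in> Hom C t I \<and> k' \<in> Hom C t I \<and>
    j \<cdot> k = \<rho> \<cdot> \<zeta> \<and> j \<cdot> k' = \<rho> \<cdot> \<zeta> \<and> di \<cdot> k = di \<cdot> k' \<longrightarrow> k = k')" for \<rho>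
  \<comment> \<open>Totality is asked locally, since the existence of an element becomes
    representable as existence up to a cover.\<close>
  define c3 where "c3 a \<rho> \<longleftrightarrow> (\<forall>t \<zeta> b. \<zeta> \<in> Hom C t (Dom C \<rho>) \<and> b \<in> Hom C t B \<and> f \<cdot> b = a \<cdot> \<zeta> \<longrightarrow>
    exists_along C dj (\<lambda>k. True) (pairing C b (\<rho> \<cdot> \<zeta>)))" for a \<rho>

  have rep1: "representable C (prod_obj C A P) (\<lambda>x. c1 (pr1 C A P \<cdot> x) (pr2 C A P \<cdot> x))"
  proof -
    have l: "f \<cdot> (di \<cdot> pr1 C I A) \<in> Hom C (prod_obj C I A) A" "pr2 C I A \<in> Hom C (prod_obj C I A) A"
      using f di IO AO by (auto simp: Hom_def)
    note r = representable_forall_prod[OF j AO representable_eq[OF l]]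
    \<comment> \<open>The quantifier lemma puts the quantified leg \<open>j\<close> over the first
      factor and the parameter into the second, whereas the shape comes first here; this arrow swaps
      the factors.\<close>
    note sw = pairing[OF pr_Hom(2)[OF AO PO] pr_Hom(1)[OF AO PO]]
    show ?thesis
    proof (rule representable_cong[OF representable_subst[OF r sw(1)]])
      fix z x assume x: "x \<in> Hom C z (prod_obj C A P)"
      let ?s = "pairing C (pr2 C A P) (pr1 C A P)"
      have D: "Dom C (?s \<cdot> x) = z" "Dom C (pr2 C A P \<cdot> x) = z" using sw(1) x AO PO by (auto simp: Hom_def)
      have s: "pr1 C P A \<cdot> (?s \<cdot> x) = pr2 C A P \<cdot> x" "pr2 C P A \<cdot> (?s \<cdot> x) = pr1 C A P \<cdot> x"
        using whisker[OF sw(2), of x] whisker[OF sw(3), of x] sw(1) x AO PO by (auto simp: Hom_def)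
      have "f \<cdot> (di \<cdot> pr1 C I A) \<cdot> pairing C \<nu> (pr1 C A P \<cdot> x \<cdot> \<zeta>) = f \<cdot> (di \<cdot> \<nu>)"
        "pr2 C I A \<cdot> pairing C \<nu> (pr1 C A P \<cdot> x \<cdot> \<zeta>) = pr1 C A P \<cdot> x \<cdot> \<zeta>"
        if "\<zeta> \<in> Hom C t z" "\<nu> \<in> Hom C t I" for t \<zeta> \<nu>
        using that x f di IO AO PO by (auto simp: Hom_def)
      then show "(\<forall>t \<zeta> \<nu>. \<zeta> \<in> Hom C t (Dom C (?s \<cdot> x)) \<and> \<nu> \<in> Hom C t I \<and>
          j \<cdot> \<nu> = pr1 C P A \<cdot> (?s \<cdot> x) \<cdot> \<zeta> \<longrightarrow>
          f \<cdot> (di \<cdot> pr1 C I A) \<cdot> pairing C \<nu> (pr2 C P A \<cdot> (?s \<cdot> x) \<cdot> \<zeta>) =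
          pr2 C I A \<cdot> pairing C \<nu> (pr2 C P A \<cdot> (?s \<cdot> x) \<cdot> \<zeta>)) \<longleftrightarrow>
        c1 (pr1 C A P \<cdot> x) (pr2 C A P \<cdot> x)"
        unfolding s c1_def D by metis
    qed
  qed
  have rep2: "representable C P c2"
  proof -
    \<comment> \<open>The kernel pair of \<open>dj\<close> consists of two elements of one coded set
      over the same point of \<open>B\<close>; uniqueness says that its projections agree over
      \<open>\<rho>\<close>.\<close>
    obtain z1 z2 where R2: "is_pullback C dj dj z1 z2"
      using lex_pullbacks[of dj dj] dj(1) by (auto simp: Hom_def)
    have z: "z1 \<in> Hom C (Dom C z1) I" "z2 \<in> Hom C (Dom C z1) I"
      using pullbackD[OF R2] dj(1) by (auto simp: Hom_def)
    have jz: "j \<cdot> z1 \<in> Hom C (Dom C z1) P" using z j by (auto simp: Hom_def)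
    show ?thesis
    proof (rule representable_cong[OF representable_forall[OF jz representable_eq[OF z]]])
      fix t \<rho> assume \<rho>: "\<rho> \<in> Hom C t P"
      show "forall_along C (j \<cdot> z1) (\<lambda>x. z1 \<cdot> x = z2 \<cdot> x) \<rho> \<longleftrightarrow> c2 \<rho>"
      proof
        assume A: "forall_along C (j \<cdot> z1) (\<lambda>x. z1 \<cdot> x = z2 \<cdot> x) \<rho>"
        show "c2 \<rho>" unfolding c2_def
        proof (intro allI impI)
          fix s \<zeta> k k' assume h: "\<zeta> \<in> Hom C s (Dom C \<rho>) \<and> k \<in> Hom C s I \<and> k' \<in> Hom C s I \<and>
            j \<cdot> k = \<rho> \<cdot> \<zeta> \<and> j \<cdot> k' = \<rho> \<cdot> \<zeta> \<and> di \<cdot> k = di \<cdot> k'"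
          then have "dj \<cdot> k = dj \<cdot> k'" using dj_k by metis
          then obtain x where x: "x \<in> Hom C s (Dom C z1)" "z1 \<cdot> x = k" "z2 \<cdot> x = k'"
            using pullbackE[OF R2, of k s k'] h dj(1) by (auto simp: Hom_def)
          have "j \<cdot> z1 \<cdot> x = \<rho> \<cdot> \<zeta>" using h x(1,2) z(1) ty by (simp add: Hom_def)
          moreover have "\<zeta> \<in> Hom C s t" "x \<in> Hom C s (Dom C (j \<cdot> z1))"
            using h \<rho> x(1) z(1) ty by (auto simp: Hom_def)
          ultimately show "k = k'" using forall_alongD[OF A \<rho>] x(2,3) by metis
        qed
      next
        assume A: "c2 \<rho>"
        show "forall_along C (j \<cdot> z1) (\<lambda>x. z1 \<cdot> x = z2 \<cdot> x) \<rho>"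
          unfolding forall_along_def
        proof (intro allI impI)
          fix s \<zeta> x assume h: "\<zeta> \<in> Hom C s (Dom C \<rho>) \<and> x \<in> Hom C s (Dom C (j \<cdot> z1)) \<and> j \<cdot> z1 \<cdot> x = \<rho> \<cdot> \<zeta>"
          then have x: "x \<in> Hom C s (Dom C z1)" using z(1) ty by (simp add: Hom_def)
          have zx: "z1 \<cdot> x \<in> Hom C s I" "z2 \<cdot> x \<in> Hom C s I" using x z by (auto simp: Hom_def)
          have "dj \<cdot> (z1 \<cdot> x) = dj \<cdot> (z2 \<cdot> x)"
            using whisker[OF pullbackD(9)[OF R2], of x] x z dj(1) by (auto simp: Hom_def)
          then have e: "di \<cdot> (z1 \<cdot> x) = di \<cdot> (z2 \<cdot> x) \<and> j \<cdot> (z1 \<cdot> x) = j \<cdot> (z2 \<cdot> x)"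
            unfolding dj_k[OF zx(1)] dj_k[OF zx(2)]
            by (subst (asm) pairing_eq_iff[of _ s B _ P]) (use zx di j in \<open>auto simp: Hom_def\<close>)
          have "j \<cdot> z1 \<cdot> x = j \<cdot> (z1 \<cdot> x)" using x z(1) ty by (simp add: Hom_def)
          then have "j \<cdot> (z1 \<cdot> x) = \<rho> \<cdot> \<zeta>" using h by simp
          then show "z1 \<cdot> x = z2 \<cdot> x" using A h zx e unfolding c2_def by metis
        qed
      qed
    qed
  qed
  have rep3: "representable C (prod_obj C A P) (\<lambda>x. c3 (pr1 C A P \<cdot> x) (pr2 C A P \<cdot> x))"
  proof (rule representable_cong[OF representable_forall_prod[OF f PO representable_exists[OF dj(1) representable_True[OF IO]]]])
    fix z x assume x: "x \<in> Hom C z (prod_obj C A P)"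
    have D: "Dom C (pr2 C A P \<cdot> x) = Dom C x" using x AO PO by (simp add: Hom_def)
    show "(\<forall>t \<zeta> \<nu>. \<zeta> \<in> Hom C t (Dom C x) \<and> \<nu> \<in> Hom C t B \<and> f \<cdot> \<nu> = pr1 C A P \<cdot> x \<cdot> \<zeta> \<longrightarrow>
        exists_along C dj (\<lambda>x. True) (pairing C \<nu> (pr2 C A P \<cdot> x \<cdot> \<zeta>))) \<longleftrightarrow>
      c3 (pr1 C A P \<cdot> x) (pr2 C A P \<cdot> x)"
      unfolding c3_def D by blast
  qed

  define Q where "Q a \<rho> \<longleftrightarrow> c1 a \<rho> \<and> c2 \<rho> \<and> c3 a \<rho>" for a \<rho>
  have repQ: "representable C (prod_obj C A P) (\<lambda>x. Q (pr1 C A P \<cdot> x) (pr2 C A P \<cdot> x))"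
    unfolding Q_def
    using representable_conj[OF rep1 representable_conj[OF representable_subst[OF rep2 pr_Hom(2)[OF AO PO]] rep3]] .
  obtain m where m: "is_mono C m" "m \<in> Hom C (Dom C m) (prod_obj C A P)"
    "\<And>z x. x \<in> Hom C z (prod_obj C A P) \<Longrightarrow> sub_le C x m \<longleftrightarrow> Q (pr1 C A P \<cdot> x) (pr2 C A P \<cdot> x)"
    using representableE[OF repQ] by blast

  text \<open>On elements satisfying \<open>Q\<close>, local unique existence becomes unique existence.\<close>
  have uc: "\<exists>k. k \<in> Hom C t I \<and> j \<cdot> k = \<rho> \<cdot> \<zeta> \<and> di \<cdot> k = b"
    if Q: "Q a \<rho>" and h: "\<rho> \<in> Hom C z P" "\<zeta> \<in> Hom C t z" "b \<in> Hom C t B" "f \<cdot> b = a \<cdot> \<zeta>" for a \<rho> z \<zeta> t b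
  proof -
    have r\<zeta>: "\<rho> \<cdot> \<zeta> \<in> Hom C t P" and \<zeta>: "\<zeta> \<in> Hom C t (Dom C \<rho>)" using h by (auto simp: Hom_def)
    note bp = pairing[OF h(3) r\<zeta>]
    have "exists_along C dj (\<lambda>k. True) (pairing C b (\<rho> \<cdot> \<zeta>))"
      using Q \<zeta> h(3,4) unfolding Q_def c3_def by blast
    then obtain e s k where "is_cover C e" "e \<in> Hom C s t" "k \<in> Hom C s (Dom C dj)"
      "dj \<cdot> k = pairing C b (\<rho> \<cdot> \<zeta>) \<cdot> e"
      using exists_alongE bp(1) by blast
    then have e: "is_cover C e" "e \<in> Hom C s t" "k \<in> Hom C s I" "dj \<cdot> k = pairing C b (\<rho> \<cdot> \<zeta>) \<cdot> e"
      using dj(1) by (auto simp: Hom_def)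
    \<comment> \<open>The pullback collects the elements of the set that lie over \<open>b\<close>.
      By \<open>c2\<close> the map \<open>x1\<close> is a mono, by \<open>c3\<close> a cover factors
      through it, so it is invertible and its inverse picks the element.\<close>
    obtain x1 x2 where X: "is_pullback C (pairing C b (\<rho> \<cdot> \<zeta>)) dj x1 x2"
      using lex_pullbacks[of "pairing C b (\<rho> \<cdot> \<zeta>)" dj] bp(1) dj(1) by (auto simp: Hom_def)
    have x: "x1 \<in> Hom C (Dom C x1) t" "x2 \<in> Hom C (Dom C x1) I"
      using pullbackD[OF X] bp(1) dj(1) by (auto simp: Hom_def)
    have djx: "di \<cdot> (x2 \<cdot> v) = b \<cdot> (x1 \<cdot> v) \<and> j \<cdot> (x2 \<cdot> v) = \<rho> \<cdot> (\<zeta> \<cdot> (x1 \<cdot> v))"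
      if v: "v \<in> Hom C w (Dom C x1)" for v w
    proof -
      have x1v: "x1 \<cdot> v \<in> Hom C w t" and x2v: "x2 \<cdot> v \<in> Hom C w I" using v x by (auto simp: Hom_def)
      have px: "pairing C b (\<rho> \<cdot> \<zeta>) \<cdot> (x1 \<cdot> v) \<in> Hom C w (prod_obj C B P)" using bp(1) x1v by (auto simp: Hom_def)
      have "dj \<cdot> (x2 \<cdot> v) = pairing C b (\<rho> \<cdot> \<zeta>) \<cdot> (x1 \<cdot> v)"
        using whisker[OF pullbackD(9)[OF X, symmetric], of v] v x dj(1) bp(1) by (auto simp: Hom_def)
      moreover have "pr1 C B P \<cdot> (pairing C b (\<rho> \<cdot> \<zeta>) \<cdot> (x1 \<cdot> v)) = b \<cdot> (x1 \<cdot> v)"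
        using whisker[OF bp(2), of "x1 \<cdot> v"] x1v bp(1) BO PO by (auto simp: Hom_def)
      moreover have "pr2 C B P \<cdot> (pairing C b (\<rho> \<cdot> \<zeta>) \<cdot> (x1 \<cdot> v)) = \<rho> \<cdot> (\<zeta> \<cdot> (x1 \<cdot> v))"
        using whisker[OF bp(3), of "x1 \<cdot> v"] x1v bp(1) BO PO h by (auto simp: Hom_def)
      ultimately show ?thesis using dj_eq[OF x2v px] by simp
    qed
    have "is_mono C x1"
    proof (rule monoI[OF x(1)])
      fix w v v' assume v: "v \<in> Hom C w (Dom C x1)" "v' \<in> Hom C w (Dom C x1)" "x1 \<cdot> v = x1 \<cdot> v'"
      have t2: "x2 \<cdot> v \<in> Hom C w I" "x2 \<cdot> v' \<in> Hom C w I" "\<zeta> \<cdot> (x1 \<cdot> v') \<in> Hom C w (Dom C \<rho>)"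
        using v(1,2) x \<zeta> by (auto simp: Hom_def)
      have "x2 \<cdot> v = x2 \<cdot> v'"
        using Q t2 djx[OF v(1)] djx[OF v(2)] v(3) unfolding Q_def c2_def by metis
      then show "v = v'" using pullback_ext[OF X v] by blast
    qed
    moreover obtain v where "v \<in> Hom C s (Dom C x1)" "x1 \<cdot> v = e"
      by (rule pullbackE[OF X, of e s k]) (use e bp(1) dj(1) in \<open>auto simp: Hom_def\<close>)
    then have "sub_le C e x1" using x(1) by (intro sub_leI) (auto simp: Hom_def)
    ultimately have "is_iso C x1" using mono_cover_iso x(1) e(1,2) by blast
    then obtain x1' where x1': "x1' \<in> Hom C t (Dom C x1)" "x1 \<cdot> x1' = Id C t" using isoE x(1) by blast
    have "di \<cdot> (x2 \<cdot> x1') = b \<and> j \<cdot> (x2 \<cdot> x1') = \<rho> \<cdot> \<zeta>"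
      using djx[OF x1'(1)] x1'(2) h(1-3) by (simp add: Hom_def)
    moreover have "x2 \<cdot> x1' \<in> Hom C t I" using x x1' by (auto simp: Hom_def)
    ultimately show ?thesis by blast
  qed

  define W where "W = Dom C m"
  define \<pi> where "\<pi> = pr1 C A P \<cdot> m"
  define \<rho>0 where "\<rho>0 = pr2 C A P \<cdot> m"
  have mH: "m \<in> Hom C W (prod_obj C A P)" using m(2) unfolding W_def .
  have \<pi>: "\<pi> \<in> Hom C W A" and \<rho>0: "\<rho>0 \<in> Hom C W P"
    unfolding \<pi>_def \<rho>0_def using mH AO PO by (auto simp: Hom_def)
  have WO: "W \<in> Obj C" using \<pi> Hom_Obj by blast
  have "sub_le C m m" using mH WO by (intro sub_leI[of "Id C W" W]) (auto simp: Hom_def)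
  then have Q0: "Q \<pi> \<rho>0" using m(3)[OF mH] unfolding \<pi>_def \<rho>0_def by blast
  obtain p q where pq: "is_pullback C \<pi> f p q"
    using lex_pullbacks[of \<pi> f] \<pi> f by (auto simp: Hom_def)
  define V where "V = Dom C p"
  have p: "p \<in> Hom C V W" and q: "q \<in> Hom C V B" using pullbackD[OF pq] \<pi> f unfolding V_def by (auto simp: Hom_def)
  \<comment> \<open>Evaluation: the element of the generic set \<open>\<rho>0\<close> over the given
    point of \<open>B\<close>, found by unique choice.\<close>
  obtain \<kappa> where \<kappa>: "\<kappa> \<in> Hom C V I" "j \<cdot> \<kappa> = \<rho>0 \<cdot> p" "di \<cdot> \<kappa> = q"
    using uc[OF Q0 \<rho>0 p q] pullbackD(9)[OF pq] by auto
  define \<epsilon> where "\<epsilon> = i \<cdot> \<kappa>"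
  have \<epsilon>: "\<epsilon> \<in> Hom C V D" unfolding \<epsilon>_def using \<kappa>(1) ty by (auto simp: Hom_def)
  have d\<epsilon>: "d \<cdot> \<epsilon> = q" unfolding \<epsilon>_def using di_k[OF \<kappa>(1)] \<kappa>(3) by simp
  have \<epsilon>_k: "\<epsilon> \<cdot> k = i \<cdot> (\<kappa> \<cdot> k)" "j \<cdot> (\<kappa> \<cdot> k) = \<rho>0 \<cdot> (p \<cdot> k)" "di \<cdot> (\<kappa> \<cdot> k) = q \<cdot> k" "\<kappa> \<cdot> k \<in> Hom C t I"
    "d \<cdot> (\<epsilon> \<cdot> k) = q \<cdot> k"
    if k: "k \<in> Hom C t V" for k t
    using whisker[OF \<kappa>(2), of k] whisker[OF \<kappa>(3), of k] whisker[OF d\<epsilon>, of k] k \<kappa>(1) ty \<rho>0 p di \<epsilon>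
    by (auto simp: Hom_def \<epsilon>_def)
  have main: "\<exists>!u. u \<in> Hom C Z W \<and> \<pi> \<cdot> u = a \<and>
       (\<forall>t \<zeta> k. \<zeta> \<in> Hom C t Z \<and> k \<in> Hom C t V \<and> p \<cdot> k = u \<cdot> \<zeta> \<longrightarrow> \<epsilon> \<cdot> k = \<phi> \<zeta> (q \<cdot> k))"
    if a: "a \<in> Hom C Z A" and fam: "is_family C f a D \<phi>"
      and sec: "\<And>t \<zeta> b. \<lbrakk>\<zeta> \<in> Hom C t Z; b \<in> Hom C t B; f \<cdot> b = a \<cdot> \<zeta>\<rbrakk> \<Longrightarrow> d \<cdot> \<phi> \<zeta> b = b"
    for a Z \<phi>
  proof -
    have ZO: "Z \<in> Obj C" using a Hom_Obj by blast
    have fam1: "\<phi> \<zeta> b \<in> Hom C t D" and fam2: "h \<in> Hom C s t \<Longrightarrow> \<phi> (\<zeta> \<cdot> h) (b \<cdot> h) = \<phi> \<zeta> b \<cdot> h"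
      if "\<zeta> \<in> Hom C t Z" "b \<in> Hom C t B" "f \<cdot> b = a \<cdot> \<zeta>" for t \<zeta> b s h
      using is_familyD[OF fam a that(1) _ that(3)] that(2) ty by auto
    obtain x y where xy: "is_pullback C a f x y"
      using lex_pullbacks[of a f] a f by (auto simp: Hom_def)
    define X where "X = Dom C x"
    have x: "x \<in> Hom C X Z" and y: "y \<in> Hom C X B" and axy: "f \<cdot> y = a \<cdot> x"
      using pullbackD[OF xy] a f unfolding X_def by (auto simp: Hom_def)
    \<comment> \<open>By Yoneda the family is its value \<open>g\<close> at the generic pair
      \<open>x\<close>, \<open>y\<close>. The span of \<open>g\<close> and \<open>x\<close> is the
      graph of the family, and it is small over \<open>Z\<close> because \<open>x\<close> is a
      pullback of \<open>f\<close>.\<close>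
    define g where "g = \<phi> x y"
    have g: "g \<in> Hom C X D" "d \<cdot> g = y" unfolding g_def using fam1 sec x y axy by auto
    have g_l: "d \<cdot> (g \<cdot> l) = y \<cdot> l" "f \<cdot> (y \<cdot> l) = a \<cdot> (x \<cdot> l)" "g \<cdot> l = \<phi> (x \<cdot> l) (y \<cdot> l)" if l: "l \<in> Hom C t X" for l t
      using whisker[OF g(2), of l] whisker[OF axy, of l] fam2[OF x y axy l] l g(1) x y a ty
      by (auto simp: Hom_def g_def)
    have char: "span_in C g x v \<zeta> \<longleftrightarrow> f \<cdot> (d \<cdot> v) = a \<cdot> \<zeta> \<and> v = \<phi> \<zeta> (d \<cdot> v)"
      if v: "v \<in> Hom C t D" and \<zeta>: "\<zeta> \<in> Hom C t Z" for v \<zeta> t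
    proof
      assume "span_in C g x v \<zeta>"
      then obtain l where "l \<in> Hom C t (Dom C g)" "g \<cdot> l = v" "x \<cdot> l = \<zeta>" using span_inE v by blast
      then have l: "l \<in> Hom C t X" "g \<cdot> l = v" "x \<cdot> l = \<zeta>" using g(1) by (auto simp: Hom_def)
      show "f \<cdot> (d \<cdot> v) = a \<cdot> \<zeta> \<and> v = \<phi> \<zeta> (d \<cdot> v)"
        using g_l[OF l(1)] l(2,3) by simp
    next
      assume h: "f \<cdot> (d \<cdot> v) = a \<cdot> \<zeta> \<and> v = \<phi> \<zeta> (d \<cdot> v)"
      have "d \<cdot> v \<in> Hom C t B" using v d by (auto simp: Hom_def)
      then obtain l where "l \<in> Hom C t (Dom C x)" "x \<cdot> l = \<zeta>" "y \<cdot> l = d \<cdot> v"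
        using pullbackE[OF xy, of \<zeta> t "d \<cdot> v"] \<zeta> h a ty by (auto simp: Hom_def)
      moreover from this have "g \<cdot> l = v" using g_l(3)[of l t] h X_def by simp
      ultimately show "span_in C g x v \<zeta>" using g(1) unfolding X_def by (intro span_inI[of l t]) (auto simp: Hom_def)
    qed
    have gxm: "joint_mono C g x"
      unfolding joint_mono_def
    proof (intro conjI allI impI)
      fix t l l' assume "l \<in> Hom C t (Dom C g) \<and> l' \<in> Hom C t (Dom C g) \<and> g \<cdot> l = g \<cdot> l' \<and> x \<cdot> l = x \<cdot> l'"
      then have l: "l \<in> Hom C t X" "l' \<in> Hom C t X" "g \<cdot> l = g \<cdot> l'" "x \<cdot> l = x \<cdot> l'"
        using g(1) by (auto simp: Hom_def)
      have "y \<cdot> l = y \<cdot> l'" using g_l(1)[OF l(1)] g_l(1)[OF l(2)] l(3) by simp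
      then show "l = l'" using pullback_ext[OF xy _ _ l(4)] l(1,2) X_def by blast
    qed (use g(1) x in \<open>auto simp: Hom_def\<close>)
    have xS: "x \<in> S" using small_pullback[OF fS xy] .
    define classifies where "classifies \<rho> \<longleftrightarrow> (\<forall>t v \<zeta>. v \<in> Hom C t D \<and> \<zeta> \<in> Hom C t Z \<longrightarrow>
      (span_in C i j v (\<rho> \<cdot> \<zeta>) \<longleftrightarrow> span_in C g x v \<zeta>))" for \<rho>
    have classifies: "classifies \<rho> \<longleftrightarrow> (\<forall>t v \<zeta>. v \<in> Hom C t D \<and> \<zeta> \<in> Hom C t Z \<longrightarrow>
      (span_in C i j v (\<rho> \<cdot> \<zeta>) \<longleftrightarrow> f \<cdot> (d \<cdot> v) = a \<cdot> \<zeta> \<and> v = \<phi> \<zeta> (d \<cdot> v)))" for \<rho>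
      unfolding classifies_def using char by blast
    have "\<exists>!\<rho>. \<rho> \<in> Hom C Z P \<and> classifies \<rho>"
      unfolding classifies_def by (rule power[OF g(1) x xS gxm])
    then obtain \<rho> where \<rho>: "\<rho> \<in> Hom C Z P" and mem0: "classifies \<rho>"
      and uniq0: "\<And>\<rho>'. \<lbrakk>\<rho>' \<in> Hom C Z P; classifies \<rho>'\<rbrakk> \<Longrightarrow> \<rho>' = \<rho>"
      by blast
    have mem: "span_in C i j v (\<rho> \<cdot> \<zeta>) \<longleftrightarrow> f \<cdot> (d \<cdot> v) = a \<cdot> \<zeta> \<and> v = \<phi> \<zeta> (d \<cdot> v)"
      if "v \<in> Hom C t D" "\<zeta> \<in> Hom C t Z" for t v \<zeta>
      using mem0 that unfolding classifies by blast
    have \<rho>_uniq: "\<rho>' = \<rho>" if "\<rho>' \<in> Hom C Z P" "\<And>t v \<zeta>. v \<in> Hom C t D \<Longrightarrow> \<zeta> \<in> Hom C t Z \<Longrightarrow>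
        span_in C i j v (\<rho>' \<cdot> \<zeta>) \<longleftrightarrow> f \<cdot> (d \<cdot> v) = a \<cdot> \<zeta> \<and> v = \<phi> \<zeta> (d \<cdot> v)" for \<rho>'
      using uniq0[OF that(1)] that(2) unfolding classifies by blast
    have memk: "f \<cdot> (di \<cdot> k) = a \<cdot> \<zeta> \<and> i \<cdot> k = \<phi> \<zeta> (di \<cdot> k)"
      if k: "k \<in> Hom C t I" "\<zeta> \<in> Hom C t Z" "j \<cdot> k = \<rho> \<cdot> \<zeta>" for k t \<zeta>
    proof -
      have "i \<cdot> k \<in> Hom C t D" using k(1) i by (auto simp: Hom_def)
      moreover have "span_in C i j (i \<cdot> k) (\<rho> \<cdot> \<zeta>)" using k ty by (intro span_inI[of k t]) auto
      ultimately show ?thesis using mem[OF _ k(2)] di_k[OF k(1)] by simp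
    qed
    have "Q a \<rho>"
      unfolding Q_def
    proof (intro conjI)
      have Dr: "Dom C \<rho> = Z" using \<rho> by (simp add: Hom_def)
      show "c1 a \<rho>" unfolding c1_def Dr using memk by blast
      show "c2 \<rho>" unfolding c2_def Dr
      proof (intro allI impI)
        fix t \<zeta> k k' assume h: "\<zeta> \<in> Hom C t Z \<and> k \<in> Hom C t I \<and> k' \<in> Hom C t I \<and>
          j \<cdot> k = \<rho> \<cdot> \<zeta> \<and> j \<cdot> k' = \<rho> \<cdot> \<zeta> \<and> di \<cdot> k = di \<cdot> k'"
        then have "i \<cdot> k = i \<cdot> k'" using memk by metis
        then show "k = k'" using joint_monoD[OF jm, of k t k'] h ty by simp
      qed
      show "c3 a \<rho>" unfolding c3_def Dr
      proof (intro allI impI)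
        fix t \<zeta> b assume h: "\<zeta> \<in> Hom C t Z \<and> b \<in> Hom C t B \<and> f \<cdot> b = a \<cdot> \<zeta>"
        then have v: "\<phi> \<zeta> b \<in> Hom C t D" "d \<cdot> \<phi> \<zeta> b = b" using fam1 sec by auto
        then have "span_in C i j (\<phi> \<zeta> b) (\<rho> \<cdot> \<zeta>)" using mem[OF v(1)] h by simp
        then obtain k where k: "k \<in> Hom C t (Dom C i)" "i \<cdot> k = \<phi> \<zeta> b" "j \<cdot> k = \<rho> \<cdot> \<zeta>"
          using span_inE v(1) by blast
        have k1: "k \<in> Hom C t I" using k(1) ty by simp
        have tO: "t \<in> Obj C" using k1 Hom_Obj by blast
        have \<rho>\<zeta>: "\<rho> \<cdot> \<zeta> \<in> Hom C t P" using \<rho> h by (auto simp: Hom_def)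
        have bp: "pairing C b (\<rho> \<cdot> \<zeta>) \<in> Hom C t (prod_obj C B P)" using pairing(1) h \<rho>\<zeta> by blast
        have "dj \<cdot> k = pairing C b (\<rho> \<cdot> \<zeta>)" using dj_k[OF k1] di_k[OF k1] k v by simp
        then show "exists_along C dj (\<lambda>k. True) (pairing C b (\<rho> \<cdot> \<zeta>))"
          by (intro exists_alongI[OF cover_Id[OF tO] Id_in_Hom[OF tO] _ _ TrueI bp])
            (use k1 dj(1) bp in \<open>auto simp: Hom_def\<close>)
      qed
    qed
    then have "sub_le C (pairing C a \<rho>) m" using m(3)[OF pairing(1)[OF a \<rho>]] pairing(2,3)[OF a \<rho>] by simp
    then obtain u where u: "u \<in> Hom C Z W" "m \<cdot> u = pairing C a \<rho>"
      using sub_leE pairing(1)[OF a \<rho>] unfolding W_def by blast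
    have \<pi>u: "\<pi> \<cdot> v = pr1 C A P \<cdot> (m \<cdot> v)" "\<rho>0 \<cdot> v = pr2 C A P \<cdot> (m \<cdot> v)" if "v \<in> Hom C t W" for v t
      unfolding \<pi>_def \<rho>0_def using that mH AO PO by (auto simp: Hom_def)
    have u': "\<pi> \<cdot> u = a" "\<rho>0 \<cdot> u = \<rho>" using \<pi>u[OF u(1)] u(2) pairing(2,3)[OF a \<rho>] by auto
    show ?thesis
    proof (rule ex1I[of _ u], intro conjI allI impI)
      fix t \<zeta> k assume h: "\<zeta> \<in> Hom C t Z \<and> k \<in> Hom C t V \<and> p \<cdot> k = u \<cdot> \<zeta>"
      then have k: "k \<in> Hom C t V" and \<zeta>: "\<zeta> \<in> Hom C t Z" by auto
      have "j \<cdot> (\<kappa> \<cdot> k) = \<rho> \<cdot> \<zeta>"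
        using \<epsilon>_k(2)[OF k] h whisker[OF u'(2), of \<zeta>] u(1) \<rho>0 by (auto simp: Hom_def)
      then show "\<epsilon> \<cdot> k = \<phi> \<zeta> (q \<cdot> k)"
        using memk[OF \<epsilon>_k(4)[OF k] \<zeta>] \<epsilon>_k(1,3)[OF k] by simp
    next
      fix v assume v0: "v \<in> Hom C Z W \<and> \<pi> \<cdot> v = a \<and>
         (\<forall>t \<zeta> k. \<zeta> \<in> Hom C t Z \<and> k \<in> Hom C t V \<and> p \<cdot> k = v \<cdot> \<zeta> \<longrightarrow> \<epsilon> \<cdot> k = \<phi> \<zeta> (q \<cdot> k))"
      then have v: "v \<in> Hom C Z W" "\<pi> \<cdot> v = a" and
        vk: "\<And>t \<zeta> k. \<lbrakk>\<zeta> \<in> Hom C t Z; k \<in> Hom C t V; p \<cdot> k = v \<cdot> \<zeta>\<rbrakk> \<Longrightarrow> \<epsilon> \<cdot> k = \<phi> \<zeta> (q \<cdot> k)"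
        by auto
      have mv: "m \<cdot> v \<in> Hom C Z (prod_obj C A P)" using mH v by (auto simp: Hom_def)
      have "sub_le C (m \<cdot> v) m" using v(1) mH W_def by (intro sub_leI[of v Z]) (auto simp: Hom_def)
      then have Qv: "Q a (\<rho>0 \<cdot> v)" using m(3)[OF mv] \<pi>u[OF v(1)] v(2) by simp
      have \<rho>v: "\<rho>0 \<cdot> v \<in> Hom C Z P" using \<rho>0 v by (auto simp: Hom_def)
      have \<rho>vD: "Dom C (\<rho>0 \<cdot> v) = Z" using \<rho>v by (simp add: Hom_def)
      have \<rho>v\<zeta>: "\<rho>0 \<cdot> v \<cdot> \<zeta> = \<rho>0 \<cdot> (v \<cdot> \<zeta>)" if "\<zeta> \<in> Hom C t Z" for \<zeta> t
        using that \<rho>0 v(1) by (simp add: Hom_def)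
      have lift: "\<exists>k. k \<in> Hom C t V \<and> p \<cdot> k = v \<cdot> \<zeta> \<and> q \<cdot> k = b"
        if h: "\<zeta> \<in> Hom C t Z" "b \<in> Hom C t B" "f \<cdot> b = a \<cdot> \<zeta>" for \<zeta> t b
      proof -
        have "v \<cdot> \<zeta> \<in> Hom C t W" using v(1) h by (auto simp: Hom_def)
        moreover have "\<pi> \<cdot> (v \<cdot> \<zeta>) = f \<cdot> b"
          using whisker[OF v(2), of \<zeta>] v(1) h \<pi> by (auto simp: Hom_def)
        moreover have "Dom C \<pi> = W" using \<pi> by (simp add: Hom_def)
        ultimately show ?thesis
          using pullbackE[OF pq, of "v \<cdot> \<zeta>" t b] h(2) ty(11) unfolding V_def by metis
      qed
      \<comment> \<open>A second solution \<open>v\<close> has the same values, so its set has the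
        same elements as the graph; the uniqueness clause of the power class then identifies the
        codes.\<close>
      have "\<rho>0 \<cdot> v = \<rho>"
      proof (rule \<rho>_uniq[OF \<rho>v])
        fix t y \<zeta> assume y: "y \<in> Hom C t D" and \<zeta>: "\<zeta> \<in> Hom C t Z"
        have dy: "d \<cdot> y \<in> Hom C t B" using y d by (auto simp: Hom_def)
        show "span_in C i j y (\<rho>0 \<cdot> v \<cdot> \<zeta>) \<longleftrightarrow> f \<cdot> (d \<cdot> y) = a \<cdot> \<zeta> \<and> y = \<phi> \<zeta> (d \<cdot> y)"
        proof
          assume "span_in C i j y (\<rho>0 \<cdot> v \<cdot> \<zeta>)"
          then obtain k where "k \<in> Hom C t (Dom C i)" "i \<cdot> k = y" "j \<cdot> k = \<rho>0 \<cdot> v \<cdot> \<zeta>"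
            using span_inE y by blast
          then have k: "k \<in> Hom C t I" "i \<cdot> k = y" "j \<cdot> k = \<rho>0 \<cdot> v \<cdot> \<zeta>" using ty by auto
          have dk: "di \<cdot> k = d \<cdot> y" using di_k[OF k(1)] k(2) by simp
          have 1: "f \<cdot> (d \<cdot> y) = a \<cdot> \<zeta>" using Qv k \<zeta> unfolding Q_def c1_def \<rho>vD dk[symmetric] by blast
          obtain k0 where k0: "k0 \<in> Hom C t V" "p \<cdot> k0 = v \<cdot> \<zeta>" "q \<cdot> k0 = d \<cdot> y"
            using lift[OF \<zeta> dy 1] by blast
          have "j \<cdot> (\<kappa> \<cdot> k0) = \<rho>0 \<cdot> v \<cdot> \<zeta>" using \<epsilon>_k(2)[OF k0(1)] k0(2) \<rho>v\<zeta>[OF \<zeta>] by simp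
          moreover have "di \<cdot> (\<kappa> \<cdot> k0) = di \<cdot> k" using \<epsilon>_k(3)[OF k0(1)] k0(3) dk by simp
          ultimately have "\<kappa> \<cdot> k0 = k"
            using Qv \<epsilon>_k(4)[OF k0(1)] k(1,3) \<zeta> unfolding Q_def c2_def \<rho>vD by metis
          then have "\<epsilon> \<cdot> k0 = y" using \<epsilon>_k(1)[OF k0(1)] k(2) by simp
          then show "f \<cdot> (d \<cdot> y) = a \<cdot> \<zeta> \<and> y = \<phi> \<zeta> (d \<cdot> y)" using 1 vk[OF \<zeta> k0(1,2)] k0(3) by simp
        next
          assume h: "f \<cdot> (d \<cdot> y) = a \<cdot> \<zeta> \<and> y = \<phi> \<zeta> (d \<cdot> y)"
          then obtain k0 where k0: "k0 \<in> Hom C t V" "p \<cdot> k0 = v \<cdot> \<zeta>" "q \<cdot> k0 = d \<cdot> y"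
            using lift[OF \<zeta> dy] by blast
          have "i \<cdot> (\<kappa> \<cdot> k0) = y" using vk[OF \<zeta> k0(1,2)] k0(3) h \<epsilon>_k(1)[OF k0(1)] by simp
          moreover have "j \<cdot> (\<kappa> \<cdot> k0) = \<rho>0 \<cdot> v \<cdot> \<zeta>" using \<epsilon>_k(2)[OF k0(1)] k0(2) \<rho>v\<zeta>[OF \<zeta>] by simp
          ultimately show "span_in C i j y (\<rho>0 \<cdot> v \<cdot> \<zeta>)"
            using \<epsilon>_k(4)[OF k0(1)] ty by (intro span_inI[of "\<kappa> \<cdot> k0" t]) auto
        qed
      qed
      then have "m \<cdot> v = m \<cdot> u"
        using \<pi>u[OF v(1)] v(2) pairing_eta[OF AO PO mv] u(2) by simp
      then show "v = u" using monoD[OF m(1), of v u Z] v(1) u(1) W_def by simp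
    qed (use u u' in auto)
  qed
  have "is_Pi C f d \<pi> p q \<epsilon>"
    unfolding is_Pi_def
  proof (intro conjI allI impI)
    fix a \<phi> assume h: "a \<in> Arr C \<and> Cod C a = Cod C f \<and> is_family C f a (Dom C d) \<phi> \<and>
        (\<forall>t \<zeta> b. \<zeta> \<in> Hom C t (Dom C a) \<and> b \<in> Hom C t (Dom C f) \<and> f \<cdot> b = a \<cdot> \<zeta> \<longrightarrow> d \<cdot> \<phi> \<zeta> b = b)"
    have "Dom C \<pi> = W" using \<pi> by (simp add: Hom_def)
    then show "\<exists>!u. u \<in> Hom C (Dom C a) (Dom C \<pi>) \<and> \<pi> \<cdot> u = a \<and>
           (\<forall>t \<zeta> k. \<zeta> \<in> Hom C t (Dom C a) \<and> k \<in> Hom C t (Dom C p) \<and> p \<cdot> k = u \<cdot> \<zeta> \<longrightarrow>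
              \<epsilon> \<cdot> k = \<phi> \<zeta> (q \<cdot> k))"
      using main[of a "Dom C a" \<phi>] h ty unfolding V_def by (simp add: Hom_def)
  qed (use pq dA dc \<epsilon> d\<epsilon> V_def D_def in auto)
  then show ?thesis by blast
qed

end

section \<open>Elements of polynomial functors\<close>

definition pb_lift :: "('o, 'm) cat \<Rightarrow> 'm \<Rightarrow> 'm \<Rightarrow> 'm \<Rightarrow> 'm \<Rightarrow> 'm" where
  "pb_lift C p q u v = (THE k. k \<in> Hom C (Dom C u) (Dom C p) \<and> p \<cdot>\<^bsub>C\<^esub> k = u \<and> q \<cdot>\<^bsub>C\<^esub> k = v)"

text \<open>\<open>ev\<close> exhibits \<open>Dom \<pi>\<close> as \<open>P\<^sub>f W\<close>: its elements over \<open>a\<close> are the families \<open>B\<^sub>a \<rightarrow> W\<close>.\<close>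

definition is_poly_obj :: "('o, 'm) cat \<Rightarrow> 'm \<Rightarrow> 'o \<Rightarrow> 'm \<Rightarrow> 'm \<Rightarrow> 'm \<Rightarrow> 'm \<Rightarrow> bool" where
  "is_poly_obj C f W \<pi> p q ev \<longleftrightarrow> is_pullback C \<pi> f p q \<and> ev \<in> Hom C (Dom C p) W \<and>
     (\<forall>a \<phi>. a \<in> Arr C \<and> Cod C a = Cod C f \<and> is_family C f a W \<phi> \<longrightarrow>
        (\<exists>!u. u \<in> Hom C (Dom C a) (Dom C \<pi>) \<and> \<pi> \<cdot>\<^bsub>C\<^esub> u = a \<and>
           (\<forall>t \<zeta> k. \<zeta> \<in> Hom C t (Dom C a) \<and> k \<in> Hom C t (Dom C p) \<and> p \<cdot>\<^bsub>C\<^esub> k = u \<cdot>\<^bsub>C\<^esub> \<zeta> \<longrightarrow>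
              ev \<cdot>\<^bsub>C\<^esub> k = \<phi> \<zeta> (q \<cdot>\<^bsub>C\<^esub> k))))"

text \<open>For an element \<open>u\<close> of the polynomial object and \<open>b\<close> in the
  fibre over its shape, this is the value of the family \<open>u\<close> at
  \<open>b\<close>.\<close>

definition papp :: "('o, 'm) cat \<Rightarrow> 'm \<Rightarrow> 'm \<Rightarrow> 'm \<Rightarrow> 'm \<Rightarrow> 'm \<Rightarrow> 'm" where
  "papp C p q ev u b = ev \<cdot>\<^bsub>C\<^esub> pb_lift C p q u b"

context category
begin

lemma pb_lift:
  assumes "is_pullback C f g p q" "u \<in> Hom C z (Dom C f)" "v \<in> Hom C z (Dom C g)" "f \<cdot> u = g \<cdot> v"
  shows "pb_lift C p q u v \<in> Hom C z (Dom C p)" "p \<cdot> pb_lift C p q u v = u" "q \<cdot> pb_lift C p q u v = v"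
proof -
  have "Dom C u = z" using assms(2) by (simp add: Hom_def)
  then show "pb_lift C p q u v \<in> Hom C z (Dom C p)" "p \<cdot> pb_lift C p q u v = u"
    "q \<cdot> pb_lift C p q u v = v"
    using theI'[OF pullback_ex1[OF assms]] unfolding pb_lift_def by auto
qed

lemma pb_lift_eq:
  assumes "is_pullback C f g p q" "k \<in> Hom C z (Dom C p)" "p \<cdot> k = u" "q \<cdot> k = v"
  shows "pb_lift C p q u v = k"
proof -
  note P = pullbackD[OF assms(1)]
  have ty: "u \<in> Hom C z (Dom C f)" "v \<in> Hom C z (Dom C g)"
    using assms(2) P(4-8) unfolding assms(3,4)[symmetric] by (auto simp: Hom_def)
  have "f \<cdot> u = g \<cdot> v"
    using whisker[OF P(9), of k] assms(2) P(1-8) unfolding assms(3,4)[symmetric] by (simp add: Hom_def)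
  note l = pb_lift[OF assms(1) ty this]
  show ?thesis using pullback_ext[OF assms(1) l(1) assms(2)] l(2,3) assms(3,4) by simp
qed

lemma pb_lift_comp:
  assumes "is_pullback C f g p q" "u \<in> Hom C z (Dom C f)" "v \<in> Hom C z (Dom C g)" "f \<cdot> u = g \<cdot> v"
    "h \<in> Hom C t z"
  shows "pb_lift C p q (u \<cdot> h) (v \<cdot> h) = pb_lift C p q u v \<cdot> h"
proof -
  note P = pullbackD[OF assms(1)] and l = pb_lift[OF assms(1-4)]
  show ?thesis
  proof (rule pb_lift_eq[OF assms(1)])
    show "pb_lift C p q u v \<cdot> h \<in> Hom C t (Dom C p)" using l(1) assms(5) by (auto simp: Hom_def)
    show "p \<cdot> (pb_lift C p q u v \<cdot> h) = u \<cdot> h" "q \<cdot> (pb_lift C p q u v \<cdot> h) = v \<cdot> h"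
      using whisker[OF l(2), of h] whisker[OF l(3), of h] l(1) assms(5) P(4-8) by (auto simp: Hom_def)
  qed
qed

text \<open>Yoneda: a natural family is determined by its value at the generic pair
  \<open>p'\<close>, \<open>q'\<close>, since every other pair is a reindexing of it.\<close>

lemma family_pullback_iff:
  assumes pq: "is_pullback C \<pi> f p q" and pq': "is_pullback C a f p' q'"
    and fam: "is_family C f a Y \<phi>"
    and u: "u \<in> Hom C (Dom C a) (Dom C \<pi>)" "\<pi> \<cdot> u = a"
    and ku: "ku \<in> Hom C (Dom C p') (Dom C p)" "p \<cdot> ku = u \<cdot> p'" "q \<cdot> ku = q'"
    and \<epsilon>: "\<epsilon> \<in> Hom C (Dom C p) Y"
  shows "(\<forall>t \<zeta> k. \<zeta> \<in> Hom C t (Dom C a) \<and> k \<in> Hom C t (Dom C p) \<and> p \<cdot> k = u \<cdot> \<zeta> \<longrightarrow>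
      \<epsilon> \<cdot> k = \<phi> \<zeta> (q \<cdot> k)) \<longleftrightarrow> \<epsilon> \<cdot> ku = \<phi> p' q'" (is "?L \<longleftrightarrow> ?R")
proof
  note P = pullbackD[OF pq] and P' = pullbackD[OF pq']
  assume ?L
  moreover have "p' \<in> Hom C (Dom C p') (Dom C a)" using P' by (simp add: Hom_def)
  ultimately have "\<epsilon> \<cdot> ku = \<phi> p' (q \<cdot> ku)" using ku(1,2) by blast
  then show ?R using ku(3) by simp
next
  note P = pullbackD[OF pq] and P' = pullbackD[OF pq']
  assume R: ?R
  show ?L
  proof (intro allI impI)
    fix t \<zeta> k assume h: "\<zeta> \<in> Hom C t (Dom C a) \<and> k \<in> Hom C t (Dom C p) \<and> p \<cdot> k = u \<cdot> \<zeta>"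
    have qk: "q \<cdot> k \<in> Hom C t (Dom C f)" using h P(4-8) by (auto simp: Hom_def)
    have "\<pi> \<cdot> (p \<cdot> k) = f \<cdot> (q \<cdot> k)" using whisker[OF P(9), of k] h P(1-8) by (auto simp: Hom_def)
    moreover have "\<pi> \<cdot> (u \<cdot> \<zeta>) = a \<cdot> \<zeta>"
      using whisker[OF u(2), of \<zeta>] h u(1) P(1) by (auto simp: Hom_def)
    ultimately have e: "a \<cdot> \<zeta> = f \<cdot> (q \<cdot> k)" using h by simp
    obtain l where l: "l \<in> Hom C t (Dom C p')" "p' \<cdot> l = \<zeta>" "q' \<cdot> l = q \<cdot> k"
      using pullbackE[OF pq' _ qk e] h by blast
    have kl: "ku \<cdot> l \<in> Hom C t (Dom C p)" using l(1) ku(1) by (auto simp: Hom_def)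
    have "p \<cdot> (ku \<cdot> l) = u \<cdot> (p' \<cdot> l)"
      using whisker[OF ku(2), of l] ku(1) l(1) u(1) P(4-7) P'(4-7) by (simp add: Hom_def)
    then have 1: "p \<cdot> (ku \<cdot> l) = p \<cdot> k" using l(2) h by simp
    have "q \<cdot> (ku \<cdot> l) = q \<cdot> k"
      using whisker[OF ku(3), of l] ku(1) l(1,3) P(4-7) P'(4-7) by (simp add: Hom_def)
    then have kk: "ku \<cdot> l = k" using pullback_ext[OF pq kl _ 1] h by blast
    have "\<epsilon> \<cdot> (ku \<cdot> l) = \<phi> p' q' \<cdot> l"
      using whisker[OF R, of l] \<epsilon> ku(1) l(1) by (simp add: Hom_def)
    also have "\<dots> = \<phi> (p' \<cdot> l) (q' \<cdot> l)"
      using is_familyD(2)[OF fam, of "Dom C a" "Cod C a" p' "Dom C p'" q' l t] P' l(1)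
      by (simp add: Hom_def)
    finally show "\<epsilon> \<cdot> k = \<phi> \<zeta> (q \<cdot> k)" using kk l(2,3) by simp
  qed
qed

lemma poly_objD:
  assumes "is_poly_obj C f W \<pi> p q ev"
  shows "is_pullback C \<pi> f p q" "ev \<in> Hom C (Dom C p) W" "\<pi> \<in> Hom C (Dom C \<pi>) (Cod C f)" "f \<in> Arr C"
  using assms pullbackD[of \<pi> f p q] unfolding is_poly_obj_def by (auto simp: Hom_def)

lemma papp_Hom:
  assumes "is_poly_obj C f W \<pi> p q ev" "u \<in> Hom C z (Dom C \<pi>)" "b \<in> Hom C z (Dom C f)" "f \<cdot> b = \<pi> \<cdot> u"
  shows "papp C p q ev u b \<in> Hom C z W"
  using pb_lift(1)[OF poly_objD(1)[OF assms(1)] assms(2,3) assms(4)[symmetric]] poly_objD(2)[OF assms(1)]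
  unfolding papp_def by (auto simp: Hom_def)

lemma papp_comp:
  assumes "is_poly_obj C f W \<pi> p q ev" "u \<in> Hom C z (Dom C \<pi>)" "b \<in> Hom C z (Dom C f)" "f \<cdot> b = \<pi> \<cdot> u"
    "h \<in> Hom C t z"
  shows "papp C p q ev (u \<cdot> h) (b \<cdot> h) = papp C p q ev u b \<cdot> h"
  using pb_lift(1)[OF poly_objD(1)[OF assms(1)] assms(2,3) assms(4)[symmetric]]
    pb_lift_comp[OF poly_objD(1)[OF assms(1)] assms(2,3) assms(4)[symmetric] assms(5)]
    poly_objD(2)[OF assms(1)] assms(5)
  unfolding papp_def by (auto simp: Hom_def)

text \<open>Elements \<open>k\<close> of the pullback and compatible pairs of
  \<open>u \<cdot> \<zeta>\<close> and \<open>b\<close> are the same data, so the universal property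
  can be read without mentioning the pullback.\<close>

lemma poly_obj_condition_iff:
  assumes P: "is_poly_obj C f W \<pi> p q ev" and u: "u \<in> Hom C z (Dom C \<pi>)"
  shows "(\<forall>t \<zeta> k. \<zeta> \<in> Hom C t z \<and> k \<in> Hom C t (Dom C p) \<and> p \<cdot> k = u \<cdot> \<zeta> \<longrightarrow>
      ev \<cdot> k = \<phi> \<zeta> (q \<cdot> k)) \<longleftrightarrow>
    (\<forall>t \<zeta> b. \<zeta> \<in> Hom C t z \<and> b \<in> Hom C t (Dom C f) \<and> f \<cdot> b = \<pi> \<cdot> (u \<cdot> \<zeta>) \<longrightarrow>
      papp C p q ev (u \<cdot> \<zeta>) b = \<phi> \<zeta> b)" (is "?L \<longleftrightarrow> ?R")
proof
  note pq = poly_objD(1)[OF P]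
  assume L: ?L
  show ?R
  proof (intro allI impI)
    fix t \<zeta> b assume h: "\<zeta> \<in> Hom C t z \<and> b \<in> Hom C t (Dom C f) \<and> f \<cdot> b = \<pi> \<cdot> (u \<cdot> \<zeta>)"
    have "u \<cdot> \<zeta> \<in> Hom C t (Dom C \<pi>)" using u h by (auto simp: Hom_def)
    note l = pb_lift[OF pq this, of b]
    show "papp C p q ev (u \<cdot> \<zeta>) b = \<phi> \<zeta> b" unfolding papp_def using L l h by metis
  qed
next
  note pq = poly_objD(1)[OF P]
  note PB = pullbackD[OF pq]
  assume R: ?R
  show ?L
  proof (intro allI impI)
    fix t \<zeta> k assume h: "\<zeta> \<in> Hom C t z \<and> k \<in> Hom C t (Dom C p) \<and> p \<cdot> k = u \<cdot> \<zeta>"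
    have qk: "q \<cdot> k \<in> Hom C t (Dom C f)" using h PB(4-8) by (auto simp: Hom_def)
    have "f \<cdot> (q \<cdot> k) = \<pi> \<cdot> (p \<cdot> k)" using whisker[OF PB(9), of k] h PB(1-8) by (auto simp: Hom_def)
    then have e: "f \<cdot> (q \<cdot> k) = \<pi> \<cdot> (u \<cdot> \<zeta>)" using h by simp
    have "pb_lift C p q (u \<cdot> \<zeta>) (q \<cdot> k) = k" using pb_lift_eq[OF pq] h by blast
    then show "ev \<cdot> k = \<phi> \<zeta> (q \<cdot> k)" using R h qk e unfolding papp_def by metis
  qed
qed

text \<open>The universal property in the form used later: an element of the polynomial object is a
  shape \<open>a\<close> together with a natural family of values.\<close>

lemma poly_obj_ex1:
  assumes P: "is_poly_obj C f W \<pi> p q ev" and a: "a \<in> Hom C z (Cod C f)" and fam: "is_family C f a W \<phi>"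
  shows "\<exists>!u. u \<in> Hom C z (Dom C \<pi>) \<and> \<pi> \<cdot> u = a \<and>
    (\<forall>t \<zeta> b. \<zeta> \<in> Hom C t z \<and> b \<in> Hom C t (Dom C f) \<and> f \<cdot> b = a \<cdot> \<zeta> \<longrightarrow>
      papp C p q ev (u \<cdot> \<zeta>) b = \<phi> \<zeta> b)"
proof -
  have z: "Dom C a = z" "a \<in> Arr C \<and> Cod C a = Cod C f" using a by (auto simp: Hom_def)
  have ex: "\<exists>!u. u \<in> Hom C z (Dom C \<pi>) \<and> \<pi> \<cdot> u = a \<and>
           (\<forall>t \<zeta> k. \<zeta> \<in> Hom C t z \<and> k \<in> Hom C t (Dom C p) \<and> p \<cdot> k = u \<cdot> \<zeta> \<longrightarrow>
              ev \<cdot> k = \<phi> \<zeta> (q \<cdot> k))"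
    using P z fam unfolding is_poly_obj_def by blast
  have "(u \<in> Hom C z (Dom C \<pi>) \<and> \<pi> \<cdot> u = a \<and>
      (\<forall>t \<zeta> k. \<zeta> \<in> Hom C t z \<and> k \<in> Hom C t (Dom C p) \<and> p \<cdot> k = u \<cdot> \<zeta> \<longrightarrow> ev \<cdot> k = \<phi> \<zeta> (q \<cdot> k)))
    = (u \<in> Hom C z (Dom C \<pi>) \<and> \<pi> \<cdot> u = a \<and>
      (\<forall>t \<zeta> b. \<zeta> \<in> Hom C t z \<and> b \<in> Hom C t (Dom C f) \<and> f \<cdot> b = a \<cdot> \<zeta> \<longrightarrow>
        papp C p q ev (u \<cdot> \<zeta>) b = \<phi> \<zeta> b))" for u
  proof (intro conj_cong refl)
    assume u: "u \<in> Hom C z (Dom C \<pi>)" "\<pi> \<cdot> u = a"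
    have "\<pi> \<cdot> (u \<cdot> \<zeta>) = a \<cdot> \<zeta>" if "\<zeta> \<in> Hom C t z" for t \<zeta>
      using whisker[OF u(2), of \<zeta>] that u(1) poly_objD(3)[OF P] by (auto simp: Hom_def)
    then show "(\<forall>t \<zeta> k. \<zeta> \<in> Hom C t z \<and> k \<in> Hom C t (Dom C p) \<and> p \<cdot> k = u \<cdot> \<zeta> \<longrightarrow> ev \<cdot> k = \<phi> \<zeta> (q \<cdot> k)) =
      (\<forall>t \<zeta> b. \<zeta> \<in> Hom C t z \<and> b \<in> Hom C t (Dom C f) \<and> f \<cdot> b = a \<cdot> \<zeta> \<longrightarrow>
        papp C p q ev (u \<cdot> \<zeta>) b = \<phi> \<zeta> b)"
      unfolding poly_obj_condition_iff[OF P u(1)] by metis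
  qed
  then show ?thesis using ex by simp
qed

lemma poly_obj_family:
  assumes P: "is_poly_obj C f W \<pi> p q ev" and u: "u \<in> Hom C z (Dom C \<pi>)"
  shows "is_family C f (\<pi> \<cdot> u) W (\<lambda>\<zeta> b. papp C p q ev (u \<cdot> \<zeta>) b)"
  unfolding is_family_def
proof (intro allI impI)
  note P3 = poly_objD(3)[OF P]
  fix t \<zeta> b assume h: "\<zeta> \<in> Hom C t (Dom C (\<pi> \<cdot> u)) \<and> b \<in> Hom C t (Dom C f) \<and> f \<cdot> b = \<pi> \<cdot> u \<cdot> \<zeta>"
  then have \<zeta>: "\<zeta> \<in> Hom C t z" using u P3 by (auto simp: Hom_def)
  have u\<zeta>: "u \<cdot> \<zeta> \<in> Hom C t (Dom C \<pi>)" using u \<zeta> by (auto simp: Hom_def)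
  have "\<pi> \<cdot> u \<cdot> \<zeta> = \<pi> \<cdot> (u \<cdot> \<zeta>)" using \<zeta> u P3 by (simp add: Hom_def)
  then have e: "f \<cdot> b = \<pi> \<cdot> (u \<cdot> \<zeta>)" using h by simp
  have "papp C p q ev (u \<cdot> (\<zeta> \<cdot> h)) (b \<cdot> h) = papp C p q ev (u \<cdot> \<zeta>) b \<cdot> h" if "h \<in> Hom C s t" for h s
    using papp_comp[OF P u\<zeta> conjunct1[OF conjunct2[OF h]] e that] that \<zeta> u by (simp add: Hom_def)
  then show "papp C p q ev (u \<cdot> \<zeta>) b \<in> Hom C t W \<and>
      (\<forall>s. \<forall>h\<in>Hom C s t. papp C p q ev (u \<cdot> (\<zeta> \<cdot> h)) (b \<cdot> h) = papp C p q ev (u \<cdot> \<zeta>) b \<cdot> h)"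
    using papp_Hom[OF P u\<zeta> _ e] h by blast
qed

text \<open>Extensionality comes from uniqueness: both elements solve the universal property for the
  family of values of \<open>u\<close>.\<close>

lemma poly_obj_ext:
  assumes P: "is_poly_obj C f W \<pi> p q ev" and u: "u \<in> Hom C z (Dom C \<pi>)" "u' \<in> Hom C z (Dom C \<pi>)"
    and e: "\<pi> \<cdot> u = \<pi> \<cdot> u'"
    and a: "\<And>t \<zeta> b. \<lbrakk>\<zeta> \<in> Hom C t z; b \<in> Hom C t (Dom C f); f \<cdot> b = \<pi> \<cdot> (u \<cdot> \<zeta>)\<rbrakk>
      \<Longrightarrow> papp C p q ev (u \<cdot> \<zeta>) b = papp C p q ev (u' \<cdot> \<zeta>) b"
  shows "u = u'"
proof -
  note P3 = poly_objD(3)[OF P]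
  have pu: "\<pi> \<cdot> u \<in> Hom C z (Cod C f)" using u P3 by (auto simp: Hom_def)
  have "\<pi> \<cdot> u \<cdot> \<zeta> = \<pi> \<cdot> (u \<cdot> \<zeta>)" if "\<zeta> \<in> Hom C t z" for t \<zeta> using that u P3 by (simp add: Hom_def)
  then have "\<forall>t \<zeta> b. \<zeta> \<in> Hom C t z \<and> b \<in> Hom C t (Dom C f) \<and> f \<cdot> b = \<pi> \<cdot> u \<cdot> \<zeta> \<longrightarrow>
    papp C p q ev (u' \<cdot> \<zeta>) b = papp C p q ev (u \<cdot> \<zeta>) b" using a by metis
  define \<Phi> where "\<Phi> v \<longleftrightarrow> v \<in> Hom C z (Dom C \<pi>) \<and> \<pi> \<cdot> v = \<pi> \<cdot> u \<and>
    (\<forall>t \<zeta> b. \<zeta> \<in> Hom C t z \<and> b \<in> Hom C t (Dom C f) \<and> f \<cdot> b = \<pi> \<cdot> u \<cdot> \<zeta> \<longrightarrow>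
      papp C p q ev (v \<cdot> \<zeta>) b = papp C p q ev (u \<cdot> \<zeta>) b)" for v
  have "\<exists>!v. \<Phi> v" unfolding \<Phi>_def by (rule poly_obj_ex1[OF P pu poly_obj_family[OF P u(1)]])
  moreover have "\<Phi> u" unfolding \<Phi>_def using u(1) by blast
  moreover have "\<Phi> u'"
    using \<open>\<forall>t \<zeta> b. _\<close> u(2) e unfolding \<Phi>_def by simp
  ultimately show ?thesis by blast
qed

end

section \<open>Chosen adjoints and the universal property on elements\<close>

context lex_cat
begin

lemma chosen_pullback:
  assumes "f \<in> Arr C" "g \<in> Arr C" "Cod C f = Cod C g"
  shows "is_pullback C f g (fst (chosen_pullback C f g)) (snd (chosen_pullback C f g))"
proof -
  have "\<exists>x. (\<lambda>(p, q). is_pullback C f g p q) x" using lex_pullbacks[OF assms] by auto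
  then have "(\<lambda>(p, q). is_pullback C f g p q) (chosen_pullback C f g)"
    unfolding chosen_pullback_def by (rule someI_ex)
  then show ?thesis by (simp add: case_prod_beta)
qed

lemma slice_Hom_iff:
  "x \<in> Hom (slice C X) a b \<longleftrightarrow> (\<exists>h. x = (a, h, b) \<and> a \<in> Arr C \<and> Cod C a = X \<and>
      b \<in> Arr C \<and> Cod C b = X \<and> h \<in> Hom C (Dom C a) (Dom C b) \<and> b \<cdot> h = a)"
  by (cases x) (auto simp: slice_def Hom_def)

lemma slice_Hom_triple:
  "(a, h, b) \<in> Hom (slice C X) a' b' \<longleftrightarrow> a = a' \<and> b = b' \<and> a \<in> Arr C \<and> Cod C a = X \<and>
      b \<in> Arr C \<and> Cod C b = X \<and> h \<in> Hom C (Dom C a) (Dom C b) \<and> b \<cdot> h = a"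
  unfolding slice_Hom_iff by blast

lemma slice_simps [simp]:
  "Dom (slice C X) (a, h, b) = a" "Cod (slice C X) (a, h, b) = b"
  "a \<in> Obj (slice C X) \<longleftrightarrow> a \<in> Arr C \<and> Cod C a = X"
  "(b', k, c) \<cdot>\<^bsub>slice C X\<^esub> (a, h, b) = (a, k \<cdot> h, c)"
  "Id (slice C X) a = (a, Id C (Dom C a), a)"
  by (auto simp: slice_def)

lemma pullback_fctr_arr:
  assumes g: "g \<in> Hom C a c" and g': "g' \<in> Hom C a' c" and f: "f \<in> Hom C b c"
    and h: "h \<in> Hom C a a'" "g' \<cdot> h = g"
    and pq: "chosen_pullback C g f = (p, q)" and pq': "chosen_pullback C g' f = (p', q')"
  obtains k where "on_arr (pullback_fctr C f) (g, h, g') = (q, k, q')"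
    "k \<in> Hom C (Dom C p) (Dom C p')" "p' \<cdot> k = h \<cdot> p" "q' \<cdot> k = q"
proof -
  have P: "is_pullback C g f p q" "is_pullback C g' f p' q'"
    using chosen_pullback[of g f] chosen_pullback[of g' f] g g' f pq pq' by (auto simp: Hom_def)
  note D = pullbackD[OF P(1)] and D' = pullbackD[OF P(2)]
  have ty: "h \<cdot> p \<in> Hom C (Dom C p) (Dom C g')" "q \<in> Hom C (Dom C p) (Dom C f)"
    using D(4-8) g g' h(1) by (auto simp: Hom_def)
  have "g' \<cdot> (h \<cdot> p) = f \<cdot> q"
    using whisker[OF h(2), of p] D g g' h(1) by (auto simp: Hom_def)
  note ex = theI'[OF pullback_ex1[OF P(2) ty this]]
  show thesis
    by (rule that[OF _ ex[THEN conjunct1] ex[THEN conjunct2, THEN conjunct1] ex[THEN conjunct2, THEN conjunct2]])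
      (simp add: pullback_fctr_def pq pq')
qed

text \<open>Existence of dependent products provides some pullback, while the functor is defined
  with the chosen one; the mediating map \<open>w\<close> between the two transports the
  evaluation.\<close>

lemma is_Pi_change_pullback:
  assumes Pi: "is_Pi C f d \<pi> p q \<epsilon>" and pq': "is_pullback C \<pi> f p' q'"
  obtains \<epsilon>' where "is_Pi C f d \<pi> p' q' \<epsilon>'"
proof -
  have pq: "is_pullback C \<pi> f p q" and d: "d \<in> Arr C" "Cod C d = Dom C f"
    and \<epsilon>: "\<epsilon> \<in> Hom C (Dom C p) (Dom C d)" "d \<cdot> \<epsilon> = q"
    using Pi unfolding is_Pi_def by blast+
  note P = pullbackD[OF pq] and P' = pullbackD[OF pq']
  have ty: "p' \<in> Hom C (Dom C p') (Dom C \<pi>)" "q' \<in> Hom C (Dom C p') (Dom C f)"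
    "p \<in> Hom C (Dom C p) (Dom C \<pi>)" "q \<in> Hom C (Dom C p) (Dom C f)"
    using P P' by (auto simp: Hom_def)
  obtain w where w: "w \<in> Hom C (Dom C p') (Dom C p)" "p \<cdot> w = p'" "q \<cdot> w = q'"
    using pullbackE[OF pq ty(1,2) P'(9)] by blast
  obtain v where v: "v \<in> Hom C (Dom C p) (Dom C p')" "p' \<cdot> v = p" "q' \<cdot> v = q"
    using pullbackE[OF pq' ty(3,4) P(9)] by blast
  have wk: "w \<cdot> k \<in> Hom C t (Dom C p)" "p \<cdot> (w \<cdot> k) = p' \<cdot> k" "q \<cdot> (w \<cdot> k) = q' \<cdot> k"
    if "k \<in> Hom C t (Dom C p')" for k t
    using whisker[OF w(2), of k] whisker[OF w(3), of k] w(1) that ty by (auto simp: Hom_def)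
  have vk: "v \<cdot> k \<in> Hom C t (Dom C p')" "p' \<cdot> (v \<cdot> k) = p \<cdot> k" "q' \<cdot> (v \<cdot> k) = q \<cdot> k"
    if "k \<in> Hom C t (Dom C p)" for k t
    using whisker[OF v(2), of k] whisker[OF v(3), of k] v(1) that ty by (auto simp: Hom_def)
  have wvk: "w \<cdot> (v \<cdot> k) = k" if "k \<in> Hom C t (Dom C p)" for k t
    using pullback_ext[OF pq wk(1)[OF vk(1)[OF that]] that] wk(2,3)[OF vk(1)[OF that]] vk(2,3)[OF that]
    by simp
  have \<epsilon>w: "\<epsilon> \<cdot> w \<cdot> k = \<epsilon> \<cdot> (w \<cdot> k)" if "k \<in> Hom C t (Dom C p')" for k t
    using that w(1) \<epsilon>(1) by (simp add: Hom_def)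
  have cond: "(\<forall>t \<zeta> k. \<zeta> \<in> Hom C t z \<and> k \<in> Hom C t (Dom C p') \<and> p' \<cdot> k = u \<cdot> \<zeta> \<longrightarrow>
        \<epsilon> \<cdot> w \<cdot> k = \<phi> \<zeta> (q' \<cdot> k)) \<longleftrightarrow>
      (\<forall>t \<zeta> k. \<zeta> \<in> Hom C t z \<and> k \<in> Hom C t (Dom C p) \<and> p \<cdot> k = u \<cdot> \<zeta> \<longrightarrow>
        \<epsilon> \<cdot> k = \<phi> \<zeta> (q \<cdot> k))" (is "?L \<longleftrightarrow> ?R") for z u \<phi>
  proof
    assume L: ?L
    show ?R
    proof (intro allI impI)
      fix t \<zeta> k assume h: "\<zeta> \<in> Hom C t z \<and> k \<in> Hom C t (Dom C p) \<and> p \<cdot> k = u \<cdot> \<zeta>"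
      then have "\<epsilon> \<cdot> w \<cdot> (v \<cdot> k) = \<phi> \<zeta> (q' \<cdot> (v \<cdot> k))" using L vk by metis
      then show "\<epsilon> \<cdot> k = \<phi> \<zeta> (q \<cdot> k)" using \<epsilon>w vk wvk h by metis
    qed
  next
    assume R: ?R
    show ?L
    proof (intro allI impI)
      fix t \<zeta> k assume h: "\<zeta> \<in> Hom C t z \<and> k \<in> Hom C t (Dom C p') \<and> p' \<cdot> k = u \<cdot> \<zeta>"
      then have "\<epsilon> \<cdot> (w \<cdot> k) = \<phi> \<zeta> (q \<cdot> (w \<cdot> k))" using R wk by metis
      then show "\<epsilon> \<cdot> w \<cdot> k = \<phi> \<zeta> (q' \<cdot> k)" using \<epsilon>w wk h by metis
    qed
  qed
  have "is_Pi C f d \<pi> p' q' (\<epsilon> \<cdot> w)"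
    unfolding is_Pi_def cond
  proof (intro conjI)
    show "\<epsilon> \<cdot> w \<in> Hom C (Dom C p') (Dom C d)" using \<epsilon>(1) w(1) by (auto simp: Hom_def)
    show "d \<cdot> (\<epsilon> \<cdot> w) = q'" using whisker[OF \<epsilon>(2), of w] \<epsilon>(1) w d by (auto simp: Hom_def)
  qed (fact pq' d Pi[unfolded is_Pi_def, THEN conjunct2, THEN conjunct2, THEN conjunct2, THEN conjunct2, THEN conjunct2])+
  then show thesis by (rule that)
qed

text \<open>Used to pass unique existence between a slice, whose arrows are triples with prescribed
  ends, and the base category.\<close>

lemma ex1_triple:
  "(\<exists>!h. (\<exists>u. h = (a, u, c) \<and> Q u) \<and> R (fst (snd h))) \<longleftrightarrow> (\<exists>!u. Q u \<and> R u)" (is "?L \<longleftrightarrow> ?R")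
proof
  assume ?L
  then obtain h where h: "(\<exists>u. h = (a, u, c) \<and> Q u) \<and> R (fst (snd h))"
    and uniq: "\<And>h'. (\<exists>u. h' = (a, u, c) \<and> Q u) \<and> R (fst (snd h')) \<Longrightarrow> h' = h" by blast
  from h obtain u where u: "h = (a, u, c)" "Q u" "R u" by auto
  show ?R
  proof (rule ex1I[of _ u])
    fix u' assume "Q u' \<and> R u'"
    then show "u' = u" using uniq[of "(a, u', c)"] u(1) by simp
  qed (use u in blast)
next
  assume ?R
  then obtain u where u: "Q u \<and> R u" "\<And>u'. Q u' \<and> R u' \<Longrightarrow> u' = u" by blast
  show ?L
  proof (rule ex1I[of _ "(a, u, c)"])
    fix h assume "(\<exists>u. h = (a, u, c) \<and> Q u) \<and> R (fst (snd h))"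
    then obtain v where "h = (a, v, c)" "Q v" "R v" by auto
    then show "h = (a, u, c)" using u(2)[of v] by simp
  qed (use u(1) in simp)
qed

text \<open>A map on the chosen pullback is the same as a natural family, by composing with
  \<open>pb_lift\<close> in one direction and by evaluating at the generic pair in the other, so
  both sides pose the same problem. Beyond this point the adjunction in the definition of the
  functor is handled through elements.\<close>

lemma is_Pi_iff_universal:
  assumes f: "f \<in> Hom C b c" and d: "d \<in> Hom C y b" and \<pi>: "\<pi> \<in> Hom C x c"
    and pq: "chosen_pullback C \<pi> f = (p, q)"
  shows "is_universal_from (slice C c) (slice C b) (pullback_fctr C f) d \<pi> (q, \<epsilon>, d) \<longleftrightarrow>
    is_Pi C f d \<pi> p q \<epsilon>"
proof -
  have PB: "is_pullback C \<pi> f p q"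
    using chosen_pullback[of \<pi> f] f \<pi> pq by (auto simp: Hom_def)
  note P = pullbackD[OF PB]
  have ty: "p \<in> Hom C (Dom C p) x" "q \<in> Hom C (Dom C p) b" using P f \<pi> by (auto simp: Hom_def)
  have F\<pi>: "on_obj (pullback_fctr C f) \<pi> = q" by (simp add: pullback_fctr_def pq)
  have dom: "Dom C f = b" "Cod C f = c" "Dom C d = y" "Cod C d = b" "Dom C \<pi> = x" "Cod C \<pi> = c"
    "f \<in> Arr C" "d \<in> Arr C" "\<pi> \<in> Arr C" "Dom C q = Dom C p"
    using f d \<pi> ty by (auto simp: Hom_def)
  define H where "H \<longleftrightarrow> \<epsilon> \<in> Hom C (Dom C p) y \<and> d \<cdot> \<epsilon> = q"
  have ehom: "(q, \<epsilon>, d) \<in> Hom (slice C b) q d \<longleftrightarrow> H"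
    unfolding slice_Hom_iff H_def using ty d dom by (auto simp: Hom_def)
  define U where "U a g \<longleftrightarrow> (\<exists>!h. h \<in> Hom (slice C c) a \<pi> \<and>
     (q, \<epsilon>, d) \<cdot>\<^bsub>slice C b\<^esub> on_arr (pullback_fctr C f) h = g)" for a g
  define V where "V a \<phi> \<longleftrightarrow> (\<exists>!u. u \<in> Hom C (Dom C a) x \<and> \<pi> \<cdot> u = a \<and>
     (\<forall>t \<zeta> k. \<zeta> \<in> Hom C t (Dom C a) \<and> k \<in> Hom C t (Dom C p) \<and> p \<cdot> k = u \<cdot> \<zeta> \<longrightarrow>
        \<epsilon> \<cdot> k = \<phi> \<zeta> (q \<cdot> k)))" for a \<phi>
  have UV: "U a (q', g, d) \<longleftrightarrow> V a \<phi>"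
    if H and a: "a \<in> Arr C" "Cod C a = c" and pq': "chosen_pullback C a f = (p', q')"
      and fam: "is_family C f a y \<phi>" and g: "g = \<phi> p' q'" for a p' q' g \<phi>
  proof -
    have PB': "is_pullback C a f p' q'" using chosen_pullback[of a f] a dom pq' by auto
    have aH: "a \<in> Hom C (Dom C a) c" using a by (simp add: Hom_def)
    have \<epsilon>: "\<epsilon> \<in> Hom C (Dom C p) y" "d \<cdot> \<epsilon> = q" using \<open>H\<close> unfolding H_def by auto
    have key: "(q, \<epsilon>, d) \<cdot>\<^bsub>slice C b\<^esub> on_arr (pullback_fctr C f) (a, u, \<pi>) = (q', g, d) \<longleftrightarrow>
       (\<forall>t \<zeta> k. \<zeta> \<in> Hom C t (Dom C a) \<and> k \<in> Hom C t (Dom C p) \<and> p \<cdot> k = u \<cdot> \<zeta> \<longrightarrow>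
        \<epsilon> \<cdot> k = \<phi> \<zeta> (q \<cdot> k))"
      if u: "u \<in> Hom C (Dom C a) x" "\<pi> \<cdot> u = a" for u
    proof -
      obtain k where k: "on_arr (pullback_fctr C f) (a, u, \<pi>) = (q', k, q)"
        "k \<in> Hom C (Dom C p') (Dom C p)" "p \<cdot> k = u \<cdot> p'" "q \<cdot> k = q'"
        using pullback_fctr_arr[OF aH \<pi> f u pq' pq] .
      have u': "u \<in> Hom C (Dom C a) (Dom C \<pi>)" using u dom by simp
      show ?thesis
        unfolding k(1) slice_simps family_pullback_iff[OF PB PB' fam u' u(2) k(2-4) \<epsilon>(1)] g by simp
    qed
    have "U a (q', g, d) \<longleftrightarrow> (\<exists>!h. h \<in> Hom (slice C c) a \<pi> \<and> (\<forall>t \<zeta> k. \<zeta> \<in> Hom C t (Dom C a) \<and>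
        k \<in> Hom C t (Dom C p) \<and> p \<cdot> k = fst (snd h) \<cdot> \<zeta> \<longrightarrow> \<epsilon> \<cdot> k = \<phi> \<zeta> (q \<cdot> k)))"
    proof -
      have "(h \<in> Hom (slice C c) a \<pi> \<and> (q, \<epsilon>, d) \<cdot>\<^bsub>slice C b\<^esub> on_arr (pullback_fctr C f) h = (q', g, d)) =
        (h \<in> Hom (slice C c) a \<pi> \<and> (\<forall>t \<zeta> k. \<zeta> \<in> Hom C t (Dom C a) \<and>
        k \<in> Hom C t (Dom C p) \<and> p \<cdot> k = fst (snd h) \<cdot> \<zeta> \<longrightarrow> \<epsilon> \<cdot> k = \<phi> \<zeta> (q \<cdot> k)))" for h
      proof (intro conj_cong refl)
        assume "h \<in> Hom (slice C c) a \<pi>"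
        then obtain u where u: "h = (a, u, \<pi>)" "u \<in> Hom C (Dom C a) x" "\<pi> \<cdot> u = a"
          unfolding slice_Hom_iff using dom by auto
        show "((q, \<epsilon>, d) \<cdot>\<^bsub>slice C b\<^esub> on_arr (pullback_fctr C f) h = (q', g, d)) =
          (\<forall>t \<zeta> k. \<zeta> \<in> Hom C t (Dom C a) \<and>
          k \<in> Hom C t (Dom C p) \<and> p \<cdot> k = fst (snd h) \<cdot> \<zeta> \<longrightarrow> \<epsilon> \<cdot> k = \<phi> \<zeta> (q \<cdot> k))"
          using key[OF u(2,3)] unfolding u(1) by simp
      qed
      then show ?thesis unfolding U_def by simp
    qed
    also have "\<dots> \<longleftrightarrow> V a \<phi>"
    proof -
      have sl: "h \<in> Hom (slice C c) a \<pi> \<longleftrightarrow> (\<exists>u. h = (a, u, \<pi>) \<and> u \<in> Hom C (Dom C a) x \<and> \<pi> \<cdot> u = a)" for h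
        unfolding slice_Hom_iff using dom a by auto
      show ?thesis unfolding V_def sl by (subst ex1_triple) (simp only: conj_assoc)
    qed
    finally show ?thesis .
  qed
  have L: "is_universal_from (slice C c) (slice C b) (pullback_fctr C f) d \<pi> (q, \<epsilon>, d) \<longleftrightarrow>
     H \<and> (\<forall>a p' q' g. a \<in> Arr C \<and> Cod C a = c \<and> chosen_pullback C a f = (p', q') \<and>
        g \<in> Hom C (Dom C p') y \<and> d \<cdot> g = q' \<longrightarrow> U a (q', g, d))"
  proof -
    have "(\<forall>a\<in>Obj (slice C c). \<forall>g\<in>Hom (slice C b) (on_obj (pullback_fctr C f) a) d. U a g) \<longleftrightarrow>
      (\<forall>a p' q' g. a \<in> Arr C \<and> Cod C a = c \<and> chosen_pullback C a f = (p', q') \<and>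
        g \<in> Hom C (Dom C p') y \<and> d \<cdot> g = q' \<longrightarrow> U a (q', g, d))" (is "?A \<longleftrightarrow> ?B")
    proof -
      have "g \<in> Hom (slice C b) (on_obj (pullback_fctr C f) a) d \<longleftrightarrow>
          (\<exists>g'. g = (q', g', d) \<and> g' \<in> Hom C (Dom C p') y \<and> d \<cdot> g' = q')"
        if "a \<in> Arr C" "Cod C a = c" "chosen_pullback C a f = (p', q')" for a g p' q'
      proof -
        have "is_pullback C a f p' q'" using chosen_pullback[of a f] that dom by auto
        from pullbackD[OF this] show ?thesis
          unfolding slice_Hom_iff using that dom by (auto simp: pullback_fctr_def)
      qed
      then show ?thesis by (metis slice_simps(3) surj_pair)
    qed
    then show ?thesis unfolding is_universal_from_def F\<pi> ehom U_def[symmetric] using dom by simp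
  qed
  have R: "is_Pi C f d \<pi> p q \<epsilon> \<longleftrightarrow> H \<and> (\<forall>a \<phi>. a \<in> Arr C \<and> Cod C a = c \<and> is_family C f a y \<phi> \<and>
        (\<forall>t \<zeta> b'. \<zeta> \<in> Hom C t (Dom C a) \<and> b' \<in> Hom C t b \<and> f \<cdot> b' = a \<cdot> \<zeta> \<longrightarrow>
           d \<cdot> \<phi> \<zeta> b' = b') \<longrightarrow> V a \<phi>)"
    unfolding is_Pi_def H_def V_def using PB dom by simp
  show ?thesis
    unfolding L R
  proof (intro conj_cong refl iffI allI impI)
    fix a \<phi> assume H
      and A: "\<forall>a p' q' g. a \<in> Arr C \<and> Cod C a = c \<and> chosen_pullback C a f = (p', q') \<and>
        g \<in> Hom C (Dom C p') y \<and> d \<cdot> g = q' \<longrightarrow> U a (q', g, d)"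
      and h: "a \<in> Arr C \<and> Cod C a = c \<and> is_family C f a y \<phi> \<and>
        (\<forall>t \<zeta> b'. \<zeta> \<in> Hom C t (Dom C a) \<and> b' \<in> Hom C t b \<and> f \<cdot> b' = a \<cdot> \<zeta> \<longrightarrow> d \<cdot> \<phi> \<zeta> b' = b')"
    obtain p' q' where pq': "chosen_pullback C a f = (p', q')" by fastforce
    have PB': "is_pullback C a f p' q'" using chosen_pullback[of a f] h dom pq' by auto
    note P' = pullbackD[OF PB']
    have pq'H: "p' \<in> Hom C (Dom C p') (Dom C a)" "q' \<in> Hom C (Dom C p') b"
      using P' dom by (auto simp: Hom_def)
    have "\<phi> p' q' \<in> Hom C (Dom C p') y" "d \<cdot> \<phi> p' q' = q'"
      using is_familyD(1)[of f a y \<phi> "Dom C a" c p' "Dom C p'" q'] h pq'H P'(9) dom by (auto simp: arr_Hom Hom_def)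
    then show "V a \<phi>" using UV[OF \<open>H\<close> _ _ pq' _ refl] A h pq' by blast
  next
    fix a p' q' g assume H
      and A: "\<forall>a \<phi>. a \<in> Arr C \<and> Cod C a = c \<and> is_family C f a y \<phi> \<and>
        (\<forall>t \<zeta> b'. \<zeta> \<in> Hom C t (Dom C a) \<and> b' \<in> Hom C t b \<and> f \<cdot> b' = a \<cdot> \<zeta> \<longrightarrow> d \<cdot> \<phi> \<zeta> b' = b') \<longrightarrow> V a \<phi>"
      and h: "a \<in> Arr C \<and> Cod C a = c \<and> chosen_pullback C a f = (p', q') \<and>
        g \<in> Hom C (Dom C p') y \<and> d \<cdot> g = q'"
    have PB': "is_pullback C a f p' q'" using chosen_pullback[of a f] h dom by auto
    note P' = pullbackD[OF PB']
    \<comment> \<open>The natural family that belongs to the map \<open>g\<close> on the chosen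
      pullback.\<close>
    define \<phi> where "\<phi> \<zeta> b' = g \<cdot> pb_lift C p' q' \<zeta> b'" for \<zeta> b'
    have lift: "pb_lift C p' q' \<zeta> b' \<in> Hom C t (Dom C p')" "q' \<cdot> pb_lift C p' q' \<zeta> b' = b'"
      "h' \<in> Hom C s t \<Longrightarrow> pb_lift C p' q' (\<zeta> \<cdot> h') (b' \<cdot> h') = pb_lift C p' q' \<zeta> b' \<cdot> h'"
      if "\<zeta> \<in> Hom C t (Dom C a)" "b' \<in> Hom C t b" "f \<cdot> b' = a \<cdot> \<zeta>" for t \<zeta> b' s h'
      using pb_lift[OF PB' that(1) _ that(3)[symmetric]] pb_lift_comp[OF PB' that(1) _ that(3)[symmetric]] that(2) dom
      by auto
    have fam: "is_family C f a y \<phi>"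
      unfolding is_family_def \<phi>_def
    proof (intro allI impI conjI ballI)
      fix t \<zeta> b' assume "\<zeta> \<in> Hom C t (Dom C a) \<and> b' \<in> Hom C t (Dom C f) \<and> f \<cdot> b' = a \<cdot> \<zeta>"
      then have z: "\<zeta> \<in> Hom C t (Dom C a)" "b' \<in> Hom C t b" "f \<cdot> b' = a \<cdot> \<zeta>" using dom by auto
      show "g \<cdot> pb_lift C p' q' \<zeta> b' \<in> Hom C t y" using lift(1)[OF z] h by (auto simp: Hom_def)
      fix s h' assume "h' \<in> Hom C s t"
      then show "g \<cdot> pb_lift C p' q' (\<zeta> \<cdot> h') (b' \<cdot> h') = g \<cdot> pb_lift C p' q' \<zeta> b' \<cdot> h'"
        using lift(1)[OF z] lift(3)[OF z] h by (simp add: Hom_def)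
    qed
    have sec: "d \<cdot> \<phi> \<zeta> b' = b'" if z: "\<zeta> \<in> Hom C t (Dom C a)" "b' \<in> Hom C t b" "f \<cdot> b' = a \<cdot> \<zeta>" for t \<zeta> b'
    proof -
      have "d \<cdot> (g \<cdot> pb_lift C p' q' \<zeta> b') = q' \<cdot> pb_lift C p' q' \<zeta> b'"
        by (rule whisker) (use h lift(1)[OF z] dom in \<open>auto simp: Hom_def\<close>)
      then show ?thesis unfolding \<phi>_def using lift(2)[OF z] by simp
    qed
    have "V a \<phi>" using A fam sec h by blast
    moreover have "g = \<phi> p' q'"
    proof -
      have "pb_lift C p' q' p' q' = Id C (Dom C p')"
        by (rule pb_lift_eq[OF PB' Id_in_Hom]) (use P' in auto)
      then show ?thesis unfolding \<phi>_def using h by (simp add: Hom_def)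
    qed
    ultimately show "U a (q', g, d)" using UV[OF \<open>H\<close> _ _ _ fam] h by blast
  qed
qed

lemma star_obj: "on_obj (star C X) Y = pr2 C Y X"
  by (simp add: star_def pr2_def)

lemma star_arr:
  assumes "h \<in> Hom C Y Y'" "X \<in> Obj C"
  shows "on_arr (star C X) h = (pr2 C Y X, pairing C (h \<cdot> pr1 C Y X) (pr2 C Y X), pr2 C Y' X)"
proof -
  have O: "Y \<in> Obj C" "Y' \<in> Obj C" using assms Hom_Obj by auto
  have hp: "h \<cdot> pr1 C Y X \<in> Hom C (prod_obj C Y X) Y'" using assms O by (auto simp: Hom_def)
  note pq = hp pr_Hom(2)[OF O(1) assms(2)]
  have "pairing C (h \<cdot> pr1 C Y X) (pr2 C Y X) = (THE k. k \<in> Hom C (prod_obj C Y X) (prod_obj C Y' X) \<and>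
     pr1 C Y' X \<cdot> k = h \<cdot> pr1 C Y X \<and> pr2 C Y' X \<cdot> k = pr2 C Y X)"
    using theI'[OF product_ex1[OF pq]] product_ex1[OF pq] pairing[OF pq] by blast
  moreover have "Dom C h = Y" "Cod C h = Y'" using assms by (auto simp: Hom_def)
  ultimately show ?thesis
    by (simp add: star_def pr1_def[symmetric] pr2_def[symmetric] prod_obj_def case_prod_beta Let_def)
qed

text \<open>A family over \<open>Dom f\<close> in the product of \<open>W\<close> with
  \<open>Dom f\<close> is a family in \<open>W\<close> paired with its own argument: the second
  component is forced.\<close>

lemma is_Pi_poly_obj:
  assumes Pi: "is_Pi C f (pr2 C W (Dom C f)) \<pi> p q \<epsilon>" and W: "W \<in> Obj C" and f: "f \<in> Arr C"
  shows "is_poly_obj C f W \<pi> p q (pr1 C W (Dom C f) \<cdot> \<epsilon>)"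
proof -
  define B where "B = Dom C f"
  have B: "B \<in> Obj C" unfolding B_def using f by simp
  have pq: "is_pullback C \<pi> f p q" and \<epsilon>: "\<epsilon> \<in> Hom C (Dom C p) (prod_obj C W B)" "pr2 C W B \<cdot> \<epsilon> = q"
    using Pi W B unfolding is_Pi_def B_def[symmetric] by auto
  note PB = pullbackD[OF pq]
  show ?thesis
    unfolding is_poly_obj_def B_def[symmetric]
  proof (intro conjI allI impI)
    show "is_pullback C \<pi> f p q" by (fact pq)
    show "pr1 C W B \<cdot> \<epsilon> \<in> Hom C (Dom C p) W" using \<epsilon>(1) W B by (auto simp: Hom_def)
    fix a \<phi> assume h: "a \<in> Arr C \<and> Cod C a = Cod C f \<and> is_family C f a W \<phi>"
    define \<phi>' where "\<phi>' \<zeta> b = pairing C (\<phi> \<zeta> b) b" for \<zeta> b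
    have fam: "\<phi> \<zeta> b \<in> Hom C t W" "h' \<in> Hom C s t \<Longrightarrow> \<phi> (\<zeta> \<cdot> h') (b \<cdot> h') = \<phi> \<zeta> b \<cdot> h'"
      if "\<zeta> \<in> Hom C t (Dom C a)" "b \<in> Hom C t B" "f \<cdot> b = a \<cdot> \<zeta>" for t \<zeta> b s h'
      using is_familyD[of f a W \<phi> "Dom C a" "Cod C a" \<zeta> t b] h that arr_Hom unfolding B_def by blast+
    have 1: "is_family C f a (prod_obj C W B) \<phi>'"
      unfolding is_family_def \<phi>'_def
    proof (intro allI impI conjI ballI)
      fix t \<zeta> b assume "\<zeta> \<in> Hom C t (Dom C a) \<and> b \<in> Hom C t (Dom C f) \<and> f \<cdot> b = a \<cdot> \<zeta>"
      then have z: "\<zeta> \<in> Hom C t (Dom C a)" "b \<in> Hom C t B" "f \<cdot> b = a \<cdot> \<zeta>" unfolding B_def by auto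
      show "pairing C (\<phi> \<zeta> b) b \<in> Hom C t (prod_obj C W B)" using pairing(1) fam(1)[OF z] z by blast
      fix s h' assume h': "h' \<in> Hom C s t"
      show "pairing C (\<phi> (\<zeta> \<cdot> h') (b \<cdot> h')) (b \<cdot> h') = pairing C (\<phi> \<zeta> b) b \<cdot> h'"
        unfolding fam(2)[OF z h'] using fam(1)[OF z] z(2) h' by (simp add: Hom_def)
    qed
    have 2: "\<forall>t \<zeta> b. \<zeta> \<in> Hom C t (Dom C a) \<and> b \<in> Hom C t (Dom C f) \<and> f \<cdot> b = a \<cdot> \<zeta> \<longrightarrow>
      pr2 C W B \<cdot> \<phi>' \<zeta> b = b"
      unfolding \<phi>'_def using pairing(3) fam(1) unfolding B_def by blast
    have D: "Dom C (pr2 C W B) = prod_obj C W B" using W B by simp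
    have ex: "\<exists>!u. u \<in> Hom C (Dom C a) (Dom C \<pi>) \<and> \<pi> \<cdot> u = a \<and>
           (\<forall>t \<zeta> k. \<zeta> \<in> Hom C t (Dom C a) \<and> k \<in> Hom C t (Dom C p) \<and> p \<cdot> k = u \<cdot> \<zeta> \<longrightarrow>
              \<epsilon> \<cdot> k = \<phi>' \<zeta> (q \<cdot> k))"
      using Pi h 1 2 unfolding is_Pi_def B_def[symmetric] D by blast
    have "(u \<in> Hom C (Dom C a) (Dom C \<pi>) \<and> \<pi> \<cdot> u = a \<and>
           (\<forall>t \<zeta> k. \<zeta> \<in> Hom C t (Dom C a) \<and> k \<in> Hom C t (Dom C p) \<and> p \<cdot> k = u \<cdot> \<zeta> \<longrightarrow>
              \<epsilon> \<cdot> k = \<phi>' \<zeta> (q \<cdot> k))) =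
      (u \<in> Hom C (Dom C a) (Dom C \<pi>) \<and> \<pi> \<cdot> u = a \<and>
           (\<forall>t \<zeta> k. \<zeta> \<in> Hom C t (Dom C a) \<and> k \<in> Hom C t (Dom C p) \<and> p \<cdot> k = u \<cdot> \<zeta> \<longrightarrow>
              pr1 C W B \<cdot> \<epsilon> \<cdot> k = \<phi> \<zeta> (q \<cdot> k)))" for u
    proof (intro conj_cong refl)
      assume u: "u \<in> Hom C (Dom C a) (Dom C \<pi>)" "\<pi> \<cdot> u = a"
      have "\<epsilon> \<cdot> k = \<phi>' \<zeta> (q \<cdot> k) \<longleftrightarrow> pr1 C W B \<cdot> \<epsilon> \<cdot> k = \<phi> \<zeta> (q \<cdot> k)"
        if k: "\<zeta> \<in> Hom C t (Dom C a)" "k \<in> Hom C t (Dom C p)" "p \<cdot> k = u \<cdot> \<zeta>" for t \<zeta> k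
      proof -
        have qk: "q \<cdot> k \<in> Hom C t B" using k(2) PB(4-8) B_def by (auto simp: Hom_def)
        have "f \<cdot> (q \<cdot> k) = \<pi> \<cdot> (p \<cdot> k)" using whisker[OF PB(9), of k] k(2) PB(1-8) by (auto simp: Hom_def)
        also have "\<dots> = a \<cdot> \<zeta>"
          unfolding k(3) using whisker[OF u(2), of \<zeta>] u(1) k(1) PB(1) by (auto simp: Hom_def)
        finally have fam_k: "\<phi> \<zeta> (q \<cdot> k) \<in> Hom C t W" using fam(1)[OF k(1) qk] by blast
        have ek: "\<epsilon> \<cdot> k \<in> Hom C t (prod_obj C W B)" using \<epsilon>(1) k(2) by (auto simp: Hom_def)
        have p1: "pr1 C W B \<cdot> (\<epsilon> \<cdot> k) \<in> Hom C t W" using ek W B by (auto simp: Hom_def)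
        have p2: "pr2 C W B \<cdot> (\<epsilon> \<cdot> k) = q \<cdot> k"
          using whisker[OF \<epsilon>(2), of k] \<epsilon>(1) k(2) W B by (auto simp: Hom_def)
        have "pr1 C W B \<cdot> \<epsilon> \<cdot> k = pr1 C W B \<cdot> (\<epsilon> \<cdot> k)" using \<epsilon>(1) k(2) W B by (simp add: Hom_def)
        moreover have "\<epsilon> \<cdot> k = pairing C (pr1 C W B \<cdot> (\<epsilon> \<cdot> k)) (q \<cdot> k)"
          using pairing_eta[OF W B ek] p2 by simp
        ultimately show ?thesis unfolding \<phi>'_def using pairing_eq_iff[OF p1 qk fam_k qk] by metis
      qed
      then show "(\<forall>t \<zeta> k. \<zeta> \<in> Hom C t (Dom C a) \<and> k \<in> Hom C t (Dom C p) \<and> p \<cdot> k = u \<cdot> \<zeta> \<longrightarrow>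
              \<epsilon> \<cdot> k = \<phi>' \<zeta> (q \<cdot> k)) =
           (\<forall>t \<zeta> k. \<zeta> \<in> Hom C t (Dom C a) \<and> k \<in> Hom C t (Dom C p) \<and> p \<cdot> k = u \<cdot> \<zeta> \<longrightarrow>
              pr1 C W B \<cdot> \<epsilon> \<cdot> k = \<phi> \<zeta> (q \<cdot> k))"
        by blast
    qed
    then show "\<exists>!u. u \<in> Hom C (Dom C a) (Dom C \<pi>) \<and> \<pi> \<cdot> u = a \<and>
           (\<forall>t \<zeta> k. \<zeta> \<in> Hom C t (Dom C a) \<and> k \<in> Hom C t (Dom C p) \<and> p \<cdot> k = u \<cdot> \<zeta> \<longrightarrow>
              pr1 C W B \<cdot> \<epsilon> \<cdot> k = \<phi> \<zeta> (q \<cdot> k))"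
      using ex by simp
  qed
qed

end

text \<open>The polynomial functor calls for dependent products at the projections that are values
  of \<open>star\<close>. They are assumed with respect to some pullback; the link to the chosen
  adjoint is derived from this, which keeps the assumption easy to verify in slices.\<close>

locale poly_cat = forall_cat +
  fixes f :: 'b
  assumes f_arr: "f \<in> Arr C"
    and Pi_exists: "Y \<in> Obj C \<Longrightarrow> \<exists>\<pi> p q \<epsilon>. is_Pi C f (pr2 C Y (Dom C f)) \<pi> p q \<epsilon>"
begin

abbreviation "P_obj \<equiv> on_obj (poly C f)"
abbreviation "P_arr \<equiv> on_arr (poly C f)"
abbreviation "P_proj \<equiv> poly_proj C f"
abbreviation "pb1 Y \<equiv> fst (chosen_pullback C (P_proj Y) f)"
abbreviation "pb2 Y \<equiv> snd (chosen_pullback C (P_proj Y) f)"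
abbreviation "app Y \<equiv> papp C (pb1 Y) (pb2 Y) (poly_ev C f Y)"

lemma f_Hom: "f \<in> Hom C (Dom C f) (Cod C f)" "Dom C f \<in> Obj C" "Cod C f \<in> Obj C"
  using f_arr arr_Hom by auto

text \<open>The choice in \<open>radj_data\<close> may differ from the dependent product that
  \<open>Pi_exists\<close> supplies. The latter shows that a universal arrow exists, and whichever
  one is chosen is a dependent product again by \<open>is_Pi_iff_universal\<close>.\<close>

lemma radj_data_Pi:
  assumes Y: "Y \<in> Obj C"
  obtains \<epsilon> where
    "radj_data (slice C (Cod C f)) (slice C (Dom C f)) (pullback_fctr C f) (pr2 C Y (Dom C f))
      = (P_proj Y, (pb2 Y, \<epsilon>, pr2 C Y (Dom C f)))"
    "is_Pi C f (pr2 C Y (Dom C f)) (P_proj Y) (pb1 Y) (pb2 Y) \<epsilon>"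
    "is_universal_from (slice C (Cod C f)) (slice C (Dom C f)) (pullback_fctr C f)
      (pr2 C Y (Dom C f)) (P_proj Y) (pb2 Y, \<epsilon>, pr2 C Y (Dom C f))"
    "poly_ev C f Y = pr1 C Y (Dom C f) \<cdot> \<epsilon>" "P_proj Y \<in> Hom C (P_obj Y) (Cod C f)"
proof -
  define B where "B = Dom C f"
  define A where "A = Cod C f"
  define d where "d = pr2 C Y B"
  have f: "f \<in> Hom C B A" unfolding A_def B_def using f_Hom by simp
  have B: "B \<in> Obj C" using f Hom_Obj by blast
  have d: "d \<in> Hom C (prod_obj C Y B) B" unfolding d_def using pr_Hom Y B by blast
  let ?univ = "is_universal_from (slice C A) (slice C B) (pullback_fctr C f) d"
  obtain \<pi> p q \<epsilon> where Pi: "is_Pi C f d \<pi> p q \<epsilon>"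
    using Pi_exists[OF Y] unfolding d_def B_def by blast
  then have pb: "is_pullback C \<pi> f p q" unfolding is_Pi_def by blast
  have \<pi>: "\<pi> \<in> Hom C (Dom C \<pi>) A" using pullbackD[OF pb] A_def by (simp add: Hom_def)
  obtain p' q' where pq': "chosen_pullback C \<pi> f = (p', q')" by fastforce
  then have "is_pullback C \<pi> f p' q'" using chosen_pullback[of \<pi> f] \<pi> f by (auto simp: Hom_def)
  then obtain \<epsilon>' where "is_Pi C f d \<pi> p' q' \<epsilon>'" using is_Pi_change_pullback[OF Pi] by blast
  then have "?univ \<pi> (q', \<epsilon>', d)" using is_Pi_iff_universal[OF f d \<pi> pq'] by blast
  then have "\<exists>x. (\<lambda>(c, e). ?univ c e) x" by auto
  then have "(\<lambda>(c, e). ?univ c e) (radj_data (slice C A) (slice C B) (pullback_fctr C f) d)"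
    unfolding radj_data_def by (rule someI_ex)
  moreover obtain \<pi>0 e0 where e0: "radj_data (slice C A) (slice C B) (pullback_fctr C f) d = (\<pi>0, e0)"
    by (rule prod.exhaust)
  ultimately have U: "?univ \<pi>0 e0" by simp
  have \<pi>0: "P_proj Y = \<pi>0"
    unfolding poly_proj_def Pi_fctr_def radj_def star_obj using e0 unfolding A_def B_def d_def by simp
  have \<pi>0H: "\<pi>0 \<in> Hom C (Dom C \<pi>0) A"
    using U unfolding is_universal_from_def by (auto simp: slice_def Hom_def)
  obtain p q where pq: "chosen_pullback C \<pi>0 f = (p, q)" by fastforce
  have "e0 \<in> Hom (slice C B) q d"
    using U unfolding is_universal_from_def by (simp add: pullback_fctr_def pq)
  then obtain \<epsilon> where \<epsilon>: "e0 = (q, \<epsilon>, d)" unfolding slice_Hom_iff by blast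
  have Pi0: "is_Pi C f d \<pi>0 p q \<epsilon>" using U is_Pi_iff_universal[OF f d \<pi>0H pq] unfolding \<epsilon> by blast
  have ev: "poly_ev C f Y = pr1 C Y B \<cdot> \<epsilon>"
    unfolding poly_ev_def star_obj counit_def pr1_def[symmetric] using e0 \<epsilon>
    unfolding A_def B_def d_def by (simp add: Sigma_fctr_def)
  have "P_obj Y = Dom C \<pi>0"
    unfolding \<pi>0[symmetric] poly_proj_def poly_def fctr_comp_def Sigma_fctr_def by simp
  then show thesis
    using that[of \<epsilon>] e0 Pi0 U ev \<pi>0H pq unfolding \<pi>0 \<epsilon> A_def B_def d_def by simp
qed

lemma poly_obj:
  assumes "Y \<in> Obj C"
  shows "is_poly_obj C f Y (P_proj Y) (pb1 Y) (pb2 Y) (poly_ev C f Y)"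
    "P_proj Y \<in> Hom C (P_obj Y) (Cod C f)" "Dom C (P_proj Y) = P_obj Y" "P_obj Y \<in> Obj C"
proof -
  obtain \<epsilon> where "is_Pi C f (pr2 C Y (Dom C f)) (P_proj Y) (pb1 Y) (pb2 Y) \<epsilon>"
    "poly_ev C f Y = pr1 C Y (Dom C f) \<cdot> \<epsilon>" and *: "P_proj Y \<in> Hom C (P_obj Y) (Cod C f)"
    using radj_data_Pi[OF assms] by metis
  then show "is_poly_obj C f Y (P_proj Y) (pb1 Y) (pb2 Y) (poly_ev C f Y)"
    using is_Pi_poly_obj[OF _ assms f_arr] by simp
  show "P_proj Y \<in> Hom C (P_obj Y) (Cod C f)" "Dom C (P_proj Y) = P_obj Y" "P_obj Y \<in> Obj C"
    using * Hom_Obj(1)[OF *] by (auto simp: Hom_def)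
qed

text \<open>The description operators behind \<open>P_arr\<close> are unfolded here once and for
  all. Later arguments use that it keeps the shape of an element and composes its values with
  \<open>h\<close>.\<close>

lemma poly_arr:
  assumes h: "h \<in> Hom C Y Y'"
  shows "P_arr h \<in> Hom C (P_obj Y) (P_obj Y')" "P_proj Y' \<cdot> P_arr h = P_proj Y"
    "\<lbrakk>u \<in> Hom C z (P_obj Y); b \<in> Hom C z (Dom C f); f \<cdot> b = P_proj Y \<cdot> u\<rbrakk>
      \<Longrightarrow> app Y' (P_arr h \<cdot> u) b = h \<cdot> app Y u b"
proof -
  have Y: "Y \<in> Obj C" "Y' \<in> Obj C" using h Hom_Obj by auto
  define B where "B = Dom C f"
  define A where "A = Cod C f"
  have f: "f \<in> Hom C B A" unfolding A_def B_def using f_Hom by simp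
  have B: "B \<in> Obj C" using f Hom_Obj by blast
  define d where "d = pr2 C Y B"
  define d' where "d' = pr2 C Y' B"
  obtain \<epsilon> where \<epsilon>: "radj_data (slice C A) (slice C B) (pullback_fctr C f) d = (P_proj Y, (pb2 Y, \<epsilon>, d))"
    "is_Pi C f d (P_proj Y) (pb1 Y) (pb2 Y) \<epsilon>" "poly_ev C f Y = pr1 C Y B \<cdot> \<epsilon>"
    unfolding A_def B_def d_def using radj_data_Pi[OF Y(1)] by metis
  obtain \<epsilon>' where \<epsilon>': "radj_data (slice C A) (slice C B) (pullback_fctr C f) d' = (P_proj Y', (pb2 Y', \<epsilon>', d'))"
    "is_Pi C f d' (P_proj Y') (pb1 Y') (pb2 Y') \<epsilon>'"
    "is_universal_from (slice C A) (slice C B) (pullback_fctr C f) d' (P_proj Y') (pb2 Y', \<epsilon>', d')"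
    "poly_ev C f Y' = pr1 C Y' B \<cdot> \<epsilon>'"
    unfolding A_def B_def d'_def using radj_data_Pi[OF Y(2)] by metis
  note P = poly_obj[OF Y(1), folded A_def] and P' = poly_obj[OF Y(2), folded A_def]
  note pb = poly_objD(1)[OF P(1)] and pb' = poly_objD(1)[OF P'(1)]
  note PB = pullbackD[OF pb] and PB' = pullbackD[OF pb']
  have e: "\<epsilon> \<in> Hom C (Dom C (pb1 Y)) (prod_obj C Y B)" "d \<cdot> \<epsilon> = pb2 Y"
    using \<epsilon>(2) Y B unfolding is_Pi_def d_def by auto
  have e': "\<epsilon>' \<in> Hom C (Dom C (pb1 Y')) (prod_obj C Y' B)" "d' \<cdot> \<epsilon>' = pb2 Y'"
    using \<epsilon>'(2) Y B unfolding is_Pi_def d'_def by auto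
  define hB where "hB = pairing C (h \<cdot> pr1 C Y B) (pr2 C Y B)"
  have hp: "h \<cdot> pr1 C Y B \<in> Hom C (prod_obj C Y B) Y'" using h Y B by (auto simp: Hom_def)
  note hB = pairing[OF hp pr_Hom(2)[OF Y(1) B], folded hB_def]
  have st: "on_arr (star C B) h = (d, hB, d')" using star_arr[OF h B] unfolding d_def d'_def hB_def .
  have q: "pb2 Y \<in> Arr C" "Cod C (pb2 Y) = B" "Dom C (pb2 Y) = Dom C (pb1 Y)"
    using PB B_def by auto
  have he: "hB \<cdot> \<epsilon> \<in> Hom C (Dom C (pb2 Y)) (prod_obj C Y' B)" using hB(1) e(1) q by (auto simp: Hom_def)
  have dd: "d \<in> Hom C (prod_obj C Y B) B" "d' \<in> Hom C (prod_obj C Y' B) B"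
    unfolding d_def d'_def using pr_Hom Y B by auto
  have "d' \<cdot> (hB \<cdot> \<epsilon>) = pb2 Y"
    using whisker[OF hB(3), of \<epsilon>] hB(1) e dd unfolding d_def d'_def by (auto simp: Hom_def)
  then have g: "(pb2 Y, hB \<cdot> \<epsilon>, d') \<in> Hom (slice C B) (on_obj (pullback_fctr C f) (P_proj Y)) d'"
    using he q dd(2) unfolding slice_Hom_triple by (auto simp: pullback_fctr_def Hom_def)
  have "P_proj Y \<in> Obj (slice C A)" using P(2) by (simp add: Hom_def)
  then have ex: "\<exists>!k. k \<in> Hom (slice C A) (P_proj Y) (P_proj Y') \<and>
      (pb2 Y', \<epsilon>', d') \<cdot>\<^bsub>slice C B\<^esub> on_arr (pullback_fctr C f) k = (pb2 Y, hB \<cdot> \<epsilon>, d')"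
    using \<epsilon>'(3) g unfolding is_universal_from_def by blast
  define K where "K = on_arr (Pi_fctr C f) (d, hB, d')"
  have "K = (THE k. k \<in> Hom (slice C A) (P_proj Y) (P_proj Y') \<and>
      (pb2 Y', \<epsilon>', d') \<cdot>\<^bsub>slice C B\<^esub> on_arr (pullback_fctr C f) k = (pb2 Y, hB \<cdot> \<epsilon>, d'))"
    unfolding K_def Pi_fctr_def radj_def counit_def A_def[symmetric] B_def[symmetric]
    by (simp add: \<epsilon>(1) \<epsilon>'(1))
  then have K: "K \<in> Hom (slice C A) (P_proj Y) (P_proj Y')"
    "(pb2 Y', \<epsilon>', d') \<cdot>\<^bsub>slice C B\<^esub> on_arr (pullback_fctr C f) K = (pb2 Y, hB \<cdot> \<epsilon>, d')"
    using theI'[OF ex] by auto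
  obtain k where k: "K = (P_proj Y, k, P_proj Y')" "k \<in> Hom C (P_obj Y) (P_obj Y')" "P_proj Y' \<cdot> k = P_proj Y"
    using K(1) P(3) P'(3) unfolding slice_Hom_iff by auto
  have Pk: "P_arr h = k"
    unfolding poly_def fctr_comp_def A_def[symmetric] B_def[symmetric]
    using k(1) st K_def by (simp add: Sigma_fctr_def)
  show "P_arr h \<in> Hom C (P_obj Y) (P_obj Y')" "P_proj Y' \<cdot> P_arr h = P_proj Y" unfolding Pk using k by auto
  obtain kk where kk: "on_arr (pullback_fctr C f) (P_proj Y, k, P_proj Y') = (pb2 Y, kk, pb2 Y')"
    "kk \<in> Hom C (Dom C (pb1 Y)) (Dom C (pb1 Y'))" "pb1 Y' \<cdot> kk = k \<cdot> pb1 Y" "pb2 Y' \<cdot> kk = pb2 Y"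
    using pullback_fctr_arr[OF P(2) P'(2) f k(2,3), of "pb1 Y" "pb2 Y" "pb1 Y'" "pb2 Y'"]
    by (metis prod.collapse)
  have ek: "\<epsilon>' \<cdot> kk = hB \<cdot> \<epsilon>" using K(2) unfolding k(1) kk(1) by simp
  \<comment> \<open>The defining equation of the mediating arrow, followed by the first projection
    of the product with \<open>B\<close>.\<close>
  have evk: "poly_ev C f Y' \<cdot> kk = h \<cdot> poly_ev C f Y"
  proof -
    have "poly_ev C f Y' \<cdot> kk = pr1 C Y' B \<cdot> (hB \<cdot> \<epsilon>)"
      unfolding \<epsilon>'(4) ek[symmetric] using e'(1) kk(2) Y B by (simp add: Hom_def)
    also have "\<dots> = h \<cdot> (pr1 C Y B \<cdot> \<epsilon>)"
      using whisker[OF hB(2), of \<epsilon>] hB(1) e(1) Y B h by (simp add: Hom_def)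
    finally show ?thesis unfolding \<epsilon>(3) .
  qed
  assume u: "u \<in> Hom C z (P_obj Y)" and b: "b \<in> Hom C z (Dom C f)" "f \<cdot> b = P_proj Y \<cdot> u"
  note l = pb_lift[OF pb u[folded P(3)] b(1) b(2)[symmetric]]
  have "pb_lift C (pb1 Y') (pb2 Y') (k \<cdot> u) b = kk \<cdot> pb_lift C (pb1 Y) (pb2 Y) u b"
  proof (rule pb_lift_eq[OF pb'])
    show "kk \<cdot> pb_lift C (pb1 Y) (pb2 Y) u b \<in> Hom C z (Dom C (pb1 Y'))"
      using kk(2) l(1) by (auto simp: Hom_def)
    have "pb1 Y' \<cdot> (kk \<cdot> pb_lift C (pb1 Y) (pb2 Y) u b) = k \<cdot> (pb1 Y \<cdot> pb_lift C (pb1 Y) (pb2 Y) u b)"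
      using whisker[OF kk(3), of "pb_lift C (pb1 Y) (pb2 Y) u b"] kk(2) l(1) k(2) PB(4-8) PB'(4-8) P(3) P'(3)
      by (simp add: Hom_def)
    then show "pb1 Y' \<cdot> (kk \<cdot> pb_lift C (pb1 Y) (pb2 Y) u b) = k \<cdot> u" using l(2) by simp
    show "pb2 Y' \<cdot> (kk \<cdot> pb_lift C (pb1 Y) (pb2 Y) u b) = b"
      using whisker[OF kk(4), of "pb_lift C (pb1 Y) (pb2 Y) u b"] kk(2) l(1,3) PB'(4-8)
      by (simp add: Hom_def)
  qed
  then have "app Y' (k \<cdot> u) b = poly_ev C f Y' \<cdot> (kk \<cdot> pb_lift C (pb1 Y) (pb2 Y) u b)"
    unfolding papp_def by simp
  also have "\<dots> = h \<cdot> app Y u b"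
    unfolding papp_def
    using whisker[OF evk, of "pb_lift C (pb1 Y) (pb2 Y) u b"] poly_objD(2)[OF P'(1)] poly_objD(2)[OF P(1)] kk(2) l(1) h
    by (simp add: Hom_def)
  finally show "app Y' (P_arr h \<cdot> u) b = h \<cdot> app Y u b" unfolding Pk .
qed

end

section \<open>Algebras and closed subobjects\<close>

text \<open>The data of the polynomial object are explicit arguments: in a slice the notion is used
  both for the object chosen there and for the image under \<open>star\<close> of the object chosen
  in the base.\<close>

definition closed_under :: "('o, 'm) cat \<Rightarrow> 'm \<Rightarrow> 'm \<Rightarrow> 'm \<Rightarrow> 'm \<Rightarrow> 'm \<Rightarrow> 'm \<Rightarrow> 'm \<Rightarrow> bool" where
  "closed_under C f \<pi> p q ev s m \<longleftrightarrow> (\<forall>z u. u \<in> Hom C z (Dom C \<pi>) \<and>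
     (\<forall>t \<zeta> b. \<zeta> \<in> Hom C t z \<and> b \<in> Hom C t (Dom C f) \<and> f \<cdot>\<^bsub>C\<^esub> b = \<pi> \<cdot>\<^bsub>C\<^esub> (u \<cdot>\<^bsub>C\<^esub> \<zeta>) \<longrightarrow>
        sub_le C (papp C p q ev (u \<cdot>\<^bsub>C\<^esub> \<zeta>) b) m) \<longrightarrow> sub_le C (s \<cdot>\<^bsub>C\<^esub> u) m)"

context category
begin

lemma has_inductive_subobjectsE:
  assumes "has_inductive_subobjects C n" "ev \<in> Hom C (Dom C n) Y" "\<beta> \<in> Hom C (Cod C n) Y"
  obtains g where "is_mono C g" "Cod C g = Y"
    "\<And>z y. y \<in> Hom C z Y \<Longrightarrow> sub_le C y g \<Longrightarrow> \<exists>t e u. is_epi C e \<and> e \<in> Hom C t z \<and>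
       u \<in> Hom C t (Cod C n) \<and> \<beta> \<cdot> u = y \<cdot> e \<and> forall_along C n (\<lambda>\<nu>. sub_le C (ev \<cdot> \<nu>) g) u"
    "\<And>z u. u \<in> Hom C z (Cod C n) \<Longrightarrow> forall_along C n (\<lambda>\<nu>. sub_le C (ev \<cdot> \<nu>) g) u \<Longrightarrow>
       sub_le C (\<beta> \<cdot> u) g"
proof -
  obtain g where g: "is_mono C g \<and> Cod C g = Y \<and>
        (\<forall>z y. y \<in> Hom C z Y \<and> sub_le C y g \<longrightarrow>
           (\<exists>t e u. is_epi C e \<and> e \<in> Hom C t z \<and> u \<in> Hom C t (Cod C n) \<and> \<beta> \<cdot> u = y \<cdot> e \<and>
              forall_along C n (\<lambda>\<nu>. sub_le C (ev \<cdot> \<nu>) g) u)) \<and>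
        (\<forall>z u. u \<in> Hom C z (Cod C n) \<and> forall_along C n (\<lambda>\<nu>. sub_le C (ev \<cdot> \<nu>) g) u \<longrightarrow>
           sub_le C (\<beta> \<cdot> u) g)"
    using assms(1)[unfolded has_inductive_subobjects_def, rule_format, OF conjI[OF assms(2,3)]] by (rule exE)
  show thesis by (rule that[of g]) (use g in blast)+
qed

end

section \<open>Algebras of a polynomial functor in terms of elements\<close>

context poly_cat
begin

lemma app_Hom:
  assumes "Y \<in> Obj C" "u \<in> Hom C z (P_obj Y)" "b \<in> Hom C z (Dom C f)" "f \<cdot> b = P_proj Y \<cdot> u"
  shows "app Y u b \<in> Hom C z Y"
  using papp_Hom[OF poly_obj(1)[OF assms(1)]] assms(2-) poly_obj(3)[OF assms(1)] by metis

lemma app_comp: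
  assumes "Y \<in> Obj C" "u \<in> Hom C z (P_obj Y)" "b \<in> Hom C z (Dom C f)" "f \<cdot> b = P_proj Y \<cdot> u"
    "h \<in> Hom C t z"
  shows "app Y (u \<cdot> h) (b \<cdot> h) = app Y u b \<cdot> h"
  using papp_comp[OF poly_obj(1)[OF assms(1)]] assms(2-) poly_obj(3)[OF assms(1)] by metis

lemma app_ext:
  assumes "Y \<in> Obj C" "u \<in> Hom C z (P_obj Y)" "u' \<in> Hom C z (P_obj Y)"
    "P_proj Y \<cdot> u = P_proj Y \<cdot> u'"
    "\<And>t \<zeta> b. \<lbrakk>\<zeta> \<in> Hom C t z; b \<in> Hom C t (Dom C f); f \<cdot> b = P_proj Y \<cdot> (u \<cdot> \<zeta>)\<rbrakk>
      \<Longrightarrow> app Y (u \<cdot> \<zeta>) b = app Y (u' \<cdot> \<zeta>) b"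
  shows "u = u'"
  by (rule poly_obj_ext[OF poly_obj(1)[OF assms(1)]]) (use assms poly_obj(3)[OF assms(1)] in auto)

lemma P_proj_arr:
  assumes h: "h \<in> Hom C Y Y'" and u: "u \<in> Hom C z (P_obj Y)"
  shows "P_proj Y' \<cdot> (P_arr h \<cdot> u) = P_proj Y \<cdot> u"
proof -
  have "Y' \<in> Obj C" using h Hom_Obj by auto
  from poly_obj(2)[OF this] show ?thesis
    using whisker[OF poly_arr(2)[OF h], of u] poly_arr(1)[OF h] u by (auto simp: Hom_def)
qed

text \<open>Functoriality is an instance of extensionality: both sides keep the shape and compose
  the values with \<open>k \<cdot> h\<close>.\<close>

lemma P_arr_comp:
  assumes h: "h \<in> Hom C X Y" and k: "k \<in> Hom C Y Z"
  shows "P_arr (k \<cdot> h) = P_arr k \<cdot> P_arr h"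
proof -
  have O: "X \<in> Obj C" "Y \<in> Obj C" "Z \<in> Obj C" using h k Hom_Obj by auto
  have kh: "k \<cdot> h \<in> Hom C X Z" using h k by (auto simp: Hom_def)
  note PX = poly_obj[OF O(1)]
  have ty: "P_arr h \<in> Hom C (P_obj X) (P_obj Y)" "P_arr k \<in> Hom C (P_obj Y) (P_obj Z)"
    "P_arr (k \<cdot> h) \<in> Hom C (P_obj X) (P_obj Z)" "P_arr k \<cdot> P_arr h \<in> Hom C (P_obj X) (P_obj Z)"
    using poly_arr(1)[OF h] poly_arr(1)[OF k] poly_arr(1)[OF kh] by (auto simp: Hom_def)
  show ?thesis
  proof (rule app_ext[OF O(3) ty(3,4)])
    show "P_proj Z \<cdot> P_arr (k \<cdot> h) = P_proj Z \<cdot> (P_arr k \<cdot> P_arr h)"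
      using poly_arr(2)[OF kh] P_proj_arr[OF k ty(1)] poly_arr(2)[OF h] by simp
    fix t \<zeta> b assume z: "\<zeta> \<in> Hom C t (P_obj X)" and b: "b \<in> Hom C t (Dom C f)"
      and e: "f \<cdot> b = P_proj Z \<cdot> (P_arr (k \<cdot> h) \<cdot> \<zeta>)"
    have e1: "f \<cdot> b = P_proj X \<cdot> \<zeta>" using e P_proj_arr[OF kh z] by simp
    have hz: "P_arr h \<cdot> \<zeta> \<in> Hom C t (P_obj Y)" using ty(1) z by (auto simp: Hom_def)
    have e2: "f \<cdot> b = P_proj Y \<cdot> (P_arr h \<cdot> \<zeta>)" using e1 P_proj_arr[OF h z] by simp
    have "app Z (P_arr (k \<cdot> h) \<cdot> \<zeta>) b = k \<cdot> (h \<cdot> app X \<zeta> b)"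
      using poly_arr(3)[OF kh z b e1] app_Hom[OF O(1) z b e1] h k by (simp add: Hom_def)
    also have "\<dots> = app Z (P_arr k \<cdot> (P_arr h \<cdot> \<zeta>)) b"
      using poly_arr(3)[OF h z b e1] poly_arr(3)[OF k hz b e2] by simp
    also have "P_arr k \<cdot> (P_arr h \<cdot> \<zeta>) = P_arr k \<cdot> P_arr h \<cdot> \<zeta>" using ty z by (simp add: Hom_def)
    finally show "app Z (P_arr (k \<cdot> h) \<cdot> \<zeta>) b = app Z (P_arr k \<cdot> P_arr h \<cdot> \<zeta>) b" .
  qed
qed

lemma P_arr_Id:
  assumes Y: "Y \<in> Obj C"
  shows "P_arr (Id C Y) = Id C (P_obj Y)"
proof -
  note P = poly_obj[OF Y] and I = Id_in_Hom[OF Y]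
  have PI: "Id C (P_obj Y) \<in> Hom C (P_obj Y) (P_obj Y)" using P(4) Id_in_Hom by blast
  show ?thesis
  proof (rule app_ext[OF Y poly_arr(1)[OF I] PI])
    show "P_proj Y \<cdot> P_arr (Id C Y) = P_proj Y \<cdot> Id C (P_obj Y)"
      using poly_arr(2)[OF I] P(2) by (simp add: Hom_def)
    fix t \<zeta> b assume z: "\<zeta> \<in> Hom C t (P_obj Y)" and b: "b \<in> Hom C t (Dom C f)"
      and e: "f \<cdot> b = P_proj Y \<cdot> (P_arr (Id C Y) \<cdot> \<zeta>)"
    have e1: "f \<cdot> b = P_proj Y \<cdot> \<zeta>" using e P_proj_arr[OF I z] by simp
    show "app Y (P_arr (Id C Y) \<cdot> \<zeta>) b = app Y (Id C (P_obj Y) \<cdot> \<zeta>) b"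
      using poly_arr(3)[OF I z b e1] app_Hom[OF Y z b e1] z by (simp add: Hom_def)
  qed
qed

lemma app_P_arr_mem:
  assumes m: "m \<in> Hom C V Y" and v: "v \<in> Hom C z (P_obj V)" and b: "b \<in> Hom C z (Dom C f)"
    "f \<cdot> b = P_proj Y \<cdot> (P_arr m \<cdot> v)"
  shows "sub_le C (app Y (P_arr m \<cdot> v) b) m"
proof -
  have V: "V \<in> Obj C" using m Hom_Obj by auto
  have e: "f \<cdot> b = P_proj V \<cdot> v" using b(2) P_proj_arr[OF m v] by simp
  show ?thesis
    using poly_arr(3)[OF m v b(1) e] app_Hom[OF V v b(1) e] m
    by (intro sub_leI[of "app V v b" z]) (auto simp: Hom_def)
qed

text \<open>A polynomial functor turns a subobject into the families whose values all lie in it. The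
  values are lifted through the mono one by one, and because lifts are unique they form a natural
  family again.\<close>

lemma P_arr_factor:
  assumes m: "m \<in> Hom C V Y" "is_mono C m" and u: "u \<in> Hom C z (P_obj Y)"
    and mem: "\<And>t \<zeta> b. \<lbrakk>\<zeta> \<in> Hom C t z; b \<in> Hom C t (Dom C f); f \<cdot> b = P_proj Y \<cdot> (u \<cdot> \<zeta>)\<rbrakk>
      \<Longrightarrow> sub_le C (app Y (u \<cdot> \<zeta>) b) m"
  shows "\<exists>v. v \<in> Hom C z (P_obj V) \<and> P_arr m \<cdot> v = u"
proof -
  have O: "V \<in> Obj C" "Y \<in> Obj C" using m Hom_Obj by auto
  note P = poly_obj[OF O(2)] and PV = poly_obj[OF O(1)]
  define a where "a = P_proj Y \<cdot> u"
  have a: "a \<in> Hom C z (Cod C f)" unfolding a_def using P(2) u by (auto simp: Hom_def)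
  have a\<zeta>: "a \<cdot> \<zeta> = P_proj Y \<cdot> (u \<cdot> \<zeta>)" if "\<zeta> \<in> Hom C t z" for t \<zeta>
    unfolding a_def using that P(2) u by (simp add: Hom_def)
  have u\<zeta>: "u \<cdot> \<zeta> \<in> Hom C t (P_obj Y)" if "\<zeta> \<in> Hom C t z" for t \<zeta>
    using that u by (auto simp: Hom_def)
  define \<phi> where "\<phi> \<zeta> b = (SOME k. k \<in> Hom C (Dom C b) V \<and> m \<cdot> k = app Y (u \<cdot> \<zeta>) b)" for \<zeta> b
  have \<phi>: "\<phi> \<zeta> b \<in> Hom C t V" "m \<cdot> \<phi> \<zeta> b = app Y (u \<cdot> \<zeta>) b"
    if h: "\<zeta> \<in> Hom C t z" "b \<in> Hom C t (Dom C f)" "f \<cdot> b = a \<cdot> \<zeta>" for t \<zeta> b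
  proof -
    have e: "f \<cdot> b = P_proj Y \<cdot> (u \<cdot> \<zeta>)" using h(3) a\<zeta>[OF h(1)] by simp
    have "\<exists>k. k \<in> Hom C (Dom C b) V \<and> m \<cdot> k = app Y (u \<cdot> \<zeta>) b"
    proof (rule sub_leE[OF mem[OF h(1,2) e] app_Hom[OF O(2) u\<zeta>[OF h(1)] h(2) e]])
      fix k assume "k \<in> Hom C t (Dom C m)" "m \<cdot> k = app Y (u \<cdot> \<zeta>) b"
      moreover have "Dom C m = V" "Dom C b = t" using m(1) h(2) by (auto simp: Hom_def)
      ultimately show ?thesis by auto
    qed
    from someI_ex[OF this] show "\<phi> \<zeta> b \<in> Hom C t V" "m \<cdot> \<phi> \<zeta> b = app Y (u \<cdot> \<zeta>) b"
      unfolding \<phi>_def[symmetric] using h(2) by (auto simp: Hom_def)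
  qed
  have "is_family C f a V \<phi>"
    unfolding is_family_def
  proof (intro allI impI conjI ballI)
    fix t \<zeta> b assume "\<zeta> \<in> Hom C t (Dom C a) \<and> b \<in> Hom C t (Dom C f) \<and> f \<cdot> b = a \<cdot> \<zeta>"
    then have h: "\<zeta> \<in> Hom C t z" "b \<in> Hom C t (Dom C f)" "f \<cdot> b = a \<cdot> \<zeta>"
      using a by (auto simp: Hom_def)
    show "\<phi> \<zeta> b \<in> Hom C t V" using \<phi>(1)[OF h] .
    fix s k assume k: "k \<in> Hom C s t"
    have h': "\<zeta> \<cdot> k \<in> Hom C s z" "b \<cdot> k \<in> Hom C s (Dom C f)" using h k by (auto simp: Hom_def)
    have "f \<cdot> (b \<cdot> k) = a \<cdot> (\<zeta> \<cdot> k)"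
      using whisker[OF h(3), of k] h(1,2) k a f_arr by (auto simp: Hom_def)
    note h' = h' this
    have e: "f \<cdot> b = P_proj Y \<cdot> (u \<cdot> \<zeta>)" using h(3) a\<zeta>[OF h(1)] by simp
    have "m \<cdot> \<phi> (\<zeta> \<cdot> k) (b \<cdot> k) = app Y (u \<cdot> \<zeta> \<cdot> k) (b \<cdot> k)"
      using \<phi>(2)[OF h'] u h(1) k by (simp add: Hom_def)
    also have "\<dots> = m \<cdot> \<phi> \<zeta> b \<cdot> k" using app_comp[OF O(2) u\<zeta>[OF h(1)] h(2) e k] \<phi>(2)[OF h] by simp
    also have "\<dots> = m \<cdot> (\<phi> \<zeta> b \<cdot> k)" using \<phi>(1)[OF h] m(1) k by (simp add: Hom_def)
    finally show "\<phi> (\<zeta> \<cdot> k) (b \<cdot> k) = \<phi> \<zeta> b \<cdot> k"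
      by (rule monoD[OF m(2), where z = s]) (use \<phi>(1)[OF h] \<phi>(1)[OF h'] m(1) k in \<open>auto simp: Hom_def\<close>)
  qed
  from poly_obj_ex1[OF PV(1) a this] obtain v where vv: "v \<in> Hom C z (P_obj V) \<and> P_proj V \<cdot> v = a \<and>
      (\<forall>t \<zeta> b. \<zeta> \<in> Hom C t z \<and> b \<in> Hom C t (Dom C f) \<and> f \<cdot> b = a \<cdot> \<zeta> \<longrightarrow> app V (v \<cdot> \<zeta>) b = \<phi> \<zeta> b)"
    unfolding PV(3) by (rule ex1E)
  have v: "v \<in> Hom C z (P_obj V)" "P_proj V \<cdot> v = a"
    "\<And>t \<zeta> b. \<lbrakk>\<zeta> \<in> Hom C t z; b \<in> Hom C t (Dom C f); f \<cdot> b = a \<cdot> \<zeta>\<rbrakk> \<Longrightarrow> app V (v \<cdot> \<zeta>) b = \<phi> \<zeta> b"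
    using vv by blast+
  have mv: "P_arr m \<cdot> v \<in> Hom C z (P_obj Y)" using poly_arr(1)[OF m(1)] v(1) by (auto simp: Hom_def)
  have "u = P_arr m \<cdot> v"
  proof (rule app_ext[OF O(2) u mv])
    show "P_proj Y \<cdot> u = P_proj Y \<cdot> (P_arr m \<cdot> v)" using P_proj_arr[OF m(1) v(1)] v(2) a_def by simp
    fix t \<zeta> b assume h: "\<zeta> \<in> Hom C t z" "b \<in> Hom C t (Dom C f)" "f \<cdot> b = P_proj Y \<cdot> (u \<cdot> \<zeta>)"
    have h3: "f \<cdot> b = a \<cdot> \<zeta>" using h(3) a\<zeta>[OF h(1)] by simp
    have v\<zeta>: "v \<cdot> \<zeta> \<in> Hom C t (P_obj V)" using v(1) h(1) by (auto simp: Hom_def)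
    have "a \<cdot> \<zeta> = P_proj V \<cdot> (v \<cdot> \<zeta>)"
      using whisker[OF v(2), of \<zeta>] v(1) h(1) PV(2) by (simp add: Hom_def)
    then have e: "f \<cdot> b = P_proj V \<cdot> (v \<cdot> \<zeta>)" using h3 by simp
    have "P_arr m \<cdot> v \<cdot> \<zeta> = P_arr m \<cdot> (v \<cdot> \<zeta>)"
      using poly_arr(1)[OF m(1)] v(1) h(1) by (simp add: Hom_def)
    then show "app Y (u \<cdot> \<zeta>) b = app Y (P_arr m \<cdot> v \<cdot> \<zeta>) b"
      using poly_arr(3)[OF m(1) v\<zeta> h(2) e] v(3)[OF h(1,2) h3] \<phi>(2)[OF h(1,2) h3] by simp
  qed
  then show ?thesis using v(1) by blast
qed

abbreviation "closed Y \<equiv> closed_under C f (P_proj Y) (pb1 Y) (pb2 Y) (poly_ev C f Y)"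

lemma closedD:
  assumes "closed Y s m" "Y \<in> Obj C" "u \<in> Hom C z (P_obj Y)"
    "\<And>t \<zeta> b. \<lbrakk>\<zeta> \<in> Hom C t z; b \<in> Hom C t (Dom C f); f \<cdot> b = P_proj Y \<cdot> (u \<cdot> \<zeta>)\<rbrakk>
      \<Longrightarrow> sub_le C (app Y (u \<cdot> \<zeta>) b) m"
  shows "sub_le C (s \<cdot> u) m"
  using assms unfolding closed_under_def poly_obj(3)[OF assms(2)] by blast

lemma closedI:
  assumes "Y \<in> Obj C" "\<And>z u. \<lbrakk>u \<in> Hom C z (P_obj Y);
    \<And>t \<zeta> b. \<lbrakk>\<zeta> \<in> Hom C t z; b \<in> Hom C t (Dom C f); f \<cdot> b = P_proj Y \<cdot> (u \<cdot> \<zeta>)\<rbrakk>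
      \<Longrightarrow> sub_le C (app Y (u \<cdot> \<zeta>) b) m\<rbrakk> \<Longrightarrow> sub_le C (s \<cdot> u) m"
  shows "closed Y s m"
  using assms unfolding closed_under_def poly_obj(3)[OF assms(1)] by blast

text \<open>The structure map of a subalgebra is determined by its mono, and it exists exactly when
  the subobject is closed: closure is applied to the generic element \<open>P_arr m\<close> in one
  direction, and \<open>P_arr_factor\<close> gives the other.\<close>

lemma no_proper_subalgebras_iff:
  assumes Y: "Y \<in> Obj C" and s: "s \<in> Hom C (P_obj Y) Y"
  shows "no_proper_subalgebras C (poly C f) Y s \<longleftrightarrow>
    (\<forall>m. is_mono C m \<and> Cod C m = Y \<and> closed Y s m \<longrightarrow> is_iso C m)"
proof
  note P = poly_obj[OF Y]
  assume np: "no_proper_subalgebras C (poly C f) Y s"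
  show "\<forall>m. is_mono C m \<and> Cod C m = Y \<and> closed Y s m \<longrightarrow> is_iso C m"
  proof (intro allI impI)
    fix m assume h: "is_mono C m \<and> Cod C m = Y \<and> closed Y s m"
    define V where "V = Dom C m"
    have m: "m \<in> Hom C V Y" "is_mono C m" using h mono_arr unfolding V_def by (auto simp: Hom_def)
    have V: "V \<in> Obj C" using m Hom_Obj by blast
    note PV = poly_obj[OF V] and Pm = poly_arr(1)[OF m(1)]
    have "sub_le C (s \<cdot> P_arr m) m"
    proof (rule closedD[OF _ Y Pm])
      show "closed Y s m" using h by blast
      fix t \<zeta> b assume "\<zeta> \<in> Hom C t (P_obj V)" "b \<in> Hom C t (Dom C f)" "f \<cdot> b = P_proj Y \<cdot> (P_arr m \<cdot> \<zeta>)"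
      then show "sub_le C (app Y (P_arr m \<cdot> \<zeta>) b) m" by (rule app_P_arr_mem[OF m(1)])
    qed
    moreover have "s \<cdot> P_arr m \<in> Hom C (P_obj V) Y" using s Pm by (auto simp: Hom_def)
    ultimately obtain t where "t \<in> Hom C (P_obj V) V" "m \<cdot> t = s \<cdot> P_arr m"
      using sub_leE unfolding V_def by blast
    then have "is_subalgebra C (poly C f) V t Y s m"
      unfolding is_subalgebra_def is_algebra_hom_def is_algebra_def using V Y s m by simp
    then show "is_iso C m" using np unfolding no_proper_subalgebras_def by blast
  qed
next
  note P = poly_obj[OF Y]
  assume A: "\<forall>m. is_mono C m \<and> Cod C m = Y \<and> closed Y s m \<longrightarrow> is_iso C m"
  show "no_proper_subalgebras C (poly C f) Y s"
    unfolding no_proper_subalgebras_def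
  proof (intro notI, elim exE conjE)
    fix V t m assume sub: "is_subalgebra C (poly C f) V t Y s m" and ni: "\<not> is_iso C m"
    then have m: "m \<in> Hom C V Y" "is_mono C m" and t: "t \<in> Hom C (P_obj V) V" "m \<cdot> t = s \<cdot> P_arr m"
      unfolding is_subalgebra_def is_algebra_hom_def is_algebra_def by auto
    have "closed Y s m"
    proof (rule closedI[OF Y])
      fix z u assume u: "u \<in> Hom C z (P_obj Y)"
        and mem: "\<And>t \<zeta> b. \<lbrakk>\<zeta> \<in> Hom C t z; b \<in> Hom C t (Dom C f); f \<cdot> b = P_proj Y \<cdot> (u \<cdot> \<zeta>)\<rbrakk>
          \<Longrightarrow> sub_le C (app Y (u \<cdot> \<zeta>) b) m"
      obtain v where v: "v \<in> Hom C z (P_obj V)" "P_arr m \<cdot> v = u"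
        using P_arr_factor[OF m u] mem by blast
      have "m \<cdot> (t \<cdot> v) = s \<cdot> (P_arr m \<cdot> v)"
        using whisker[OF t(2), of v] v(1) t(1) m(1) s poly_arr(1)[OF m(1)] by (simp add: Hom_def)
      then show "sub_le C (s \<cdot> u) m"
        using v t(1) m(1) by (intro sub_leI[of "t \<cdot> v" z]) (auto simp: Hom_def)
    qed
    then show False using A m ni by (auto simp: Hom_def)
  qed
qed

text \<open>The first claim is Lambek's lemma. For the second, the map from \<open>W\<close> into a
  subalgebra given by initiality is a section of the inclusion, because the composite is an
  endomorphism of the initial algebra.\<close>

lemma W_type_iso_and_no_proper_subalgebras:
  assumes W: "is_W_type C f W \<sigma>"
  shows "is_iso C \<sigma>" "no_proper_subalgebras C (poly C f) W \<sigma>"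
proof -
  have alg: "is_algebra C (poly C f) W \<sigma>" and init: "\<And>V t. is_algebra C (poly C f) V t \<Longrightarrow>
      \<exists>!h. is_algebra_hom C (poly C f) W \<sigma> V t h"
    using W unfolding is_W_type_def by auto
  have WO: "W \<in> Obj C" and s: "\<sigma> \<in> Hom C (P_obj W) W" using alg unfolding is_algebra_def by auto
  note P = poly_obj[OF WO]
  have idh: "is_algebra_hom C (poly C f) W \<sigma> W \<sigma> (Id C W)"
    unfolding is_algebra_hom_def P_arr_Id[OF WO] using alg WO s by (auto simp: Hom_def)
  have endo: "k = Id C W" if "is_algebra_hom C (poly C f) W \<sigma> W \<sigma> k" for k
    using init[OF alg] idh that by blast
  have comp: "is_algebra_hom C (poly C f) W \<sigma> W \<sigma> (m \<cdot> h)"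
    if h: "is_algebra_hom C (poly C f) W \<sigma> V t h" and m: "is_algebra_hom C (poly C f) V t W \<sigma> m" for V t h m
  proof -
    have h': "h \<in> Hom C W V" "h \<cdot> \<sigma> = t \<cdot> P_arr h" "t \<in> Hom C (P_obj V) V"
      and m': "m \<in> Hom C V W" "m \<cdot> t = \<sigma> \<cdot> P_arr m"
      using h m unfolding is_algebra_hom_def is_algebra_def by auto
    note Ph = poly_arr(1)[OF h'(1)] and Pm = poly_arr(1)[OF m'(1)]
    have "m \<cdot> h \<cdot> \<sigma> = m \<cdot> (h \<cdot> \<sigma>)" using m'(1) h'(1) s by (simp add: Hom_def)
    also have "\<dots> = m \<cdot> (t \<cdot> P_arr h)" unfolding h'(2) ..
    also have "\<dots> = \<sigma> \<cdot> P_arr m \<cdot> P_arr h" by (rule whisker[OF m'(2)]) (use m'(1) h'(3) Ph in \<open>auto simp: Hom_def\<close>)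
    also have "\<dots> = \<sigma> \<cdot> P_arr (m \<cdot> h)" unfolding P_arr_comp[OF h'(1) m'(1)] using s Ph Pm by (simp add: Hom_def)
    finally have "m \<cdot> h \<cdot> \<sigma> = \<sigma> \<cdot> P_arr (m \<cdot> h)" .
    moreover have "m \<cdot> h \<in> Hom C W W" using m'(1) h'(1) by (auto simp: Hom_def)
    ultimately show ?thesis using alg unfolding is_algebra_hom_def by blast
  qed
  show "is_iso C \<sigma>"
  proof -
    note Ps = poly_arr(1)[OF s]
    have algP: "is_algebra C (poly C f) (P_obj W) (P_arr \<sigma>)" unfolding is_algebra_def using P(4) Ps by blast
    obtain h where h: "is_algebra_hom C (poly C f) W \<sigma> (P_obj W) (P_arr \<sigma>) h" using init[OF algP] by blast
    have h': "h \<in> Hom C W (P_obj W)" "h \<cdot> \<sigma> = P_arr \<sigma> \<cdot> P_arr h" using h unfolding is_algebra_hom_def by auto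
    have "is_algebra_hom C (poly C f) (P_obj W) (P_arr \<sigma>) W \<sigma> \<sigma>"
      unfolding is_algebra_hom_def using alg algP s by blast
    from endo[OF comp[OF h this]] have 1: "\<sigma> \<cdot> h = Id C W" .
    \<comment> \<open>As \<open>h\<close> is a morphism into \<open>P_obj W\<close>, this composite
      is \<open>P_arr (\<sigma> \<cdot> h)\<close>, and \<open>\<sigma> \<cdot> h\<close> is already
      known to be the identity.\<close>
    have "h \<cdot> \<sigma> = Id C (P_obj W)"
      unfolding h'(2) P_arr_comp[OF h'(1) s, symmetric] 1 by (rule P_arr_Id[OF WO])
    then show ?thesis using isoI[OF s h'(1)] 1 by blast
  qed
  show "no_proper_subalgebras C (poly C f) W \<sigma>"
    unfolding no_proper_subalgebras_def
  proof (intro notI, elim exE conjE)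
    fix V t m assume sub: "is_subalgebra C (poly C f) V t W \<sigma> m" and ni: "\<not> is_iso C m"
    then have m: "is_algebra_hom C (poly C f) V t W \<sigma> m" "is_mono C m" unfolding is_subalgebra_def by auto
    then have "is_algebra C (poly C f) V t" and mH: "m \<in> Hom C V W" unfolding is_algebra_hom_def by auto
    then obtain h where h: "is_algebra_hom C (poly C f) W \<sigma> V t h" using init by blast
    have "h \<in> Hom C W V" using h unfolding is_algebra_hom_def by blast
    then have "sub_le C (Id C W) m"
      using endo[OF comp[OF h m(1)]] mH by (intro sub_leI[of h W]) (auto simp: Hom_def)
    then show False using mono_split_iso[OF m(2) mH] ni by blast
  qed
qed

text \<open>The equalizer of the two morphisms is closed: if they agree on all values of
  \<open>u\<close>, then \<open>P_arr h\<close> and \<open>P_arr h'\<close> agree on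
  \<open>u\<close> by extensionality, hence \<open>h\<close> and \<open>h'\<close> agree on
  \<open>\<sigma> \<cdot> u\<close>.\<close>

lemma hom_unique:
  assumes closed_iso: "\<And>m. \<lbrakk>is_mono C m; Cod C m = W; closed W \<sigma> m\<rbrakk> \<Longrightarrow> is_iso C m"
    and h: "is_algebra_hom C (poly C f) W \<sigma> V t h" and h': "is_algebra_hom C (poly C f) W \<sigma> V t h'"
  shows "h = h'"
proof -
  have H: "h \<in> Hom C W V" "h \<cdot> \<sigma> = t \<cdot> P_arr h" and H': "h' \<in> Hom C W V" "h' \<cdot> \<sigma> = t \<cdot> P_arr h'"
    and s: "\<sigma> \<in> Hom C (P_obj W) W" and t: "t \<in> Hom C (P_obj V) V" and O: "W \<in> Obj C" "V \<in> Obj C"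
    using h h' unfolding is_algebra_hom_def is_algebra_def by auto
  obtain m where m: "is_mono C m" "Cod C m = W"
    "\<And>z x. x \<in> Hom C z W \<Longrightarrow> sub_le C x m \<longleftrightarrow> h \<cdot> x = h' \<cdot> x"
    by (rule equalizer[OF H(1) H'(1)]) (rule that)
  have "closed W \<sigma> m"
  proof (rule closedI[OF O(1)])
    fix z u assume u: "u \<in> Hom C z (P_obj W)"
      and mem: "\<And>t \<zeta> b. \<lbrakk>\<zeta> \<in> Hom C t z; b \<in> Hom C t (Dom C f); f \<cdot> b = P_proj W \<cdot> (u \<cdot> \<zeta>)\<rbrakk>
        \<Longrightarrow> sub_le C (app W (u \<cdot> \<zeta>) b) m"
    have Pu: "P_arr k \<cdot> u \<in> Hom C z (P_obj V)" if "k \<in> Hom C W V" for k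
      using poly_arr(1)[OF that] u by (auto simp: Hom_def)
    have "P_arr h \<cdot> u = P_arr h' \<cdot> u"
    proof (rule app_ext[OF O(2) Pu[OF H(1)] Pu[OF H'(1)]])
      show "P_proj V \<cdot> (P_arr h \<cdot> u) = P_proj V \<cdot> (P_arr h' \<cdot> u)"
        using P_proj_arr[OF H(1) u] P_proj_arr[OF H'(1) u] by simp
      fix t \<zeta> b assume g: "\<zeta> \<in> Hom C t z" "b \<in> Hom C t (Dom C f)" "f \<cdot> b = P_proj V \<cdot> (P_arr h \<cdot> u \<cdot> \<zeta>)"
      have u\<zeta>: "u \<cdot> \<zeta> \<in> Hom C t (P_obj W)" using u g(1) by (auto simp: Hom_def)
      have as: "P_arr k \<cdot> u \<cdot> \<zeta> = P_arr k \<cdot> (u \<cdot> \<zeta>)" if "k \<in> Hom C W V" for k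
        using poly_arr(1)[OF that] u g(1) by (simp add: Hom_def)
      have e: "f \<cdot> b = P_proj W \<cdot> (u \<cdot> \<zeta>)" using g(3) P_proj_arr[OF H(1) u\<zeta>] as[OF H(1)] by simp
      have "h \<cdot> app W (u \<cdot> \<zeta>) b = h' \<cdot> app W (u \<cdot> \<zeta>) b"
        using m(3)[OF app_Hom[OF O(1) u\<zeta> g(2) e]] mem[OF g(1,2) e] by blast
      then show "app V (P_arr h \<cdot> u \<cdot> \<zeta>) b = app V (P_arr h' \<cdot> u \<cdot> \<zeta>) b"
        using poly_arr(3)[OF H(1) u\<zeta> g(2) e] poly_arr(3)[OF H'(1) u\<zeta> g(2) e] as H(1) H'(1) by simp
    qed
    moreover have "h \<cdot> (\<sigma> \<cdot> u) = t \<cdot> (P_arr h \<cdot> u)" "h' \<cdot> (\<sigma> \<cdot> u) = t \<cdot> (P_arr h' \<cdot> u)"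
      using whisker[OF H(2), of u] whisker[OF H'(2), of u] H(1) H'(1) s t u
        poly_arr(1)[OF H(1)] poly_arr(1)[OF H'(1)] by (simp_all add: Hom_def)
    moreover have "\<sigma> \<cdot> u \<in> Hom C z W" using s u by (auto simp: Hom_def)
    ultimately show "sub_le C (\<sigma> \<cdot> u) m" using m(3) by simp
  qed
  then have "is_iso C m" using closed_iso m by blast
  then have "sub_le C (Id C W) m"
    using sub_le_iso[of m "Dom C m" W] m mono_arr Id_in_Hom[OF O(1)] by (auto simp: Hom_def)
  then show "h = h'" using m(3)[OF Id_in_Hom[OF O(1)]] H H' by (simp add: Hom_def)
qed

text \<open>Translates the premise condition of a rule system into one on values, for the system
  whose premises are indexed by \<open>pb1 Y\<close>: its fibre over \<open>u\<close> consists of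
  the arguments of the family \<open>u\<close>.\<close>

lemma forall_along_app:
  assumes Y: "Y \<in> Obj C" and u: "u \<in> Hom C z (P_obj Y)"
  shows "forall_along C (pb1 Y) (\<lambda>\<nu>. sub_le C (poly_ev C f Y \<cdot> \<nu>) m) u \<longleftrightarrow>
    (\<forall>t \<zeta> b. \<zeta> \<in> Hom C t z \<and> b \<in> Hom C t (Dom C f) \<and> f \<cdot> b = P_proj Y \<cdot> (u \<cdot> \<zeta>) \<longrightarrow>
      sub_le C (app Y (u \<cdot> \<zeta>) b) m)" (is "?L \<longleftrightarrow> ?R")
proof
  note P = poly_obj[OF Y]
  note pb = poly_objD(1)[OF P(1)]
  note PB = pullbackD[OF pb]
  have uD: "Dom C u = z" using u by (simp add: Hom_def)
  {
    assume L: ?L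
    show ?R
    proof (intro allI impI)
      fix t \<zeta> b assume h: "\<zeta> \<in> Hom C t z \<and> b \<in> Hom C t (Dom C f) \<and> f \<cdot> b = P_proj Y \<cdot> (u \<cdot> \<zeta>)"
      have "u \<cdot> \<zeta> \<in> Hom C t (Dom C (P_proj Y))" unfolding P(3) using u h by (auto simp: Hom_def)
      note l = pb_lift[OF pb this, of b]
      show "sub_le C (app Y (u \<cdot> \<zeta>) b) m"
        unfolding papp_def by (rule forall_alongD[OF L u]) (use h l in auto)
    qed
  next
    assume R: ?R
    show ?L
      unfolding forall_along_def uD
    proof (intro allI impI)
      fix t \<zeta> \<nu> assume h: "\<zeta> \<in> Hom C t z \<and> \<nu> \<in> Hom C t (Dom C (pb1 Y)) \<and> pb1 Y \<cdot> \<nu> = u \<cdot> \<zeta>"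
      have q\<nu>: "pb2 Y \<cdot> \<nu> \<in> Hom C t (Dom C f)" using h PB(4-8) by (auto simp: Hom_def)
      have "f \<cdot> (pb2 Y \<cdot> \<nu>) = P_proj Y \<cdot> (pb1 Y \<cdot> \<nu>)"
        using whisker[OF PB(9), of \<nu>] h PB(1-8) by (auto simp: Hom_def)
      then have "sub_le C (app Y (u \<cdot> \<zeta>) (pb2 Y \<cdot> \<nu>)) m" using R h q\<nu> by metis
      moreover have "pb_lift C (pb1 Y) (pb2 Y) (u \<cdot> \<zeta>) (pb2 Y \<cdot> \<nu>) = \<nu>" using pb_lift_eq[OF pb] h by blast
      ultimately show "sub_le C (poly_ev C f Y \<cdot> \<nu>) m" unfolding papp_def by simp
    qed
  }
qed

text \<open>Smallness enters through \<open>ind\<close> alone, which provides generated subobjects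
  for every pullback of \<open>f\<close>. In this form the argument also runs in a slice, where no
  class of small maps has been set up.\<close>

lemma W_type_if_no_closed_subobjects:
  assumes alg: "is_algebra C (poly C f) W \<sigma>" and iso: "is_iso C \<sigma>"
    and closed_iso: "\<And>m. \<lbrakk>is_mono C m; Cod C m = W; closed W \<sigma> m\<rbrakk> \<Longrightarrow> is_iso C m"
    and ind: "\<And>h n k. is_pullback C h f n k \<Longrightarrow> has_inductive_subobjects C n"
  shows "is_W_type C f W \<sigma>"
  unfolding is_W_type_def
proof (intro conjI allI impI)
  show "is_algebra C (poly C f) W \<sigma>" by (fact alg)
  fix V t assume algV: "is_algebra C (poly C f) V t"
  have W: "W \<in> Obj C" and s: "\<sigma> \<in> Hom C (P_obj W) W" and V: "V \<in> Obj C" and t: "t \<in> Hom C (P_obj V) V"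
    using alg algV unfolding is_algebra_def by auto
  have smono: "is_mono C \<sigma>" using iso_mono[OF iso s] .
  define Y where "Y = prod_obj C W V"
  define x where "x = pr1 C W V"
  define y where "y = pr2 C W V"
  have x: "x \<in> Hom C Y W" and y: "y \<in> Hom C Y V" unfolding x_def y_def Y_def using pr_Hom W V by auto
  have Y: "Y \<in> Obj C" using x Hom_Obj by blast
  note PY = poly_obj[OF Y] and PW = poly_obj[OF W] and PV = poly_obj[OF V]
  note Px = poly_arr(1)[OF x] and Py = poly_arr(1)[OF y]
  have xyext: "k = k'" if "k \<in> Hom C z Y" "k' \<in> Hom C z Y" "x \<cdot> k = x \<cdot> k'" "y \<cdot> k = y \<cdot> k'" for k k' z
    using product_ext[OF W V] that unfolding x_def y_def Y_def by blast
  \<comment> \<open>The rules: an element of \<open>P_obj Y\<close> is a family of pairs, and it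
    derives the pair obtained by applying the two structure maps to its components.\<close>
  define \<beta> where "\<beta> = pairing C (\<sigma> \<cdot> P_arr x) (t \<cdot> P_arr y)"
  have "\<sigma> \<cdot> P_arr x \<in> Hom C (P_obj Y) W" "t \<cdot> P_arr y \<in> Hom C (P_obj Y) V"
    using s t Px Py by (auto simp: Hom_def)
  note \<beta> = pairing[OF this, folded \<beta>_def x_def y_def Y_def]
  have x\<beta>: "x \<cdot> (\<beta> \<cdot> u) = \<sigma> \<cdot> (P_arr x \<cdot> u)" and y\<beta>: "y \<cdot> (\<beta> \<cdot> u) = t \<cdot> (P_arr y \<cdot> u)"
    if "u \<in> Hom C z (P_obj Y)" for u z
    using whisker[OF \<beta>(2), of u] whisker[OF \<beta>(3), of u] that \<beta>(1) x y s t Px Py by (simp_all add: Hom_def)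
  define n where "n = pb1 Y"
  have n: "is_pullback C (P_proj Y) f n (pb2 Y)" unfolding n_def using poly_objD(1)[OF PY(1)] .
  have nC: "Cod C n = P_obj Y" using pullbackD(7)[OF n] PY(3) by simp
  have ev: "poly_ev C f Y \<in> Hom C (Dom C n) Y" unfolding n_def using poly_objD(2)[OF PY(1)] .
  have \<beta>n: "\<beta> \<in> Hom C (Cod C n) Y" using \<beta>(1) nC by simp
  \<comment> \<open>\<open>g_post\<close> is backward closure of the relation,
    \<open>g_closed\<close> its forward closure.\<close>
  obtain g where g: "is_mono C g" "Cod C g = Y"
    and g_post: "\<And>z k. k \<in> Hom C z Y \<Longrightarrow> sub_le C k g \<Longrightarrow> \<exists>r e u. is_epi C e \<and> e \<in> Hom C r z \<and>
       u \<in> Hom C r (P_obj Y) \<and> \<beta> \<cdot> u = k \<cdot> e \<and>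
       forall_along C n (\<lambda>\<nu>. sub_le C (poly_ev C f Y \<cdot> \<nu>) g) u"
    and g_closed: "\<And>z u. u \<in> Hom C z (P_obj Y) \<Longrightarrow>
       forall_along C n (\<lambda>\<nu>. sub_le C (poly_ev C f Y \<cdot> \<nu>) g) u \<Longrightarrow> sub_le C (\<beta> \<cdot> u) g"
    by (rule has_inductive_subobjectsE[OF ind[OF n] ev \<beta>n, unfolded nC]) (rule that)
  have fa: "forall_along C n (\<lambda>\<nu>. sub_le C (poly_ev C f Y \<cdot> \<nu>) m) u \<longleftrightarrow>
    (\<forall>t \<zeta> b. \<zeta> \<in> Hom C t z \<and> b \<in> Hom C t (Dom C f) \<and> f \<cdot> b = P_proj Y \<cdot> (u \<cdot> \<zeta>) \<longrightarrow>
      sub_le C (app Y (u \<cdot> \<zeta>) b) m)" if "u \<in> Hom C z (P_obj Y)" for u z m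
    unfolding n_def by (rule forall_along_app[OF Y that])
  define G where "G = Dom C g"
  have gH: "g \<in> Hom C G Y" using mono_arr[OF g(1)] g(2) unfolding G_def by (simp add: Hom_def)
  have GO: "G \<in> Obj C" using gH Hom_Obj by blast
  define gx where "gx = x \<cdot> g"
  have gx: "gx \<in> Hom C G W" unfolding gx_def using x gH by (auto simp: Hom_def)
  have gxk: "gx \<cdot> k = x \<cdot> (g \<cdot> k)" if "k \<in> Hom C z G" for k z
    unfolding gx_def using that x gH by (simp add: Hom_def)
  have gk: "g \<cdot> k \<in> Hom C z Y" "sub_le C (g \<cdot> k) g" if "k \<in> Hom C z G" for k z
    using that gH G_def by (auto simp: Hom_def intro!: sub_leI[of k z])
  have gE: "\<exists>k. k \<in> Hom C z G \<and> g \<cdot> k = v" if "sub_le C v g" "v \<in> Hom C z Y" for v z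
    using sub_leE[OF that] unfolding G_def by blast

  text \<open>By induction on \<open>W\<close>, any two elements of \<open>G\<close> with the same first component agree.\<close>
  have gx_mono: "is_mono C gx"
  proof -
    obtain z1 z2 where K: "is_pullback C gx gx z1 z2" using lex_pullbacks[of gx gx] gx by (auto simp: Hom_def)
    have z: "z1 \<in> Hom C (Dom C z1) G" "z2 \<in> Hom C (Dom C z1) G" using pullbackD[OF K] gx by (auto simp: Hom_def)
    have gz: "gx \<cdot> z1 \<in> Hom C (Dom C z1) W" using gx z by (auto simp: Hom_def)
    \<comment> \<open>\<open>\<Phi> w\<close> says that any two elements of \<open>G\<close> over
      \<open>w\<close>, at any later stage, are equal. It is expressed through the kernel pair
      \<open>z1\<close>, \<open>z2\<close> of \<open>gx\<close> so as to be representable.\<close>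
    define \<Phi> where "\<Phi> = forall_along C (gx \<cdot> z1) (\<lambda>v. z1 \<cdot> v = z2 \<cdot> v)"
    have \<Phi>D: "l = l'" if \<Phi>w: "\<Phi> w" and h: "w \<in> Hom C r W" "l \<in> Hom C r G" "l' \<in> Hom C r G" "gx \<cdot> l = w" "gx \<cdot> l' = w" for w r l l'
    proof -
      obtain v where v: "v \<in> Hom C r (Dom C z1)" "z1 \<cdot> v = l" "z2 \<cdot> v = l'"
        using pullbackE[OF K, of l r l'] h gx by (auto simp: Hom_def)
      have rO: "r \<in> Obj C" using h Hom_Obj by blast
      have "z1 \<cdot> v = z2 \<cdot> v"
      proof (rule forall_alongD[OF \<Phi>w[unfolded \<Phi>_def] h(1) Id_in_Hom[OF rO]])
        show "v \<in> Hom C r (Dom C (gx \<cdot> z1))" using v(1) gz by (simp add: Hom_def)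
        show "gx \<cdot> z1 \<cdot> v = w \<cdot> Id C r" using v(1,2) z(1) gx h(1,4) by (simp add: Hom_def)
      qed
      then show ?thesis using v by simp
    qed
    have \<Phi>I: "\<Phi> w" if w: "w \<in> Hom C r W" and a: "\<And>q \<zeta> l l'. \<lbrakk>\<zeta> \<in> Hom C q r; l \<in> Hom C q G; l' \<in> Hom C q G;
        gx \<cdot> l = w \<cdot> \<zeta>; gx \<cdot> l' = w \<cdot> \<zeta>\<rbrakk> \<Longrightarrow> l = l'" for w r
      unfolding \<Phi>_def forall_along_def
    proof (intro allI impI)
      fix q \<zeta> v assume h: "\<zeta> \<in> Hom C q (Dom C w) \<and> v \<in> Hom C q (Dom C (gx \<cdot> z1)) \<and> gx \<cdot> z1 \<cdot> v = w \<cdot> \<zeta>"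
      have v: "v \<in> Hom C q (Dom C z1)" and \<zeta>: "\<zeta> \<in> Hom C q r" using h gz w by (auto simp: Hom_def)
      have zv: "z1 \<cdot> v \<in> Hom C q G" "z2 \<cdot> v \<in> Hom C q G" using v z by (auto simp: Hom_def)
      have 1: "gx \<cdot> z1 \<cdot> v = gx \<cdot> (z1 \<cdot> v)" using v z gx by (simp add: Hom_def)
      have 2: "gx \<cdot> (z1 \<cdot> v) = gx \<cdot> (z2 \<cdot> v)"
        using whisker[OF pullbackD(9)[OF K], of v] v z gx by (simp add: Hom_def)
      show "z1 \<cdot> v = z2 \<cdot> v" by (rule a[OF \<zeta> zv]) (use h 1 2 in auto)
    qed
    have "representable C W \<Phi>" unfolding \<Phi>_def by (rule representable_forall[OF gz representable_eq[OF z]])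
    then obtain d where d: "is_mono C d" "d \<in> Hom C (Dom C d) W"
      "\<And>z w. w \<in> Hom C z W \<Longrightarrow> sub_le C w d \<longleftrightarrow> \<Phi> w" using representableE by blast
    have "closed W \<sigma> d"
    proof (rule closedI[OF W])
      fix z u assume u: "u \<in> Hom C z (P_obj W)"
        and mem: "\<And>t \<zeta> b. \<lbrakk>\<zeta> \<in> Hom C t z; b \<in> Hom C t (Dom C f); f \<cdot> b = P_proj W \<cdot> (u \<cdot> \<zeta>)\<rbrakk>
          \<Longrightarrow> sub_le C (app W (u \<cdot> \<zeta>) b) d"
      have su: "\<sigma> \<cdot> u \<in> Hom C z W" using s u by (auto simp: Hom_def)
      have "\<Phi> (\<sigma> \<cdot> u)"
      proof (rule \<Phi>I[OF su])
        fix q \<zeta> l l' assume h: "\<zeta> \<in> Hom C q z" "l \<in> Hom C q G" "l' \<in> Hom C q G"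
          "gx \<cdot> l = \<sigma> \<cdot> u \<cdot> \<zeta>" "gx \<cdot> l' = \<sigma> \<cdot> u \<cdot> \<zeta>"
        obtain r e v where v: "is_epi C e" "e \<in> Hom C r q" "v \<in> Hom C r (P_obj Y)" "\<beta> \<cdot> v = g \<cdot> l \<cdot> e"
          "forall_along C n (\<lambda>\<nu>. sub_le C (poly_ev C f Y \<cdot> \<nu>) g) v"
          using g_post[OF gk[OF h(2)]] by blast
        have l'e: "l' \<cdot> e \<in> Hom C r G" using h(3) v(2) by (auto simp: Hom_def)
        \<comment> \<open>The second element is first restricted along \<open>e\<close>, so that its
          rule is found over the stage of the first rule; \<open>v1\<close> below is the first rule
          at the common stage \<open>r'\<close>.\<close>
        obtain r' e' v' where v': "is_epi C e'" "e' \<in> Hom C r' r" "v' \<in> Hom C r' (P_obj Y)" "\<beta> \<cdot> v' = g \<cdot> (l' \<cdot> e) \<cdot> e'"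
          "forall_along C n (\<lambda>\<nu>. sub_le C (poly_ev C f Y \<cdot> \<nu>) g) v'"
          using g_post[OF gk[OF l'e]] by blast
        define v1 where "v1 = v \<cdot> e'"
        define \<xi> where "\<xi> = \<zeta> \<cdot> (e \<cdot> e')"
        have ty: "v1 \<in> Hom C r' (P_obj Y)" "\<xi> \<in> Hom C r' z" "e \<cdot> e' \<in> Hom C r' q"
          unfolding v1_def \<xi>_def using v(2,3) v'(2) h(1) by (auto simp: Hom_def)
        have u\<xi>: "u \<cdot> \<xi> \<in> Hom C r' (P_obj W)" using u ty by (auto simp: Hom_def)
        have b1: "\<beta> \<cdot> v1 = g \<cdot> (l \<cdot> (e \<cdot> e'))"
          unfolding v1_def using whisker[OF v(4), of e'] v(2,3) v'(2) \<beta>(1) gH h(2) by (simp add: Hom_def)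
        have b2: "\<beta> \<cdot> v' = g \<cdot> (l' \<cdot> (e \<cdot> e'))"
          using v'(4) v(2) v'(2) gH h(3) by (simp add: Hom_def)
        have lee: "l \<cdot> (e \<cdot> e') \<in> Hom C r' G" "l' \<cdot> (e \<cdot> e') \<in> Hom C r' G" using h ty by (auto simp: Hom_def)
        have su\<xi>: "\<sigma> \<cdot> (u \<cdot> \<xi>) = \<sigma> \<cdot> u \<cdot> \<zeta> \<cdot> (e \<cdot> e')"
          unfolding \<xi>_def using s u h(1) ty(3) by (simp add: Hom_def)
        \<comment> \<open>Here \<open>\<sigma>\<close> being monic enters: both rules derive pairs
          with the same first component, which is a restriction of
          \<open>\<sigma> \<cdot> u\<close>, so the first components of both families of premises
          are those of \<open>u \<cdot> \<xi>\<close>.\<close>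
        have P1: "P_arr x \<cdot> w = u \<cdot> \<xi>"
          if w: "w \<in> Hom C r' (P_obj Y)" "\<beta> \<cdot> w = g \<cdot> (k \<cdot> (e \<cdot> e'))" "k \<in> Hom C q G" "gx \<cdot> k = \<sigma> \<cdot> u \<cdot> \<zeta>" for w k
        proof -
          have kee: "k \<cdot> (e \<cdot> e') \<in> Hom C r' G" using w(3) ty by (auto simp: Hom_def)
          have "\<sigma> \<cdot> (P_arr x \<cdot> w) = gx \<cdot> (k \<cdot> (e \<cdot> e'))" using x\<beta>[OF w(1)] w(2) gxk[OF kee] by simp
          also have "\<dots> = \<sigma> \<cdot> (u \<cdot> \<xi>)"
            unfolding su\<xi> by (rule whisker[OF w(4)]) (use gx w(3) ty(3) in \<open>auto simp: Hom_def\<close>)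
          finally show ?thesis
            by (rule monoD[OF smono, where z = r']) (use Px w(1) u\<xi> s in \<open>auto simp: Hom_def\<close>)
        qed
        note P1v = P1[OF ty(1) b1 h(2,4)] and P1v' = P1[OF v'(3) b2 h(3,5)]
        have "v1 = v'"
        proof (rule app_ext[OF Y ty(1) v'(3)])
          show "P_proj Y \<cdot> v1 = P_proj Y \<cdot> v'"
            using P_proj_arr[OF x ty(1)] P_proj_arr[OF x v'(3)] P1v P1v' by simp
          fix i \<eta> b assume a: "\<eta> \<in> Hom C i r'" "b \<in> Hom C i (Dom C f)" "f \<cdot> b = P_proj Y \<cdot> (v1 \<cdot> \<eta>)"
          have t2: "v1 \<cdot> \<eta> \<in> Hom C i (P_obj Y)" "v' \<cdot> \<eta> \<in> Hom C i (P_obj Y)" "\<xi> \<cdot> \<eta> \<in> Hom C i z"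
            "u \<cdot> (\<xi> \<cdot> \<eta>) \<in> Hom C i (P_obj W)" "e' \<cdot> \<eta> \<in> Hom C i r"
            using ty v'(2,3) a(1) u by (auto simp: Hom_def)
          have Pv: "P_arr x \<cdot> (v1 \<cdot> \<eta>) = u \<cdot> (\<xi> \<cdot> \<eta>)" "P_arr x \<cdot> (v' \<cdot> \<eta>) = u \<cdot> (\<xi> \<cdot> \<eta>)"
            using whisker[OF P1v, of \<eta>] whisker[OF P1v', of \<eta>] Px ty v'(3) a(1) u by (simp_all add: Hom_def)
          have e1: "f \<cdot> b = P_proj W \<cdot> (u \<cdot> (\<xi> \<cdot> \<eta>))" using a(3) P_proj_arr[OF x t2(1)] Pv(1) by simp
          have e2: "f \<cdot> b = P_proj Y \<cdot> (v' \<cdot> \<eta>)" using e1 P_proj_arr[OF x t2(2)] Pv(2) by simp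
          have v1\<eta>: "v1 \<cdot> \<eta> = v \<cdot> (e' \<cdot> \<eta>)" unfolding v1_def using v(3) v'(2) a(1) by (simp add: Hom_def)
          define c where "c = app Y (v1 \<cdot> \<eta>) b"
          define c' where "c' = app Y (v' \<cdot> \<eta>) b"
          have cY: "c \<in> Hom C i Y" "c' \<in> Hom C i Y"
            unfolding c_def c'_def using app_Hom[OF Y t2(1) a(2,3)] app_Hom[OF Y t2(2) a(2) e2] by auto
          have xc: "x \<cdot> c = app W (u \<cdot> (\<xi> \<cdot> \<eta>)) b" "x \<cdot> c' = app W (u \<cdot> (\<xi> \<cdot> \<eta>)) b"
            unfolding c_def c'_def using poly_arr(3)[OF x t2(1) a(2,3)] poly_arr(3)[OF x t2(2) a(2) e2] Pv by auto
          have "sub_le C c g" unfolding c_def v1\<eta>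
            using v(5)[unfolded fa[OF v(3)]] t2(5) a(2,3) unfolding v1\<eta> by blast
          then obtain m where m: "m \<in> Hom C i G" "g \<cdot> m = c" using gE cY(1) by blast
          have "sub_le C c' g" unfolding c'_def
            using v'(5)[unfolded fa[OF v'(3)]] a(1,2) e2 by blast
          then obtain m' where m': "m' \<in> Hom C i G" "g \<cdot> m' = c'" using gE cY(2) by blast
          have aW: "app W (u \<cdot> (\<xi> \<cdot> \<eta>)) b \<in> Hom C i W" using app_Hom[OF W t2(4) a(2) e1] .
          \<comment> \<open>Induction hypothesis: corresponding premises lie in \<open>G\<close>
            over the same element of \<open>W\<close>, so they agree, and therefore so do the two
            rules.\<close>
          have "\<Phi> (app W (u \<cdot> (\<xi> \<cdot> \<eta>)) b)" using mem[OF t2(3) a(2) e1] d(3)[OF aW] by blast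
          then have "m = m'"
            by (rule \<Phi>D[OF _ aW m(1) m'(1)]) (use gxk[OF m(1)] gxk[OF m'(1)] m(2) m'(2) xc in auto)
          then show "app Y (v1 \<cdot> \<eta>) b = app Y (v' \<cdot> \<eta>) b" using m(2) m'(2) unfolding c_def c'_def by simp
        qed
        \<comment> \<open>Equal rules have equal conclusions; cancelling the mono \<open>g\<close>
          and the epis \<open>e'\<close> and \<open>e\<close> returns to the original stage.\<close>
        then have "g \<cdot> (l \<cdot> (e \<cdot> e')) = g \<cdot> (l' \<cdot> (e \<cdot> e'))" using b1 b2 by simp
        then have "l \<cdot> (e \<cdot> e') = l' \<cdot> (e \<cdot> e')"
          using monoD[OF g(1) _ lee[unfolded G_def]] by blast
        then have "l \<cdot> e \<cdot> e' = l' \<cdot> e \<cdot> e'" using h(2,3) v(2) v'(2) by (simp add: Hom_def)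
        then have "l \<cdot> e = l' \<cdot> e"
          by (rule epiD[OF v'(1), where y = G]) (use h(2,3) v(2) v'(2) in \<open>auto simp: Hom_def\<close>)
        then show "l = l'"
          by (rule epiD[OF v(1), where y = G]) (use h(2,3) v(2) in \<open>auto simp: Hom_def\<close>)
      qed
      then show "sub_le C (\<sigma> \<cdot> u) d" using d(3)[OF su] by blast
    qed
    then have "is_iso C d" using closed_iso d(1,2) by (simp add: Hom_def)
    then have \<Phi>all: "\<Phi> w" if "w \<in> Hom C z W" for w z using sub_le_iso[OF _ d(2) that] d(3)[OF that] by blast
    show ?thesis
    proof (rule monoI[OF gx])
      fix z k k' assume h: "k \<in> Hom C z G" "k' \<in> Hom C z G" "gx \<cdot> k = gx \<cdot> k'"
      have "gx \<cdot> k \<in> Hom C z W" using gx h(1) by (auto simp: Hom_def)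
      then show "k = k'" using \<Phi>D[OF \<Phi>all _ h(1,2) refl h(3)[symmetric]] by blast
    qed
  qed

  \<comment> \<open>Monicity of \<open>gx\<close> allows all second components to be picked at once:
    a family with values in its image comes from a family \<open>v\<close> in \<open>G\<close>, and
    \<open>w\<close> is the resulting family of pairs.\<close>
  have "closed W \<sigma> gx"
  proof (rule closedI[OF W])
    fix z u assume u: "u \<in> Hom C z (P_obj W)"
      and mem: "\<And>t \<zeta> b. \<lbrakk>\<zeta> \<in> Hom C t z; b \<in> Hom C t (Dom C f); f \<cdot> b = P_proj W \<cdot> (u \<cdot> \<zeta>)\<rbrakk>
        \<Longrightarrow> sub_le C (app W (u \<cdot> \<zeta>) b) gx"
    obtain v where v: "v \<in> Hom C z (P_obj G)" "P_arr gx \<cdot> v = u"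
      using P_arr_factor[OF gx gx_mono u] mem by blast
    define w where "w = P_arr g \<cdot> v"
    have w: "w \<in> Hom C z (P_obj Y)" unfolding w_def using poly_arr(1)[OF gH] v(1) by (auto simp: Hom_def)
    have Pw: "P_arr x \<cdot> w = u"
      using v(2) unfolding gx_def P_arr_comp[OF gH x] w_def
      using v(1) Px poly_arr(1)[OF gH] by (simp add: Hom_def)
    have "sub_le C (\<beta> \<cdot> w) g"
    proof (rule g_closed[OF w], subst fa[OF w], intro allI impI)
      fix t \<zeta> b assume h: "\<zeta> \<in> Hom C t z \<and> b \<in> Hom C t (Dom C f) \<and> f \<cdot> b = P_proj Y \<cdot> (w \<cdot> \<zeta>)"
      have 1: "w \<cdot> \<zeta> = P_arr g \<cdot> (v \<cdot> \<zeta>)"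
        unfolding w_def using h v(1) poly_arr(1)[OF gH] by (simp add: Hom_def)
      have "v \<cdot> \<zeta> \<in> Hom C t (P_obj G)" using h v(1) by (auto simp: Hom_def)
      then show "sub_le C (app Y (w \<cdot> \<zeta>) b) g" using app_P_arr_mem[OF gH] h unfolding 1 by blast
    qed
    moreover have "\<beta> \<cdot> w \<in> Hom C z Y" using \<beta>(1) w by (auto simp: Hom_def)
    ultimately obtain k where k: "k \<in> Hom C z G" "g \<cdot> k = \<beta> \<cdot> w" using gE by blast
    have "gx \<cdot> k = \<sigma> \<cdot> u" using gxk[OF k(1)] k(2) x\<beta>[OF w] Pw by simp
    then show "sub_le C (\<sigma> \<cdot> u) gx" using k(1) gx by (intro sub_leI[of k z]) (auto simp: Hom_def)
  qed
  then have "is_iso C gx" using closed_iso gx_mono gx by (simp add: Hom_def)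
  \<comment> \<open>\<open>G\<close> is now the graph of a map: \<open>r\<close> inverts its first
    projection, and \<open>h\<close> reads off the second component.\<close>
  then obtain r where r: "r \<in> Hom C W G" "r \<cdot> gx = Id C G" "gx \<cdot> r = Id C W" using isoE gx by blast
  define gr where "gr = g \<cdot> r"
  define h where "h = y \<cdot> gr"
  have gr: "gr \<in> Hom C W Y" unfolding gr_def using gH r(1) by (auto simp: Hom_def)
  have h: "h \<in> Hom C W V" unfolding h_def using y gr by (auto simp: Hom_def)
  have xgr: "x \<cdot> gr = Id C W" using r(3) gxk[OF r(1)] unfolding gr_def by simp
  \<comment> \<open>That \<open>h\<close> is a morphism is tested on the generic element of
    \<open>P_obj W\<close>: the pairs formed from its values lie in \<open>G\<close>, hence so does
    the pair derived from them.\<close>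
  define w where "w = P_arr gr"
  have w: "w \<in> Hom C (P_obj W) (P_obj Y)" unfolding w_def using poly_arr(1)[OF gr] .
  have "sub_le C (\<beta> \<cdot> w) g"
  proof (rule g_closed[OF w], subst fa[OF w], intro allI impI)
    fix t \<zeta> b assume a: "\<zeta> \<in> Hom C t (P_obj W) \<and> b \<in> Hom C t (Dom C f) \<and> f \<cdot> b = P_proj Y \<cdot> (w \<cdot> \<zeta>)"
    have e: "f \<cdot> b = P_proj W \<cdot> \<zeta>" using a P_proj_arr[OF gr, of \<zeta> t] unfolding w_def by simp
    have aW: "app W \<zeta> b \<in> Hom C t W" using app_Hom[OF W _ _ e] a by blast
    have "app Y (w \<cdot> \<zeta>) b = gr \<cdot> app W \<zeta> b" unfolding w_def using poly_arr(3)[OF gr _ _ e] a by blast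
    also have "\<dots> = g \<cdot> (r \<cdot> app W \<zeta> b)" unfolding gr_def using gH r(1) aW by (simp add: Hom_def)
    finally show "sub_le C (app Y (w \<cdot> \<zeta>) b) g"
      using gk(2)[of "r \<cdot> app W \<zeta> b" t] r(1) aW by (auto simp: Hom_def)
  qed
  moreover have \<beta>w: "\<beta> \<cdot> w \<in> Hom C (P_obj W) Y" using \<beta>(1) w by (auto simp: Hom_def)
  ultimately obtain k where k: "k \<in> Hom C (P_obj W) G" "g \<cdot> k = \<beta> \<cdot> w" using gE by blast
  have "gx \<cdot> k = \<sigma> \<cdot> (P_arr x \<cdot> w)" using gxk[OF k(1)] k(2) x\<beta>[OF w] by simp
  also have "P_arr x \<cdot> w = Id C (P_obj W)"
    unfolding w_def P_arr_comp[OF gr x, symmetric] xgr by (rule P_arr_Id[OF W])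
  finally have gxk\<sigma>: "gx \<cdot> k = \<sigma>" using s PW(4) by (simp add: Hom_def)
  have "r \<cdot> \<sigma> = k"
    using whisker[OF r(2), of k] r(1) gx k(1) gxk\<sigma> by (auto simp: Hom_def)
  then have "gr \<cdot> \<sigma> = \<beta> \<cdot> w" unfolding gr_def using gH r(1) s k(2) by (simp add: Hom_def)
  then have "h \<cdot> \<sigma> = y \<cdot> (\<beta> \<cdot> w)" unfolding h_def using y gr s by (simp add: Hom_def)
  also have "\<dots> = t \<cdot> P_arr h" unfolding y\<beta>[OF w] unfolding w_def h_def P_arr_comp[OF gr y] ..
  finally have hom: "is_algebra_hom C (poly C f) W \<sigma> V t h"
    unfolding is_algebra_hom_def using alg algV h by blast
  then show "\<exists>!h. is_algebra_hom C (poly C f) W \<sigma> V t h"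
    using hom_unique[OF closed_iso] by blast
qed

end

section \<open>Slices\<close>

context lex_cat
begin

lemma slice_HomE:
  assumes "x \<in> Hom (slice C X) a b"
  obtains h where "x = (a, h, b)" "a \<in> Arr C" "Cod C a = X" "b \<in> Arr C" "Cod C b = X"
    "h \<in> Hom C (Dom C a) (Dom C b)" "b \<cdot> h = a"
  using assms unfolding slice_Hom_iff by blast

lemma slice_ArrD:
  assumes "(a, h, b) \<in> Arr (slice C X)"
  shows "(a, h, b) \<in> Hom (slice C X) a b" "a \<in> Arr C" "Cod C a = X" "b \<in> Arr C" "Cod C b = X"
    "h \<in> Hom C (Dom C a) (Dom C b)" "b \<cdot> h = a" "h \<in> Arr C" "Dom C h = Dom C a" "Cod C h = Dom C b"
proof -
  show "(a, h, b) \<in> Hom (slice C X) a b" using assms by (simp add: Hom_def)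
  then show "a \<in> Arr C" "Cod C a = X" "b \<in> Arr C" "Cod C b = X"
    "h \<in> Hom C (Dom C a) (Dom C b)" "b \<cdot> h = a" "h \<in> Arr C" "Dom C h = Dom C a" "Cod C h = Dom C b"
    unfolding slice_Hom_triple by (auto simp: Hom_def)
qed

text \<open>Every arrow into the domain of an object of the slice is an element of that object, at
  the stage given by composing with the structure map.\<close>

lemma slice_lift:
  assumes "b \<in> Arr C" "Cod C b = X" "h \<in> Hom C t (Dom C b)"
  shows "(b \<cdot> h, h, b) \<in> Hom (slice C X) (b \<cdot> h) b" "Dom C (b \<cdot> h) = t"
  using assms unfolding slice_Hom_triple by (auto simp: Hom_def)

text \<open>A factorisation found in the base lies automatically over \<open>X\<close>, because both
  \<open>u\<close> and \<open>m\<close> do.\<close>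

lemma slice_sub_le_iff:
  assumes "(z, u, a) \<in> Hom (slice C X) z a" "(m0, m, a) \<in> Hom (slice C X) m0 a"
  shows "sub_le (slice C X) (z, u, a) (m0, m, a) \<longleftrightarrow> sub_le C u m"
proof
  have U: "u \<in> Hom C (Dom C z) (Dom C a)" "a \<cdot> u = z" and M: "m \<in> Hom C (Dom C m0) (Dom C a)" "a \<cdot> m = m0"
    and A: "z \<in> Arr C" "Cod C z = X" "m0 \<in> Arr C" "Cod C m0 = X" "a \<in> Arr C"
    using assms unfolding slice_Hom_triple by auto
  {
    assume "sub_le (slice C X) (z, u, a) (m0, m, a)"
    then obtain k where k: "k \<in> Hom (slice C X) z m0" "(m0, m, a) \<cdot>\<^bsub>slice C X\<^esub> k = (z, u, a)"
      unfolding sub_le_def by auto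
    then obtain k1 where "k = (z, k1, m0)" "k1 \<in> Hom C (Dom C z) (Dom C m0)" by (auto elim: slice_HomE)
    then show "sub_le C u m" using k(2) M(1) by (intro sub_leI[of k1 "Dom C z"]) (auto simp: Hom_def)
  next
    assume "sub_le C u m"
    then obtain k where "k \<in> Hom C (Dom C z) (Dom C m)" and mk: "m \<cdot> k = u" using sub_leE U(1) by blast
    then have k: "k \<in> Hom C (Dom C z) (Dom C m0)" using M(1) by (simp add: Hom_def)
    have "m0 \<cdot> k = z"
      using whisker[OF M(2), of k] k M(1) A(5) mk U(2) by (simp add: Hom_def)
    then have "(z, k, m0) \<in> Hom (slice C X) z m0" unfolding slice_Hom_triple using k A by simp
    then show "sub_le (slice C X) (z, u, a) (m0, m, a)"
      unfolding sub_le_def using mk by (intro bexI[of _ "(z, k, m0)"]) auto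
  }
qed

lemma slice_mono_iff:
  assumes "(m0, m, a) \<in> Hom (slice C X) m0 a"
  shows "is_mono (slice C X) (m0, m, a) \<longleftrightarrow> is_mono C m"
proof
  interpret D: category "slice C X" by (rule category_slice)
  have M: "m \<in> Hom C (Dom C m0) (Dom C a)" "a \<cdot> m = m0"
    and A: "m0 \<in> Arr C" "Cod C m0 = X" "a \<in> Arr C"
    using assms unfolding slice_Hom_triple by auto
  {
    assume mono: "is_mono (slice C X) (m0, m, a)"
    show "is_mono C m"
    proof (rule monoI[OF M(1)])
      fix t u v assume h: "u \<in> Hom C t (Dom C m0)" "v \<in> Hom C t (Dom C m0)" "m \<cdot> u = m \<cdot> v"
      have e: "m0 \<cdot> w = a \<cdot> (m \<cdot> w)" if "w \<in> Hom C t (Dom C m0)" for w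
        using whisker[OF M(2), of w] that M(1) A(3) by (simp add: Hom_def)
      then have "m0 \<cdot> u = m0 \<cdot> v" using h by simp
      then have "(m0 \<cdot> u, u, m0) \<in> Hom (slice C X) (m0 \<cdot> u) m0" "(m0 \<cdot> u, v, m0) \<in> Hom (slice C X) (m0 \<cdot> u) m0"
        using slice_lift(1)[OF A(1,2) h(1)] slice_lift(1)[OF A(1,2) h(2)] by auto
      then have "(m0 \<cdot> u, u, m0) = (m0 \<cdot> u, v, m0)"
        by (rule D.monoD[OF mono, unfolded slice_simps, rotated]) (simp only: slice_simps h(3))
      then show "u = v" by simp
    qed
  next
    assume mono: "is_mono C m"
    show "is_mono (slice C X) (m0, m, a)"
    proof (rule D.monoI[OF assms])
      fix t u v assume h: "u \<in> Hom (slice C X) t m0" "v \<in> Hom (slice C X) t m0"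
        "(m0, m, a) \<cdot>\<^bsub>slice C X\<^esub> u = (m0, m, a) \<cdot>\<^bsub>slice C X\<^esub> v"
      obtain u1 where u1: "u = (t, u1, m0)" "u1 \<in> Hom C (Dom C t) (Dom C m0)" using h(1) slice_HomE by blast
      obtain v1 where v1: "v = (t, v1, m0)" "v1 \<in> Hom C (Dom C t) (Dom C m0)" using h(2) slice_HomE by blast
      have "u1 = v1"
        by (rule monoD[OF mono, where z = "Dom C t"]) (use h(3) u1 v1 M(1) in \<open>auto simp: Hom_def\<close>)
      then show "u = v" using u1 v1 by simp
    qed
  }
qed

lemma slice_iso_iff:
  assumes "(m0, m, a) \<in> Hom (slice C X) m0 a"
  shows "is_iso (slice C X) (m0, m, a) \<longleftrightarrow> is_iso C m"
proof
  interpret D: category "slice C X" by (rule category_slice)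
  have M: "m \<in> Hom C (Dom C m0) (Dom C a)" "a \<cdot> m = m0"
    and A: "m0 \<in> Arr C" "Cod C m0 = X" "a \<in> Arr C" "Cod C a = X"
    using assms unfolding slice_Hom_triple by auto
  {
    assume "is_iso (slice C X) (m0, m, a)"
    then obtain g where g: "g \<in> Hom (slice C X) a m0" "g \<cdot>\<^bsub>slice C X\<^esub> (m0, m, a) = Id (slice C X) m0"
      "(m0, m, a) \<cdot>\<^bsub>slice C X\<^esub> g = Id (slice C X) a" using D.isoE assms by blast
    obtain g1 where g1: "g = (a, g1, m0)" "g1 \<in> Hom C (Dom C a) (Dom C m0)" using g(1) slice_HomE by blast
    have "g1 \<cdot> m = Id C (Dom C m0)" "m \<cdot> g1 = Id C (Dom C a)" using g(2,3) unfolding g1(1) slice_simps by blast+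
    then show "is_iso C m" using isoI[OF M(1) g1(2)] by blast
  next
    assume "is_iso C m"
    then obtain g where g: "g \<in> Hom C (Dom C a) (Dom C m0)" "g \<cdot> m = Id C (Dom C m0)" "m \<cdot> g = Id C (Dom C a)"
      using isoE M(1) by blast
    have "a \<cdot> (m \<cdot> g) = m0 \<cdot> g" by (rule whisker[OF M(2)]) (use g(1) M(1) A in \<open>auto simp: Hom_def\<close>)
    then have "m0 \<cdot> g = a" unfolding g(3) using Id_comp(2)[OF A(3) refl] by simp
    then have "(a, g, m0) \<in> Hom (slice C X) a m0" unfolding slice_Hom_triple using g(1) A by simp
    then show "is_iso (slice C X) (m0, m, a)" by (rule D.isoI[OF assms]) (use g in auto)
  }
qed

lemma slice_epi:
  assumes "(z, e, a) \<in> Hom (slice C X) z a" "is_epi C e"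
  shows "is_epi (slice C X) (z, e, a)"
  unfolding is_epi_def
proof (intro conjI allI impI)
  show "(z, e, a) \<in> Arr (slice C X)" using assms(1) by (simp add: Hom_def)
  have ce: "Cod C e = Dom C a" using assms(1) unfolding slice_Hom_triple by (simp add: Hom_def)
  fix u v Y assume h: "u \<in> Hom (slice C X) (Cod (slice C X) (z, e, a)) Y \<and>
    v \<in> Hom (slice C X) (Cod (slice C X) (z, e, a)) Y \<and> u \<cdot>\<^bsub>slice C X\<^esub> (z, e, a) = v \<cdot>\<^bsub>slice C X\<^esub> (z, e, a)"
  then have hh: "u \<in> Hom (slice C X) a Y" "v \<in> Hom (slice C X) a Y" by auto
  obtain u1 where u1: "u = (a, u1, Y)" "u1 \<in> Hom C (Dom C a) (Dom C Y)" using hh(1) slice_HomE by blast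
  obtain v1 where v1: "v = (a, v1, Y)" "v1 \<in> Hom C (Dom C a) (Dom C Y)" using hh(2) slice_HomE by blast
  have "u1 = v1" by (rule epiD[OF assms(2), where y = "Dom C Y"]) (use h u1 v1 ce in auto)
  then show "u = v" using u1 v1 by simp
qed

text \<open>If \<open>f \<cdot> x = y \<cdot> \<zeta>\<close>, then \<open>x\<close> and
  \<open>\<zeta>\<close> have the same composite to \<open>X\<close>; test elements of the base are
  therefore already test elements of the slice.\<close>

lemma slice_forall_along_iff:
  assumes f: "(a, f, b) \<in> Hom (slice C X) a b" and y: "(z, y, b) \<in> Hom (slice C X) z b"
    and \<Phi>: "\<And>t x. (t, x, a) \<in> Hom (slice C X) t a \<Longrightarrow> \<Phi> (t, x, a) \<longleftrightarrow> \<Psi> x"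
  shows "forall_along (slice C X) (a, f, b) \<Phi> (z, y, b) \<longleftrightarrow> forall_along C f \<Psi> y" (is "?L \<longleftrightarrow> ?R")
proof
  have F: "f \<in> Hom C (Dom C a) (Dom C b)" "b \<cdot> f = a" and Y: "y \<in> Hom C (Dom C z) (Dom C b)" "b \<cdot> y = z"
    and A: "a \<in> Arr C" "Cod C a = X" "b \<in> Arr C" "z \<in> Arr C" "Cod C z = X"
    using f y unfolding slice_Hom_triple by auto
  {
    assume L: ?L
    show ?R
      unfolding forall_along_def
    proof (intro allI impI)
      fix t \<zeta> x assume "\<zeta> \<in> Hom C t (Dom C y) \<and> x \<in> Hom C t (Dom C f) \<and> f \<cdot> x = y \<cdot> \<zeta>"
      then have h: "\<zeta> \<in> Hom C t (Dom C z)" "x \<in> Hom C t (Dom C a)" "f \<cdot> x = y \<cdot> \<zeta>"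
        using F(1) Y(1) by (auto simp: Hom_def)
      have "a \<cdot> x = b \<cdot> (f \<cdot> x)" using whisker[OF F(2), of x] h(2) F(1) A by (simp add: Hom_def)
      also have "\<dots> = z \<cdot> \<zeta>" unfolding h(3) using whisker[OF Y(2), of \<zeta>] h(1) Y(1) A by (simp add: Hom_def)
      finally have e: "a \<cdot> x = z \<cdot> \<zeta>" .
      have x': "(z \<cdot> \<zeta>, x, a) \<in> Hom (slice C X) (z \<cdot> \<zeta>) a" using slice_lift(1)[OF A(1,2) h(2)] e by simp
      have \<zeta>': "(z \<cdot> \<zeta>, \<zeta>, z) \<in> Hom (slice C X) (z \<cdot> \<zeta>) z" using slice_lift(1)[OF A(4,5) h(1)] .
      have "\<Phi> (z \<cdot> \<zeta>, x, a)"
        using L x' \<zeta>' h(3) unfolding forall_along_def slice_simps by (metis slice_simps(4))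
      then show "\<Psi> x" using \<Phi>[OF x'] by blast
    qed
  next
    assume R: ?R
    show ?L
      unfolding forall_along_def slice_simps
    proof (intro allI impI)
      fix t \<zeta> x assume h: "\<zeta> \<in> Hom (slice C X) t z \<and> x \<in> Hom (slice C X) t a \<and>
        (a, f, b) \<cdot>\<^bsub>slice C X\<^esub> x = (z, y, b) \<cdot>\<^bsub>slice C X\<^esub> \<zeta>"
      obtain x1 where x1: "x = (t, x1, a)" "x1 \<in> Hom C (Dom C t) (Dom C a)" using h slice_HomE by blast
      obtain \<zeta>1 where z1: "\<zeta> = (t, \<zeta>1, z)" "\<zeta>1 \<in> Hom C (Dom C t) (Dom C z)" using h slice_HomE by blast
      have "\<Psi> x1"
        by (rule forall_alongD[OF R Y(1) z1(2)]) (use h x1 z1 F(1) in \<open>auto simp: Hom_def\<close>)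
      then show "\<Phi> x" using \<Phi>[of t x1] h x1(1) by simp
    qed
  }
qed

text \<open>Test cones in the base acquire a structure map to \<open>X\<close> from their composite
  with \<open>z\<close>, and mediating arrows in the base then lie over \<open>X\<close>
  automatically.\<close>

lemma slice_pullback_iff:
  assumes f: "(x, f, z) \<in> Arr (slice C X)" and g: "(y, g, z) \<in> Arr (slice C X)"
    and p: "(w, p, x) \<in> Arr (slice C X)" and q: "(w, q, y) \<in> Arr (slice C X)"
  shows "is_pullback (slice C X) (x, f, z) (y, g, z) (w, p, x) (w, q, y) \<longleftrightarrow> is_pullback C f g p q"
proof
  interpret D: category "slice C X" by (rule category_slice)
  note F = slice_ArrD[OF f] and G = slice_ArrD[OF g] and P = slice_ArrD[OF p] and Q = slice_ArrD[OF q]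
  {
    assume pb: "is_pullback (slice C X) (x, f, z) (y, g, z) (w, p, x) (w, q, y)"
    show "is_pullback C f g p q"
    proof (rule pullbackI[OF F(6) G(6) P(6) Q(6)])
      show "f \<cdot> p = g \<cdot> q" using D.pullbackD(9)[OF pb] by simp
      fix t u v assume h: "u \<in> Hom C t (Dom C x)" "v \<in> Hom C t (Dom C y)" "f \<cdot> u = g \<cdot> v"
      have "x \<cdot> u = z \<cdot> (f \<cdot> u)" using whisker[OF F(7), of u] h(1) F by (simp add: Hom_def)
      also have "\<dots> = y \<cdot> v" unfolding h(3) using whisker[OF G(7), of v] h(2) G by (simp add: Hom_def)
      finally have e: "x \<cdot> u = y \<cdot> v" .
      have u': "(x \<cdot> u, u, x) \<in> Hom (slice C X) (x \<cdot> u) x" using slice_lift(1)[OF F(2,3) h(1)] .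
      have v': "(x \<cdot> u, v, y) \<in> Hom (slice C X) (x \<cdot> u) y" using slice_lift(1)[OF G(2,3) h(2)] e by simp
      obtain k where k: "k \<in> Hom (slice C X) (x \<cdot> u) w" "(w, p, x) \<cdot>\<^bsub>slice C X\<^esub> k = (x \<cdot> u, u, x)"
        "(w, q, y) \<cdot>\<^bsub>slice C X\<^esub> k = (x \<cdot> u, v, y)"
        by (rule D.pullbackE[OF pb, of "(x \<cdot> u, u, x)" "x \<cdot> u" "(x \<cdot> u, v, y)"]) (use u' v' h(3) in auto)
      obtain k1 where k1: "k = (x \<cdot> u, k1, w)" "k1 \<in> Hom C (Dom C (x \<cdot> u)) (Dom C w)"
        using k(1) slice_HomE by blast
      moreover have "Dom C (x \<cdot> u) = t" using slice_lift(2)[OF F(2,3) h(1)] .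
      ultimately show "\<exists>k. k \<in> Hom C t (Dom C w) \<and> p \<cdot> k = u \<and> q \<cdot> k = v" using k(2,3) by auto
    next
      fix t k k' assume h: "k \<in> Hom C t (Dom C w)" "k' \<in> Hom C t (Dom C w)" "p \<cdot> k = p \<cdot> k'" "q \<cdot> k = q \<cdot> k'"
      have "w \<cdot> v = x \<cdot> (p \<cdot> v)" if "v \<in> Hom C t (Dom C w)" for v
        using whisker[OF P(7), of v] that P by (simp add: Hom_def)
      then have e: "w \<cdot> k' = w \<cdot> k" using h by simp
      have "(w \<cdot> k, k, w) = (w \<cdot> k, k', w)"
      proof (rule D.pullback_ext[OF pb])
        show "(w \<cdot> k, k, w) \<in> Hom (slice C X) (w \<cdot> k) (Dom (slice C X) (w, p, x))"
          "(w \<cdot> k, k', w) \<in> Hom (slice C X) (w \<cdot> k) (Dom (slice C X) (w, p, x))"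
          using slice_lift(1)[OF P(2,3) h(1)] slice_lift(1)[OF P(2,3) h(2)] e by auto
      qed (use h(3,4) in auto)
      then show "k = k'" by simp
    qed
  next
    assume pb: "is_pullback C f g p q"
    show "is_pullback (slice C X) (x, f, z) (y, g, z) (w, p, x) (w, q, y)"
    proof (rule D.pullbackI[OF F(1) G(1) P(1) Q(1)])
      show "(x, f, z) \<cdot>\<^bsub>slice C X\<^esub> (w, p, x) = (y, g, z) \<cdot>\<^bsub>slice C X\<^esub> (w, q, y)"
        using pullbackD(9)[OF pb] by simp
      fix t u v assume h: "u \<in> Hom (slice C X) t x" "v \<in> Hom (slice C X) t y"
        "(x, f, z) \<cdot>\<^bsub>slice C X\<^esub> u = (y, g, z) \<cdot>\<^bsub>slice C X\<^esub> v"
      obtain u1 where u1: "u = (t, u1, x)" "t \<in> Arr C" "Cod C t = X" "u1 \<in> Hom C (Dom C t) (Dom C x)" "x \<cdot> u1 = t"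
        using h(1) slice_HomE by metis
      obtain v1 where v1: "v = (t, v1, y)" "v1 \<in> Hom C (Dom C t) (Dom C y)" using h(2) slice_HomE by metis
      have uv: "f \<cdot> u1 = g \<cdot> v1" using h(3) u1(1) v1(1) by simp
      obtain k where k: "k \<in> Hom C (Dom C t) (Dom C p)" "p \<cdot> k = u1" "q \<cdot> k = v1"
        by (rule pullbackE[OF pb _ _ uv]) (use u1 v1 F G in auto)
      have "w \<cdot> k = t"
        using whisker[OF P(7), of k] k(1,2) P u1(5) by (simp add: Hom_def)
      then have "(t, k, w) \<in> Hom (slice C X) t w" unfolding slice_Hom_triple using k(1) u1 P by simp
      then show "\<exists>k. k \<in> Hom (slice C X) t w \<and> (w, p, x) \<cdot>\<^bsub>slice C X\<^esub> k = u \<and> (w, q, y) \<cdot>\<^bsub>slice C X\<^esub> k = v"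
        using k u1 v1 by (intro exI[of _ "(t, k, w)"]) auto
    next
      fix t k k' assume h: "k \<in> Hom (slice C X) t w" "k' \<in> Hom (slice C X) t w"
        "(w, p, x) \<cdot>\<^bsub>slice C X\<^esub> k = (w, p, x) \<cdot>\<^bsub>slice C X\<^esub> k'" "(w, q, y) \<cdot>\<^bsub>slice C X\<^esub> k = (w, q, y) \<cdot>\<^bsub>slice C X\<^esub> k'"
      obtain k1 where k1: "k = (t, k1, w)" "k1 \<in> Hom C (Dom C t) (Dom C w)" using h(1) slice_HomE by metis
      obtain k2 where k2: "k' = (t, k2, w)" "k2 \<in> Hom C (Dom C t) (Dom C w)" using h(2) slice_HomE by metis
      have "k1 = k2" by (rule pullback_ext[OF pb, of _ "Dom C t"]) (use h(3,4) k1 k2 P in auto)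
      then show "k = k'" using k1 k2 by simp
    qed
  }
qed

text \<open>The terminal object is the identity of \<open>X\<close>, and pullbacks are those of the
  base.\<close>

lemma lex_cat_slice:
  assumes X: "X \<in> Obj C"
  shows "lex_cat (slice C X)"
proof -
  interpret D: category "slice C X" by (rule category_slice)
  show ?thesis
  proof
    have "is_terminal (slice C X) (Id C X)"
      unfolding is_terminal_def
    proof (intro conjI ballI)
      show "Id C X \<in> Obj (slice C X)" using X by simp
      fix a assume "a \<in> Obj (slice C X)"
      then have a: "a \<in> Arr C" "Cod C a = X" by auto
      show "\<exists>!u. u \<in> Hom (slice C X) a (Id C X)"
      proof (rule ex1I[of _ "(a, a, Id C X)"])
        show "(a, a, Id C X) \<in> Hom (slice C X) a (Id C X)"
          unfolding slice_Hom_triple using a X arr_Hom[OF a(1)] by simp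
        fix u assume "u \<in> Hom (slice C X) a (Id C X)"
        then obtain h where "u = (a, h, Id C X)" "h \<in> Hom C (Dom C a) (Dom C (Id C X))" "Id C X \<cdot> h = a"
          using slice_HomE by metis
        then show "u = (a, a, Id C X)" using X by (simp add: Hom_def)
      qed
    qed
    then show "\<exists>t. is_terminal (slice C X) t" by blast
  next
    fix F G assume h: "F \<in> Arr (slice C X)" "G \<in> Arr (slice C X)" "Cod (slice C X) F = Cod (slice C X) G"
    obtain x f z where F: "F = (x, f, z)" by (cases F)
    obtain y g z' where G: "G = (y, g, z')" by (cases G)
    have zz: "z' = z" using h(3) unfolding F G by simp
    note F' = slice_ArrD[OF h(1)[unfolded F]] and G' = slice_ArrD[OF h(2)[unfolded G zz]]
    obtain p q where pq: "is_pullback C f g p q" using lex_pullbacks[of f g] F' G' by auto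
    note P = pullbackD[OF pq]
    have ty: "p \<in> Hom C (Dom C p) (Dom C x)" "q \<in> Hom C (Dom C p) (Dom C y)" using P F' G' by (auto simp: Hom_def)
    have "x \<cdot> p = z \<cdot> (f \<cdot> p)" using whisker[OF F'(7), of p] ty F' by (simp add: Hom_def)
    also have "\<dots> = y \<cdot> q" unfolding P(9) using whisker[OF G'(7), of q] ty G' by (simp add: Hom_def)
    finally have e: "x \<cdot> p = y \<cdot> q" .
    have "(x \<cdot> p, p, x) \<in> Arr (slice C X)" "(x \<cdot> p, q, y) \<in> Arr (slice C X)"
      using slice_lift(1)[OF F'(2,3) ty(1)] slice_lift(1)[OF G'(2,3) ty(2)] e unfolding Hom_def by auto
    then have "is_pullback (slice C X) (x, f, z) (y, g, z) (x \<cdot> p, p, x) (x \<cdot> p, q, y)"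
      using slice_pullback_iff h pq unfolding F G zz by blast
    then show "\<exists>p q. is_pullback (slice C X) F G p q" unfolding F G zz by blast
  qed
qed

end

section \<open>Quantifiers and inductive subobjects in slices\<close>

context forall_cat
begin

text \<open>A predicate on elements of the slice is replaced by its representing mono, whose
  underlying arrow is a subobject in the base; the quantification is carried out there.\<close>

lemma forall_cat_slice:
  assumes X: "X \<in> Obj C"
  shows "forall_cat (slice C X)"
proof -
  interpret D: lex_cat "slice C X" by (rule lex_cat_slice[OF X])
  show ?thesis
  proof
    fix F a b \<Phi> assume F: "F \<in> Hom (slice C X) a b" and \<Phi>: "representable (slice C X) a \<Phi>"
    obtain f where f: "F = (a, f, b)" "a \<in> Arr C" "Cod C a = X" "b \<in> Arr C" "Cod C b = X"
      "f \<in> Hom C (Dom C a) (Dom C b)" using F slice_HomE by metis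
    obtain M where M: "is_mono (slice C X) M" "M \<in> Hom (slice C X) (Dom (slice C X) M) a"
      "\<And>z x. x \<in> Hom (slice C X) z a \<Longrightarrow> sub_le (slice C X) x M \<longleftrightarrow> \<Phi> x"
      using D.representableE[OF \<Phi>] by blast
    obtain m0 m where m: "M = (m0, m, a)" using M(2) slice_HomE by metis
    have mH: "(m0, m, a) \<in> Hom (slice C X) m0 a" using M(2) unfolding m by simp
    have m1: "is_mono C m" "Cod C m = Dom C a"
      using M(1) slice_mono_iff[OF mH] mH unfolding m slice_Hom_triple by (auto simp: Hom_def)
    have "representable C (Dom C a) (\<lambda>x. sub_le C x m)" by (rule representableI[OF m1]) simp
    then obtain n where n: "is_mono C n" "n \<in> Hom C (Dom C n) (Dom C b)"
      "\<And>z x. x \<in> Hom C z (Dom C b) \<Longrightarrow> sub_le C x n \<longleftrightarrow> forall_along C f (\<lambda>x. sub_le C x m) x"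
      using representableE[OF representable_forall[OF f(6)]] by blast
    have nH: "(b \<cdot> n, n, b) \<in> Hom (slice C X) (b \<cdot> n) b" using slice_lift(1)[OF f(4,5) n(2)] .
    show "representable (slice C X) b (forall_along (slice C X) F \<Phi>)"
    proof (rule D.representableI)
      show "is_mono (slice C X) (b \<cdot> n, n, b)" using slice_mono_iff[OF nH] n(1) by blast
      show "Cod (slice C X) (b \<cdot> n, n, b) = b" by simp
      fix z y assume y: "y \<in> Hom (slice C X) z b"
      then obtain y1 where y1: "y = (z, y1, b)" "y1 \<in> Hom C (Dom C z) (Dom C b)" using slice_HomE by metis
      note yH = y[unfolded y1(1)]
      have "forall_along (slice C X) F \<Phi> y \<longleftrightarrow> forall_along C f (\<lambda>x. sub_le C x m) y1"
        unfolding f(1) y1(1)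
      proof (rule slice_forall_along_iff[OF F[unfolded f(1)] yH])
        fix t x assume x: "(t, x, a) \<in> Hom (slice C X) t a"
        show "\<Phi> (t, x, a) \<longleftrightarrow> sub_le C x m" using M(3)[OF x] slice_sub_le_iff[OF x mH] unfolding m by simp
      qed
      then show "sub_le (slice C X) y (b \<cdot> n, n, b) \<longleftrightarrow> forall_along (slice C X) F \<Phi> y"
        using slice_sub_le_iff[OF yH nH] n(3)[OF y1(2)] y1(1) by simp
    qed
  qed
qed

text \<open>The subobject generated in the base serves in the slice as well: the rules lie over
  \<open>X\<close>, so the stage of a derived element determines that of its rule. Local witnesses
  transfer because an epi of the base is one in the slice.\<close>

lemma has_inductive_subobjects_slice:
  assumes nA: "(x, n, y) \<in> Arr (slice C X)" and ind: "has_inductive_subobjects C n"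
  shows "has_inductive_subobjects (slice C X) (x, n, y)"
  unfolding has_inductive_subobjects_def slice_simps
proof (intro allI impI)
  note N = slice_ArrD[OF nA]
  fix Y ev \<beta> assume h: "ev \<in> Hom (slice C X) x Y \<and> \<beta> \<in> Hom (slice C X) y Y"
  obtain e where e: "ev = (x, e, Y)" "Y \<in> Arr C" "Cod C Y = X" "e \<in> Hom C (Dom C x) (Dom C Y)" "Y \<cdot> e = x"
    using h slice_HomE by metis
  obtain b where b: "\<beta> = (y, b, Y)" "b \<in> Hom C (Dom C y) (Dom C Y)" "Y \<cdot> b = y" using h slice_HomE by metis
  have e': "e \<in> Hom C (Dom C n) (Dom C Y)" and b': "b \<in> Hom C (Cod C n) (Dom C Y)" using e b N by auto
  obtain g where g: "is_mono C g" "Cod C g = Dom C Y"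
    "\<And>z y. y \<in> Hom C z (Dom C Y) \<Longrightarrow> sub_le C y g \<Longrightarrow> \<exists>t r u. is_epi C r \<and> r \<in> Hom C t z \<and>
       u \<in> Hom C t (Cod C n) \<and> b \<cdot> u = y \<cdot> r \<and> forall_along C n (\<lambda>\<nu>. sub_le C (e \<cdot> \<nu>) g) u"
    "\<And>z u. u \<in> Hom C z (Cod C n) \<Longrightarrow> forall_along C n (\<lambda>\<nu>. sub_le C (e \<cdot> \<nu>) g) u \<Longrightarrow>
       sub_le C (b \<cdot> u) g"
    by (rule has_inductive_subobjectsE[OF ind e' b']) (rule that)
  have gH: "g \<in> Hom C (Dom C g) (Dom C Y)" using mono_arr[OF g(1)] g(2) by (simp add: Hom_def)
  note gS = slice_lift(1)[OF e(2,3) gH]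
  let ?g = "(Y \<cdot> g, g, Y)"
  have sub: "sub_le (slice C X) (z, v, Y) ?g \<longleftrightarrow> sub_le C v g" if "(z, v, Y) \<in> Hom (slice C X) z Y" for z v
    using slice_sub_le_iff[OF that gS] .
  have evS: "(x, e, Y) \<in> Hom (slice C X) x Y" and bS: "(y, b, Y) \<in> Hom (slice C X) y Y" using h e(1) b(1) by auto
  have fa: "forall_along (slice C X) (x, n, y) (\<lambda>\<nu>. sub_le (slice C X) (ev \<cdot>\<^bsub>slice C X\<^esub> \<nu>) ?g) (z, u, y) \<longleftrightarrow>
    forall_along C n (\<lambda>\<nu>. sub_le C (e \<cdot> \<nu>) g) u" if u: "(z, u, y) \<in> Hom (slice C X) z y" for z u
  proof (rule slice_forall_along_iff[OF N(1) u])
    fix t \<nu> assume v: "(t, \<nu>, x) \<in> Hom (slice C X) t x"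
    have "(t, e \<cdot> \<nu>, Y) \<in> Hom (slice C X) t Y"
      using category.Comp_in_Hom[OF category_slice v evS] by simp
    then show "sub_le (slice C X) (ev \<cdot>\<^bsub>slice C X\<^esub> (t, \<nu>, x)) ?g \<longleftrightarrow> sub_le C (e \<cdot> \<nu>) g"
      using sub unfolding e(1) by simp
  qed
  show "\<exists>g. is_mono (slice C X) g \<and> Cod (slice C X) g = Y \<and>
      (\<forall>z ya. ya \<in> Hom (slice C X) z Y \<and> sub_le (slice C X) ya g \<longrightarrow>
        (\<exists>t e u. is_epi (slice C X) e \<and> e \<in> Hom (slice C X) t z \<and> u \<in> Hom (slice C X) t y \<and>
          \<beta> \<cdot>\<^bsub>slice C X\<^esub> u = ya \<cdot>\<^bsub>slice C X\<^esub> e \<and>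
          forall_along (slice C X) (x, n, y) (\<lambda>\<nu>. sub_le (slice C X) (ev \<cdot>\<^bsub>slice C X\<^esub> \<nu>) g) u)) \<and>
      (\<forall>z u. u \<in> Hom (slice C X) z y \<and>
        forall_along (slice C X) (x, n, y) (\<lambda>\<nu>. sub_le (slice C X) (ev \<cdot>\<^bsub>slice C X\<^esub> \<nu>) g) u \<longrightarrow>
        sub_le (slice C X) (\<beta> \<cdot>\<^bsub>slice C X\<^esub> u) g)"
  proof (intro exI[of _ ?g] conjI allI impI)
    show "is_mono (slice C X) ?g" using slice_mono_iff[OF gS] g(1) by blast
    show "Cod (slice C X) ?g = Y" by simp
  next
    fix z v assume v: "v \<in> Hom (slice C X) z Y \<and> sub_le (slice C X) v ?g"
    then obtain v1 where v1: "v = (z, v1, Y)" "z \<in> Arr C" "Cod C z = X" "v1 \<in> Hom C (Dom C z) (Dom C Y)" "Y \<cdot> v1 = z"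
      using slice_HomE by metis
    have "sub_le C v1 g" using v sub unfolding v1(1) by blast
    then obtain t r u where r: "is_epi C r" "r \<in> Hom C t (Dom C z)" "u \<in> Hom C t (Cod C n)" "b \<cdot> u = v1 \<cdot> r"
      "forall_along C n (\<lambda>\<nu>. sub_le C (e \<cdot> \<nu>) g) u" using g(3)[OF v1(4)] by blast
    have u: "u \<in> Hom C t (Dom C y)" using r(3) N by simp
    have "y \<cdot> u = Y \<cdot> (b \<cdot> u)" using whisker[OF b(3), of u] u b(2) e(2) by (simp add: Hom_def)
    also have "\<dots> = z \<cdot> r" unfolding r(4) using whisker[OF v1(5), of r] v1(4) r(2) e(2) by (simp add: Hom_def)
    finally have yu: "y \<cdot> u = z \<cdot> r" .
    note rS = slice_lift(1)[OF v1(2,3) r(2)]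
    have uS: "(z \<cdot> r, u, y) \<in> Hom (slice C X) (z \<cdot> r) y" using slice_lift(1)[OF N(4,5) u] yu by simp
    show "\<exists>t e u. is_epi (slice C X) e \<and> e \<in> Hom (slice C X) t z \<and> u \<in> Hom (slice C X) t y \<and>
          \<beta> \<cdot>\<^bsub>slice C X\<^esub> u = v \<cdot>\<^bsub>slice C X\<^esub> e \<and>
          forall_along (slice C X) (x, n, y) (\<lambda>\<nu>. sub_le (slice C X) (ev \<cdot>\<^bsub>slice C X\<^esub> \<nu>) ?g) u"
      using slice_epi[OF rS r(1)] rS uS fa[OF uS] r(4,5) unfolding b(1) v1(1)
      by (intro exI[of _ "z \<cdot> r"] exI[of _ "(z \<cdot> r, r, z)"] exI[of _ "(z \<cdot> r, u, y)"]) simp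
  next
    fix z u assume u: "u \<in> Hom (slice C X) z y \<and>
        forall_along (slice C X) (x, n, y) (\<lambda>\<nu>. sub_le (slice C X) (ev \<cdot>\<^bsub>slice C X\<^esub> \<nu>) ?g) u"
    then obtain u1 where u1: "u = (z, u1, y)" "u1 \<in> Hom C (Dom C z) (Dom C y)" using slice_HomE by metis
    then have uS: "(z, u1, y) \<in> Hom (slice C X) z y" using u by simp
    have "sub_le C (b \<cdot> u1) g" using g(4)[of u1 "Dom C z"] u1(2) N fa[OF uS] u unfolding u1(1) by simp
    moreover have "(z, b \<cdot> u1, Y) \<in> Hom (slice C X) z Y"
      using category.Comp_in_Hom[OF category_slice uS bS] by simp
    ultimately show "sub_le (slice C X) (\<beta> \<cdot>\<^bsub>slice C X\<^esub> u) ?g" using sub unfolding b(1) u1(1) by simp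
  qed
qed

end

text \<open>The underlying arrow of \<open>on_arr (star C X) h\<close>, that is, the product of
  \<open>h\<close> with the identity of \<open>X\<close>.\<close>

definition times_arr :: "('o, 'm) cat \<Rightarrow> 'o \<Rightarrow> 'm \<Rightarrow> 'm" where
  "times_arr C X h = pairing C (h \<cdot>\<^bsub>C\<^esub> pr1 C (Dom C h) X) (pr2 C (Dom C h) X)"

section \<open>Comparing two presentations of one polynomial object\<close>

context category
begin

text \<open>The universal property of the second object is applied to the tautological family of the
  first, and \<open>family_pullback_iff\<close> rewrites its condition into the form used by
  \<open>poly_comparison\<close>. The second claim, preservation of values, is how the comparison is
  exploited afterwards.\<close>

lemma poly_obj_comparison:
  assumes P: "is_poly_obj C f W \<pi> p q ev" and P': "is_poly_obj C f W \<pi>' p' q' ev'"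
  shows "\<exists>!\<theta>. \<theta> \<in> Hom C (Dom C \<pi>) (Dom C \<pi>') \<and> \<pi>' \<cdot> \<theta> = \<pi> \<and>
      (\<exists>s \<in> Hom C (Dom C p) (Dom C p'). p' \<cdot> s = \<theta> \<cdot> p \<and> q' \<cdot> s = q \<and> ev' \<cdot> s = ev)"
    "\<lbrakk>\<theta> \<in> Hom C (Dom C \<pi>) (Dom C \<pi>'); \<pi>' \<cdot> \<theta> = \<pi>; s \<in> Hom C (Dom C p) (Dom C p');
       p' \<cdot> s = \<theta> \<cdot> p; q' \<cdot> s = q; ev' \<cdot> s = ev; u \<in> Hom C z (Dom C \<pi>); b \<in> Hom C z (Dom C f);
       f \<cdot> b = \<pi> \<cdot> u\<rbrakk> \<Longrightarrow> papp C p' q' ev' (\<theta> \<cdot> u) b = papp C p q ev u b"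
proof -
  note pb = poly_objD(1)[OF P] and pb' = poly_objD(1)[OF P']
  note PB = pullbackD[OF pb] and PB' = pullbackD[OF pb']
  define Z where "Z = Dom C \<pi>"
  have \<pi>: "\<pi> \<in> Hom C Z (Cod C f)" unfolding Z_def using poly_objD(3)[OF P] .
  have ZO: "Z \<in> Obj C" using \<pi> Hom_Obj by blast
  define \<phi> where "\<phi> \<zeta> b = papp C p q ev \<zeta> b" for \<zeta> b
  have IdZ: "Id C Z \<in> Hom C Z (Dom C \<pi>)" unfolding Z_def[symmetric] by (rule Id_in_Hom[OF ZO])
  have fam: "is_family C f \<pi> W \<phi>"
  proof -
    have "is_family C f (\<pi> \<cdot> Id C Z) W (\<lambda>\<zeta> b. papp C p q ev (Id C Z \<cdot> \<zeta>) b)"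
      by (rule poly_obj_family[OF P IdZ])
    moreover have \<pi>I: "\<pi> \<cdot> Id C Z = \<pi>" using \<pi> by (simp add: Hom_def)
    ultimately have fI: "is_family C f \<pi> W (\<lambda>\<zeta> b. papp C p q ev (Id C Z \<cdot> \<zeta>) b)" by simp
    have I: "Id C Z \<cdot> \<zeta> = \<zeta>" if "\<zeta> \<in> Hom C t Z" for \<zeta> t using that by (simp add: Hom_def)
    show ?thesis
      unfolding is_family_def \<phi>_def Z_def[symmetric]
    proof (intro allI impI)
      fix t \<zeta> b assume "\<zeta> \<in> Hom C t Z \<and> b \<in> Hom C t (Dom C f) \<and> f \<cdot> b = \<pi> \<cdot> \<zeta>"
      then have h: "\<zeta> \<in> Hom C t Z" "b \<in> Hom C t (Dom C f)" "f \<cdot> b = \<pi> \<cdot> \<zeta>" by auto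
      have "Id C Z \<cdot> (\<zeta> \<cdot> k) = \<zeta> \<cdot> k" if "k \<in> Hom C s t" for k s
        using I Comp_in_Hom[OF that h(1)] by blast
      then show "papp C p q ev \<zeta> b \<in> Hom C t W \<and>
          (\<forall>s. \<forall>k\<in>Hom C s t. papp C p q ev (\<zeta> \<cdot> k) (b \<cdot> k) = papp C p q ev \<zeta> b \<cdot> k)"
        using is_familyD[OF fI \<pi> h] I[OF h(1)] by simp
    qed
  qed
  have "pb_lift C p q p q = Id C (Dom C p)"
    by (rule pb_lift_eq[OF pb Id_in_Hom]) (use PB in auto)
  then have \<phi>pq: "\<phi> p q = ev" unfolding \<phi>_def papp_def using poly_objD(2)[OF P] by (simp add: Hom_def)
  have \<pi>A: "\<pi> \<in> Arr C \<and> Cod C \<pi> = Cod C f \<and> is_family C f \<pi> W \<phi>"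
    using \<pi> fam by (simp add: Hom_def)
  have ex: "\<exists>!\<theta>. \<theta> \<in> Hom C (Dom C \<pi>) (Dom C \<pi>') \<and> \<pi>' \<cdot> \<theta> = \<pi> \<and>
           (\<forall>t \<zeta> k. \<zeta> \<in> Hom C t (Dom C \<pi>) \<and> k \<in> Hom C t (Dom C p') \<and> p' \<cdot> k = \<theta> \<cdot> \<zeta> \<longrightarrow>
              ev' \<cdot> k = \<phi> \<zeta> (q' \<cdot> k))"
    using P' \<pi>A unfolding is_poly_obj_def by blast
  have iff: "(\<forall>t \<zeta> k. \<zeta> \<in> Hom C t (Dom C \<pi>) \<and> k \<in> Hom C t (Dom C p') \<and> p' \<cdot> k = \<theta> \<cdot> \<zeta> \<longrightarrow>
              ev' \<cdot> k = \<phi> \<zeta> (q' \<cdot> k)) \<longleftrightarrow> ev' \<cdot> s = ev"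
    if "\<theta> \<in> Hom C (Dom C \<pi>) (Dom C \<pi>')" "\<pi>' \<cdot> \<theta> = \<pi>" "s \<in> Hom C (Dom C p) (Dom C p')"
      "p' \<cdot> s = \<theta> \<cdot> p" "q' \<cdot> s = q" for \<theta> s
    using family_pullback_iff[OF pb' pb fam that poly_objD(2)[OF P']] \<phi>pq by simp
  have s_ex: "\<exists>s. s \<in> Hom C (Dom C p) (Dom C p') \<and> p' \<cdot> s = \<theta> \<cdot> p \<and> q' \<cdot> s = q"
    if \<theta>: "\<theta> \<in> Hom C (Dom C \<pi>) (Dom C \<pi>')" "\<pi>' \<cdot> \<theta> = \<pi>" for \<theta>
  proof -
    have "\<theta> \<cdot> p \<in> Hom C (Dom C p) (Dom C \<pi>')" "q \<in> Hom C (Dom C p) (Dom C f)"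
      using \<theta>(1) PB(4-8) by (auto simp: Hom_def)
    moreover have "\<pi>' \<cdot> (\<theta> \<cdot> p) = f \<cdot> q"
      using whisker[OF \<theta>(2), of p] \<theta>(1) PB PB'(1) by (simp add: Hom_def)
    ultimately show ?thesis using pullbackE[OF pb'] by metis
  qed
  have "(\<theta> \<in> Hom C (Dom C \<pi>) (Dom C \<pi>') \<and> \<pi>' \<cdot> \<theta> = \<pi> \<and>
      (\<exists>s \<in> Hom C (Dom C p) (Dom C p'). p' \<cdot> s = \<theta> \<cdot> p \<and> q' \<cdot> s = q \<and> ev' \<cdot> s = ev)) =
    (\<theta> \<in> Hom C (Dom C \<pi>) (Dom C \<pi>') \<and> \<pi>' \<cdot> \<theta> = \<pi> \<and>
           (\<forall>t \<zeta> k. \<zeta> \<in> Hom C t (Dom C \<pi>) \<and> k \<in> Hom C t (Dom C p') \<and> p' \<cdot> k = \<theta> \<cdot> \<zeta> \<longrightarrow>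
              ev' \<cdot> k = \<phi> \<zeta> (q' \<cdot> k)))" for \<theta>
  proof (intro conj_cong refl)
    assume \<theta>: "\<theta> \<in> Hom C (Dom C \<pi>) (Dom C \<pi>')" "\<pi>' \<cdot> \<theta> = \<pi>"
    show "(\<exists>s \<in> Hom C (Dom C p) (Dom C p'). p' \<cdot> s = \<theta> \<cdot> p \<and> q' \<cdot> s = q \<and> ev' \<cdot> s = ev) =
      (\<forall>t \<zeta> k. \<zeta> \<in> Hom C t (Dom C \<pi>) \<and> k \<in> Hom C t (Dom C p') \<and> p' \<cdot> k = \<theta> \<cdot> \<zeta> \<longrightarrow>
              ev' \<cdot> k = \<phi> \<zeta> (q' \<cdot> k))"
      using s_ex[OF \<theta>] iff[OF \<theta>] by blast
  qed
  then show "\<exists>!\<theta>. \<theta> \<in> Hom C (Dom C \<pi>) (Dom C \<pi>') \<and> \<pi>' \<cdot> \<theta> = \<pi> \<and>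
      (\<exists>s \<in> Hom C (Dom C p) (Dom C p'). p' \<cdot> s = \<theta> \<cdot> p \<and> q' \<cdot> s = q \<and> ev' \<cdot> s = ev)"
    using ex by simp
  assume \<theta>: "\<theta> \<in> Hom C (Dom C \<pi>) (Dom C \<pi>')" "\<pi>' \<cdot> \<theta> = \<pi>" and s: "s \<in> Hom C (Dom C p) (Dom C p')"
       "p' \<cdot> s = \<theta> \<cdot> p" "q' \<cdot> s = q" "ev' \<cdot> s = ev"
    and u: "u \<in> Hom C z (Dom C \<pi>)" "b \<in> Hom C z (Dom C f)" "f \<cdot> b = \<pi> \<cdot> u"
  note l = pb_lift[OF pb u(1,2) u(3)[symmetric]]
  have sl: "s \<cdot> pb_lift C p q u b \<in> Hom C z (Dom C p')" using s(1) l(1) by (auto simp: Hom_def)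
  have "p' \<cdot> (s \<cdot> pb_lift C p q u b) = \<theta> \<cdot> (p \<cdot> pb_lift C p q u b)"
    using whisker[OF s(2), of "pb_lift C p q u b"] s(1) l(1) \<theta>(1) PB(4-8) PB'(4-8) by (simp add: Hom_def)
  moreover have "q' \<cdot> (s \<cdot> pb_lift C p q u b) = b"
    using whisker[OF s(3), of "pb_lift C p q u b"] s(1) l(1,3) PB'(4-8) by (simp add: Hom_def)
  ultimately have "pb_lift C p' q' (\<theta> \<cdot> u) b = s \<cdot> pb_lift C p q u b"
    using pb_lift_eq[OF pb' sl] l(2) by simp
  then show "papp C p' q' ev' (\<theta> \<cdot> u) b = papp C p q ev u b"
    unfolding papp_def
    using whisker[OF s(4), of "pb_lift C p q u b"] s(1) l(1) poly_objD(2)[OF P'] by (simp add: Hom_def)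
qed

text \<open>The comparison in the other direction is inverse to \<open>\<theta>\<close> by
  extensionality, as both composites preserve shapes and values.\<close>

lemma poly_obj_comparison_iso:
  assumes P: "is_poly_obj C f W \<pi> p q ev" and P': "is_poly_obj C f W \<pi>' p' q' ev'"
    and \<theta>: "\<theta> \<in> Hom C (Dom C \<pi>) (Dom C \<pi>')" "\<pi>' \<cdot> \<theta> = \<pi>"
    and app: "\<And>z u b. \<lbrakk>u \<in> Hom C z (Dom C \<pi>); b \<in> Hom C z (Dom C f); f \<cdot> b = \<pi> \<cdot> u\<rbrakk> \<Longrightarrow>
      papp C p' q' ev' (\<theta> \<cdot> u) b = papp C p q ev u b"
  shows "is_iso C \<theta>"
proof -
  note \<pi> = poly_objD(3)[OF P] and \<pi>' = poly_objD(3)[OF P']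
  have O: "Dom C \<pi> \<in> Obj C" "Dom C \<pi>' \<in> Obj C" using \<pi> \<pi>' Hom_Obj by auto
  obtain \<psi> s where \<psi>: "\<psi> \<in> Hom C (Dom C \<pi>') (Dom C \<pi>)" "\<pi> \<cdot> \<psi> = \<pi>'"
    "s \<in> Hom C (Dom C p') (Dom C p)" "p \<cdot> s = \<psi> \<cdot> p'" "q \<cdot> s = q'" "ev \<cdot> s = ev'"
    using poly_obj_comparison(1)[OF P' P] by blast
  note app' = poly_obj_comparison(2)[OF P' P \<psi>]
  show ?thesis
  proof (rule isoI[OF \<theta>(1) \<psi>(1)])
    have ty: "\<psi> \<cdot> \<theta> \<in> Hom C (Dom C \<pi>) (Dom C \<pi>)" "\<theta> \<cdot> \<psi> \<in> Hom C (Dom C \<pi>') (Dom C \<pi>')"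
      using \<theta>(1) \<psi>(1) by (auto simp: Hom_def)
    have \<pi>t: "\<pi>' \<cdot> (\<theta> \<cdot> v) = \<pi> \<cdot> v" if "v \<in> Hom C t (Dom C \<pi>)" for v t
      using whisker[OF \<theta>(2), of v] \<theta>(1) that \<pi>' by (simp add: Hom_def)
    have \<pi>t': "\<pi> \<cdot> (\<psi> \<cdot> v) = \<pi>' \<cdot> v" if "v \<in> Hom C t (Dom C \<pi>')" for v t
      using whisker[OF \<psi>(2), of v] \<psi>(1) that \<pi> by (simp add: Hom_def)
    have tv: "\<theta> \<cdot> v \<in> Hom C t (Dom C \<pi>')" if "v \<in> Hom C t (Dom C \<pi>)" for v t
      using that \<theta>(1) by (auto simp: Hom_def)
    have pv: "\<psi> \<cdot> v \<in> Hom C t (Dom C \<pi>)" if "v \<in> Hom C t (Dom C \<pi>')" for v t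
      using that \<psi>(1) by (auto simp: Hom_def)
    show "\<psi> \<cdot> \<theta> = Id C (Dom C \<pi>)"
    proof (rule poly_obj_ext[OF P ty(1) Id_in_Hom[OF O(1)]])
      show "\<pi> \<cdot> (\<psi> \<cdot> \<theta>) = \<pi> \<cdot> Id C (Dom C \<pi>)" using \<pi>t'[OF \<theta>(1)] \<theta>(2) \<pi> by (simp add: Hom_def)
      fix t \<zeta> b assume h: "\<zeta> \<in> Hom C t (Dom C \<pi>)" "b \<in> Hom C t (Dom C f)" "f \<cdot> b = \<pi> \<cdot> (\<psi> \<cdot> \<theta> \<cdot> \<zeta>)"
      have as: "\<psi> \<cdot> \<theta> \<cdot> \<zeta> = \<psi> \<cdot> (\<theta> \<cdot> \<zeta>)" using \<theta>(1) \<psi>(1) h(1) by (simp add: Hom_def)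
      have e: "f \<cdot> b = \<pi>' \<cdot> (\<theta> \<cdot> \<zeta>)" using h(3) as \<pi>t'[OF tv[OF h(1)]] by simp
      have e2: "f \<cdot> b = \<pi> \<cdot> \<zeta>" using e \<pi>t[OF h(1)] by simp
      show "papp C p q ev (\<psi> \<cdot> \<theta> \<cdot> \<zeta>) b = papp C p q ev (Id C (Dom C \<pi>) \<cdot> \<zeta>) b"
        unfolding as app'[OF tv[OF h(1)] h(2) e] app[OF h(1,2) e2] using h(1) by (simp add: Hom_def)
    qed
    show "\<theta> \<cdot> \<psi> = Id C (Dom C \<pi>')"
    proof (rule poly_obj_ext[OF P' ty(2) Id_in_Hom[OF O(2)]])
      show "\<pi>' \<cdot> (\<theta> \<cdot> \<psi>) = \<pi>' \<cdot> Id C (Dom C \<pi>')" using \<pi>t[OF \<psi>(1)] \<psi>(2) \<pi>' by (simp add: Hom_def)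
      fix t \<zeta> b assume h: "\<zeta> \<in> Hom C t (Dom C \<pi>')" "b \<in> Hom C t (Dom C f)" "f \<cdot> b = \<pi>' \<cdot> (\<theta> \<cdot> \<psi> \<cdot> \<zeta>)"
      have as: "\<theta> \<cdot> \<psi> \<cdot> \<zeta> = \<theta> \<cdot> (\<psi> \<cdot> \<zeta>)" using \<theta>(1) \<psi>(1) h(1) by (simp add: Hom_def)
      have e: "f \<cdot> b = \<pi> \<cdot> (\<psi> \<cdot> \<zeta>)" using h(3) as \<pi>t[OF pv[OF h(1)]] by simp
      have e2: "f \<cdot> b = \<pi>' \<cdot> \<zeta>" using e \<pi>t'[OF h(1)] by simp
      show "papp C p' q' ev' (\<theta> \<cdot> \<psi> \<cdot> \<zeta>) b = papp C p' q' ev' (Id C (Dom C \<pi>') \<cdot> \<zeta>) b"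
        unfolding as app[OF pv[OF h(1)] h(2) e] app'[OF h(1,2) e2] using h(1) by (simp add: Hom_def)
    qed
  qed
qed

text \<open>Closure speaks about shapes, values and the structure map, and \<open>\<theta>\<close>
  matches all three.\<close>

lemma closed_under_comparison:
  assumes \<pi>: "\<pi> \<in> Arr C" "\<pi>' \<in> Arr C" and s: "s \<in> Hom C (Dom C \<pi>) W"
    and \<theta>: "\<theta> \<in> Hom C (Dom C \<pi>) (Dom C \<pi>')" "\<pi>' \<cdot> \<theta> = \<pi>" "is_iso C \<theta>"
    and app: "\<And>z u b. \<lbrakk>u \<in> Hom C z (Dom C \<pi>); b \<in> Hom C z (Dom C f); f \<cdot> b = \<pi> \<cdot> u\<rbrakk> \<Longrightarrow>
      papp C p' q' ev' (\<theta> \<cdot> u) b = papp C p q ev u b"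
  shows "closed_under C f \<pi>' p' q' ev' (s \<cdot> inverse_arrow C \<theta>) m \<longleftrightarrow> closed_under C f \<pi> p q ev s m"
proof -
  define \<psi> where "\<psi> = inverse_arrow C \<theta>"
  have \<psi>: "\<psi> \<in> Hom C (Dom C \<pi>') (Dom C \<pi>)" "\<psi> \<cdot> \<theta> = Id C (Dom C \<pi>)" "\<theta> \<cdot> \<psi> = Id C (Dom C \<pi>')"
    unfolding \<psi>_def using inverse_arrow[OF \<theta>(3,1)] by auto
  have \<pi>t: "\<pi>' \<cdot> (\<theta> \<cdot> v) = \<pi> \<cdot> v" if "v \<in> Hom C t (Dom C \<pi>)" for v t
    using whisker[OF \<theta>(2), of v] \<theta>(1) that \<pi> by (simp add: Hom_def)
  have cond: "(\<forall>t \<zeta> b. \<zeta> \<in> Hom C t z \<and> b \<in> Hom C t (Dom C f) \<and> f \<cdot> b = \<pi>' \<cdot> (\<theta> \<cdot> u \<cdot> \<zeta>) \<longrightarrow>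
        sub_le C (papp C p' q' ev' (\<theta> \<cdot> u \<cdot> \<zeta>) b) m) \<longleftrightarrow>
      (\<forall>t \<zeta> b. \<zeta> \<in> Hom C t z \<and> b \<in> Hom C t (Dom C f) \<and> f \<cdot> b = \<pi> \<cdot> (u \<cdot> \<zeta>) \<longrightarrow>
        sub_le C (papp C p q ev (u \<cdot> \<zeta>) b) m)" if u: "u \<in> Hom C z (Dom C \<pi>)" for u z
  proof -
    have "\<theta> \<cdot> u \<cdot> \<zeta> = \<theta> \<cdot> (u \<cdot> \<zeta>)" "u \<cdot> \<zeta> \<in> Hom C t (Dom C \<pi>)" if "\<zeta> \<in> Hom C t z" for t \<zeta>
      using that u \<theta>(1) by (auto simp: Hom_def)
    note as = this
    have "f \<cdot> b = \<pi>' \<cdot> (\<theta> \<cdot> u \<cdot> \<zeta>) \<longleftrightarrow> f \<cdot> b = \<pi> \<cdot> (u \<cdot> \<zeta>)" if "\<zeta> \<in> Hom C t z" for t \<zeta> b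
      unfolding as(1)[OF that] \<pi>t[OF as(2)[OF that]] ..
    moreover have "papp C p' q' ev' (\<theta> \<cdot> u \<cdot> \<zeta>) b = papp C p q ev (u \<cdot> \<zeta>) b"
      if "\<zeta> \<in> Hom C t z" "b \<in> Hom C t (Dom C f)" "f \<cdot> b = \<pi> \<cdot> (u \<cdot> \<zeta>)" for t \<zeta> b
      unfolding as(1)[OF that(1)] by (rule app[OF as(2)[OF that(1)] that(2,3)])
    ultimately show ?thesis by (metis (no_types, lifting))
  qed
  have su: "s \<cdot> \<psi> \<cdot> (\<theta> \<cdot> u) = s \<cdot> u" if u: "u \<in> Hom C z (Dom C \<pi>)" for u z
    using whisker[OF \<psi>(2), of u] u s \<psi>(1) \<theta>(1) by (simp add: Hom_def)
  have tu: "\<theta> \<cdot> u \<in> Hom C z (Dom C \<pi>')" if "u \<in> Hom C z (Dom C \<pi>)" for u z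
    using that \<theta>(1) by (auto simp: Hom_def)
  have inv: "\<psi> \<cdot> u \<in> Hom C z (Dom C \<pi>)" "\<theta> \<cdot> (\<psi> \<cdot> u) = u" if "u \<in> Hom C z (Dom C \<pi>')" for u z
    using that \<psi>(1) \<theta>(1) whisker[OF \<psi>(3), of u] by (auto simp: Hom_def)
  show ?thesis
    unfolding \<psi>_def[symmetric]
  proof
    assume "closed_under C f \<pi>' p' q' ev' (s \<cdot> \<psi>) m"
    then have A: "sub_le C (s \<cdot> \<psi> \<cdot> u) m" if "u \<in> Hom C z (Dom C \<pi>')"
      "\<forall>t \<zeta> b. \<zeta> \<in> Hom C t z \<and> b \<in> Hom C t (Dom C f) \<and> f \<cdot> b = \<pi>' \<cdot> (u \<cdot> \<zeta>) \<longrightarrow>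
          sub_le C (papp C p' q' ev' (u \<cdot> \<zeta>) b) m" for u z
      using that unfolding closed_under_def by blast
    show "closed_under C f \<pi> p q ev s m"
      unfolding closed_under_def
    proof (intro allI impI, elim conjE)
      fix z u assume u: "u \<in> Hom C z (Dom C \<pi>)"
        and h: "\<forall>t \<zeta> b. \<zeta> \<in> Hom C t z \<and> b \<in> Hom C t (Dom C f) \<and> f \<cdot> b = \<pi> \<cdot> (u \<cdot> \<zeta>) \<longrightarrow>
          sub_le C (papp C p q ev (u \<cdot> \<zeta>) b) m"
      show "sub_le C (s \<cdot> u) m" using A[OF tu[OF u] cond[OF u, THEN iffD2, OF h]] su[OF u] by simp
    qed
  next
    assume A: "closed_under C f \<pi> p q ev s m"
    show "closed_under C f \<pi>' p' q' ev' (s \<cdot> \<psi>) m"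
      unfolding closed_under_def
    proof (intro allI impI, elim conjE)
      fix z u assume u: "u \<in> Hom C z (Dom C \<pi>')"
        and h: "\<forall>t \<zeta> b. \<zeta> \<in> Hom C t z \<and> b \<in> Hom C t (Dom C f) \<and> f \<cdot> b = \<pi>' \<cdot> (u \<cdot> \<zeta>) \<longrightarrow>
          sub_le C (papp C p' q' ev' (u \<cdot> \<zeta>) b) m"
      have "sub_le C (s \<cdot> (\<psi> \<cdot> u)) m"
        using A inv(1)[OF u] cond[OF inv(1)[OF u], unfolded inv(2)[OF u]] h unfolding closed_under_def by blast
      then show "sub_le C (s \<cdot> \<psi> \<cdot> u) m" using su[OF inv(1)[OF u], unfolded inv(2)[OF u]] by simp
    qed
  qed
qed

end

section \<open>Base change of families and polynomial objects\<close>

context lex_cat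
begin

lemma times_arr:
  assumes "h \<in> Hom C Y Y'" "X \<in> Obj C"
  shows "times_arr C X h \<in> Hom C (prod_obj C Y X) (prod_obj C Y' X)"
    "pr2 C Y' X \<cdot> times_arr C X h = pr2 C Y X"
    "u \<in> Hom C z (prod_obj C Y X) \<Longrightarrow> pr1 C Y' X \<cdot> (times_arr C X h \<cdot> u) = h \<cdot> (pr1 C Y X \<cdot> u)"
    "u \<in> Hom C z (prod_obj C Y X) \<Longrightarrow> pr2 C Y' X \<cdot> (times_arr C X h \<cdot> u) = pr2 C Y X \<cdot> u"
    "v \<in> Hom C z Y \<Longrightarrow> w \<in> Hom C z X \<Longrightarrow> times_arr C X h \<cdot> pairing C v w = pairing C (h \<cdot> v) w"
    "on_arr (star C X) h = (pr2 C Y X, times_arr C X h, pr2 C Y' X)"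
    "on_arr (star C X) h \<in> Hom (slice C X) (pr2 C Y X) (pr2 C Y' X)"
proof -
  have O: "Y \<in> Obj C" "Y' \<in> Obj C" using assms Hom_Obj by auto
  have D: "Dom C h = Y" using assms by (simp add: Hom_def)
  have hp: "h \<cdot> pr1 C Y X \<in> Hom C (prod_obj C Y X) Y'" using assms O by (auto simp: Hom_def)
  note t = pairing[OF hp pr_Hom(2)[OF O(1) assms(2)]]
  show th: "times_arr C X h \<in> Hom C (prod_obj C Y X) (prod_obj C Y' X)"
    and t2: "pr2 C Y' X \<cdot> times_arr C X h = pr2 C Y X"
    unfolding times_arr_def D using t by auto
  show "pr1 C Y' X \<cdot> (times_arr C X h \<cdot> u) = h \<cdot> (pr1 C Y X \<cdot> u)" "pr2 C Y' X \<cdot> (times_arr C X h \<cdot> u) = pr2 C Y X \<cdot> u"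
    if "u \<in> Hom C z (prod_obj C Y X)"
    unfolding times_arr_def D using whisker[OF t(2), of u] whisker[OF t(3), of u] t(1) that O assms
    by (simp_all add: Hom_def)
  show "times_arr C X h \<cdot> pairing C v w = pairing C (h \<cdot> v) w" if "v \<in> Hom C z Y" "w \<in> Hom C z X"
    unfolding times_arr_def D using that O assms by (simp add: Hom_def)
  show st: "on_arr (star C X) h = (pr2 C Y X, times_arr C X h, pr2 C Y' X)"
    unfolding times_arr_def D by (rule star_arr[OF assms])
  show "on_arr (star C X) h \<in> Hom (slice C X) (pr2 C Y X) (pr2 C Y' X)"
    unfolding st slice_Hom_triple using th t2 O assms by simp
qed

text \<open>On elements, taking the product with \<open>X\<close> adds a component that all four
  arrows leave alone.\<close>

lemma times_pullback:
  assumes pb: "is_pullback C f g p q" and X: "X \<in> Obj C"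
  shows "is_pullback C (times_arr C X f) (times_arr C X g) (times_arr C X p) (times_arr C X q)"
proof -
  note P = pullbackD[OF pb]
  have ty: "f \<in> Hom C (Dom C f) (Cod C f)" "g \<in> Hom C (Dom C g) (Cod C f)"
    "p \<in> Hom C (Dom C p) (Dom C f)" "q \<in> Hom C (Dom C p) (Dom C g)" using P by (auto simp: Hom_def)
  have O: "Dom C f \<in> Obj C" "Cod C f \<in> Obj C" "Dom C g \<in> Obj C" "Dom C p \<in> Obj C" using P by auto
  note F = times_arr[OF ty(1) X] and G = times_arr[OF ty(2) X] and Pt = times_arr[OF ty(3) X] and Q = times_arr[OF ty(4) X]
  show ?thesis
  proof (rule pullbackI[OF F(1) G(1) Pt(1) Q(1)])
    let ?V = "prod_obj C (Dom C p) X"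
    have I: "Id C ?V \<in> Hom C ?V ?V" using O X by (simp add: Hom_def)
    have pr: "pr1 C (Dom C p) X \<in> Hom C ?V (Dom C p)" "pr2 C (Dom C p) X \<in> Hom C ?V X" using pr_Hom O X by auto
    have eta: "times_arr C X p = pairing C (p \<cdot> pr1 C (Dom C p) X) (pr2 C (Dom C p) X)"
      "times_arr C X q = pairing C (q \<cdot> pr1 C (Dom C p) X) (pr2 C (Dom C p) X)"
      unfolding times_arr_def P(6) by auto
    have pp: "p \<cdot> pr1 C (Dom C p) X \<in> Hom C ?V (Dom C f)" "q \<cdot> pr1 C (Dom C p) X \<in> Hom C ?V (Dom C g)"
      using pr(1) ty by (auto simp: Hom_def)
    have "f \<cdot> (p \<cdot> pr1 C (Dom C p) X) = g \<cdot> (q \<cdot> pr1 C (Dom C p) X)"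
      using whisker[OF P(9), of "pr1 C (Dom C p) X"] pr(1) P(1-8) by (simp add: Hom_def)
    then show "times_arr C X f \<cdot> times_arr C X p = times_arr C X g \<cdot> times_arr C X q"
      unfolding eta F(5)[OF pp(1) pr(2)] G(5)[OF pp(2) pr(2)] by simp
  next
    fix z u v assume h: "u \<in> Hom C z (prod_obj C (Dom C f) X)" "v \<in> Hom C z (prod_obj C (Dom C g) X)"
      "times_arr C X f \<cdot> u = times_arr C X g \<cdot> v"
    have c: "pr1 C (Dom C f) X \<cdot> u \<in> Hom C z (Dom C f)" "pr1 C (Dom C g) X \<cdot> v \<in> Hom C z (Dom C g)"
      "pr2 C (Dom C f) X \<cdot> u \<in> Hom C z X" using h(1,2) O X by (auto simp: Hom_def)
    have "f \<cdot> (pr1 C (Dom C f) X \<cdot> u) = g \<cdot> (pr1 C (Dom C g) X \<cdot> v)"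
      using F(3)[OF h(1)] G(3)[OF h(2)] h(3) by simp
    then obtain k where k: "k \<in> Hom C z (Dom C p)" "p \<cdot> k = pr1 C (Dom C f) X \<cdot> u" "q \<cdot> k = pr1 C (Dom C g) X \<cdot> v"
      using pullbackE[OF pb c(1,2)] by blast
    have e: "pr2 C (Dom C f) X \<cdot> u = pr2 C (Dom C g) X \<cdot> v" using F(4)[OF h(1)] G(4)[OF h(2)] h(3) by simp
    have "times_arr C X p \<cdot> pairing C k (pr2 C (Dom C f) X \<cdot> u) = u"
      unfolding Pt(5)[OF k(1) c(3)] k(2) using pairing_eta[OF O(1) X h(1)] .
    moreover have "times_arr C X q \<cdot> pairing C k (pr2 C (Dom C f) X \<cdot> u) = v"
      unfolding e Q(5)[OF k(1) c(3)[unfolded e]] k(3) using pairing_eta[OF O(3) X h(2)] .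
    ultimately show "\<exists>k. k \<in> Hom C z (prod_obj C (Dom C p) X) \<and> times_arr C X p \<cdot> k = u \<and> times_arr C X q \<cdot> k = v"
      using pairing(1)[OF k(1) c(3)] by blast
  next
    fix z k k' assume h: "k \<in> Hom C z (prod_obj C (Dom C p) X)" "k' \<in> Hom C z (prod_obj C (Dom C p) X)"
      "times_arr C X p \<cdot> k = times_arr C X p \<cdot> k'" "times_arr C X q \<cdot> k = times_arr C X q \<cdot> k'"
    have c: "pr1 C (Dom C p) X \<cdot> k \<in> Hom C z (Dom C p)" "pr1 C (Dom C p) X \<cdot> k' \<in> Hom C z (Dom C p)"
      using h(1,2) O X by (auto simp: Hom_def)
    have "pr1 C (Dom C p) X \<cdot> k = pr1 C (Dom C p) X \<cdot> k'"
      by (rule pullback_ext[OF pb c])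
        (use Pt(3)[OF h(1)] Pt(3)[OF h(2)] Q(3)[OF h(1)] Q(3)[OF h(2)] h(3,4) in auto)
    moreover have "pr2 C (Dom C p) X \<cdot> k = pr2 C (Dom C p) X \<cdot> k'"
      using Pt(4)[OF h(1)] Pt(4)[OF h(2)] h(3) by simp
    ultimately show "k = k'" using product_ext[OF O(4) X h(1,2)] by blast
  qed
qed

text \<open>In a slice the stage of an argument is forced: both \<open>\<zeta>\<close> and
  \<open>b\<close> lie over \<open>z \<cdot> \<zeta>\<close>. The triples can be rebuilt from their
  middle components, and a family in the slice becomes one in the base.\<close>

lemma slice_family:
  assumes F: "(b0, f, a0) \<in> Arr (slice C X)" and a: "(z, a, a0) \<in> Arr (slice C X)"
    and fam: "is_family (slice C X) (b0, f, a0) (z, a, a0) y0 \<phi>'" and y0: "y0 \<in> Arr C" "Cod C y0 = X"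
  defines "\<phi> \<equiv> \<lambda>\<zeta> b. fst (snd (\<phi>' (z \<cdot> \<zeta>, \<zeta>, z) (z \<cdot> \<zeta>, b, b0)))"
  shows "is_family C f a (Dom C y0) \<phi>"
    "\<lbrakk>\<zeta> \<in> Hom C t (Dom C z); b \<in> Hom C t (Dom C b0); f \<cdot> b = a \<cdot> \<zeta>\<rbrakk> \<Longrightarrow>
      \<phi>' (z \<cdot> \<zeta>, \<zeta>, z) (z \<cdot> \<zeta>, b, b0) = (z \<cdot> \<zeta>, \<phi> \<zeta> b, y0) \<and>
      \<phi> \<zeta> b \<in> Hom C t (Dom C y0) \<and> y0 \<cdot> \<phi> \<zeta> b = z \<cdot> \<zeta> \<and>
      (z \<cdot> \<zeta>, \<zeta>, z) \<in> Hom (slice C X) (z \<cdot> \<zeta>) z \<and> (z \<cdot> \<zeta>, b, b0) \<in> Hom (slice C X) (z \<cdot> \<zeta>) b0 \<and>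
      (b0, f, a0) \<cdot>\<^bsub>slice C X\<^esub> (z \<cdot> \<zeta>, b, b0) = (z, a, a0) \<cdot>\<^bsub>slice C X\<^esub> (z \<cdot> \<zeta>, \<zeta>, z)"
proof -
  interpret D: category "slice C X" by (rule category_slice)
  note FD = slice_ArrD[OF F] and AD = slice_ArrD[OF a]
  have main: "\<phi>' (z \<cdot> \<zeta>, \<zeta>, z) (z \<cdot> \<zeta>, b, b0) = (z \<cdot> \<zeta>, \<phi> \<zeta> b, y0) \<and>
      \<phi> \<zeta> b \<in> Hom C t (Dom C y0) \<and> y0 \<cdot> \<phi> \<zeta> b = z \<cdot> \<zeta> \<and>
      (z \<cdot> \<zeta>, \<zeta>, z) \<in> Hom (slice C X) (z \<cdot> \<zeta>) z \<and> (z \<cdot> \<zeta>, b, b0) \<in> Hom (slice C X) (z \<cdot> \<zeta>) b0 \<and>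
      (b0, f, a0) \<cdot>\<^bsub>slice C X\<^esub> (z \<cdot> \<zeta>, b, b0) = (z, a, a0) \<cdot>\<^bsub>slice C X\<^esub> (z \<cdot> \<zeta>, \<zeta>, z)"
    and nat: "\<forall>s. \<forall>h\<in>Hom C s t. \<phi> (\<zeta> \<cdot> h) (b \<cdot> h) = \<phi> \<zeta> b \<cdot> h"
    if h: "\<zeta> \<in> Hom C t (Dom C z)" "b \<in> Hom C t (Dom C b0)" "f \<cdot> b = a \<cdot> \<zeta>" for \<zeta> b t
  proof -
    have e: "b0 \<cdot> b = z \<cdot> \<zeta>"
    proof -
      have "b0 \<cdot> b = a0 \<cdot> (f \<cdot> b)" using whisker[OF FD(7), of b] h(2) FD by (simp add: Hom_def)
      also have "\<dots> = z \<cdot> \<zeta>" unfolding h(3) using whisker[OF AD(7), of \<zeta>] h(1) AD by (simp add: Hom_def)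
      finally show ?thesis .
    qed
    have \<zeta>S: "(z \<cdot> \<zeta>, \<zeta>, z) \<in> Hom (slice C X) (z \<cdot> \<zeta>) z" and dz: "Dom C (z \<cdot> \<zeta>) = t"
      using slice_lift[OF AD(2,3) h(1)] .
    have bS: "(z \<cdot> \<zeta>, b, b0) \<in> Hom (slice C X) (z \<cdot> \<zeta>) b0" using slice_lift(1)[OF FD(2,3) h(2)] e by simp
    have eq: "(b0, f, a0) \<cdot>\<^bsub>slice C X\<^esub> (z \<cdot> \<zeta>, b, b0) = (z, a, a0) \<cdot>\<^bsub>slice C X\<^esub> (z \<cdot> \<zeta>, \<zeta>, z)"
      using h(3) by simp
    have bS': "(z \<cdot> \<zeta>, b, b0) \<in> Hom (slice C X) (z \<cdot> \<zeta>) (Dom (slice C X) (b0, f, a0))" using bS by simp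
    note fd = D.is_familyD[OF fam AD(1) \<zeta>S bS' eq]
    obtain k where k: "\<phi>' (z \<cdot> \<zeta>, \<zeta>, z) (z \<cdot> \<zeta>, b, b0) = (z \<cdot> \<zeta>, k, y0)"
      "k \<in> Hom C (Dom C (z \<cdot> \<zeta>)) (Dom C y0)" "y0 \<cdot> k = z \<cdot> \<zeta>" using fd(1) slice_HomE by metis
    have \<phi>k: "\<phi> \<zeta> b = k" unfolding \<phi>_def k(1) by simp
    show "\<phi>' (z \<cdot> \<zeta>, \<zeta>, z) (z \<cdot> \<zeta>, b, b0) = (z \<cdot> \<zeta>, \<phi> \<zeta> b, y0) \<and>
      \<phi> \<zeta> b \<in> Hom C t (Dom C y0) \<and> y0 \<cdot> \<phi> \<zeta> b = z \<cdot> \<zeta> \<and>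
      (z \<cdot> \<zeta>, \<zeta>, z) \<in> Hom (slice C X) (z \<cdot> \<zeta>) z \<and> (z \<cdot> \<zeta>, b, b0) \<in> Hom (slice C X) (z \<cdot> \<zeta>) b0 \<and>
      (b0, f, a0) \<cdot>\<^bsub>slice C X\<^esub> (z \<cdot> \<zeta>, b, b0) = (z, a, a0) \<cdot>\<^bsub>slice C X\<^esub> (z \<cdot> \<zeta>, \<zeta>, z)"
      unfolding \<phi>k using k \<zeta>S bS eq dz by simp
    show "\<forall>s. \<forall>h\<in>Hom C s t. \<phi> (\<zeta> \<cdot> h) (b \<cdot> h) = \<phi> \<zeta> b \<cdot> h"
    proof (intro allI ballI)
      fix s k' assume k': "k' \<in> Hom C s t"
      have zt: "z \<cdot> \<zeta> \<in> Arr C" "Cod C (z \<cdot> \<zeta>) = X" using h(1) AD by (auto simp: Hom_def)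
      have "(z \<cdot> \<zeta> \<cdot> k', k', z \<cdot> \<zeta>) \<in> Hom (slice C X) (z \<cdot> \<zeta> \<cdot> k') (z \<cdot> \<zeta>)"
        using slice_lift(1)[OF zt] k' dz by simp
      moreover have "z \<cdot> \<zeta> \<cdot> k' = z \<cdot> (\<zeta> \<cdot> k')" using k' h(1) AD by (simp add: Hom_def)
      ultimately have "\<phi>' (z \<cdot> (\<zeta> \<cdot> k'), \<zeta> \<cdot> k', z) (z \<cdot> (\<zeta> \<cdot> k'), b \<cdot> k', b0) = (z \<cdot> (\<zeta> \<cdot> k'), k \<cdot> k', y0)"
        using fd(2)[of "(z \<cdot> \<zeta> \<cdot> k', k', z \<cdot> \<zeta>)" "z \<cdot> \<zeta> \<cdot> k'"] unfolding k(1) slice_simps by simp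
      then show "\<phi> (\<zeta> \<cdot> k') (b \<cdot> k') = \<phi> \<zeta> b \<cdot> k'" unfolding \<phi>k unfolding \<phi>_def by simp
    qed
  qed
  show "is_family C f a (Dom C y0) \<phi>"
    unfolding is_family_def
  proof (intro allI impI)
    fix t \<zeta> b assume "\<zeta> \<in> Hom C t (Dom C a) \<and> b \<in> Hom C t (Dom C f) \<and> f \<cdot> b = a \<cdot> \<zeta>"
    then have h: "\<zeta> \<in> Hom C t (Dom C z)" "b \<in> Hom C t (Dom C b0)" "f \<cdot> b = a \<cdot> \<zeta>" using FD AD by auto
    show "\<phi> \<zeta> b \<in> Hom C t (Dom C y0) \<and> (\<forall>s. \<forall>h\<in>Hom C s t. \<phi> (\<zeta> \<cdot> h) (b \<cdot> h) = \<phi> \<zeta> b \<cdot> h)"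
      using main[OF h] nat[OF h] by blast
  qed
  assume "\<zeta> \<in> Hom C t (Dom C z)" "b \<in> Hom C t (Dom C b0)" "f \<cdot> b = a \<cdot> \<zeta>"
  then show "\<phi>' (z \<cdot> \<zeta>, \<zeta>, z) (z \<cdot> \<zeta>, b, b0) = (z \<cdot> \<zeta>, \<phi> \<zeta> b, y0) \<and>
      \<phi> \<zeta> b \<in> Hom C t (Dom C y0) \<and> y0 \<cdot> \<phi> \<zeta> b = z \<cdot> \<zeta> \<and>
      (z \<cdot> \<zeta>, \<zeta>, z) \<in> Hom (slice C X) (z \<cdot> \<zeta>) z \<and> (z \<cdot> \<zeta>, b, b0) \<in> Hom (slice C X) (z \<cdot> \<zeta>) b0 \<and>
      (b0, f, a0) \<cdot>\<^bsub>slice C X\<^esub> (z \<cdot> \<zeta>, b, b0) = (z, a, a0) \<cdot>\<^bsub>slice C X\<^esub> (z \<cdot> \<zeta>, \<zeta>, z)"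
    by (rule main)
qed

text \<open>Dependent products are computed in a slice as in the base, decorated with structure maps
  to \<open>X\<close>; \<open>slice_family\<close> translates the families and
  \<open>ex1_triple\<close> the unique solution.\<close>

lemma is_Pi_slice:
  assumes F: "(b0, f, a0) \<in> Arr (slice C X)" and dd: "(d0, d, b0) \<in> Arr (slice C X)"
    and Pi: "is_Pi C f d \<pi> p q \<epsilon>"
  shows "is_Pi (slice C X) (b0, f, a0) (d0, d, b0) (a0 \<cdot> \<pi>, \<pi>, a0) (b0 \<cdot> q, p, a0 \<cdot> \<pi>) (b0 \<cdot> q, q, b0) (b0 \<cdot> q, \<epsilon>, d0)"
proof -
  interpret D: category "slice C X" by (rule category_slice)
  note FD = slice_ArrD[OF F] and DD = slice_ArrD[OF dd]
  have pb: "is_pullback C \<pi> f p q" and \<epsilon>: "\<epsilon> \<in> Hom C (Dom C p) (Dom C d)" "d \<cdot> \<epsilon> = q"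
    using Pi unfolding is_Pi_def by blast+
  note P = pullbackD[OF pb]
  have \<pi>: "\<pi> \<in> Hom C (Dom C \<pi>) (Dom C a0)" using P FD by (simp add: Hom_def)
  have p: "p \<in> Hom C (Dom C p) (Dom C (a0 \<cdot> \<pi>))" and q: "q \<in> Hom C (Dom C p) (Dom C b0)"
    using P FD by (auto simp: Hom_def)
  note \<pi>S = slice_lift[OF FD(4,5) \<pi>]
  have a\<pi>: "a0 \<cdot> \<pi> \<in> Arr C" "Cod C (a0 \<cdot> \<pi>) = X" using \<pi> FD by (auto simp: Hom_def)
  note qS = slice_lift[OF FD(2,3) q]
  have e1: "a0 \<cdot> \<pi> \<cdot> p = b0 \<cdot> q"
  proof -
    have "a0 \<cdot> \<pi> \<cdot> p = a0 \<cdot> (\<pi> \<cdot> p)" using P FD by simp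
    also have "\<dots> = b0 \<cdot> q" unfolding P(9) by (rule whisker[OF FD(7)]) (use P FD in auto)
    finally show ?thesis .
  qed
  have pS: "(b0 \<cdot> q, p, a0 \<cdot> \<pi>) \<in> Hom (slice C X) (b0 \<cdot> q) (a0 \<cdot> \<pi>)" using slice_lift(1)[OF a\<pi> p] e1 by simp
  have \<epsilon>': "\<epsilon> \<in> Hom C (Dom C p) (Dom C d0)" using \<epsilon>(1) DD by simp
  have "d0 \<cdot> \<epsilon> = b0 \<cdot> q"
    using whisker[OF DD(7), of \<epsilon>] \<epsilon> DD(1-6,8-) by (simp add: Hom_def)
  then have \<epsilon>S: "(b0 \<cdot> q, \<epsilon>, d0) \<in> Hom (slice C X) (b0 \<cdot> q) d0" using slice_lift(1)[OF DD(2,3) \<epsilon>'] by simp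
  show ?thesis
    unfolding is_Pi_def slice_simps
  proof (intro conjI allI impI)
    show "is_pullback (slice C X) (a0 \<cdot> \<pi>, \<pi>, a0) (b0, f, a0) (b0 \<cdot> q, p, a0 \<cdot> \<pi>) (b0 \<cdot> q, q, b0)"
      using slice_pullback_iff[of "a0 \<cdot> \<pi>" \<pi> a0 X b0 f "b0 \<cdot> q" p q] \<pi>S(1) F pS qS(1) pb by (simp add: Hom_def)
    show "(d0, d, b0) \<in> Arr (slice C X)" "b0 = b0" by (simp_all add: dd)
    show "(b0 \<cdot> q, \<epsilon>, d0) \<in> Hom (slice C X) (b0 \<cdot> q) d0" by (fact \<epsilon>S)
    show "(b0 \<cdot> q, d \<cdot> \<epsilon>, b0) = (b0 \<cdot> q, q, b0)" unfolding \<epsilon>(2) ..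
    fix a' \<phi>' assume h: "a' \<in> Arr (slice C X) \<and> Cod (slice C X) a' = a0 \<and>
      is_family (slice C X) (b0, f, a0) a' d0 \<phi>' \<and>
      (\<forall>t \<zeta> b. \<zeta> \<in> Hom (slice C X) t (Dom (slice C X) a') \<and> b \<in> Hom (slice C X) t b0 \<and>
        (b0, f, a0) \<cdot>\<^bsub>slice C X\<^esub> b = a' \<cdot>\<^bsub>slice C X\<^esub> \<zeta> \<longrightarrow> (d0, d, b0) \<cdot>\<^bsub>slice C X\<^esub> \<phi>' \<zeta> b = b)"
    obtain z a where a': "a' = (z, a, a0)" using h by (cases a') auto
    have aA: "(z, a, a0) \<in> Arr (slice C X)" using h a' by simp
    note AD = slice_ArrD[OF aA]
    define \<phi> where "\<phi> \<zeta> b = fst (snd (\<phi>' (z \<cdot> \<zeta>, \<zeta>, z) (z \<cdot> \<zeta>, b, b0)))" for \<zeta> b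
    have fam': "is_family (slice C X) (b0, f, a0) (z, a, a0) d0 \<phi>'" using h a' by simp
    note sf = slice_family[OF F aA fam' DD(2,3), folded \<phi>_def]
    have hs: "(d0, d, b0) \<cdot>\<^bsub>slice C X\<^esub> \<phi>' \<zeta> b = b"
      if "\<zeta> \<in> Hom (slice C X) t z" "b \<in> Hom (slice C X) t b0"
        "(b0, f, a0) \<cdot>\<^bsub>slice C X\<^esub> b = (z, a, a0) \<cdot>\<^bsub>slice C X\<^esub> \<zeta>" for t \<zeta> b
      using h that unfolding a' slice_simps(1) by blast
    have sec: "d \<cdot> \<phi> \<zeta> b = b" if g: "\<zeta> \<in> Hom C t (Dom C z)" "b \<in> Hom C t (Dom C b0)" "f \<cdot> b = a \<cdot> \<zeta>" for t \<zeta> b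
    proof -
      have "(d0, d, b0) \<cdot>\<^bsub>slice C X\<^esub> \<phi>' (z \<cdot> \<zeta>, \<zeta>, z) (z \<cdot> \<zeta>, b, b0) = (z \<cdot> \<zeta>, b, b0)"
        using hs sf(2)[OF g] by blast
      then show ?thesis using sf(2)[OF g] by simp
    qed
    have ex: "\<exists>!u. u \<in> Hom C (Dom C a) (Dom C \<pi>) \<and> \<pi> \<cdot> u = a \<and>
           (\<forall>t \<zeta> k. \<zeta> \<in> Hom C t (Dom C a) \<and> k \<in> Hom C t (Dom C p) \<and> p \<cdot> k = u \<cdot> \<zeta> \<longrightarrow>
              \<epsilon> \<cdot> k = \<phi> \<zeta> (q \<cdot> k))"
    proof -
      have 1: "a \<in> Arr C \<and> Cod C a = Cod C f \<and> is_family C f a (Dom C d) \<phi> \<and>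
        (\<forall>t \<zeta> b. \<zeta> \<in> Hom C t (Dom C a) \<and> b \<in> Hom C t (Dom C f) \<and> f \<cdot> b = a \<cdot> \<zeta> \<longrightarrow> d \<cdot> \<phi> \<zeta> b = b)"
      proof (intro conjI allI impI)
        fix t \<zeta> b assume "\<zeta> \<in> Hom C t (Dom C a) \<and> b \<in> Hom C t (Dom C f) \<and> f \<cdot> b = a \<cdot> \<zeta>"
        then show "d \<cdot> \<phi> \<zeta> b = b" using sec unfolding AD(9) FD(9) by blast
      qed (use sf(1) AD FD DD in auto)
      show ?thesis using Pi 1 unfolding is_Pi_def by blast
    qed
    have cond: "(\<forall>t \<zeta> k. \<zeta> \<in> Hom (slice C X) t z \<and> k \<in> Hom (slice C X) t (b0 \<cdot> q) \<and>
          (b0 \<cdot> q, p, a0 \<cdot> \<pi>) \<cdot>\<^bsub>slice C X\<^esub> k = (z, u, a0 \<cdot> \<pi>) \<cdot>\<^bsub>slice C X\<^esub> \<zeta> \<longrightarrow>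
          (b0 \<cdot> q, \<epsilon>, d0) \<cdot>\<^bsub>slice C X\<^esub> k = \<phi>' \<zeta> ((b0 \<cdot> q, q, b0) \<cdot>\<^bsub>slice C X\<^esub> k)) \<longleftrightarrow>
        (\<forall>t \<zeta> k. \<zeta> \<in> Hom C t (Dom C a) \<and> k \<in> Hom C t (Dom C p) \<and> p \<cdot> k = u \<cdot> \<zeta> \<longrightarrow>
          \<epsilon> \<cdot> k = \<phi> \<zeta> (q \<cdot> k))" (is "?L \<longleftrightarrow> ?R")
      if u: "u \<in> Hom C (Dom C z) (Dom C \<pi>)" "\<pi> \<cdot> u = a" for u
    proof -
      have fqk: "q \<cdot> k \<in> Hom C t (Dom C b0)" "f \<cdot> (q \<cdot> k) = a \<cdot> \<zeta>" "b0 \<cdot> q \<cdot> k = z \<cdot> \<zeta>"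
        if g: "\<zeta> \<in> Hom C t (Dom C z)" "k \<in> Hom C t (Dom C p)" "p \<cdot> k = u \<cdot> \<zeta>" for t \<zeta> k
      proof -
        show "q \<cdot> k \<in> Hom C t (Dom C b0)" using g(2) q by (auto simp: Hom_def)
        have "f \<cdot> (q \<cdot> k) = \<pi> \<cdot> (p \<cdot> k)" using whisker[OF P(9), of k] g(2) P(1-8) by (simp add: Hom_def)
        also have "\<dots> = a \<cdot> \<zeta>" unfolding g(3) using whisker[OF u(2), of \<zeta>] u(1) g(1) P(1) by (simp add: Hom_def)
        finally show fq: "f \<cdot> (q \<cdot> k) = a \<cdot> \<zeta>" .
        have "b0 \<cdot> q \<cdot> k = a0 \<cdot> (f \<cdot> (q \<cdot> k))"
          using whisker[OF FD(7), of "q \<cdot> k"] g(2) q FD by (simp add: Hom_def)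
        also have "\<dots> = z \<cdot> \<zeta>" unfolding fq using whisker[OF AD(7), of \<zeta>] g(1) AD by (simp add: Hom_def)
        finally show "b0 \<cdot> q \<cdot> k = z \<cdot> \<zeta>" .
      qed
      show ?thesis
      proof
        assume L: ?L
        show ?R
        proof (intro allI impI)
          fix t \<zeta> k assume "\<zeta> \<in> Hom C t (Dom C a) \<and> k \<in> Hom C t (Dom C p) \<and> p \<cdot> k = u \<cdot> \<zeta>"
          then have g: "\<zeta> \<in> Hom C t (Dom C z)" "k \<in> Hom C t (Dom C p)" "p \<cdot> k = u \<cdot> \<zeta>" using AD by auto
          note fq = fqk[OF g]
          have bq: "b0 \<cdot> q \<in> Arr C" "Cod C (b0 \<cdot> q) = X" using q FD by (auto simp: Hom_def)
          have kS: "(z \<cdot> \<zeta>, k, b0 \<cdot> q) \<in> Hom (slice C X) (z \<cdot> \<zeta>) (b0 \<cdot> q)"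
            using slice_lift(1)[OF bq, of k t] g(2) qS(2) fq(3) by simp
          have "(b0 \<cdot> q, p, a0 \<cdot> \<pi>) \<cdot>\<^bsub>slice C X\<^esub> (z \<cdot> \<zeta>, k, b0 \<cdot> q) = (z, u, a0 \<cdot> \<pi>) \<cdot>\<^bsub>slice C X\<^esub> (z \<cdot> \<zeta>, \<zeta>, z)"
            using g(3) by simp
          then have "(b0 \<cdot> q, \<epsilon>, d0) \<cdot>\<^bsub>slice C X\<^esub> (z \<cdot> \<zeta>, k, b0 \<cdot> q) =
            \<phi>' (z \<cdot> \<zeta>, \<zeta>, z) ((b0 \<cdot> q, q, b0) \<cdot>\<^bsub>slice C X\<^esub> (z \<cdot> \<zeta>, k, b0 \<cdot> q))"
            using L kS sf(2)[OF g(1) fq(1,2)] by blast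
          then show "\<epsilon> \<cdot> k = \<phi> \<zeta> (q \<cdot> k)" using sf(2)[OF g(1) fq(1,2)] by simp
        qed
      next
        assume R: ?R
        show ?L
        proof (intro allI impI)
          fix t \<zeta>' k' assume g0: "\<zeta>' \<in> Hom (slice C X) t z \<and> k' \<in> Hom (slice C X) t (b0 \<cdot> q) \<and>
            (b0 \<cdot> q, p, a0 \<cdot> \<pi>) \<cdot>\<^bsub>slice C X\<^esub> k' = (z, u, a0 \<cdot> \<pi>) \<cdot>\<^bsub>slice C X\<^esub> \<zeta>'"
          obtain \<zeta> where \<zeta>: "\<zeta>' = (t, \<zeta>, z)" "\<zeta> \<in> Hom C (Dom C t) (Dom C z)" "z \<cdot> \<zeta> = t" using g0 slice_HomE by metis
          obtain k where k: "k' = (t, k, b0 \<cdot> q)" "k \<in> Hom C (Dom C t) (Dom C (b0 \<cdot> q))" using g0 slice_HomE by metis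
          have g: "k \<in> Hom C (Dom C t) (Dom C p)" "p \<cdot> k = u \<cdot> \<zeta>" using g0 k qS(2) unfolding \<zeta>(1) by auto
          have "\<epsilon> \<cdot> k = \<phi> \<zeta> (q \<cdot> k)" using R \<zeta>(2) g AD by simp
          then show "(b0 \<cdot> q, \<epsilon>, d0) \<cdot>\<^bsub>slice C X\<^esub> k' = \<phi>' \<zeta>' ((b0 \<cdot> q, q, b0) \<cdot>\<^bsub>slice C X\<^esub> k')"
            unfolding \<zeta>(1) k(1) slice_simps
            using sf(2)[OF \<zeta>(2) fqk(1,2)[OF \<zeta>(2) g], unfolded \<zeta>(3)] by simp
        qed
      qed
    qed
    have sl: "h \<in> Hom (slice C X) z (a0 \<cdot> \<pi>) \<and> (a0 \<cdot> \<pi>, \<pi>, a0) \<cdot>\<^bsub>slice C X\<^esub> h = (z, a, a0) \<longleftrightarrow>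
      (\<exists>u. h = (z, u, a0 \<cdot> \<pi>) \<and> u \<in> Hom C (Dom C z) (Dom C \<pi>) \<and> \<pi> \<cdot> u = a)" for h
    proof
      assume "h \<in> Hom (slice C X) z (a0 \<cdot> \<pi>) \<and> (a0 \<cdot> \<pi>, \<pi>, a0) \<cdot>\<^bsub>slice C X\<^esub> h = (z, a, a0)"
      moreover from this obtain u where "h = (z, u, a0 \<cdot> \<pi>)" "u \<in> Hom C (Dom C z) (Dom C (a0 \<cdot> \<pi>))"
        using slice_HomE by metis
      ultimately show "\<exists>u. h = (z, u, a0 \<cdot> \<pi>) \<and> u \<in> Hom C (Dom C z) (Dom C \<pi>) \<and> \<pi> \<cdot> u = a"
        using \<pi>S(2) by auto
    next
      assume "\<exists>u. h = (z, u, a0 \<cdot> \<pi>) \<and> u \<in> Hom C (Dom C z) (Dom C \<pi>) \<and> \<pi> \<cdot> u = a"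
      then obtain u where u: "h = (z, u, a0 \<cdot> \<pi>)" "u \<in> Hom C (Dom C z) (Dom C \<pi>)" "\<pi> \<cdot> u = a" by blast
      have "a0 \<cdot> \<pi> \<cdot> u = a0 \<cdot> (\<pi> \<cdot> u)" using u(2) \<pi> FD by (simp add: Hom_def)
      then have "a0 \<cdot> \<pi> \<cdot> u = z" unfolding u(3) using AD(7) by simp
      then have "(z, u, a0 \<cdot> \<pi>) \<in> Hom (slice C X) z (a0 \<cdot> \<pi>)"
        unfolding slice_Hom_triple using u(2) AD a\<pi> \<pi>S(2) by simp
      then show "h \<in> Hom (slice C X) z (a0 \<cdot> \<pi>) \<and> (a0 \<cdot> \<pi>, \<pi>, a0) \<cdot>\<^bsub>slice C X\<^esub> h = (z, a, a0)"
        using u by simp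
    qed
    define R where "R u \<longleftrightarrow> (\<forall>t \<zeta> k. \<zeta> \<in> Hom C t (Dom C a) \<and> k \<in> Hom C t (Dom C p) \<and> p \<cdot> k = u \<cdot> \<zeta> \<longrightarrow>
          \<epsilon> \<cdot> k = \<phi> \<zeta> (q \<cdot> k))" for u
    have ex': "\<exists>!u. (u \<in> Hom C (Dom C z) (Dom C \<pi>) \<and> \<pi> \<cdot> u = a) \<and> R u"
      using ex unfolding R_def AD(9) conj_assoc .
    have "(\<exists>!h. (\<exists>u. h = (z, u, a0 \<cdot> \<pi>) \<and> u \<in> Hom C (Dom C z) (Dom C \<pi>) \<and> \<pi> \<cdot> u = a) \<and> R (fst (snd h)))"
      by (rule ex1_triple[THEN iffD2, OF ex'])
    moreover have "((\<exists>u. h = (z, u, a0 \<cdot> \<pi>) \<and> u \<in> Hom C (Dom C z) (Dom C \<pi>) \<and> \<pi> \<cdot> u = a) \<and> R (fst (snd h))) =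
      (h \<in> Hom (slice C X) z (a0 \<cdot> \<pi>) \<and> (a0 \<cdot> \<pi>, \<pi>, a0) \<cdot>\<^bsub>slice C X\<^esub> h = (z, a, a0) \<and>
        (\<forall>t \<zeta> k. \<zeta> \<in> Hom (slice C X) t z \<and> k \<in> Hom (slice C X) t (b0 \<cdot> q) \<and>
          (b0 \<cdot> q, p, a0 \<cdot> \<pi>) \<cdot>\<^bsub>slice C X\<^esub> k = h \<cdot>\<^bsub>slice C X\<^esub> \<zeta> \<longrightarrow>
          (b0 \<cdot> q, \<epsilon>, d0) \<cdot>\<^bsub>slice C X\<^esub> k = \<phi>' \<zeta> ((b0 \<cdot> q, q, b0) \<cdot>\<^bsub>slice C X\<^esub> k)))"
      (is "(?E \<and> ?R) = (?H \<and> ?Q \<and> ?B)") for h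
    proof -
      have "?R = ?B" if ?E
      proof -
        obtain u where u: "h = (z, u, a0 \<cdot> \<pi>)" "u \<in> Hom C (Dom C z) (Dom C \<pi>)" "\<pi> \<cdot> u = a" using \<open>?E\<close> by blast
        show ?thesis using cond[OF u(2,3)] unfolding u(1) R_def by simp
      qed
      then show ?thesis using sl[of h] by blast
    qed
    ultimately show "\<exists>!u. u \<in> Hom (slice C X) (Dom (slice C X) a') (a0 \<cdot> \<pi>) \<and>
        (a0 \<cdot> \<pi>, \<pi>, a0) \<cdot>\<^bsub>slice C X\<^esub> u = a' \<and>
        (\<forall>t \<zeta> k. \<zeta> \<in> Hom (slice C X) t (Dom (slice C X) a') \<and> k \<in> Hom (slice C X) t (b0 \<cdot> q) \<and>
          (b0 \<cdot> q, p, a0 \<cdot> \<pi>) \<cdot>\<^bsub>slice C X\<^esub> k = u \<cdot>\<^bsub>slice C X\<^esub> \<zeta> \<longrightarrow>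
          (b0 \<cdot> q, \<epsilon>, d0) \<cdot>\<^bsub>slice C X\<^esub> k = \<phi>' \<zeta> ((b0 \<cdot> q, q, b0) \<cdot>\<^bsub>slice C X\<^esub> k))"
      unfolding a' slice_simps by simp
  qed
qed

text \<open>An element of the base change of \<open>Y\<close> at a stage \<open>z\<close> is an
  element of \<open>Y\<close> paired with \<open>z\<close> itself. Families in the base change of
  \<open>W\<close> thus amount to families in \<open>W\<close>, the second component being forced;
  this is why base change commutes with polynomial functors.\<close>

lemma star_poly_obj:
  assumes P: "is_poly_obj C f W \<pi> p q ev" and X: "X \<in> Obj C"
  shows "is_poly_obj (slice C X) (on_arr (star C X) f) (on_obj (star C X) W) (on_arr (star C X) \<pi>)
    (on_arr (star C X) p) (on_arr (star C X) q) (on_arr (star C X) ev)"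
proof -
  interpret D: category "slice C X" by (rule category_slice)
  note pb = poly_objD(1)[OF P]
  note PB = pullbackD[OF pb]
  define A where "A = Cod C f"
  define B where "B = Dom C f"
  define PW where "PW = Dom C \<pi>"
  define V where "V = Dom C p"
  have f: "f \<in> Hom C B A" and \<pi>: "\<pi> \<in> Hom C PW A" and p: "p \<in> Hom C V PW" and q: "q \<in> Hom C V B"
    and ev: "ev \<in> Hom C V W"
    unfolding A_def B_def PW_def V_def using PB poly_objD(2)[OF P] by (auto simp: Hom_def)
  have O: "A \<in> Obj C" "B \<in> Obj C" "PW \<in> Obj C" "V \<in> Obj C" "W \<in> Obj C" using f p ev Hom_Obj by auto
  note F = times_arr[OF f X] and Pi = times_arr[OF \<pi> X] and Pp = times_arr[OF p X] and Pq = times_arr[OF q X] and Ev = times_arr[OF ev X]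
  note SF = F(7)[unfolded F(6)] and SPi = Pi(7)[unfolded Pi(6)] and Sp = Pp(7)[unfolded Pp(6)]
    and Sq = Pq(7)[unfolded Pq(6)] and Sev = Ev(7)[unfolded Ev(6)]
  define prj where "prj Y = pr2 C Y X" for Y
  define pr where "pr Y = pr1 C Y X" for Y
  have prj: "prj Y \<in> Hom C (prod_obj C Y X) X" "pr Y \<in> Hom C (prod_obj C Y X) Y" if "Y \<in> Obj C" for Y
    unfolding prj_def pr_def using pr_Hom[OF that X] by auto
  have lift: "(z, pairing C v z, prj Y) \<in> Hom (slice C X) z (prj Y)"
    if "v \<in> Hom C (Dom C z) Y" "z \<in> Arr C" "Cod C z = X" for z v Y
  proof -
    have "z \<in> Hom C (Dom C z) X" using that by (simp add: Hom_def)
    note t = pairing[OF that(1) this]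
    show ?thesis unfolding slice_Hom_triple prj_def using t that X Hom_Obj(2)[OF that(1)] by simp
  qed
  have unlift: "pr Y \<cdot> v \<in> Hom C (Dom C z) Y" "v = pairing C (pr Y \<cdot> v) z" "prj Y \<cdot> v = z" "v \<in> Hom C (Dom C z) (prod_obj C Y X)"
    if "(z, v, prj Y) \<in> Hom (slice C X) z (prj Y)" "Y \<in> Obj C" for z v Y
  proof -
    have v: "v \<in> Hom C (Dom C z) (prod_obj C Y X)" and vz: "prj Y \<cdot> v = z"
      using that X unfolding slice_Hom_triple prj_def by auto
    then show "v \<in> Hom C (Dom C z) (prod_obj C Y X)" "prj Y \<cdot> v = z" by auto
    show "pr Y \<cdot> v \<in> Hom C (Dom C z) Y" using v prj(2)[OF that(2)] by (auto simp: Hom_def)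
    show "v = pairing C (pr Y \<cdot> v) z" using pairing_eta[OF that(2) X v] vz unfolding pr_def prj_def by simp
  qed
  show ?thesis
    unfolding is_poly_obj_def star_obj F(6) Pi(6) Pp(6) Pq(6) Ev(6) slice_simps prj_def[symmetric]
  proof (intro conjI allI impI)
    show "is_pullback (slice C X) (prj PW, times_arr C X \<pi>, prj A) (prj B, times_arr C X f, prj A)
      (prj V, times_arr C X p, prj PW) (prj V, times_arr C X q, prj B)"
      using slice_pullback_iff[of "prj PW" "times_arr C X \<pi>" "prj A" X "prj B" "times_arr C X f" "prj V" "times_arr C X p" "times_arr C X q"]
        SF SPi Sp Sq times_pullback[OF pb X] unfolding prj_def[symmetric] by (simp add: Hom_def)
    show "(prj V, times_arr C X ev, prj W) \<in> Hom (slice C X) (prj V) (prj W)" using Sev unfolding prj_def .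
    fix a' \<phi>' assume h: "a' \<in> Arr (slice C X) \<and> Cod (slice C X) a' = prj A \<and>
      is_family (slice C X) (prj B, times_arr C X f, prj A) a' (prj W) \<phi>'"
    obtain z a1 where a': "a' = (z, a1, prj A)" using h by (cases a') auto
    have aA: "(z, a1, prj A) \<in> Arr (slice C X)" using h a' by simp
    note AD = slice_ArrD[OF aA]
    define Z where "Z = Dom C z"
    have z: "z \<in> Hom C Z X" unfolding Z_def using AD by (simp add: Hom_def)
    note ua = unlift[OF AD(1) O(1), folded Z_def]
    define a where "a = pr A \<cdot> a1"
    have a: "a \<in> Hom C Z A" unfolding a_def using ua(1) .
    have a1: "a1 = pairing C a z" unfolding a_def using ua(2) .
    have fam': "is_family (slice C X) (prj B, times_arr C X f, prj A) (z, a1, prj A) (prj W) \<phi>'" using h a' by simp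
    have FA: "(prj B, times_arr C X f, prj A) \<in> Arr (slice C X)" using SF unfolding prj_def by (simp add: Hom_def)
    have prjW: "prj W \<in> Arr C" "Cod C (prj W) = X" "Dom C (prj W) = prod_obj C W X"
      "Dom C (prj B) = prod_obj C B X" using prj(1)[OF O(5)] prj(1)[OF O(2)] by (auto simp: Hom_def)
    define \<phi>1 where "\<phi>1 \<zeta> b = fst (snd (\<phi>' (z \<cdot> \<zeta>, \<zeta>, z) (z \<cdot> \<zeta>, b, prj B)))" for \<zeta> b
    note sf = slice_family[OF FA aA fam' prjW(1,2), folded \<phi>1_def Z_def, unfolded prjW(3,4)]
    \<comment> \<open>The family in \<open>W\<close> underlying \<open>\<phi>1\<close>: an argument
      \<open>b\<close> is completed by the forced component \<open>z \<cdot> \<zeta>\<close>, and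
      the first component of the value is kept.\<close>
    define \<phi> where "\<phi> \<zeta> b = pr W \<cdot> \<phi>1 \<zeta> (pairing C b (z \<cdot> \<zeta>))" for \<zeta> b
    have z\<zeta>: "z \<cdot> \<zeta> \<in> Hom C t X" if "\<zeta> \<in> Hom C t Z" for \<zeta> t using that z by (auto simp: Hom_def)
    have pb_eq: "times_arr C X f \<cdot> pairing C b (z \<cdot> \<zeta>) = a1 \<cdot> \<zeta>" "pairing C b (z \<cdot> \<zeta>) \<in> Hom C t (prod_obj C B X)"
      if g: "\<zeta> \<in> Hom C t Z" "b \<in> Hom C t B" "f \<cdot> b = a \<cdot> \<zeta>" for \<zeta> b t
    proof -
      have "a1 \<cdot> \<zeta> = pairing C (a \<cdot> \<zeta>) (z \<cdot> \<zeta>)" unfolding a1 using a z g(1) by (simp add: Hom_def)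
      then show "times_arr C X f \<cdot> pairing C b (z \<cdot> \<zeta>) = a1 \<cdot> \<zeta>"
        using F(5)[OF g(2) z\<zeta>[OF g(1)]] g(3) by simp
      show "pairing C b (z \<cdot> \<zeta>) \<in> Hom C t (prod_obj C B X)" using pairing(1)[OF g(2) z\<zeta>[OF g(1)]] .
    qed
    have \<phi>1: "\<phi>1 \<zeta> (pairing C b (z \<cdot> \<zeta>)) \<in> Hom C t (prod_obj C W X)" "\<phi> \<zeta> b \<in> Hom C t W"
      "\<phi>1 \<zeta> (pairing C b (z \<cdot> \<zeta>)) = pairing C (\<phi> \<zeta> b) (z \<cdot> \<zeta>)"
      if g: "\<zeta> \<in> Hom C t Z" "b \<in> Hom C t B" "f \<cdot> b = a \<cdot> \<zeta>" for \<zeta> b t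
    proof -
      have s: "\<phi>1 \<zeta> (pairing C b (z \<cdot> \<zeta>)) \<in> Hom C t (prod_obj C W X)" "prj W \<cdot> \<phi>1 \<zeta> (pairing C b (z \<cdot> \<zeta>)) = z \<cdot> \<zeta>"
        using sf(2)[OF g(1) pb_eq(2)[OF g] pb_eq(1)[OF g]] by auto
      then show "\<phi>1 \<zeta> (pairing C b (z \<cdot> \<zeta>)) \<in> Hom C t (prod_obj C W X)" by simp
      show "\<phi> \<zeta> b \<in> Hom C t W" unfolding \<phi>_def using s(1) prj(2)[OF O(5)] by (auto simp: Hom_def)
      show "\<phi>1 \<zeta> (pairing C b (z \<cdot> \<zeta>)) = pairing C (\<phi> \<zeta> b) (z \<cdot> \<zeta>)"
        using pairing_eta[OF O(5) X s(1)] s(2) unfolding \<phi>_def pr_def prj_def by simp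
    qed
    have fam: "is_family C f a W \<phi>"
      unfolding is_family_def
    proof (intro allI impI conjI ballI)
      fix t \<zeta> b assume "\<zeta> \<in> Hom C t (Dom C a) \<and> b \<in> Hom C t (Dom C f) \<and> f \<cdot> b = a \<cdot> \<zeta>"
      then have g: "\<zeta> \<in> Hom C t Z" "b \<in> Hom C t B" "f \<cdot> b = a \<cdot> \<zeta>" using a B_def by (auto simp: Hom_def)
      show "\<phi> \<zeta> b \<in> Hom C t W" using \<phi>1(2)[OF g] .
      fix s k assume k: "k \<in> Hom C s t"
      have aH: "a1 \<in> Hom C Z (Dom C (prj A))" using AD unfolding Z_def by simp
      have bF: "pairing C b (z \<cdot> \<zeta>) \<in> Hom C t (Dom C (times_arr C X f))" using pb_eq(2)[OF g] F(1) by (simp add: Hom_def)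
      have "\<phi>1 (\<zeta> \<cdot> k) (pairing C b (z \<cdot> \<zeta>) \<cdot> k) = \<phi>1 \<zeta> (pairing C b (z \<cdot> \<zeta>)) \<cdot> k"
        by (rule is_familyD(2)[OF sf(1) aH g(1) bF pb_eq(1)[OF g] k])
      moreover have "pairing C b (z \<cdot> \<zeta>) \<cdot> k = pairing C (b \<cdot> k) (z \<cdot> (\<zeta> \<cdot> k))"
        using g(1,2) k z by (simp add: Hom_def)
      ultimately show "\<phi> (\<zeta> \<cdot> k) (b \<cdot> k) = \<phi> \<zeta> b \<cdot> k"
        unfolding \<phi>_def using \<phi>1(1)[OF g] prj(2)[OF O(5)] k by (simp add: Hom_def)
    qed
    define R where "R u \<longleftrightarrow> (\<forall>t \<zeta> k. \<zeta> \<in> Hom C t Z \<and> k \<in> Hom C t V \<and> p \<cdot> k = u \<cdot> \<zeta> \<longrightarrow>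
              ev \<cdot> k = \<phi> \<zeta> (q \<cdot> k))" for u
    have ex: "\<exists>!u. u \<in> Hom C Z PW \<and> \<pi> \<cdot> u = a \<and> R u"
    proof -
      have 1: "a \<in> Arr C \<and> Cod C a = Cod C f \<and> is_family C f a W \<phi>" and 2: "Dom C a = Z"
        using a fam A_def by (auto simp: Hom_def)
      show ?thesis using P 1 unfolding is_poly_obj_def R_def PW_def V_def 2[symmetric] by blast
    qed
    have R_iff: "(\<forall>t \<zeta> k. \<zeta> \<in> Hom (slice C X) t z \<and> k \<in> Hom (slice C X) t (prj V) \<and>
          (prj V, times_arr C X p, prj PW) \<cdot>\<^bsub>slice C X\<^esub> k = (z, pairing C u z, prj PW) \<cdot>\<^bsub>slice C X\<^esub> \<zeta> \<longrightarrow>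
          (prj V, times_arr C X ev, prj W) \<cdot>\<^bsub>slice C X\<^esub> k = \<phi>' \<zeta> ((prj V, times_arr C X q, prj B) \<cdot>\<^bsub>slice C X\<^esub> k)) \<longleftrightarrow> R u"
      (is "?L \<longleftrightarrow> _") if u: "u \<in> Hom C Z PW" "\<pi> \<cdot> u = a" for u
    proof -
      have fqk: "q \<cdot> k \<in> Hom C t B" "f \<cdot> (q \<cdot> k) = a \<cdot> \<zeta>"
        if g: "\<zeta> \<in> Hom C t Z" "k \<in> Hom C t V" "p \<cdot> k = u \<cdot> \<zeta>" for t \<zeta> k
      proof -
        show "q \<cdot> k \<in> Hom C t B" using g(2) q by (auto simp: Hom_def)
        have "f \<cdot> (q \<cdot> k) = \<pi> \<cdot> (p \<cdot> k)" using whisker[OF PB(9), of k] g(2) f q \<pi> p by (simp add: Hom_def)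
        also have "\<dots> = a \<cdot> \<zeta>" unfolding g(3) using whisker[OF u(2), of \<zeta>] u(1) g(1) \<pi> by (simp add: Hom_def)
        finally show "f \<cdot> (q \<cdot> k) = a \<cdot> \<zeta>" .
      qed
      have uz\<zeta>: "pairing C u z \<cdot> \<zeta> = pairing C (u \<cdot> \<zeta>) (z \<cdot> \<zeta>)" if "\<zeta> \<in> Hom C t Z" for \<zeta> t
        using that u(1) z by (simp add: Hom_def)
      show ?thesis
      proof
        assume L: ?L
        show "R u"
          unfolding R_def
        proof (intro allI impI)
          fix t \<zeta> k assume "\<zeta> \<in> Hom C t Z \<and> k \<in> Hom C t V \<and> p \<cdot> k = u \<cdot> \<zeta>"
          then have g: "\<zeta> \<in> Hom C t Z" "k \<in> Hom C t V" "p \<cdot> k = u \<cdot> \<zeta>" by auto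
          note fq = fqk[OF g]
          note zz = z\<zeta>[OF g(1)]
          have zA: "z \<cdot> \<zeta> \<in> Arr C" "Cod C (z \<cdot> \<zeta>) = X" "Dom C (z \<cdot> \<zeta>) = t" using zz by (auto simp: Hom_def)
          have kS: "(z \<cdot> \<zeta>, pairing C k (z \<cdot> \<zeta>), prj V) \<in> Hom (slice C X) (z \<cdot> \<zeta>) (prj V)"
            using lift[of k "z \<cdot> \<zeta>" V] zA g(2) by simp
          have \<zeta>S: "(z \<cdot> \<zeta>, \<zeta>, z) \<in> Hom (slice C X) (z \<cdot> \<zeta>) z" using sf(2)[OF g(1) pb_eq(2)[OF g(1) fq] pb_eq(1)[OF g(1) fq]] by blast
          have e1: "(prj V, times_arr C X p, prj PW) \<cdot>\<^bsub>slice C X\<^esub> (z \<cdot> \<zeta>, pairing C k (z \<cdot> \<zeta>), prj V) =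
            (z, pairing C u z, prj PW) \<cdot>\<^bsub>slice C X\<^esub> (z \<cdot> \<zeta>, \<zeta>, z)"
            unfolding slice_simps Pp(5)[OF g(2) zz] uz\<zeta>[OF g(1)] g(3) ..
          have "(prj V, times_arr C X ev, prj W) \<cdot>\<^bsub>slice C X\<^esub> (z \<cdot> \<zeta>, pairing C k (z \<cdot> \<zeta>), prj V) =
            \<phi>' (z \<cdot> \<zeta>, \<zeta>, z) ((prj V, times_arr C X q, prj B) \<cdot>\<^bsub>slice C X\<^esub> (z \<cdot> \<zeta>, pairing C k (z \<cdot> \<zeta>), prj V))"
            using L kS \<zeta>S e1 by blast
          then have "pairing C (ev \<cdot> k) (z \<cdot> \<zeta>) = pairing C (\<phi> \<zeta> (q \<cdot> k)) (z \<cdot> \<zeta>)"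
            unfolding slice_simps Ev(5)[OF g(2) zz] Pq(5)[OF g(2) zz]
            using sf(2)[OF g(1) pb_eq(2)[OF g(1) fq] pb_eq(1)[OF g(1) fq]] \<phi>1(3)[OF g(1) fq] by simp
          moreover have "ev \<cdot> k \<in> Hom C t W" using g(2) ev by (auto simp: Hom_def)
          ultimately show "ev \<cdot> k = \<phi> \<zeta> (q \<cdot> k)" using pairing_eq_iff zz \<phi>1(2)[OF g(1) fq] by metis
        qed
      next
        assume R: "R u"
        show ?L
        proof (intro allI impI)
          fix t \<zeta>' k' assume g0: "\<zeta>' \<in> Hom (slice C X) t z \<and> k' \<in> Hom (slice C X) t (prj V) \<and>
            (prj V, times_arr C X p, prj PW) \<cdot>\<^bsub>slice C X\<^esub> k' = (z, pairing C u z, prj PW) \<cdot>\<^bsub>slice C X\<^esub> \<zeta>'"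
          obtain \<zeta> where \<zeta>: "\<zeta>' = (t, \<zeta>, z)" "\<zeta> \<in> Hom C (Dom C t) Z" "z \<cdot> \<zeta> = t"
            using g0 slice_HomE unfolding Z_def by metis
          obtain k1 where k1: "k' = (t, k1, prj V)" using g0 slice_HomE by metis
          have "(t, k1, prj V) \<in> Hom (slice C X) t (prj V)" using g0 k1 by simp
          note uk = unlift[OF this O(4)]
          define k where "k = pr V \<cdot> k1"
          have k: "k \<in> Hom C (Dom C t) V" "k1 = pairing C k t" unfolding k_def using uk by auto
          have t: "t \<in> Hom C (Dom C t) X" using z\<zeta>[OF \<zeta>(2)] \<zeta>(3) by simp
          have "pairing C (p \<cdot> k) t = pairing C (u \<cdot> \<zeta>) t"
            using g0 uz\<zeta>[OF \<zeta>(2)] \<zeta>(3) Pp(5)[OF k(1) t] unfolding k1 \<zeta>(1) slice_simps k(2) by simp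
          moreover have "p \<cdot> k \<in> Hom C (Dom C t) PW" "u \<cdot> \<zeta> \<in> Hom C (Dom C t) PW"
            using p k(1) u(1) \<zeta>(2) by (auto simp: Hom_def)
          ultimately have pk: "p \<cdot> k = u \<cdot> \<zeta>" using pairing_eq_iff t by metis
          have "ev \<cdot> k = \<phi> \<zeta> (q \<cdot> k)" using R \<zeta>(2) k(1) pk unfolding R_def by blast
          note fq = fqk[OF \<zeta>(2) k(1) pk]
          show "(prj V, times_arr C X ev, prj W) \<cdot>\<^bsub>slice C X\<^esub> k' = \<phi>' \<zeta>' ((prj V, times_arr C X q, prj B) \<cdot>\<^bsub>slice C X\<^esub> k')"
            unfolding k1 \<zeta>(1) slice_simps k(2) Ev(5)[OF k(1) t] Pq(5)[OF k(1) t]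
            using sf(2)[OF \<zeta>(2) pb_eq(2)[OF \<zeta>(2) fq] pb_eq(1)[OF \<zeta>(2) fq]] \<phi>1(3)[OF \<zeta>(2) fq] \<open>ev \<cdot> k = \<phi> \<zeta> (q \<cdot> k)\<close> unfolding \<zeta>(3) by simp
        qed
      qed
    qed
    have pi_eq: "times_arr C X \<pi> \<cdot> pairing C u z = a1 \<longleftrightarrow> \<pi> \<cdot> u = a" if u: "u \<in> Hom C Z PW" for u
    proof -
      have "\<pi> \<cdot> u \<in> Hom C Z A" using u \<pi> by (auto simp: Hom_def)
      then show ?thesis unfolding Pi(5)[OF u z] a1 using pairing_eq_iff[OF _ z a z] by blast
    qed
    obtain u where u: "u \<in> Hom C Z PW" "\<pi> \<cdot> u = a" "R u" and uniq: "\<And>v. v \<in> Hom C Z PW \<Longrightarrow> \<pi> \<cdot> v = a \<Longrightarrow> R v \<Longrightarrow> v = u"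
      using ex by blast
    show "\<exists>!u. u \<in> Hom (slice C X) (Dom (slice C X) a') (prj PW) \<and>
        (prj PW, times_arr C X \<pi>, prj A) \<cdot>\<^bsub>slice C X\<^esub> u = a' \<and>
        (\<forall>t \<zeta> k. \<zeta> \<in> Hom (slice C X) t (Dom (slice C X) a') \<and> k \<in> Hom (slice C X) t (prj V) \<and>
          (prj V, times_arr C X p, prj PW) \<cdot>\<^bsub>slice C X\<^esub> k = u \<cdot>\<^bsub>slice C X\<^esub> \<zeta> \<longrightarrow>
          (prj V, times_arr C X ev, prj W) \<cdot>\<^bsub>slice C X\<^esub> k = \<phi>' \<zeta> ((prj V, times_arr C X q, prj B) \<cdot>\<^bsub>slice C X\<^esub> k))"
      unfolding a' slice_simps(1)
    proof (rule ex1I[of _ "(z, pairing C u z, prj PW)"], intro conjI)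
      show "(z, pairing C u z, prj PW) \<in> Hom (slice C X) z (prj PW)"
        using lift[of u z PW] u(1) AD Z_def by simp
      show "(prj PW, times_arr C X \<pi>, prj A) \<cdot>\<^bsub>slice C X\<^esub> (z, pairing C u z, prj PW) = (z, a1, prj A)"
        using pi_eq[OF u(1)] u(2) by simp
      show "\<forall>t \<zeta> k. \<zeta> \<in> Hom (slice C X) t z \<and> k \<in> Hom (slice C X) t (prj V) \<and>
          (prj V, times_arr C X p, prj PW) \<cdot>\<^bsub>slice C X\<^esub> k = (z, pairing C u z, prj PW) \<cdot>\<^bsub>slice C X\<^esub> \<zeta> \<longrightarrow>
          (prj V, times_arr C X ev, prj W) \<cdot>\<^bsub>slice C X\<^esub> k = \<phi>' \<zeta> ((prj V, times_arr C X q, prj B) \<cdot>\<^bsub>slice C X\<^esub> k)"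
        using R_iff[OF u(1,2)] u(3) by blast
    next
      fix w assume w: "w \<in> Hom (slice C X) z (prj PW) \<and>
        (prj PW, times_arr C X \<pi>, prj A) \<cdot>\<^bsub>slice C X\<^esub> w = (z, a1, prj A) \<and>
        (\<forall>t \<zeta> k. \<zeta> \<in> Hom (slice C X) t z \<and> k \<in> Hom (slice C X) t (prj V) \<and>
          (prj V, times_arr C X p, prj PW) \<cdot>\<^bsub>slice C X\<^esub> k = w \<cdot>\<^bsub>slice C X\<^esub> \<zeta> \<longrightarrow>
          (prj V, times_arr C X ev, prj W) \<cdot>\<^bsub>slice C X\<^esub> k = \<phi>' \<zeta> ((prj V, times_arr C X q, prj B) \<cdot>\<^bsub>slice C X\<^esub> k))"
      obtain w1 where w1: "w = (z, w1, prj PW)" using w slice_HomE by metis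
      have "(z, w1, prj PW) \<in> Hom (slice C X) z (prj PW)" using w w1 by simp
      note uw = unlift[OF this O(3), folded Z_def]
      define v where "v = pr PW \<cdot> w1"
      have v: "v \<in> Hom C Z PW" "w1 = pairing C v z" unfolding v_def using uw by auto
      have \<pi>v: "\<pi> \<cdot> v = a" using w pi_eq[OF v(1)] unfolding w1 v(2) by simp
      have "R v" using R_iff[OF v(1) \<pi>v] w unfolding w1 v(2) by blast
      then show "w = (z, pairing C u z, prj PW)" using uniq[OF v(1) \<pi>v] w1 v(2) by simp
    qed
  qed
qed

text \<open>Normal form for elements of a base change: a pair whose second component is the
  stage.\<close>

lemma star_element:
  assumes "v \<in> Hom C (Dom C z) Y" "z \<in> Arr C" "Cod C z = X"
  shows "(z, pairing C v z, pr2 C Y X) \<in> Hom (slice C X) z (pr2 C Y X)"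
    "pairing C v z \<in> Hom C (Dom C z) (prod_obj C Y X)"
    "h \<in> Hom C Y Y' \<Longrightarrow>
      on_arr (star C X) h \<cdot>\<^bsub>slice C X\<^esub> (z, pairing C v z, pr2 C Y X) = (z, pairing C (h \<cdot> v) z, pr2 C Y' X)"
proof -
  have z: "z \<in> Hom C (Dom C z) X" and X: "X \<in> Obj C" using assms by (auto simp: Hom_def)
  note t = pairing[OF assms(1) z]
  show "(z, pairing C v z, pr2 C Y X) \<in> Hom (slice C X) z (pr2 C Y X)"
    unfolding slice_Hom_triple using t assms(2,3) X Hom_Obj(2)[OF assms(1)] by simp
  show "pairing C v z \<in> Hom C (Dom C z) (prod_obj C Y X)" using t(1) .
  show "on_arr (star C X) h \<cdot>\<^bsub>slice C X\<^esub> (z, pairing C v z, pr2 C Y X) = (z, pairing C (h \<cdot> v) z, pr2 C Y' X)"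
    if "h \<in> Hom C Y Y'"
    unfolding times_arr(6)[OF that X] slice_simps times_arr(5)[OF that X assms(1) z] ..
qed

lemma star_elementE:
  assumes "x \<in> Hom (slice C X) z (pr2 C Y X)" "Y \<in> Obj C" "X \<in> Obj C"
  obtains v where "x = (z, pairing C v z, pr2 C Y X)" "v \<in> Hom C (Dom C z) Y" "z \<in> Arr C" "Cod C z = X"
proof -
  obtain w where w0: "x = (z, w, pr2 C Y X)" "z \<in> Arr C" "Cod C z = X"
    "w \<in> Hom C (Dom C z) (Dom C (pr2 C Y X))" "pr2 C Y X \<cdot> w = z"
    using slice_HomE[OF assms(1)] by metis
  have w: "x = (z, w, pr2 C Y X)" "z \<in> Arr C" "Cod C z = X" "w \<in> Hom C (Dom C z) (prod_obj C Y X)"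
    "pr2 C Y X \<cdot> w = z"
    using w0 assms(2,3) by simp_all
  have "pr1 C Y X \<cdot> w \<in> Hom C (Dom C z) Y" using w(4) assms(2,3) by (auto simp: Hom_def)
  moreover have "w = pairing C (pr1 C Y X \<cdot> w) z" using pairing_eta[OF assms(2,3) w(4)] w(5) by simp
  ultimately show thesis using that[of "pr1 C Y X \<cdot> w"] w(1-3) by simp
qed

text \<open>Evaluation commutes with base change because the lift to the pullback is computed in the
  first component.\<close>

lemma star_papp:
  assumes P: "is_poly_obj C f W \<pi> p q ev" and t: "t \<in> Arr C" "Cod C t = X"
    and u: "u \<in> Hom C (Dom C t) (Dom C \<pi>)" and b: "b \<in> Hom C (Dom C t) (Dom C f)" "f \<cdot> b = \<pi> \<cdot> u"
  shows "papp (slice C X) (on_arr (star C X) p) (on_arr (star C X) q) (on_arr (star C X) ev)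
      (t, pairing C u t, pr2 C (Dom C \<pi>) X) (t, pairing C b t, pr2 C (Dom C f) X)
    = (t, pairing C (papp C p q ev u b) t, pr2 C W X)"
proof -
  interpret D: category "slice C X" by (rule category_slice)
  note pb = poly_objD(1)[OF P]
  note PB = pullbackD[OF pb]
  have X: "X \<in> Obj C" using t by auto
  note l = pb_lift[OF pb u b(1) b(2)[symmetric]]
  have p: "p \<in> Hom C (Dom C p) (Dom C \<pi>)" and q: "q \<in> Hom C (Dom C p) (Dom C f)" using PB by (auto simp: Hom_def)
  note pb' = D.poly_objD(1)[OF star_poly_obj[OF P X]]
  note lS = star_element[OF l(1) t]
  have "pb_lift (slice C X) (on_arr (star C X) p) (on_arr (star C X) q)
      (t, pairing C u t, pr2 C (Dom C \<pi>) X) (t, pairing C b t, pr2 C (Dom C f) X)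
    = (t, pairing C (pb_lift C p q u b) t, pr2 C (Dom C p) X)"
  proof (rule D.pb_lift_eq[OF pb'])
    show "(t, pairing C (pb_lift C p q u b) t, pr2 C (Dom C p) X)
      \<in> Hom (slice C X) t (Dom (slice C X) (on_arr (star C X) p))"
      using lS(1) unfolding times_arr(6)[OF p X] slice_simps .
  qed (use lS(3)[OF p] lS(3)[OF q] l(2,3) in simp_all)
  then show ?thesis unfolding papp_def using lS(3)[OF poly_objD(2)[OF P]] by simp
qed

text \<open>Closure in the slice becomes closure of a subobject of the product of \<open>W\<close>
  and \<open>X\<close> in which the component in \<open>X\<close> is a fixed parameter. The passage
  between the base and its slices rests on this description in both directions.\<close>

lemma star_closed_under_iff:
  assumes P: "is_poly_obj C f W \<pi> p q ev" and X: "X \<in> Obj C" and s: "\<sigma> \<in> Hom C (Dom C \<pi>) W"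
    and M: "(m0, m, pr2 C W X) \<in> Hom (slice C X) m0 (pr2 C W X)"
  shows "closed_under (slice C X) (on_arr (star C X) f) (on_arr (star C X) \<pi>) (on_arr (star C X) p)
      (on_arr (star C X) q) (on_arr (star C X) ev) (on_arr (star C X) \<sigma>) (m0, m, pr2 C W X) \<longleftrightarrow>
    (\<forall>Z z u. z \<in> Hom C Z X \<and> u \<in> Hom C Z (Dom C \<pi>) \<and>
       (\<forall>t \<zeta> b. \<zeta> \<in> Hom C t Z \<and> b \<in> Hom C t (Dom C f) \<and> f \<cdot> b = \<pi> \<cdot> (u \<cdot> \<zeta>) \<longrightarrow>
          sub_le C (pairing C (papp C p q ev (u \<cdot> \<zeta>) b) (z \<cdot> \<zeta>)) m) \<longrightarrow>
       sub_le C (pairing C (\<sigma> \<cdot> u) z) m)"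
proof -
  note PB = pullbackD[OF poly_objD(1)[OF P]]
  have \<pi>: "\<pi> \<in> Hom C (Dom C \<pi>) (Cod C f)" and f: "f \<in> Hom C (Dom C f) (Cod C f)" using PB by (auto simp: Hom_def)
  have O: "Dom C \<pi> \<in> Obj C" "Dom C f \<in> Obj C" "W \<in> Obj C" using \<pi> f s Hom_Obj by auto
  let ?S = "slice C X" and ?T = "on_arr (star C X)"
  have cond: "(\<forall>t \<zeta> b. \<zeta> \<in> Hom ?S t z \<and> b \<in> Hom ?S t (pr2 C (Dom C f) X) \<and>
        ?T f \<cdot>\<^bsub>?S\<^esub> b = ?T \<pi> \<cdot>\<^bsub>?S\<^esub> ((z, pairing C u z, pr2 C (Dom C \<pi>) X) \<cdot>\<^bsub>?S\<^esub> \<zeta>) \<longrightarrow>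
        sub_le ?S (papp ?S (?T p) (?T q) (?T ev) ((z, pairing C u z, pr2 C (Dom C \<pi>) X) \<cdot>\<^bsub>?S\<^esub> \<zeta>) b) (m0, m, pr2 C W X)) \<longleftrightarrow>
      (\<forall>t \<zeta> b. \<zeta> \<in> Hom C t (Dom C z) \<and> b \<in> Hom C t (Dom C f) \<and> f \<cdot> b = \<pi> \<cdot> (u \<cdot> \<zeta>) \<longrightarrow>
          sub_le C (pairing C (papp C p q ev (u \<cdot> \<zeta>) b) (z \<cdot> \<zeta>)) m)" (is "?L \<longleftrightarrow> ?R")
    if z: "z \<in> Arr C" "Cod C z = X" and u: "u \<in> Hom C (Dom C z) (Dom C \<pi>)" for z u
  proof -
    have el: "(z, pairing C u z, pr2 C (Dom C \<pi>) X) \<cdot>\<^bsub>?S\<^esub> (z \<cdot> \<zeta>, \<zeta>, z) = (z \<cdot> \<zeta>, pairing C (u \<cdot> \<zeta>) (z \<cdot> \<zeta>), pr2 C (Dom C \<pi>) X)"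
        "u \<cdot> \<zeta> \<in> Hom C t (Dom C \<pi>)" "z \<cdot> \<zeta> \<in> Arr C" "Cod C (z \<cdot> \<zeta>) = X" "Dom C (z \<cdot> \<zeta>) = t"
        "(z \<cdot> \<zeta>, \<zeta>, z) \<in> Hom ?S (z \<cdot> \<zeta>) z"
      if \<zeta>: "\<zeta> \<in> Hom C t (Dom C z)" for \<zeta> t
      using z u \<zeta> slice_lift[OF z \<zeta>] by (auto simp: Hom_def)
    have iff: "?T f \<cdot>\<^bsub>?S\<^esub> (r, pairing C b r, pr2 C (Dom C f) X) = ?T \<pi> \<cdot>\<^bsub>?S\<^esub> (r, pairing C v r, pr2 C (Dom C \<pi>) X)
        \<longleftrightarrow> f \<cdot> b = \<pi> \<cdot> v"
      if r: "r \<in> Arr C" "Cod C r = X" and v: "v \<in> Hom C (Dom C r) (Dom C \<pi>)" and b: "b \<in> Hom C (Dom C r) (Dom C f)" for r v b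
    proof -
      have "f \<cdot> b \<in> Hom C (Dom C r) (Cod C f)" "\<pi> \<cdot> v \<in> Hom C (Dom C r) (Cod C f)" "r \<in> Hom C (Dom C r) X"
        using f \<pi> v b r by (auto simp: Hom_def)
      then show ?thesis
        unfolding star_element(3)[OF b r f] star_element(3)[OF v r \<pi>] using pairing_eq_iff by auto
    qed
    have sub: "sub_le ?S (papp ?S (?T p) (?T q) (?T ev) (r, pairing C v r, pr2 C (Dom C \<pi>) X) (r, pairing C b r, pr2 C (Dom C f) X))
        (m0, m, pr2 C W X) \<longleftrightarrow> sub_le C (pairing C (papp C p q ev v b) r) m"
      if r: "r \<in> Arr C" "Cod C r = X" and v: "v \<in> Hom C (Dom C r) (Dom C \<pi>)" and b: "b \<in> Hom C (Dom C r) (Dom C f)" "f \<cdot> b = \<pi> \<cdot> v" for r v b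
      unfolding star_papp[OF P r v b]
      by (rule slice_sub_le_iff[OF star_element(1)[OF papp_Hom[OF P v b] r] M])
    show ?thesis
    proof
      assume L: ?L
      show ?R
      proof (intro allI impI)
        fix t \<zeta> b assume "\<zeta> \<in> Hom C t (Dom C z) \<and> b \<in> Hom C t (Dom C f) \<and> f \<cdot> b = \<pi> \<cdot> (u \<cdot> \<zeta>)"
        then have g: "\<zeta> \<in> Hom C t (Dom C z)" "b \<in> Hom C t (Dom C f)" "f \<cdot> b = \<pi> \<cdot> (u \<cdot> \<zeta>)" by auto
        note e = el[OF g(1)]
        have v: "u \<cdot> \<zeta> \<in> Hom C (Dom C (z \<cdot> \<zeta>)) (Dom C \<pi>)" and b: "b \<in> Hom C (Dom C (z \<cdot> \<zeta>)) (Dom C f)"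
          using e(2,5) g(2) by auto
        have "sub_le ?S (papp ?S (?T p) (?T q) (?T ev) (z \<cdot> \<zeta>, pairing C (u \<cdot> \<zeta>) (z \<cdot> \<zeta>), pr2 C (Dom C \<pi>) X)
            (z \<cdot> \<zeta>, pairing C b (z \<cdot> \<zeta>), pr2 C (Dom C f) X)) (m0, m, pr2 C W X)"
          using L[rule_format, of "(z \<cdot> \<zeta>, \<zeta>, z)" "z \<cdot> \<zeta>" "(z \<cdot> \<zeta>, pairing C b (z \<cdot> \<zeta>), pr2 C (Dom C f) X)"]
            e(6) star_element(1)[OF b e(3,4)] iff[OF e(3,4) v b] g(3) unfolding e(1) by blast
        then show "sub_le C (pairing C (papp C p q ev (u \<cdot> \<zeta>) b) (z \<cdot> \<zeta>)) m"
          using sub[OF e(3,4) v b g(3)] by blast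
      qed
    next
      assume R: ?R
      show ?L
      proof (intro allI impI)
        fix t \<zeta>' b' assume h: "\<zeta>' \<in> Hom ?S t z \<and> b' \<in> Hom ?S t (pr2 C (Dom C f) X) \<and>
          ?T f \<cdot>\<^bsub>?S\<^esub> b' = ?T \<pi> \<cdot>\<^bsub>?S\<^esub> ((z, pairing C u z, pr2 C (Dom C \<pi>) X) \<cdot>\<^bsub>?S\<^esub> \<zeta>')"
        obtain \<zeta> where \<zeta>: "\<zeta>' = (t, \<zeta>, z)" "\<zeta> \<in> Hom C (Dom C t) (Dom C z)" "z \<cdot> \<zeta> = t" using h slice_HomE by metis
        obtain b where b: "b' = (t, pairing C b t, pr2 C (Dom C f) X)" "b \<in> Hom C (Dom C t) (Dom C f)"
          using star_elementE[OF _ O(2) X] h by metis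
        note e = el[OF \<zeta>(2), unfolded \<zeta>(3)]
        have fb: "f \<cdot> b = \<pi> \<cdot> (u \<cdot> \<zeta>)" using iff[OF e(3,4,2) b(2)] h unfolding \<zeta>(1) b(1) e(1) by blast
        show "sub_le ?S (papp ?S (?T p) (?T q) (?T ev) ((z, pairing C u z, pr2 C (Dom C \<pi>) X) \<cdot>\<^bsub>?S\<^esub> \<zeta>') b') (m0, m, pr2 C W X)"
          unfolding \<zeta>(1) b(1) e(1) sub[OF e(3,4,2) b(2) fb] using R \<zeta>(2,3) b(2) fb by blast
      qed
    qed
  qed
  have sub: "sub_le ?S (?T \<sigma> \<cdot>\<^bsub>?S\<^esub> (z, pairing C u z, pr2 C (Dom C \<pi>) X)) (m0, m, pr2 C W X) \<longleftrightarrow>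
      sub_le C (pairing C (\<sigma> \<cdot> u) z) m"
    if z: "z \<in> Arr C" "Cod C z = X" and u: "u \<in> Hom C (Dom C z) (Dom C \<pi>)" for z u
  proof -
    have "\<sigma> \<cdot> u \<in> Hom C (Dom C z) W" using s u by (auto simp: Hom_def)
    from slice_sub_le_iff[OF star_element(1)[OF this z] M] show ?thesis
      unfolding star_element(3)[OF u z s] .
  qed
  have D: "Dom ?S (?T \<pi>) = pr2 C (Dom C \<pi>) X" "Dom ?S (?T f) = pr2 C (Dom C f) X"
    using times_arr(6)[OF \<pi> X] times_arr(6)[OF f X] by auto
  show ?thesis (is "?L \<longleftrightarrow> ?R")
  proof
    assume L: ?L
    show ?R
    proof (intro allI impI, elim conjE)
      fix Z z u assume z: "z \<in> Hom C Z X" and u: "u \<in> Hom C Z (Dom C \<pi>)"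
        and h: "\<forall>t \<zeta> b. \<zeta> \<in> Hom C t Z \<and> b \<in> Hom C t (Dom C f) \<and> f \<cdot> b = \<pi> \<cdot> (u \<cdot> \<zeta>) \<longrightarrow>
          sub_le C (pairing C (papp C p q ev (u \<cdot> \<zeta>) b) (z \<cdot> \<zeta>)) m"
      have z': "z \<in> Arr C" "Cod C z = X" and Z: "Z = Dom C z" using z by (auto simp: Hom_def)
      note u' = u[unfolded Z]
      show "sub_le C (pairing C (\<sigma> \<cdot> u) z) m"
        using L[unfolded closed_under_def D] star_element(1)[OF u' z'] cond[OF z' u'] h[unfolded Z] sub[OF z' u'] by blast
    qed
  next
    assume R: ?R
    show ?L
      unfolding closed_under_def D
    proof (intro allI impI, elim conjE)
      fix z u' assume u': "u' \<in> Hom ?S z (pr2 C (Dom C \<pi>) X)"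
        and h: "\<forall>t \<zeta> b. \<zeta> \<in> Hom ?S t z \<and> b \<in> Hom ?S t (pr2 C (Dom C f) X) \<and>
          ?T f \<cdot>\<^bsub>?S\<^esub> b = ?T \<pi> \<cdot>\<^bsub>?S\<^esub> (u' \<cdot>\<^bsub>?S\<^esub> \<zeta>) \<longrightarrow>
          sub_le ?S (papp ?S (?T p) (?T q) (?T ev) (u' \<cdot>\<^bsub>?S\<^esub> \<zeta>) b) (m0, m, pr2 C W X)"
      obtain u where u: "u' = (z, pairing C u z, pr2 C (Dom C \<pi>) X)" "u \<in> Hom C (Dom C z) (Dom C \<pi>)" "z \<in> Arr C" "Cod C z = X"
        using star_elementE[OF u' O(1) X] .
      have "z \<in> Hom C (Dom C z) X" using u(3,4) by (simp add: Hom_def)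
      then have "sub_le C (pairing C (\<sigma> \<cdot> u) z) m" using R u(2) cond[OF u(3,4,2)] h[unfolded u(1)] by blast
      then show "sub_le ?S (?T \<sigma> \<cdot>\<^bsub>?S\<^esub> u') (m0, m, pr2 C W X)" unfolding u(1) sub[OF u(3,4,2)] .
    qed
  qed
qed

lemma star_iso:
  assumes "is_iso C h" "h \<in> Hom C Y Y'" "X \<in> Obj C"
  shows "is_iso (slice C X) (on_arr (star C X) h)"
proof -
  obtain g where g: "g \<in> Hom C Y' Y" "g \<cdot> h = Id C Y" "h \<cdot> g = Id C Y'" using isoE[OF assms(1,2)] .
  note H = times_arr[OF assms(2,3)] and G = times_arr[OF g(1) assms(3)]
  have O: "Y \<in> Obj C" "Y' \<in> Obj C" using assms(2) Hom_Obj by auto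
  have inv: "times_arr C X g' \<cdot> times_arr C X h' = Id C (prod_obj C Z X)"
    if h': "h' \<in> Hom C Z Z'" and g': "g' \<in> Hom C Z' Z" and e: "g' \<cdot> h' = Id C Z" for g' h' Z Z'
  proof -
    have ZO: "Z \<in> Obj C" "Z' \<in> Obj C" using h' Hom_Obj by auto
    note H' = times_arr[OF h' assms(3)] and G' = times_arr[OF g' assms(3)]
    have I: "Id C (prod_obj C Z X) \<in> Hom C (prod_obj C Z X) (prod_obj C Z X)" using ZO assms(3) by (simp add: Hom_def)
    note pZ = pr_Hom[OF ZO(1) assms(3)]
    show ?thesis
    proof (rule product_ext[OF ZO(1) assms(3) _ I])
      show "times_arr C X g' \<cdot> times_arr C X h' \<in> Hom C (prod_obj C Z X) (prod_obj C Z X)" using H'(1) G'(1) by (auto simp: Hom_def)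
      have "pr1 C Z X \<cdot> (times_arr C X g' \<cdot> times_arr C X h') = g' \<cdot> (pr1 C Z' X \<cdot> times_arr C X h')" using G'(3)[OF H'(1)] .
      also have "pr1 C Z' X \<cdot> times_arr C X h' = h' \<cdot> pr1 C Z X"
        using H'(3)[OF I] H'(1) pZ by (simp add: Hom_def)
      also have "g' \<cdot> (h' \<cdot> pr1 C Z X) = Id C Z \<cdot> pr1 C Z X" by (rule whisker[OF e]) (use g' h' pZ in \<open>auto simp: Hom_def\<close>)
      finally show "pr1 C Z X \<cdot> (times_arr C X g' \<cdot> times_arr C X h') = pr1 C Z X \<cdot> Id C (prod_obj C Z X)"
        using pZ ZO assms(3) by (simp add: Hom_def)
      show "pr2 C Z X \<cdot> (times_arr C X g' \<cdot> times_arr C X h') = pr2 C Z X \<cdot> Id C (prod_obj C Z X)"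
        using G'(4)[OF H'(1)] H'(2) pZ ZO assms(3) by (simp add: Hom_def)
    qed
  qed
  have "is_iso C (times_arr C X h)"
    by (rule isoI[OF H(1) G(1) inv[OF assms(2) g(1,2)] inv[OF g(1) assms(2) g(3)]])
  then show ?thesis using slice_iso_iff[OF H(7)[unfolded H(6)]] unfolding H(6) by blast
qed

end

section \<open>The induced algebra in a slice\<close>

context category_with_small_maps_PE
begin

text \<open>The arrow is a pullback of \<open>f\<close> along the projection from the product of
  \<open>Cod C f\<close> and \<open>X\<close>.\<close>

lemma times_small:
  assumes fS: "f \<in> S" and X: "X \<in> Obj C"
  shows "times_arr C X f \<in> S"
proof -
  define B where "B = Dom C f"
  define A where "A = Cod C f"
  have f: "f \<in> Hom C B A" using small_arr[OF fS] unfolding A_def B_def by (simp add: Hom_def)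
  have O: "B \<in> Obj C" "A \<in> Obj C" using f Hom_Obj by auto
  note F = times_arr[OF f X]
  note pA = pr_Hom[OF O(2) X] and pB = pr_Hom[OF O(1) X]
  have I: "Id C (prod_obj C B X) \<in> Hom C (prod_obj C B X) (prod_obj C B X)" using O X by (simp add: Hom_def)
  have "is_pullback C (pr1 C A X) f (times_arr C X f) (pr1 C B X)"
  proof (rule pullbackI[OF pA(1) f F(1) pB(1)])
    show "pr1 C A X \<cdot> times_arr C X f = f \<cdot> pr1 C B X" using F(3)[OF I] F(1) pB by (simp add: Hom_def)
    fix z u v assume h: "u \<in> Hom C z (prod_obj C A X)" "v \<in> Hom C z B" "pr1 C A X \<cdot> u = f \<cdot> v"
    have c: "pr2 C A X \<cdot> u \<in> Hom C z X" using h(1) pA by (auto simp: Hom_def)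
    have "times_arr C X f \<cdot> pairing C v (pr2 C A X \<cdot> u) = u"
      unfolding F(5)[OF h(2) c] h(3)[symmetric] by (rule pairing_eta[OF O(2) X h(1)])
    then show "\<exists>k. k \<in> Hom C z (prod_obj C B X) \<and> times_arr C X f \<cdot> k = u \<and> pr1 C B X \<cdot> k = v"
      using pairing[OF h(2) c] by blast
  next
    fix z k k' assume h: "k \<in> Hom C z (prod_obj C B X)" "k' \<in> Hom C z (prod_obj C B X)"
      "times_arr C X f \<cdot> k = times_arr C X f \<cdot> k'" "pr1 C B X \<cdot> k = pr1 C B X \<cdot> k'"
    have "pr2 C B X \<cdot> k = pr2 C B X \<cdot> k'" using F(4)[OF h(1)] F(4)[OF h(2)] h(3) by simp
    then show "k = k'" using product_ext[OF O(1) X h(1,2,4)] by blast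
  qed
  then show ?thesis using small_pullback[OF fS] by blast
qed

lemma small_poly_cat:
  assumes fS: "f \<in> S"
  shows "poly_cat C f"
proof
  show f: "f \<in> Arr C" using small_arr[OF fS] .
  fix Y assume "Y \<in> Obj C"
  then show "\<exists>\<pi> p q \<epsilon>. is_Pi C f (pr2 C Y (Dom C f)) \<pi> p q \<epsilon>"
    by (intro small_Pi_exists[OF fS]) (use f in auto)
qed

text \<open>A dependent product in the slice along the base change of \<open>f\<close> is obtained
  from one in the base along \<open>times_arr C X f\<close>, which is small again.\<close>

lemma slice_poly_cat:
  assumes fS: "f \<in> S" and X: "X \<in> Obj C"
  shows "poly_cat (slice C X) (on_arr (star C X) f)"
proof -
  interpret D: forall_cat "slice C X" by (rule forall_cat_slice[OF X])
  have f: "f \<in> Hom C (Dom C f) (Cod C f)" using small_arr[OF fS] by (simp add: Hom_def)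
  note F = times_arr[OF f X]
  define b0 where "b0 = pr2 C (Dom C f) X"
  define a0 where "a0 = pr2 C (Cod C f) X"
  have Tf: "on_arr (star C X) f = (b0, times_arr C X f, a0)" unfolding b0_def a0_def using F(6) .
  have FA: "(b0, times_arr C X f, a0) \<in> Arr (slice C X)" using F(7) unfolding Tf Hom_def by blast
  note FD = slice_ArrD[OF FA]
  show ?thesis
    unfolding Tf
  proof
    show "(b0, times_arr C X f, a0) \<in> Arr (slice C X)" by (fact FA)
    fix Y assume Y: "Y \<in> Obj (slice C X)"
    have b0: "b0 \<in> Obj (slice C X)" using FD by simp
    define d where "d = pr2 (slice C X) Y b0"
    have dS: "d \<in> Hom (slice C X) (prod_obj (slice C X) Y b0) b0" unfolding d_def using D.pr_Hom(2)[OF Y b0] .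
    then obtain d0 d1 where d: "d = (d0, d1, b0)" using slice_HomE by metis
    have dA: "(d0, d1, b0) \<in> Arr (slice C X)" using dS unfolding d Hom_def by blast
    note DD = slice_ArrD[OF dA]
    obtain \<pi> p q \<epsilon> where "is_Pi C (times_arr C X f) d1 \<pi> p q \<epsilon>"
      using small_Pi_exists[OF times_small[OF fS X], of d1] DD FD by auto
    from is_Pi_slice[OF FA dA this]
    show "\<exists>\<pi> p q \<epsilon>. is_Pi (slice C X) (b0, times_arr C X f, a0)
        (pr2 (slice C X) Y (Dom (slice C X) (b0, times_arr C X f, a0))) \<pi> p q \<epsilon>"
      unfolding slice_simps d_def[symmetric] d by blast
  qed
qed

lemma pullback_has_inductive_subobjects:
  assumes "f \<in> S" "is_pullback C h f n k"
  shows "has_inductive_subobjects C n"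
  using small_has_inductive_subobjects small_pullback assms by blast

text \<open>A pullback in the slice has an underlying pullback in the base, where the pulled back
  map is small; the generated subobjects are then carried over to the slice.\<close>

lemma slice_pullback_has_inductive_subobjects:
  assumes fS: "f \<in> S" and X: "X \<in> Obj C"
    and pb: "is_pullback (slice C X) H (on_arr (star C X) f) N K"
  shows "has_inductive_subobjects (slice C X) N"
proof -
  interpret D: category "slice C X" by (rule category_slice)
  have f: "f \<in> Hom C (Dom C f) (Cod C f)" using small_arr[OF fS] by (simp add: Hom_def)
  note F = times_arr[OF f X]
  define b0 where "b0 = pr2 C (Dom C f) X"
  define a0 where "a0 = pr2 C (Cod C f) X"
  have Tf: "on_arr (star C X) f = (b0, times_arr C X f, a0)" unfolding b0_def a0_def using F(6) .
  note P = D.pullbackD[OF pb[unfolded Tf], unfolded slice_simps]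
  obtain y h where H: "H = (y, h, a0)" using P(3) by (cases H) auto
  obtain w n where N: "N = (w, n, y)" using P(7) unfolding H by (cases N) auto
  obtain k where K: "K = (w, k, b0)" using P(6,8) unfolding N by (cases K) auto
  have "is_pullback C h (times_arr C X f) n k"
    using slice_pullback_iff[OF P(1)[unfolded H] P(2) P(4)[unfolded N] P(5)[unfolded K]] pb
    unfolding Tf H N K by blast
  then have "has_inductive_subobjects C n"
    using pullback_has_inductive_subobjects times_small[OF fS X] by blast
  then show ?thesis using has_inductive_subobjects_slice P(4) unfolding N by blast
qed

text \<open>The induced structure map involves the polynomial functor chosen in the slice and the
  inverse of the comparison. Both are eliminated here: closure under it becomes closure with respect
  to the base change of the data chosen for \<open>W\<close>.\<close>

lemma star_algebra_properties:
  assumes fS: "f \<in> S" and X: "X \<in> Obj C" and alg: "is_algebra C (poly C f) W \<sigma>"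
  defines "D \<equiv> slice C X" and "T \<equiv> on_obj (star C X)" and "T1 \<equiv> on_arr (star C X)"
    and "s \<equiv> star_algebra C X f W \<sigma>"
    and "pb \<equiv> chosen_pullback C (poly_proj C f W) f"
  shows "is_algebra D (poly D (T1 f)) (T W) s"
    "is_iso C \<sigma> \<Longrightarrow> is_iso D s"
    "no_proper_subalgebras D (poly D (T1 f)) (T W) s \<longleftrightarrow>
       (\<forall>m. is_mono D m \<and> Cod D m = T W \<and>
         closed_under D (T1 f) (T1 (poly_proj C f W)) (T1 (fst pb)) (T1 (snd pb)) (T1 (poly_ev C f W)) (T1 \<sigma>) m
         \<longrightarrow> is_iso D m)"
    "\<lbrakk>is_iso C \<sigma>; no_proper_subalgebras D (poly D (T1 f)) (T W) s\<rbrakk> \<Longrightarrow> is_W_type D (T1 f) (T W) s"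
proof -
  interpret P: poly_cat C f by (rule small_poly_cat[OF fS])
  interpret PD: poly_cat D "T1 f" unfolding D_def T1_def by (rule slice_poly_cat[OF fS X])
  have WO: "W \<in> Obj C" and \<sigma>: "\<sigma> \<in> Hom C (on_obj (poly C f) W) W" using alg unfolding is_algebra_def by auto
  note PW = P.poly_obj[OF WO]
  define \<pi> where "\<pi> = T1 (poly_proj C f W)"
  define p where "p = T1 (fst pb)"
  define q where "q = T1 (snd pb)"
  define ev where "ev = T1 (poly_ev C f W)"
  have TW: "T W \<in> Obj D" unfolding T_def D_def star_obj using WO X by simp
  have Q: "is_poly_obj D (T1 f) (T W) \<pi> p q ev"
    unfolding D_def T_def T1_def \<pi>_def p_def q_def ev_def pb_def using star_poly_obj[OF PW(1) X] .
  note Q' = PD.poly_obj[OF TW]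
  note PB = pullbackD[OF poly_objD(1)[OF PW(1)]]
  have pH: "fst pb \<in> Hom C (Dom C (fst pb)) (on_obj (poly C f) W)" using PB PW(3) unfolding pb_def by (simp add: Hom_def)
  have D\<pi>: "Dom D \<pi> = T (on_obj (poly C f) W)"
    unfolding D_def T_def T1_def \<pi>_def star_obj times_arr(6)[OF PW(2) X] by simp
  have Dp: "Dom D p = T (Dom C (fst pb))"
    unfolding D_def T_def T1_def p_def star_obj times_arr(6)[OF pH X] by simp
  define \<theta> where "\<theta> = poly_comparison C X f W"
  have ex: "\<exists>!\<theta>. \<theta> \<in> Hom D (Dom D \<pi>) (Dom D (poly_proj D (T1 f) (T W))) \<and> poly_proj D (T1 f) (T W) \<cdot>\<^bsub>D\<^esub> \<theta> = \<pi> \<and>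
      (\<exists>s \<in> Hom D (Dom D p) (Dom D (PD.pb1 (T W))).
        PD.pb1 (T W) \<cdot>\<^bsub>D\<^esub> s = \<theta> \<cdot>\<^bsub>D\<^esub> p \<and> PD.pb2 (T W) \<cdot>\<^bsub>D\<^esub> s = q \<and> poly_ev D (T1 f) (T W) \<cdot>\<^bsub>D\<^esub> s = ev)"
    by (rule PD.poly_obj_comparison(1)[OF Q Q'(1)])
  \<comment> \<open>The definition of \<open>poly_comparison\<close> is matched with the unique
    comparison between two polynomial objects for \<open>T W\<close>: the base change of the one in
    the base, and the one chosen in the slice.\<close>
  have "\<theta> = (THE \<theta>. \<theta> \<in> Hom D (Dom D \<pi>) (Dom D (poly_proj D (T1 f) (T W))) \<and> poly_proj D (T1 f) (T W) \<cdot>\<^bsub>D\<^esub> \<theta> = \<pi> \<and>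
      (\<exists>s \<in> Hom D (Dom D p) (Dom D (PD.pb1 (T W))).
        PD.pb1 (T W) \<cdot>\<^bsub>D\<^esub> s = \<theta> \<cdot>\<^bsub>D\<^esub> p \<and> PD.pb2 (T W) \<cdot>\<^bsub>D\<^esub> s = q \<and> poly_ev D (T1 f) (T W) \<cdot>\<^bsub>D\<^esub> s = ev))"
    unfolding D\<pi> Dp Q'(3) \<theta>_def poly_comparison_def Let_def case_prod_beta
    unfolding D_def T_def T1_def \<pi>_def p_def q_def ev_def pb_def ..
  then have \<theta>: "\<theta> \<in> Hom D (Dom D \<pi>) (Dom D (poly_proj D (T1 f) (T W)))" "poly_proj D (T1 f) (T W) \<cdot>\<^bsub>D\<^esub> \<theta> = \<pi>"
    and "\<exists>s \<in> Hom D (Dom D p) (Dom D (PD.pb1 (T W))).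
        PD.pb1 (T W) \<cdot>\<^bsub>D\<^esub> s = \<theta> \<cdot>\<^bsub>D\<^esub> p \<and> PD.pb2 (T W) \<cdot>\<^bsub>D\<^esub> s = q \<and> poly_ev D (T1 f) (T W) \<cdot>\<^bsub>D\<^esub> s = ev"
    using theI'[OF ex] by auto
  then obtain r where r: "r \<in> Hom D (Dom D p) (Dom D (PD.pb1 (T W)))" "PD.pb1 (T W) \<cdot>\<^bsub>D\<^esub> r = \<theta> \<cdot>\<^bsub>D\<^esub> p"
    "PD.pb2 (T W) \<cdot>\<^bsub>D\<^esub> r = q" "poly_ev D (T1 f) (T W) \<cdot>\<^bsub>D\<^esub> r = ev" by blast
  note app = PD.poly_obj_comparison(2)[OF Q Q'(1) \<theta> r]
  have iso: "is_iso D \<theta>" by (rule PD.poly_obj_comparison_iso[OF Q Q'(1) \<theta> app])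
  note inv = PD.inverse_arrow[OF iso \<theta>(1)]
  have T\<sigma>: "T1 \<sigma> \<in> Hom D (Dom D \<pi>) (T W)"
    unfolding D\<pi> unfolding D_def T_def T1_def star_obj using times_arr(7)[OF \<sigma> X] .
  have s: "s = T1 \<sigma> \<cdot>\<^bsub>D\<^esub> inverse_arrow D \<theta>"
    unfolding s_def star_algebra_def D_def T1_def \<theta>_def ..
  have sH: "s \<in> Hom D (on_obj (poly D (T1 f)) (T W)) (T W)"
    using PD.Comp_in_Hom[OF inv(1) T\<sigma>] unfolding s Q'(3) .
  then show algD: "is_algebra D (poly D (T1 f)) (T W) s" unfolding is_algebra_def using TW by blast
  show isoD: "is_iso D s" if "is_iso C \<sigma>"
  proof -
    have "is_iso D (inverse_arrow D \<theta>)" using PD.isoI[OF inv(1) \<theta>(1) inv(3,2)] .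
    moreover have "is_iso D (T1 \<sigma>)" unfolding D_def T1_def by (rule star_iso[OF that \<sigma> X])
    ultimately show ?thesis unfolding s using PD.iso_comp inv(1) T\<sigma> by blast
  qed
  have arr: "\<pi> \<in> Arr D" "poly_proj D (T1 f) (T W) \<in> Arr D"
    using PD.poly_objD(3)[OF Q] Q'(2) by (auto simp: Hom_def)
  have cl: "PD.closed (T W) s m \<longleftrightarrow> closed_under D (T1 f) \<pi> p q ev (T1 \<sigma>) m" for m
    unfolding s by (rule PD.closed_under_comparison[OF arr T\<sigma> \<theta> iso app])
  note np = PD.no_proper_subalgebras_iff[OF TW sH]
  show "no_proper_subalgebras D (poly D (T1 f)) (T W) s \<longleftrightarrow>
       (\<forall>m. is_mono D m \<and> Cod D m = T W \<and>
         closed_under D (T1 f) (T1 (poly_proj C f W)) (T1 (fst pb)) (T1 (snd pb)) (T1 (poly_ev C f W)) (T1 \<sigma>) m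
         \<longrightarrow> is_iso D m)"
    unfolding np cl \<pi>_def p_def q_def ev_def ..
  show "is_W_type D (T1 f) (T W) s"
    if "is_iso C \<sigma>" "no_proper_subalgebras D (poly D (T1 f)) (T W) s"
  proof (rule PD.W_type_if_no_closed_subobjects[OF algD isoD[OF that(1)]])
    show "is_iso D m" if "is_mono D m" "Cod D m = T W" "PD.closed (T W) s m" for m
      using \<open>no_proper_subalgebras D _ _ _\<close> that unfolding np by blast
    show "has_inductive_subobjects D n" if "is_pullback D h (T1 f) n k" for h n k
      using slice_pullback_has_inductive_subobjects[OF fS X] that unfolding D_def T1_def by blast
  qed
qed

end

section \<open>The four conditions on an algebra, in the base and in its slices\<close>

theorem theorem6p13:
  fixes E :: "('o, 'm) cat" and S :: "'m set" and f \<sigma> :: 'm and A B W :: 'o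
  assumes "category_with_small_maps_PE E S"
    and "f \<in> S" and "f \<in> Hom E B A"
    and "is_algebra E (poly E f) W \<sigma>"
  shows
    "(is_W_type E f W \<sigma>
        \<longleftrightarrow> is_iso E \<sigma> \<and> no_proper_subalgebras E (poly E f) W \<sigma>) \<and>
     (is_iso E \<sigma> \<and> no_proper_subalgebras E (poly E f) W \<sigma>
        \<longleftrightarrow> is_iso E \<sigma> \<and>
            (\<forall>X\<in>Obj E. no_proper_subalgebras (slice E X) (poly (slice E X) (on_arr (star E X) f))
               (on_obj (star E X) W) (star_algebra E X f W \<sigma>))) \<and>
     (is_iso E \<sigma> \<and>
            (\<forall>X\<in>Obj E. no_proper_subalgebras (slice E X) (poly (slice E X) (on_arr (star E X) f))
               (on_obj (star E X) W) (star_algebra E X f W \<sigma>))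
        \<longleftrightarrow> is_indexed_W_type E f W \<sigma>)"
proof -
  interpret C: category_with_small_maps_PE E S by (rule assms(1))
  interpret P: poly_cat E f by (rule C.small_poly_cat[OF assms(2)])
  let ?np = "\<lambda>X. no_proper_subalgebras (slice E X) (poly (slice E X) (on_arr (star E X) f))
               (on_obj (star E X) W) (star_algebra E X f W \<sigma>)"
  have W: "W \<in> Obj E" and \<sigma>: "\<sigma> \<in> Hom E (on_obj (poly E f) W) W" using assms(4) unfolding is_algebra_def by auto
  note PW = P.poly_obj[OF W]
  have \<sigma>': "\<sigma> \<in> Hom E (Dom E (poly_proj E f W)) W" using \<sigma> PW(3) by simp
  note star = C.star_algebra_properties[OF assms(2) _ assms(4)]
  note np = P.no_proper_subalgebras_iff[OF W \<sigma>]
  note closed_iff = C.star_closed_under_iff[OF PW(1) _ \<sigma>', unfolded PW(3)]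
  have W1: "is_W_type E f W \<sigma>" if "is_iso E \<sigma>" "no_proper_subalgebras E (poly E f) W \<sigma>"
  proof (rule P.W_type_if_no_closed_subobjects[OF assms(4) that(1)])
    show "is_iso E m" if "is_mono E m" "Cod E m = W" "P.closed W \<sigma> m" for m
      using \<open>no_proper_subalgebras E _ _ _\<close> that unfolding np by blast
    show "has_inductive_subobjects E n" if "is_pullback E h f n k" for h n k
      using C.pullback_has_inductive_subobjects[OF assms(2)] that by blast
  qed
  have 12: "is_W_type E f W \<sigma> \<longleftrightarrow> is_iso E \<sigma> \<and> no_proper_subalgebras E (poly E f) W \<sigma>"
    using W1 P.W_type_iso_and_no_proper_subalgebras by blast

  have 23: "?np X" if X: "X \<in> Obj E" and npE: "no_proper_subalgebras E (poly E f) W \<sigma>" for X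
    unfolding star(3)[OF X]
  proof (intro allI impI, elim conjE)
    fix M assume M: "is_mono (slice E X) M" "Cod (slice E X) M = on_obj (star E X) W"
      and cl: "closed_under (slice E X) (on_arr (star E X) f) (on_arr (star E X) (poly_proj E f W))
         (on_arr (star E X) (P.pb1 W)) (on_arr (star E X) (P.pb2 W)) (on_arr (star E X) (poly_ev E f W)) (on_arr (star E X) \<sigma>) M"
    obtain m0 m where m: "M = (m0, m, pr2 E W X)" using M(2) unfolding C.star_obj by (cases M) auto
    have MH: "(m0, m, pr2 E W X) \<in> Hom (slice E X) m0 (pr2 E W X)"
      using M(1) unfolding m is_mono_def by (simp add: Hom_def)
    have mono: "is_mono E m" using C.slice_mono_iff[OF MH] M(1) unfolding m by blast
    note MA = MH[unfolded C.slice_Hom_triple]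
    have mH: "m \<in> Hom E (Dom E m0) (prod_obj E W X)" using MA W X by simp
    have cl': "sub_le E (pairing E (\<sigma> \<cdot>\<^bsub>E\<^esub> u) z) m"
      if "z \<in> Hom E Z X" "u \<in> Hom E Z (on_obj (poly E f) W)"
        "\<And>t \<zeta> b. \<lbrakk>\<zeta> \<in> Hom E t Z; b \<in> Hom E t (Dom E f); f \<cdot>\<^bsub>E\<^esub> b = poly_proj E f W \<cdot>\<^bsub>E\<^esub> (u \<cdot>\<^bsub>E\<^esub> \<zeta>)\<rbrakk> \<Longrightarrow>
          sub_le E (pairing E (P.app W (u \<cdot>\<^bsub>E\<^esub> \<zeta>) b) (z \<cdot>\<^bsub>E\<^esub> \<zeta>)) m" for Z z u
      using cl[unfolded m closed_iff[OF X MH]] that by blast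
    note pr = C.pr_Hom[OF W X]
    have "representable E (prod_obj E W X) (\<lambda>x. sub_le E x m)"
      by (rule C.representableI[OF mono]) (use mH in \<open>auto simp: Hom_def\<close>)
    \<comment> \<open>Quantifying along \<open>pr1 E W X\<close> removes the parameter, so that
      induction in the base applies to \<open>n\<close>.\<close>
    then obtain n where n: "is_mono E n" "n \<in> Hom E (Dom E n) W"
      "\<And>z x. x \<in> Hom E z W \<Longrightarrow> sub_le E x n \<longleftrightarrow> forall_along E (pr1 E W X) (\<lambda>x. sub_le E x m) x"
      using C.representableE[OF C.representable_forall[OF pr(1)]] by blast
    have "P.closed W \<sigma> n"
    proof (rule P.closedI[OF W])
      fix Z u assume u: "u \<in> Hom E Z (on_obj (poly E f) W)"
        and mem: "\<And>t \<zeta> b. \<lbrakk>\<zeta> \<in> Hom E t Z; b \<in> Hom E t (Dom E f); f \<cdot>\<^bsub>E\<^esub> b = poly_proj E f W \<cdot>\<^bsub>E\<^esub> (u \<cdot>\<^bsub>E\<^esub> \<zeta>)\<rbrakk>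
          \<Longrightarrow> sub_le E (P.app W (u \<cdot>\<^bsub>E\<^esub> \<zeta>) b) n"
      have su: "\<sigma> \<cdot>\<^bsub>E\<^esub> u \<in> Hom E Z W" using C.Comp_in_Hom[OF u \<sigma>] .
      have "forall_along E (pr1 E W X) (\<lambda>x. sub_le E x m) (\<sigma> \<cdot>\<^bsub>E\<^esub> u)"
        unfolding forall_along_def
      proof (intro allI impI)
        fix t \<zeta> x assume "\<zeta> \<in> Hom E t (Dom E (\<sigma> \<cdot>\<^bsub>E\<^esub> u)) \<and> x \<in> Hom E t (Dom E (pr1 E W X)) \<and>
          pr1 E W X \<cdot>\<^bsub>E\<^esub> x = \<sigma> \<cdot>\<^bsub>E\<^esub> u \<cdot>\<^bsub>E\<^esub> \<zeta>"
        then have h: "\<zeta> \<in> Hom E t Z" "x \<in> Hom E t (prod_obj E W X)" "pr1 E W X \<cdot>\<^bsub>E\<^esub> x = \<sigma> \<cdot>\<^bsub>E\<^esub> u \<cdot>\<^bsub>E\<^esub> \<zeta>"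
          using su W X by (auto simp: Hom_def)
        \<comment> \<open>An element \<open>x\<close> over the restricted conclusion fixes a
          component \<open>z\<close> in \<open>X\<close>; the hypothesis on the values of
          \<open>u\<close> is instantiated at the restrictions of this \<open>z\<close>.\<close>
        define z where "z = pr2 E W X \<cdot>\<^bsub>E\<^esub> x"
        have z: "z \<in> Hom E t X" unfolding z_def using C.Comp_in_Hom[OF h(2) pr(2)] .
        have u\<zeta>: "u \<cdot>\<^bsub>E\<^esub> \<zeta> \<in> Hom E t (on_obj (poly E f) W)" using C.Comp_in_Hom[OF h(1) u] .
        have "sub_le E (pairing E (\<sigma> \<cdot>\<^bsub>E\<^esub> (u \<cdot>\<^bsub>E\<^esub> \<zeta>)) z) m"
        proof (rule cl'[OF z u\<zeta>])
          fix r \<xi> b assume g: "\<xi> \<in> Hom E r t" "b \<in> Hom E r (Dom E f)"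
            "f \<cdot>\<^bsub>E\<^esub> b = poly_proj E f W \<cdot>\<^bsub>E\<^esub> (u \<cdot>\<^bsub>E\<^esub> \<zeta> \<cdot>\<^bsub>E\<^esub> \<xi>)"
          have as: "u \<cdot>\<^bsub>E\<^esub> \<zeta> \<cdot>\<^bsub>E\<^esub> \<xi> = u \<cdot>\<^bsub>E\<^esub> (\<zeta> \<cdot>\<^bsub>E\<^esub> \<xi>)" using C.Comp_assoc[OF g(1) h(1) u] .
          have zx: "\<zeta> \<cdot>\<^bsub>E\<^esub> \<xi> \<in> Hom E r Z" "z \<cdot>\<^bsub>E\<^esub> \<xi> \<in> Hom E r X" using C.Comp_in_Hom[OF g(1)] h(1) z by auto
          have rO: "r \<in> Obj E" using g(1) C.Hom_Obj by blast
          define c where "c = P.app W (u \<cdot>\<^bsub>E\<^esub> \<zeta> \<cdot>\<^bsub>E\<^esub> \<xi>) b"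
          have c: "c \<in> Hom E r W" unfolding c_def using P.app_Hom[OF W _ g(2,3)] C.Comp_in_Hom[OF g(1) u\<zeta>] by blast
          have "sub_le E c n" unfolding c_def as using mem[OF zx(1) g(2)] g(3) unfolding as by blast
          then have fa: "forall_along E (pr1 E W X) (\<lambda>x. sub_le E x m) c" using n(3)[OF c] by blast
          note cp = C.pairing[OF c zx(2)]
          have "sub_le E (pairing E c (z \<cdot>\<^bsub>E\<^esub> \<xi>)) m"
            by (rule C.forall_alongD[OF fa c C.Id_in_Hom[OF rO]]) (use cp c W X in \<open>auto simp: Hom_def\<close>)
          then show "sub_le E (pairing E (P.app W (u \<cdot>\<^bsub>E\<^esub> \<zeta> \<cdot>\<^bsub>E\<^esub> \<xi>) b) (z \<cdot>\<^bsub>E\<^esub> \<xi>)) m" unfolding c_def .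
        qed
        moreover have "pairing E (\<sigma> \<cdot>\<^bsub>E\<^esub> (u \<cdot>\<^bsub>E\<^esub> \<zeta>)) z = x"
          using C.pairing_eta[OF W X h(2)] h(3) C.Comp_assoc[OF h(1) u \<sigma>] unfolding z_def by simp
        ultimately show "sub_le E x m" by simp
      qed
      then show "sub_le E (\<sigma> \<cdot>\<^bsub>E\<^esub> u) n" using n(3)[OF su] by blast
    qed
    then have "is_iso E n" using npE n(1,2) unfolding np by (auto simp: Hom_def)
    then have fa: "forall_along E (pr1 E W X) (\<lambda>x. sub_le E x m) (Id E W)"
      using C.sub_le_iso[OF _ n(2) C.Id_in_Hom[OF W]] n(3)[OF C.Id_in_Hom[OF W]] by blast
    have XO: "prod_obj E W X \<in> Obj E" using W X by simp
    \<comment> \<open>The universal statement at the identity of \<open>W\<close> is reindexed along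
      the first projection and instantiated at the identity of the product.\<close>
    have "sub_le E (Id E (prod_obj E W X)) m"
      by (rule C.forall_alongD[OF fa C.Id_in_Hom[OF W] pr(1)]) (use pr W X in \<open>auto simp: Hom_def\<close>)
    then have "is_iso E m" using C.mono_split_iso[OF mono mH] by blast
    then show "is_iso (slice E X) M" using C.slice_iso_iff[OF MH] unfolding m by blast
  qed

  \<comment> \<open>Coming back from the product of \<open>W\<close> and \<open>X\<close> to
    \<open>W\<close> calls for a map from \<open>W\<close> to \<open>X\<close>; with
    \<open>X = W\<close> the identity is one, and it gives the diagonal used at the end.\<close>
  have 32: "no_proper_subalgebras E (poly E f) W \<sigma>" if "?np W"
    unfolding np
  proof (intro allI impI, elim conjE)
    fix m assume mono: "is_mono E m" and mc: "Cod E m = W" and cl: "P.closed W \<sigma> m"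
    define V where "V = Dom E m"
    have m: "m \<in> Hom E V W" using C.mono_arr[OF mono] mc V_def by (simp add: Hom_def)
    have V: "V \<in> Obj E" using m C.Hom_Obj by blast
    note M = C.times_arr[OF m W]
    note MH = M(7)[unfolded M(6)]
    have mem: "sub_le E (pairing E w z) (times_arr E W m) \<longleftrightarrow> sub_le E w m"
      if w: "w \<in> Hom E Z W" "z \<in> Hom E Z W" for w z Z
    proof
      note p = C.pairing[OF w]
      assume "sub_le E (pairing E w z) (times_arr E W m)"
      then obtain k where "k \<in> Hom E Z (Dom E (times_arr E W m))" and k2: "times_arr E W m \<cdot>\<^bsub>E\<^esub> k = pairing E w z"
        using C.sub_leE p(1) by blast
      then have k: "k \<in> Hom E Z (prod_obj E V W)" using M(1) by (simp add: Hom_def)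
      have "m \<cdot>\<^bsub>E\<^esub> (pr1 E V W \<cdot>\<^bsub>E\<^esub> k) = w" using M(3)[OF k] k2 p(2) by simp
      moreover have "pr1 E V W \<cdot>\<^bsub>E\<^esub> k \<in> Hom E Z (Dom E m)"
        using C.Comp_in_Hom[OF k C.pr_Hom(1)[OF V W]] unfolding V_def .
      ultimately show "sub_le E w m" using C.sub_leI C.mono_arr[OF mono] by blast
    next
      assume "sub_le E w m"
      then obtain k where k: "k \<in> Hom E Z V" "m \<cdot>\<^bsub>E\<^esub> k = w" using C.sub_leE w(1) unfolding V_def by blast
      have "times_arr E W m \<cdot>\<^bsub>E\<^esub> pairing E k z = pairing E w z" using M(5)[OF k(1) w(2)] k(2) by simp
      moreover have "pairing E k z \<in> Hom E Z (Dom E (times_arr E W m))" "times_arr E W m \<in> Arr E"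
        using C.pairing(1)[OF k(1) w(2)] M(1) by (auto simp: Hom_def)
      ultimately show "sub_le E (pairing E w z) (times_arr E W m)" using C.sub_leI by blast
    qed
    have "is_mono E (times_arr E W m)"
    proof (rule C.monoI[OF M(1)])
      fix z u v assume h: "u \<in> Hom E z (prod_obj E V W)" "v \<in> Hom E z (prod_obj E V W)"
        "times_arr E W m \<cdot>\<^bsub>E\<^esub> u = times_arr E W m \<cdot>\<^bsub>E\<^esub> v"
      have "pr1 E V W \<cdot>\<^bsub>E\<^esub> u \<in> Hom E z (Dom E m)" "pr1 E V W \<cdot>\<^bsub>E\<^esub> v \<in> Hom E z (Dom E m)"
        using C.Comp_in_Hom[OF h(1) C.pr_Hom(1)[OF V W]] C.Comp_in_Hom[OF h(2) C.pr_Hom(1)[OF V W]] unfolding V_def by auto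
      then have "pr1 E V W \<cdot>\<^bsub>E\<^esub> u = pr1 E V W \<cdot>\<^bsub>E\<^esub> v"
        using C.monoD[OF mono] M(3)[OF h(1)] M(3)[OF h(2)] h(3) by metis
      moreover have "pr2 E V W \<cdot>\<^bsub>E\<^esub> u = pr2 E V W \<cdot>\<^bsub>E\<^esub> v" using M(4)[OF h(1)] M(4)[OF h(2)] h(3) by simp
      ultimately show "u = v" using C.product_ext[OF V W h(1,2)] by blast
    qed
    then have monoS: "is_mono (slice E W) (on_arr (star E W) m)"
      unfolding M(6) using C.slice_mono_iff[OF MH] by blast
    have "closed_under (slice E W) (on_arr (star E W) f) (on_arr (star E W) (poly_proj E f W))
         (on_arr (star E W) (P.pb1 W)) (on_arr (star E W) (P.pb2 W)) (on_arr (star E W) (poly_ev E f W)) (on_arr (star E W) \<sigma>)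
         (on_arr (star E W) m)"
      unfolding M(6) closed_iff[OF W MH]
    proof (intro allI impI, elim conjE)
      fix Z z u assume z: "z \<in> Hom E Z W" and u: "u \<in> Hom E Z (on_obj (poly E f) W)"
        and h: "\<forall>t \<zeta> b. \<zeta> \<in> Hom E t Z \<and> b \<in> Hom E t (Dom E f) \<and> f \<cdot>\<^bsub>E\<^esub> b = poly_proj E f W \<cdot>\<^bsub>E\<^esub> (u \<cdot>\<^bsub>E\<^esub> \<zeta>) \<longrightarrow>
          sub_le E (pairing E (P.app W (u \<cdot>\<^bsub>E\<^esub> \<zeta>) b) (z \<cdot>\<^bsub>E\<^esub> \<zeta>)) (times_arr E W m)"
      have "sub_le E (\<sigma> \<cdot>\<^bsub>E\<^esub> u) m"
      proof (rule P.closedD[OF cl W u])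
        fix t \<zeta> b assume g: "\<zeta> \<in> Hom E t Z" "b \<in> Hom E t (Dom E f)" "f \<cdot>\<^bsub>E\<^esub> b = poly_proj E f W \<cdot>\<^bsub>E\<^esub> (u \<cdot>\<^bsub>E\<^esub> \<zeta>)"
        have "P.app W (u \<cdot>\<^bsub>E\<^esub> \<zeta>) b \<in> Hom E t W" using P.app_Hom[OF W C.Comp_in_Hom[OF g(1) u] g(2,3)] .
        then show "sub_le E (P.app W (u \<cdot>\<^bsub>E\<^esub> \<zeta>) b) m"
          using mem[OF _ C.Comp_in_Hom[OF g(1) z]] h g by blast
      qed
      then show "sub_le E (pairing E (\<sigma> \<cdot>\<^bsub>E\<^esub> u) z) (times_arr E W m)"
        using mem[OF C.Comp_in_Hom[OF u \<sigma>] z] by blast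
    qed
    moreover have "Cod (slice E W) (on_arr (star E W) m) = on_obj (star E W) W"
      unfolding M(6) C.star_obj by simp
    ultimately have "is_iso (slice E W) (on_arr (star E W) m)"
      using \<open>?np W\<close> monoS unfolding star(3)[OF W] by blast
    then have "is_iso E (times_arr E W m)" unfolding M(6) using C.slice_iso_iff[OF MH] by blast
    note Id = C.Id_in_Hom[OF W]
    \<comment> \<open>The diagonal of \<open>W\<close> belongs to the product of \<open>m\<close>
      with \<open>W\<close>; its first component shows that the identity belongs to
      \<open>m\<close>.\<close>
    have "sub_le E (pairing E (Id E W) (Id E W)) (times_arr E W m)"
      by (rule C.sub_le_iso[OF \<open>is_iso E (times_arr E W m)\<close> M(1) C.pairing(1)[OF Id Id]])
    then have "sub_le E (Id E W) m" using mem[OF Id Id] by blast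
    then show "is_iso E m" using C.mono_split_iso[OF mono m] by blast
  qed

  \<comment> \<open>Over each \<open>X\<close> the absence of proper subalgebras is given; that the
    induced structure map is an isomorphism follows because base change preserves
    isomorphisms.\<close>
  have 34: "is_indexed_W_type E f W \<sigma>" if "is_iso E \<sigma>" "\<forall>X\<in>Obj E. ?np X"
    unfolding is_indexed_W_type_def using W1 32 star(4) that W by blast
  have 43: "is_iso E \<sigma> \<and> (\<forall>X\<in>Obj E. ?np X)" if "is_indexed_W_type E f W \<sigma>"
  proof (intro conjI ballI)
    show "is_iso E \<sigma>"
      using P.W_type_iso_and_no_proper_subalgebras(1) that unfolding is_indexed_W_type_def by blast
    fix X assume X: "X \<in> Obj E"
    interpret PX: poly_cat "slice E X" "on_arr (star E X) f" by (rule C.slice_poly_cat[OF assms(2) X])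
    show "?np X"
      using PX.W_type_iso_and_no_proper_subalgebras(2) that X unfolding is_indexed_W_type_def by blast
  qed
  show ?thesis using 12 23 32 34 43 W by blast
qed

end
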